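(* Let $n\ge 1$, let $f$ be a holomorphic mapping of the unit disc $\triangle=\{z\in\mathbb C:|z|<1\}$ into $P^n(\mathbb C)$, and let $H_1,H_2,\dots,H_q$ be hyperplanes in general position in $P^n(\mathbb C)$. Assume that $$\sup\Big\{(1-|z|^2)f^{\#}(z): z\in\bigcup_{j=1}^q f^{-1}(H_j)\Big\}<\infty.$$ If $q\ge n(2n+1)+2$, then $f$ is normal.
   Context: For a holomorphic mapping $f=(f_0:\cdots:f_n)$ from a domain in $\mathbb C$ to $P^n(\mathbb C)$, given by holomorphic homogeneous coordinate functions $f_j$ without common zeros, the Fubini-Study derivative $f^{\#}\ge 0$ is defined by $$(f^{\#})^2:=\frac{\partial^2}{\partial z\,\partial\overline z}\log\sum_{i=0}^n|f_i|^2=\frac{\sum_{0\le s<t\le n}|f_sf_t'-f_tf_s'|^2}{\big(\sum_{i=0}^n|f_i|^2\big)^2}.$$ Hyperplanes $H_1,\dots,H_q$ in $P^n(\mathbb C)$ are in general position if $\bigcap_{i=0}^nH_{j_i}=\varnothing$ for all $1\le j_0<\cdots<j_n\le q$. $f^{-1}(H_j)$ is the set of points $z$ with $f(z)\in H_j$. The supremum over the empty set is regarded as finite. A holomorphic mapping $f:\triangle\to P^n(\mathbb C)$ is normal if the family $\{f\circ\varphi:\varphi\in\mathrm{Aut}(\triangle)\}$, where $\mathrm{Aut}(\triangle)$ is the group of biholomorphic self-maps of $\triangle$, is a normal family, i.e. every sequence in it has a subsequence converging uniformly on compact subsets of $\triangle$ to a holomorphic mapping of $\triangle$ into $P^n(\mathbb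 C)$. *)

theory Defs
  imports "HOL-Complex_Analysis.Complex_Analysis"
begin

no_notation fps_nth (infixl \<open>$\<close> 75)

section \<open>Complex projective space\<close>

definition hermitian :: "complex ^ 'i \<Rightarrow> complex ^ 'i \<Rightarrow> complex" where
  "hermitian v w = (\<Sum>i\<in>UNIV. v $ i * cnj (w $ i))"

definition proportional :: "complex ^ 'i \<Rightarrow> complex ^ 'i \<Rightarrow> bool" where
  "proportional v w \<longleftrightarrow> v \<noteq> 0 \<and> w \<noteq> 0 \<and> (\<exists>c. w = c *s v)"

lemma part_equivp_proportional: "part_equivp proportional"
proof (rule part_equivpI)
  show "\<exists>x::complex^'i. proportional x x"
    by (rule exI[of _ "vec 1"]) (auto simp: proportional_def vec_eq_iff intro!: exI[of _ 1])
  show "symp (proportional :: complex^'i \<Rightarrow> _)"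
  proof (rule sympI)
    fix v w :: "complex^'i" assume "proportional v w"
    then obtain c where c: "v \<noteq> 0" "w \<noteq> 0" "w = c *s v" by (auto simp: proportional_def)
    then have "c \<noteq> 0" by auto
    then have "v = inverse c *s w" using c by simp
    then show "proportional w v" using c unfolding proportional_def by blast
  qed
  show "transp (proportional :: complex^'i \<Rightarrow> _)"
    by (rule transpI) (auto simp: proportional_def)
qed

text \<open>
  The points of the complex projective space with homogeneous coordinates indexed by the
  finite type \<open>'i\<close>; its dimension is \<open>CARD('i) - 1\<close>.
\<close>

quotient_type 'i cproj = "complex ^ ('i::finite)" / partial: proportional
  by (rule part_equivp_proportional)

text \<open>The point with homogeneous coordinates \<open>v\<close>; meaningful only for \<open>v \<noteq> 0\<close>.\<close>

definition proj_point :: "complex ^ 'i \<Rightarrow> 'i::finite cproj" where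
  "proj_point v = abs_cproj v"

lemma proportional_refl_iff: "proportional v v \<longleftrightarrow> v \<noteq> 0"
  by (auto simp: proportional_def intro!: exI[of _ 1])

lemma proj_point_eq_iff:
  assumes "v \<noteq> 0" "w \<noteq> 0"
  shows "proj_point v = proj_point w \<longleftrightarrow> (\<exists>c. w = c *s v)"
  using Quotient3_rel[OF Quotient3_cproj, of v w] assms
  unfolding proj_point_def proportional_refl_iff by (simp add: proportional_def)

lemma proj_point_cases:
  obtains v where "v \<noteq> 0" "p = proj_point v"
  by (metis Quotient3_abs_rep Quotient3_cproj Quotient3_rep_reflp proj_point_def proportional_refl_iff)


subsection \<open>The Fubini-Study metric\<close>

lemma norm_cvec_power2: "(norm (v :: complex^'i))\<^sup>2 = (\<Sum>i\<in>UNIV. (cmod (v $ i))\<^sup>2)"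
  by (simp add: norm_vec_def L2_set_def sum_nonneg)

lemma norm_vector_smult: "norm (c *s (v :: complex^'i)) = cmod c * norm v"
proof -
  have "(norm (c *s v))\<^sup>2 = (cmod c * norm v)\<^sup>2"
    unfolding power_mult_distrib norm_cvec_power2 by (simp add: norm_mult power_mult_distrib sum_distrib_left)
  then show ?thesis by (simp add: power2_eq_iff_nonneg)
qed

lemma Re_hermitian: "Re (hermitian v w) = v \<bullet> w"
  by (simp add: hermitian_def inner_vec_def inner_complex_def)

lemma hermitian_smult_left: "hermitian (c *s v) w = c * hermitian v w"
  by (simp add: hermitian_def sum_distrib_left mult.assoc)

lemma hermitian_commute: "hermitian w v = cnj (hermitian v w)"
  by (simp add: hermitian_def mult.commute)

lemma hermitian_smult_right: "hermitian v (c *s w) = cnj c * hermitian v w"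
  by (simp add: hermitian_def sum_distrib_left mult_ac)

lemma hermitian_self: "hermitian v v = of_real ((norm v)\<^sup>2)"
  unfolding norm_cvec_power2 hermitian_def of_real_sum
  by (rule sum.cong) (simp_all only: complex_norm_square)

lemma hermitian_phase:
  obtains c where "cmod c = 1" "(c *s v) \<bullet> w = cmod (hermitian v w)"
proof -
  obtain c where c: "cmod c = 1" "c * hermitian v w = of_real (cmod (hermitian v w))"
  proof (cases "hermitian v w = 0")
    case True then show ?thesis by (intro that[of 1]) auto
  next
    case False
    show ?thesis
    proof (rule that[of "cnj (sgn (hermitian v w))"])
      show "cmod (cnj (sgn (hermitian v w))) = 1" using False by (simp add: norm_sgn)
      have "cnj (hermitian v w) * hermitian v w = of_real ((cmod (hermitian v w))\<^sup>2)"
        by (simp only: complex_norm_square mult.commute)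
      then show "cnj (sgn (hermitian v w)) * hermitian v w = of_real (cmod (hermitian v w))"
        using False by (simp add: sgn_eq power2_eq_square)
    qed
  qed
  have "(c *s v) \<bullet> w = Re (c * hermitian v w)"
    by (simp add: Re_hermitian[symmetric] hermitian_smult_left)
  then show ?thesis using c that[of c] by simp
qed

lemma cmod_hermitian_le: "cmod (hermitian v w) \<le> norm v * norm w"
proof -
  obtain c where c: "cmod c = 1" "(c *s v) \<bullet> w = cmod (hermitian v w)" by (rule hermitian_phase)
  have "(c *s v) \<bullet> w \<le> norm (c *s v) * norm w" by (rule norm_cauchy_schwarz)
  then show ?thesis using c by (simp add: norm_vector_smult)
qed

lemma fs_ratio_cong:
  assumes "proportional v v'" "proportional w w'"
  shows "cmod (hermitian v w) / (norm v * norm w) = cmod (hermitian v' w') / (norm v' * norm w')"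
  using assms unfolding proportional_def
  by (auto simp: hermitian_smult_left hermitian_smult_right norm_vector_smult norm_mult)

lift_definition fs_dist :: "'i::finite cproj \<Rightarrow> 'i cproj \<Rightarrow> real" is
  "\<lambda>v w. arccos (cmod (hermitian v w) / (norm v * norm w))"
  using fs_ratio_cong by metis

lemma fs_dist_proj_point:
  assumes "v \<noteq> 0" "w \<noteq> 0"
  shows "fs_dist (proj_point v) (proj_point w) =
    arccos (cmod (hermitian v w) / (norm v * norm w))"
  using assms by (simp add: fs_dist.abs_eq proj_point_def proportional_refl_iff)

lemma arccos_inner_triangle:
  fixes u v w :: "'a::real_inner"
  assumes n: "norm u = 1" "norm v = 1" "norm w = 1" and nn: "0 \<le> u \<bullet> v" "0 \<le> v \<bullet> w"
  shows "arccos (u \<bullet> w) \<le> arccos (u \<bullet> v) + arccos (v \<bullet> w)"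
proof -
  have b: "\<bar>x \<bullet> y\<bar> \<le> 1" if "norm x = 1" "norm y = 1" for x y :: 'a
    using Cauchy_Schwarz_ineq2[of x y] that by simp
  have uu: "u \<bullet> u = 1" "v \<bullet> v = 1" "w \<bullet> w = 1" using n by (simp_all add: dot_square_norm)
  define a c where "a = u \<bullet> v" and "c = v \<bullet> w"
  have ac: "0 \<le> a" "a \<le> 1" "0 \<le> c" "c \<le> 1"
    using nn b[of u v] b[of v w] n by (auto simp: a_def c_def)
  define u' w' where "u' = u - a *\<^sub>R v" and "w' = w - c *\<^sub>R v"
  have nu: "(norm u')\<^sup>2 = 1 - a\<^sup>2" "(norm w')\<^sup>2 = 1 - c\<^sup>2"
    unfolding u'_def w'_def power2_norm_eq_inner
    using uu by (simp_all add: inner_diff_left inner_diff_right a_def c_def inner_commute power2_eq_square algebra_simps)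
  have uw: "u' \<bullet> w' = u \<bullet> w - a * c"
    unfolding u'_def w'_def
    using uu by (simp add: inner_diff_left inner_diff_right a_def c_def inner_commute algebra_simps)
  have nu': "norm u' = sqrt (1 - a\<^sup>2)" "norm w' = sqrt (1 - c\<^sup>2)"
    using nu by (metis norm_ge_zero real_sqrt_abs abs_of_nonneg)+
  have "cos (arccos a + arccos c) = a * c - norm u' * norm w'"
    using ac by (simp add: cos_add sin_arccos nu')
  also have "\<dots> \<le> u \<bullet> w"
    using uw Cauchy_Schwarz_ineq2[of u' w'] by linarith
  finally have "cos (arccos a + arccos c) \<le> u \<bullet> w" .
  then have "arccos (u \<bullet> w) \<le> arccos (cos (arccos a + arccos c))"
    using b[of u w] n by (intro arccos_le_mono[THEN iffD2]) auto
  also have "\<dots> = arccos a + arccos c"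
  proof (rule arccos_cos)
    have "arccos a \<le> pi/2" "arccos c \<le> pi/2"
      using ac using arccos_le_pi2 by blast+
    then show "arccos a + arccos c \<le> pi" by simp
    show "0 \<le> arccos a + arccos c" using ac by (auto intro!: add_nonneg_nonneg arccos_lbound)
  qed
  finally show ?thesis by (simp add: a_def c_def)
qed

lemma proj_point_normalized:
  obtains v where "norm v = 1" "p = proj_point v"
proof -
  obtain v where v: "v \<noteq> 0" "p = proj_point v" by (rule proj_point_cases)
  define c :: complex where "c = of_real (1 / norm v)"
  have c: "norm (c *s v) = 1" using v by (simp add: norm_vector_smult c_def norm_divide)
  moreover have "proj_point v = proj_point (c *s v)"
    using v c by (subst proj_point_eq_iff) auto
  ultimately show ?thesis using that v by metis
qed

lemma proj_point_smult:
  assumes "c \<noteq> 0" "v \<noteq> 0" shows "proj_point (c *s v) = proj_point v"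
  using proj_point_eq_iff[of v "c *s v"] assms by auto

lemma fs_dist_triangle: "fs_dist p r \<le> fs_dist p q + fs_dist q r"
proof -
  obtain u0 where u0: "norm u0 = 1" "p = proj_point u0" by (rule proj_point_normalized)
  obtain v where v: "norm v = 1" "q = proj_point v" by (rule proj_point_normalized)
  obtain w0 where w0: "norm w0 = 1" "r = proj_point w0" by (rule proj_point_normalized)
  obtain c where c: "cmod c = 1" "(c *s u0) \<bullet> v = cmod (hermitian u0 v)" by (rule hermitian_phase)
  obtain d where d: "cmod d = 1" "(d *s w0) \<bullet> v = cmod (hermitian w0 v)" by (rule hermitian_phase)
  define u w where "u = c *s u0" and "w = d *s w0"
  have un: "norm u = 1" "norm w = 1" using u0 w0 c d by (simp_all add: u_def w_def norm_vector_smult)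
  have nz: "u \<noteq> 0" "v \<noteq> 0" "w \<noteq> 0" "u0 \<noteq> 0" "w0 \<noteq> 0" "c \<noteq> 0" "d \<noteq> 0"
    using un v u0 w0 c d by auto
  have pr: "p = proj_point u" "r = proj_point w"
    using u0 w0 nz by (simp_all add: u_def w_def proj_point_smult)
  have uv: "u \<bullet> v = cmod (hermitian u v)"
    using c by (simp add: u_def hermitian_smult_left norm_mult)
  have vw: "v \<bullet> w = cmod (hermitian v w)"
    using d hermitian_commute[of w0 v]
    by (simp add: w_def hermitian_smult_right norm_mult inner_commute)
  have "fs_dist p r = arccos (cmod (hermitian u w))"
    using pr nz un by (simp add: fs_dist_proj_point)
  also have "\<dots> \<le> arccos (u \<bullet> w)"
  proof (subst arccos_le_mono)
    show "\<bar>cmod (hermitian u w)\<bar> \<le> 1" using cmod_hermitian_le[of u w] un by simp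
    show "\<bar>u \<bullet> w\<bar> \<le> 1" using Cauchy_Schwarz_ineq2[of u w] un by simp
    show "u \<bullet> w \<le> cmod (hermitian u w)"
      using complex_Re_le_cmod[of "hermitian u w"] by (simp add: Re_hermitian)
  qed
  also have "\<dots> \<le> arccos (u \<bullet> v) + arccos (v \<bullet> w)"
    using un v uv vw by (intro arccos_inner_triangle) auto
  also have "\<dots> = fs_dist p q + fs_dist q r"
    using pr v nz un by (simp add: fs_dist_proj_point uv vw)
  finally show ?thesis .
qed

lemma fs_dist_commute: "fs_dist p q = fs_dist q p"
proof -
  obtain u where u: "norm u = 1" "p = proj_point u" by (rule proj_point_normalized)
  obtain v where v: "norm v = 1" "q = proj_point v" by (rule proj_point_normalized)
  have "u \<noteq> 0" "v \<noteq> 0" using u v by auto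
  then show ?thesis using u v by (simp add: fs_dist_proj_point hermitian_commute[of u v])
qed

lemma fs_dist_eq_0_iff: "fs_dist p q = 0 \<longleftrightarrow> p = q"
proof -
  obtain u where u: "norm u = 1" "p = proj_point u" by (rule proj_point_normalized)
  obtain v where v: "norm v = 1" "q = proj_point v" by (rule proj_point_normalized)
  have nz: "u \<noteq> 0" "v \<noteq> 0" using u v by auto
  have d: "fs_dist p q = arccos (cmod (hermitian u v))"
    using u v nz by (simp add: fs_dist_proj_point)
  show ?thesis
  proof
    assume "fs_dist p q = 0"
    then have h: "cmod (hermitian u v) = 1"
      using d cmod_hermitian_le[of u v] u v
      by (metis arccos_0 arccos_eq_iff cos_arccos_abs cos_zero abs_norm_cancel mult_1)
    obtain c where c: "cmod c = 1" "(c *s u) \<bullet> v = cmod (hermitian u v)" by (rule hermitian_phase)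
    have "norm (c *s u) = 1" using c u by (simp add: norm_vector_smult)
    then have "v = c *s u"
      using norm_cauchy_schwarz_eq[of "c *s u" v] c h v by simp
    then show "p = q" using u v nz proj_point_eq_iff by metis
  next
    assume "p = q"
    then have "fs_dist p q = fs_dist (proj_point u) (proj_point u)" using u by simp
    also have "\<dots> = arccos (cmod (hermitian u u))"
      using u(1) nz by (simp add: fs_dist_proj_point)
    finally have "fs_dist p q = arccos (cmod (hermitian u u))" .
    then show "fs_dist p q = 0" using u by (simp add: hermitian_self norm_power)
  qed
qed

instantiation cproj :: (finite) metric_space
begin

definition dist_cproj :: "'a cproj \<Rightarrow> 'a cproj \<Rightarrow> real" where
  "dist_cproj = fs_dist"

definition uniformity_cproj :: "('a cproj \<times> 'a cproj) filter" where
  "uniformity_cproj = (INF e\<in>{0 <..}. principal {(x, y). dist x y < e})"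

definition open_cproj :: "'a cproj set \<Rightarrow> bool" where
  "open_cproj U \<longleftrightarrow> (\<forall>x\<in>U. eventually (\<lambda>(x', y). x' = x \<longrightarrow> y \<in> U) uniformity)"

instance
proof
  fix x y z :: "'a cproj"
  show "dist x y = 0 \<longleftrightarrow> x = y" by (simp add: dist_cproj_def fs_dist_eq_0_iff)
  show "dist x y \<le> dist x z + dist y z"
    using fs_dist_triangle[of x y z] by (simp add: dist_cproj_def fs_dist_commute[of z y])
qed (simp_all only: uniformity_cproj_def open_cproj_def)

end


subsection \<open>Hyperplanes\<close>

definition hyperplane :: "'i::finite cproj set \<Rightarrow> bool" where
  "hyperplane H \<longleftrightarrow> (\<exists>a :: complex ^ 'i. a \<noteq> 0 \<and>
     H = {proj_point v | v. v \<noteq> 0 \<and> (\<Sum>i\<in>UNIV. a $ i * v $ i) = 0})"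

text \<open>
  The intersection of any \<open>CARD('i)\<close>, i.e. dimension plus one, members of the family is empty.
\<close>

definition general_position :: "nat \<Rightarrow> (nat \<Rightarrow> 'i::finite cproj set) \<Rightarrow> bool" where
  "general_position q H \<longleftrightarrow>
     (\<forall>J \<subseteq> {1..q}. card J = CARD('i) \<longrightarrow> (\<Inter>j\<in>J. H j) = {})"


section \<open>Holomorphic mappings into projective space\<close>

definition homogeneous_coords ::
    "(complex \<Rightarrow> complex ^ 'i) \<Rightarrow> (complex \<Rightarrow> 'i::finite cproj) \<Rightarrow> complex set \<Rightarrow> bool" where
  "homogeneous_coords F f S \<longleftrightarrow>
     (\<forall>i. (\<lambda>z. F z $ i) holomorphic_on S) \<and> (\<forall>z\<in>S. F z \<noteq> 0 \<and> f z = proj_point (F z))"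

definition proj_holomorphic_on :: "(complex \<Rightarrow> 'i::finite cproj) \<Rightarrow> complex set \<Rightarrow> bool"
    (infixl \<open>proj'_holomorphic'_on\<close> 50) where
  "f proj_holomorphic_on S \<longleftrightarrow> (\<exists>F. homogeneous_coords F f S)"


subsection \<open>The Fubini-Study derivative\<close>

text \<open>The operators \<open>\<partial>/\<partial>z\<close> and \<open>\<partial>/\<partial>z\<close>-bar.\<close>

definition wirtinger_z :: "(complex \<Rightarrow> complex) \<Rightarrow> complex \<Rightarrow> complex" where
  "wirtinger_z g z =
     (frechet_derivative g (at z) 1 - \<i> * frechet_derivative g (at z) \<i>) / 2"

definition wirtinger_zbar :: "(complex \<Rightarrow> complex) \<Rightarrow> complex \<Rightarrow> complex" where
  "wirtinger_zbar g z =
     (frechet_derivative g (at z) 1 + \<i> * frechet_derivative g (at z) \<i>) / 2"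

definition fs_deriv_coords :: "(complex \<Rightarrow> complex ^ 'i) \<Rightarrow> complex \<Rightarrow> real" where
  "fs_deriv_coords F z =
     sqrt (Re (wirtinger_z (wirtinger_zbar
       (\<lambda>w. complex_of_real (ln (\<Sum>i\<in>UNIV. (cmod (F w $ i))\<^sup>2)))) z))"

text \<open>
  The value does not depend on the chosen coordinates; see \<open>fs_deriv_eq_coords\<close> below.
\<close>

definition fs_deriv :: "(complex \<Rightarrow> 'i::finite cproj) \<Rightarrow> complex \<Rightarrow> real" where
  "fs_deriv f z = (THE r. \<exists>F S. open S \<and> z \<in> S \<and> homogeneous_coords F f S \<and>
                            r = fs_deriv_coords F z)"

lemma lagrange_identity_complex:
  fixes a b :: "'i::finite \<Rightarrow> complex"
  shows "(\<Sum>s\<in>UNIV. \<Sum>t\<in>UNIV. (cmod (a s * b t - a t * b s))\<^sup>2) =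
    2 * ((\<Sum>i\<in>UNIV. (cmod (a i))\<^sup>2) * (\<Sum>i\<in>UNIV. (cmod (b i))\<^sup>2)
         - (cmod (\<Sum>i\<in>UNIV. b i * cnj (a i)))\<^sup>2)"
proof -
  have "complex_of_real (\<Sum>s\<in>UNIV. \<Sum>t\<in>UNIV. (cmod (a s * b t - a t * b s))\<^sup>2) =
    (\<Sum>s\<in>UNIV. \<Sum>t\<in>UNIV. (a s * cnj (a s)) * (b t * cnj (b t)) + (b s * cnj (b s)) * (a t * cnj (a t))
       - (b s * cnj (a s)) * (a t * cnj (b t)) - (a s * cnj (b s)) * (b t * cnj (a t)))"
    unfolding of_real_sum complex_norm_square by (intro sum.cong refl) (simp add: algebra_simps)
  also have "\<dots> = 2 * ((\<Sum>i\<in>UNIV. a i * cnj (a i)) * (\<Sum>i\<in>UNIV. b i * cnj (b i))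
      - (\<Sum>i\<in>UNIV. b i * cnj (a i)) * (\<Sum>i\<in>UNIV. a i * cnj (b i)))"
    unfolding sum.distrib sum_subtractf sum_product[symmetric] by (simp add: algebra_simps)
  also have "(\<Sum>i\<in>UNIV. a i * cnj (b i)) = cnj (\<Sum>i\<in>UNIV. b i * cnj (a i))"
    by (simp add: mult.commute)
  also have "(\<Sum>i\<in>UNIV. b i * cnj (a i)) * cnj (\<Sum>i\<in>UNIV. b i * cnj (a i)) =
     complex_of_real ((cmod (\<Sum>i\<in>UNIV. b i * cnj (a i)))\<^sup>2)"
    by (rule complex_norm_square[symmetric])
  also have "(\<Sum>i\<in>UNIV. a i * cnj (a i)) = complex_of_real (\<Sum>i\<in>UNIV. (cmod (a i))\<^sup>2)"
    unfolding of_real_sum complex_norm_square ..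
  also have "(\<Sum>i\<in>UNIV. b i * cnj (b i)) = complex_of_real (\<Sum>i\<in>UNIV. (cmod (b i))\<^sup>2)"
    unfolding of_real_sum complex_norm_square ..
  finally show ?thesis
    by (metis (no_types, lifting) of_real_diff of_real_eq_iff of_real_mult of_real_numeral)
qed

text \<open>
  The explicit formula for the Fubini-Study derivative. As \<open>'i\<close> carries no order, the sum over
  \<open>s < t\<close> appears as half of the sum over all pairs.
\<close>

lemma fs_deriv_coords_eq:
  fixes F :: "complex \<Rightarrow> complex ^ 'i::finite"
  assumes S: "open S" "z \<in> S" and hol: "\<And>i. (\<lambda>z. F z $ i) holomorphic_on S"
    and nz: "\<And>z. z \<in> S \<Longrightarrow> F z \<noteq> 0"
  shows "(fs_deriv_coords F z)\<^sup>2 =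
    (\<Sum>s\<in>UNIV. \<Sum>t\<in>UNIV. (cmod (F z $ s * deriv (\<lambda>z. F z $ t) z
                               - F z $ t * deriv (\<lambda>z. F z $ s) z))\<^sup>2) / 2
      / (\<Sum>i\<in>UNIV. (cmod (F z $ i))\<^sup>2)\<^sup>2"
    (is "_ = ?R") and "fs_deriv_coords F z \<ge> 0"
proof -
  define F' where "F' z i = deriv (\<lambda>z. F z $ i) z" for z i
  define F'' where "F'' z i = deriv (\<lambda>z. F' z i) z" for z i
  have d1: "((\<lambda>z. F z $ i) has_field_derivative F' w i) (at w)" if "w \<in> S" for w i
    unfolding F'_def using holomorphic_derivI[OF hol S(1) that] by simp
  have hol': "(\<lambda>z. F' z i) holomorphic_on S" for i
    unfolding F'_def by (intro holomorphic_deriv hol S)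
  have d2: "((\<lambda>z. F' z i) has_field_derivative F'' w i) (at w)" if "w \<in> S" for w i
    unfolding F''_def using holomorphic_derivI[OF hol' S(1) that] by simp
  note D1 = d1[unfolded has_field_derivative_def] and D2 = d2[unfolded has_field_derivative_def]
  define N where "N w = (\<Sum>i\<in>UNIV. (cmod (F w $ i))\<^sup>2)" for w
  define A where "A w = (\<Sum>i\<in>UNIV. F' w i * cnj (F w $ i))" for w
  define B where "B w = (\<Sum>i\<in>UNIV. (cmod (F' w i))\<^sup>2)" for w
  define C where "C w = (\<Sum>i\<in>UNIV. F w $ i * cnj (F'' w i))" for w
  have Npos: "N w > 0" if "w \<in> S" for w
    unfolding N_def norm_cvec_power2[symmetric] using nz[OF that] by simp
  have Nc: "complex_of_real (N w) = (\<Sum>i\<in>UNIV. F w $ i * cnj (F w $ i))" for w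
    unfolding N_def of_real_sum complex_norm_square ..
  have DNc: "((\<lambda>w. complex_of_real (N w)) has_derivative (\<lambda>h. A w * h + cnj (A w * h))) (at w)"
    if "w \<in> S" for w
    unfolding Nc
    by (rule has_derivative_eq_rhs, (rule derivative_intros D1 that)+)
       (simp add: A_def fun_eq_iff sum_distrib_left sum.distrib algebra_simps)
  have DN: "(N has_derivative (\<lambda>h. 2 * Re (A w * h))) (at w)" if "w \<in> S" for w
    using has_derivative_Re[OF DNc[OF that]] by (simp add: mult.commute)
  define u where "u w = complex_of_real (ln (N w))" for w
  have Du: "(u has_derivative (\<lambda>h. complex_of_real (2 * Re (A w * h) / N w))) (at w)"
    if "w \<in> S" for w
    unfolding u_def
    by (rule has_derivative_eq_rhs, (rule derivative_intros DN that Npos)+)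
       (simp add: fun_eq_iff field_simps)
  have zbar: "wirtinger_zbar u w = cnj (A w) / complex_of_real (N w)" if "w \<in> S" for w
    unfolding wirtinger_zbar_def frechet_derivative_at[OF Du[OF that], symmetric]
    using Npos[OF that] by (simp add: complex_eq_iff)
  have DA: "((\<lambda>w. cnj (A w)) has_derivative (\<lambda>h. C z * cnj h + of_real (B z) * h)) (at z)"
  proof -
    have "of_real (B z) = (\<Sum>i\<in>UNIV. F' z i * cnj (F' z i))"
      unfolding B_def of_real_sum complex_norm_square ..
    then show ?thesis
      unfolding A_def
      by - (rule has_derivative_eq_rhs, (rule derivative_intros D1 D2 S)+,
       simp add: C_def fun_eq_iff sum_distrib_left sum.distrib algebra_simps)
  qed
  have Dq: "((\<lambda>w. cnj (A w) / complex_of_real (N w)) has_derivative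
    (\<lambda>h. ((C z * cnj h + of_real (B z) * h) * of_real (N z) - cnj (A z) * (A z * h + cnj (A z * h)))
            / (of_real (N z) * of_real (N z)))) (at z)"
    using Npos[OF S(2)] by (intro has_derivative_divide' DA DNc S) simp
  have Dz: "(wirtinger_zbar u has_derivative
    (\<lambda>h. ((C z * cnj h + of_real (B z) * h) * of_real (N z) - cnj (A z) * (A z * h + cnj (A z * h)))
            / (of_real (N z) * of_real (N z)))) (at z)"
    by (rule has_derivative_transform_within_open[OF Dq S]) (simp add: zbar)
  have "wirtinger_z (wirtinger_zbar u) z =
     (of_real (B z) * of_real (N z) - A z * cnj (A z)) / (of_real (N z) * of_real (N z))"
    unfolding wirtinger_z_def frechet_derivative_at[OF Dz, symmetric]
    using Npos[OF S(2)] by (simp add: field_simps)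
  also have "\<dots> = of_real ((B z * N z - (cmod (A z))\<^sup>2) / (N z)\<^sup>2)"
    by (simp only: complex_norm_square[symmetric] of_real_mult[symmetric] of_real_diff[symmetric]
        of_real_divide[symmetric] power2_eq_square)
  finally have W: "Re (wirtinger_z (wirtinger_zbar u) z) = (B z * N z - (cmod (A z))\<^sup>2) / (N z)\<^sup>2"
    by simp
  have L: "(\<Sum>s\<in>UNIV. \<Sum>t\<in>UNIV. (cmod (F z $ s * F' z t - F z $ t * F' z s))\<^sup>2) =
      2 * (N z * B z - (cmod (A z))\<^sup>2)"
    unfolding N_def B_def A_def by (rule lagrange_identity_complex)
  have RW: "?R = Re (wirtinger_z (wirtinger_zbar u) z)"
    unfolding W unfolding F'_def[symmetric] L N_def[symmetric]
    using Npos[OF S(2)] by (simp add: field_simps)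
  have "?R \<ge> 0" by (intro divide_nonneg_nonneg sum_nonneg) auto
  then show "fs_deriv_coords F z \<ge> 0" "(fs_deriv_coords F z)\<^sup>2 = ?R"
    unfolding RW fs_deriv_coords_def u_def N_def by simp_all
qed

lemma fs_deriv_coords_unique:
  assumes F: "homogeneous_coords F f S" "open S" "z \<in> S"
    and G: "homogeneous_coords G f T" "open T" "z \<in> T"
  shows "fs_deriv_coords F z = fs_deriv_coords G z"
proof -
  have Fz: "F z \<noteq> 0" using F by (auto simp: homogeneous_coords_def)
  then obtain k where k: "F z $ k \<noteq> 0" by (auto simp: vec_eq_iff)
  have cont: "continuous_on (S \<inter> T) (\<lambda>z. F z $ k)"
  proof (rule continuous_on_subset)
    show "continuous_on S (\<lambda>z. F z $ k)"
      using F(1) by (simp add: homogeneous_coords_def holomorphic_on_imp_continuous_on)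
  qed simp
  define U where "U = (S \<inter> T) \<inter> (\<lambda>z. F z $ k) -` (- {0})"
  have "open U"
    unfolding U_def by (rule continuous_open_preimage[OF cont]) (use F G in auto)
  moreover have zU: "z \<in> U" using k F G by (auto simp: U_def)
  ultimately have U: "open U" "z \<in> U" by auto
  have hF: "(\<lambda>z. F z $ i) holomorphic_on U" and hG: "(\<lambda>z. G z $ i) holomorphic_on U" for i
  proof -
    have US: "U \<subseteq> S" "U \<subseteq> T" by (auto simp: U_def)
    show "(\<lambda>z. F z $ i) holomorphic_on U"
      using F(1) US(1) unfolding homogeneous_coords_def by (meson holomorphic_on_subset)
    show "(\<lambda>z. G z $ i) holomorphic_on U"
      using G(1) US(2) unfolding homogeneous_coords_def by (meson holomorphic_on_subset)
  qed
  have nF: "F w \<noteq> 0" and nG: "G w \<noteq> 0" if "w \<in> U" for w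
    using that F G by (auto simp: homogeneous_coords_def U_def)
  define c where "c w = G w $ k / F w $ k" for w
  have hc: "c holomorphic_on U"
    unfolding c_def by (intro holomorphic_intros hF hG) (auto simp: U_def)
  have Gc: "G w = c w *s F w" if "w \<in> U" for w
  proof -
    have "proj_point (F w) = proj_point (G w)"
      using that F G by (auto simp: homogeneous_coords_def U_def)
    then have "\<exists>d. G w = d *s F w" using proj_point_eq_iff[OF nF[OF that] nG[OF that]] by simp
    then obtain d where d: "G w = d *s F w" by blast
    have "F w $ k \<noteq> 0" using that by (auto simp: U_def)
    then have "c w = d" using d by (simp add: c_def)
    then show ?thesis using d by simp
  qed
  have cz: "c z \<noteq> 0" using Gc[OF zU] nG[OF zU] by auto
  have dG: "deriv (\<lambda>z. G z $ i) z = deriv c z * F z $ i + c z * deriv (\<lambda>z. F z $ i) z" for i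
  proof -
    have "((\<lambda>z. c z * F z $ i) has_field_derivative
        deriv c z * F z $ i + c z * deriv (\<lambda>z. F z $ i) z) (at z)"
      using DERIV_mult[OF holomorphic_derivI[OF hc U] holomorphic_derivI[OF hF U]]
      by (simp add: algebra_simps)
    then have "((\<lambda>z. G z $ i) has_field_derivative
        deriv c z * F z $ i + c z * deriv (\<lambda>z. F z $ i) z) (at z)"
      by (rule has_field_derivative_transform_within_open[OF _ U]) (simp add: Gc)
    then show ?thesis by (rule DERIV_imp_deriv)
  qed
  have wr: "G z $ s * deriv (\<lambda>z. G z $ t) z - G z $ t * deriv (\<lambda>z. G z $ s) z =
    (c z)\<^sup>2 * (F z $ s * deriv (\<lambda>z. F z $ t) z - F z $ t * deriv (\<lambda>z. F z $ s) z)" for s t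
    unfolding dG by (simp add: Gc[OF zU] power2_eq_square algebra_simps)
  have nr: "(\<Sum>i\<in>UNIV. (cmod (G z $ i))\<^sup>2) = (cmod (c z))\<^sup>2 * (\<Sum>i\<in>UNIV. (cmod (F z $ i))\<^sup>2)"
    by (simp add: Gc[OF zU] norm_mult power_mult_distrib sum_distrib_left)
  have "(fs_deriv_coords G z)\<^sup>2 =
    (\<Sum>s\<in>UNIV. \<Sum>t\<in>UNIV. (cmod (G z $ s * deriv (\<lambda>z. G z $ t) z
                               - G z $ t * deriv (\<lambda>z. G z $ s) z))\<^sup>2) / 2
      / (\<Sum>i\<in>UNIV. (cmod (G z $ i))\<^sup>2)\<^sup>2"
    by (rule fs_deriv_coords_eq(1)[OF U hG]) (rule nG)
  also have "\<dots> =
    (\<Sum>s\<in>UNIV. \<Sum>t\<in>UNIV. (cmod (F z $ s * deriv (\<lambda>z. F z $ t) z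
                               - F z $ t * deriv (\<lambda>z. F z $ s) z))\<^sup>2) / 2
      / (\<Sum>i\<in>UNIV. (cmod (F z $ i))\<^sup>2)\<^sup>2"
    unfolding wr nr norm_mult norm_power power_mult_distrib sum_distrib_left[symmetric]
    using cz by simp
  also have "\<dots> = (fs_deriv_coords F z)\<^sup>2"
    by (rule fs_deriv_coords_eq(1)[OF U hF, symmetric]) (rule nF)
  finally have "(fs_deriv_coords G z)\<^sup>2 = (fs_deriv_coords F z)\<^sup>2" .
  moreover have "fs_deriv_coords F z \<ge> 0"
    by (rule fs_deriv_coords_eq(2)[OF U hF]) (rule nF)
  moreover have "fs_deriv_coords G z \<ge> 0"
    by (rule fs_deriv_coords_eq(2)[OF U hG]) (rule nG)
  ultimately show ?thesis by (simp add: power2_eq_iff_nonneg)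
qed

lemma fs_deriv_eq_coords:
  assumes "homogeneous_coords F f S" "open S" "z \<in> S"
  shows "fs_deriv f z = fs_deriv_coords F z"
  unfolding fs_deriv_def using assms fs_deriv_coords_unique by (intro the_equality) blast+


section \<open>Normal families and normal mappings\<close>

text \<open>Uniform convergence is with respect to the Fubini-Study distance.\<close>

definition normal_family :: "(complex \<Rightarrow> 'i::finite cproj) set \<Rightarrow> complex set \<Rightarrow> bool" where
  "normal_family \<F> D \<longleftrightarrow>
     (\<forall>g :: nat \<Rightarrow> complex \<Rightarrow> 'i cproj. range g \<subseteq> \<F> \<longrightarrow>
        (\<exists>r h. strict_mono (r :: nat \<Rightarrow> nat) \<and> h proj_holomorphic_on D \<and>
           (\<forall>K. compact K \<and> K \<subseteq> D \<longrightarrow> uniform_limit K (g \<circ> r) h sequentially)))"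

abbreviation unit_disc :: "complex set" where
  "unit_disc \<equiv> ball 0 1"

text \<open>
  Only the values of an automorphism on the disc matter; its values elsewhere are arbitrary.
\<close>

definition Aut_disc :: "(complex \<Rightarrow> complex) set" where
  "Aut_disc = {\<phi>. \<phi> holomorphic_on unit_disc \<and> bij_betw \<phi> unit_disc unit_disc \<and>
                  inv_into unit_disc \<phi> holomorphic_on unit_disc}"

definition normal_map :: "(complex \<Rightarrow> 'i::finite cproj) \<Rightarrow> bool" where
  "normal_map f \<longleftrightarrow>
     f proj_holomorphic_on unit_disc \<and> normal_family {f \<circ> \<phi> | \<phi>. \<phi> \<in> Aut_disc} unit_disc"

end

theory Submission
  imports Defs "Jordan_Normal_Form.Determinant"
begin

no_notation vec_index (infixl \<open>$\<close> 100)
hide_const (open) Determinants.det Finite_Cartesian_Product.mat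

text \<open>
  If \<open>(1 - |z|\<^sup>2) f\<^sup>#(z)\<close> is bounded on the disc, then \<open>f\<close> is normal by Marty's criterion and the
  Schwarz-Pick lemma. Otherwise Zalcman rescaling yields a nonconstant entire curve \<open>F\<close> with
  bounded Fubini-Study derivative, and by the hypothesis and Hurwitz's theorem the derivative of \<open>F\<close>
  vanishes wherever \<open>F\<close> meets one of the hyperplanes without being contained in it.

  No such \<open>F\<close> exists. For the linear forms \<open>h\<^sub>a\<close> of the \<open>q'\<close> hyperplanes not containing \<open>F\<close>, powers of
  \<open>wr2 F s t\<close> and of the Wronskian cancel all zeros of \<open>\<Prod>h\<^sub>a\<close>, so there is an entire \<open>\<phi>\<close> with
  \<open>\<phi> \<Prod>h\<^sub>a = (wr2 F s t)^(k n) * Wr^m\<close>, and the bound on \<open>q\<close> leaves a positive exponent \<open>e\<close> for which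
  \<open>|\<phi>| |F|^e\<close> is dominated by products of logarithmic derivatives of the \<open>h\<^sub>a\<close>. As \<open>F\<close> has bounded
  derivative, these are polynomially bounded on suitable circles, so each \<open>\<phi> h\<^sub>a^e\<close> is a polynomial.
  Then the quotients of the \<open>h\<^sub>a\<close> are rational up to a root, the logarithmic derivatives tend to \<open>0\<close>
  at infinity, and \<open>\<phi> h\<^sub>a^e\<close> vanishes, a contradiction.
\<close>

section \<open>The Fubini-Study derivative in coordinates\<close>

text \<open>Where r forms vanish, with r at most \<open>n\<close>, \<open>wr2\<close> vanishes too,
  so its power \<open>k n\<close> has order at least \<open>k r\<close>: that is \<open>k\<close>
  for each form. A form of higher order \<open>\<nu>\<close> leaves an excess
  \<open>\<nu> - k\<close>, and at least this order survives in its column of a Wronskian, where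
  derivatives of order at most \<open>k\<close> occur. A Wronskian sees only the forms of one basis.
  If the image spans a subspace of codimension \<open>d\<close>, the forms need not stay in general
  position on it, and a well chosen basis catches at least the part \<open>1 / (d + 1)\<close> of
  the excess; hence the power \<open>m = d + 1\<close>.

  The bound on \<open>q\<close> is a degree count in \<open>F\<close>: \<open>wr2\<close> has degree
  2 and the Wronskian degree \<open>k + 1\<close>, so \<open>2 k n + (d + 1) (k + 1)\<close> must
  stay below the number of forms left. For \<open>d = 0\<close> this reads
  \<open>2 n^2 + n + 1 < q\<close>, which is the hypothesis; \<open>d > 0\<close> is no worse.

  Lower bounds for the forms come from a maximum principle, as a bounded derivative bounds the
  Laplacian of \<open>ln (nsq F)\<close>. Limits are found in local coordinates, whereas a
  holomorphic mapping has coordinates on its whole domain; a multiplicative Cousin problem bridges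
  the gap.\<close>

definition wr2 :: "(complex \<Rightarrow> complex ^ 'i) \<Rightarrow> 'i \<Rightarrow> 'i \<Rightarrow> complex \<Rightarrow> complex" where
  "wr2 F s t z = F z $ s * deriv (\<lambda>z. F z $ t) z - F z $ t * deriv (\<lambda>z. F z $ s) z"

lemma holomorphic_on_wr2:
  assumes "open U" "\<And>i. (\<lambda>z. F z $ i) holomorphic_on U"
  shows "wr2 F s t holomorphic_on U"
  unfolding wr2_def[abs_def] using assms by (intro holomorphic_intros) auto

text \<open>The terms with \<open>deriv u\<close> cancel by antisymmetry. Hence a change of
  homogeneous coordinates multiplies \<open>wr2\<close> by a square, just as it multiplies
  \<open>nsq\<close> by the square of a modulus, and quotients of the two are intrinsic up to
  phase.\<close>

lemma wr2_smult:
  assumes U: "open U" "z \<in> U" and F: "\<And>i. (\<lambda>z. F z $ i) holomorphic_on U" and u: "u holomorphic_on U"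
  shows "wr2 (\<lambda>z. u z *s F z) s t z = (u z)\<^sup>2 * wr2 F s t z"
proof -
  have "deriv (\<lambda>z. (u z *s F z) $ i) z = deriv u z * F z $ i + u z * deriv (\<lambda>z. F z $ i) z" for i
    using DERIV_mult[OF holomorphic_derivI[OF u U] holomorphic_derivI[OF F[of i] U]]
    by (intro DERIV_imp_deriv) (simp add: algebra_simps)
  then show ?thesis by (simp add: wr2_def power2_eq_square algebra_simps)
qed

lemma wr2_compose:
  assumes U: "open U" "g z \<in> U" and F: "\<And>i. (\<lambda>z. F z $ i) holomorphic_on U"
    and g: "(g has_field_derivative g') (at z)"
  shows "wr2 (\<lambda>z. F (g z)) s t z = g' * wr2 F s t (g z)"
proof -
  have "deriv (\<lambda>z. F (g z) $ i) z = deriv (\<lambda>z. F z $ i) (g z) * g'" for i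
    using DERIV_chain2[OF holomorphic_derivI[OF F[of i] U, of UNIV] g]
    by (intro DERIV_imp_deriv)
  then show ?thesis by (simp add: wr2_def algebra_simps)
qed

definition nsq :: "complex ^ 'i::finite \<Rightarrow> real" where "nsq v = (norm v)\<^sup>2"

lemma nsq_smult: "nsq (c *s v) = (cmod c)\<^sup>2 * nsq v"
  by (simp add: nsq_def norm_vector_smult power_mult_distrib)

lemma nsq_pos: "v \<noteq> 0 \<Longrightarrow> nsq v > 0"
  by (simp add: nsq_def)

lemma nsq_sum: "nsq v = (\<Sum>i\<in>UNIV. (cmod (v $ i))\<^sup>2)"
  by (simp add: nsq_def norm_cvec_power2)

lemma nsq_complex: "complex_of_real (nsq v) = (\<Sum>i\<in>UNIV. v $ i * cnj (v $ i))"
  unfolding nsq_sum of_real_sum complex_norm_square ..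

text \<open>By Lagrange's identity the left side is the sum of all \<open>|wr2|^2\<close>, twice the
  Gram determinant of \<open>F\<close> and \<open>F'\<close>. Divided by \<open>nsq^2\<close> that
  determinant is the mixed second derivative of \<open>ln (nsq F)\<close>; in this form the bound
  enters the maximum principle.\<close>

lemma wr2_bound_gram:
  fixes F :: "complex \<Rightarrow> complex ^ 'i::finite"
  assumes "\<And>s t. cmod (wr2 F s t z) \<le> nsq (F z)"
  defines "B \<equiv> \<Sum>i\<in>UNIV. (cmod (deriv (\<lambda>z. F z $ i) z))\<^sup>2"
    and "A \<equiv> \<Sum>i\<in>UNIV. deriv (\<lambda>z. F z $ i) z * cnj (F z $ i)"
  shows "2 * (B * nsq (F z) - (cmod A)\<^sup>2) \<le> (real CARD('i))\<^sup>2 * (nsq (F z))\<^sup>2"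
proof -
  have "2 * (nsq (F z) * B - (cmod A)\<^sup>2) = (\<Sum>s\<in>UNIV. \<Sum>t\<in>UNIV. (cmod (wr2 F s t z))\<^sup>2)"
    unfolding wr2_def nsq_sum B_def A_def by (rule lagrange_identity_complex[symmetric])
  also have "\<dots> \<le> (\<Sum>s\<in>(UNIV::'i set). \<Sum>t\<in>(UNIV::'i set). (nsq (F z))\<^sup>2)"
    using assms(1) by (intro sum_mono power_mono) auto
  finally show ?thesis by (simp add: power2_eq_square mult_ac)
qed

section \<open>A maximum principle for curves with bounded Fubini-Study derivative\<close>

lemma second_derivative_test:
  fixes \<psi> :: "real \<Rightarrow> real"
  assumes e: "\<epsilon> > 0" and d1: "\<And>t. \<bar>t\<bar> < \<epsilon> \<Longrightarrow> (\<psi> has_real_derivative \<psi>1 t) (at t)"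
    and d2: "(\<psi>1 has_real_derivative c) (at 0)" and min: "\<And>t. \<bar>t\<bar> < \<epsilon> \<Longrightarrow> \<psi> 0 \<le> \<psi> t"
  shows "c \<ge> 0"
proof (rule ccontr)
  assume "\<not> c \<ge> 0"
  have 0: "\<psi>1 0 = 0" using DERIV_local_min[OF d1[of 0] e] min e by auto
  obtain d where d: "d > 0" "\<And>h. 0 < h \<Longrightarrow> h < d \<Longrightarrow> \<psi>1 h < 0"
    using DERIV_neg_dec_right[OF d2] \<open>\<not> c \<ge> 0\<close> 0 by auto
  define t where "t = min d \<epsilon> / 2"
  have t: "0 < t" "t < d" "t < \<epsilon>" using d e by (auto simp: t_def)
  obtain z where z: "0 < z" "z < t" "\<psi> t - \<psi> 0 = (t - 0) * \<psi>1 z"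
    using MVT2[OF t(1), of \<psi> \<psi>1] d1 t by force
  have "t * \<psi>1 z < 0" using d(2)[of z] z t by (simp add: mult_pos_neg)
  then show False using z min[of t] t by simp
qed

text \<open>
  The Laplacian of \<open>ln (nsq F)\<close> is four times the square of the Fubini-Study derivative,
  hence smaller than that of \<open>2 K |z - z0|\<^sup>2\<close>.
\<close>

lemma no_local_minimum:
  fixes F :: "complex \<Rightarrow> complex ^ 'i::finite"
  assumes r: "r > 0" and F: "\<And>i. (\<lambda>z. F z $ i) holomorphic_on ball z1 r"
    and nz: "\<And>z. z \<in> ball z1 r \<Longrightarrow> F z \<noteq> 0"
    and wr: "\<And>s t. cmod (wr2 F s t z1) \<le> nsq (F z1)"
    and K: "K = (real CARD('i))\<^sup>2"
    and min: "\<And>z. z \<in> ball z1 r \<Longrightarrow> ln (nsq (F z1)) - 2 * K * (cmod (z1 - z0))\<^sup>2 \<le> ln (nsq (F z)) - 2 * K * (cmod (z - z0))\<^sup>2"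
  shows False
proof -
  define F' where "F' z i = deriv (\<lambda>z. F z $ i) z" for z i
  define F'' where "F'' z i = deriv (\<lambda>z. F' z i) z" for z i
  have D1: "((\<lambda>z. F z $ i) has_field_derivative F' z i) (at z)" if "z \<in> ball z1 r" for z i
    unfolding F'_def by (rule holomorphic_derivI[OF F open_ball that])
  have "(\<lambda>z. F' z i) holomorphic_on ball z1 r" for i
    unfolding F'_def by (intro holomorphic_deriv F) auto
  then have D2: "((\<lambda>z. F' z i) has_field_derivative F'' z i) (at z)" if "z \<in> ball z1 r" for z i
    unfolding F''_def using that by (rule holomorphic_derivI[OF _ open_ball])
  define A B C where "A = (\<Sum>i\<in>UNIV. F' z1 i * cnj (F z1 $ i))" and "B = (\<Sum>i\<in>UNIV. (cmod (F' z1 i))\<^sup>2)"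
    and "C = (\<Sum>i\<in>UNIV. F'' z1 i * cnj (F z1 $ i))"
  define N where "N = nsq (F z1)"
  have N: "N > 0" unfolding N_def using nz r by (intro nsq_pos) auto
  \<comment> \<open>Second derivative at \<open>z1\<close> along the line in direction
    \<open>d\<close>. The first terms are \<open>(ln n)'' = n'' / n - (n' / n)^2\<close>, and
    \<open>4 K\<close> is the second derivative of \<open>2 K |z - z0|^2\<close>.\<close>
  have main: "(2 * B + 2 * Re (d\<^sup>2 * C)) / N - (2 * Re (d * A) / N)\<^sup>2 - 4 * K \<ge> 0" if d: "cmod d = 1" for d
  proof (rule second_derivative_test)
    define \<gamma> where "\<gamma> t = z1 + of_real t * d" for t :: real
    have \<gamma>: "\<gamma> t \<in> ball z1 r" if "\<bar>t\<bar> < r" for t using that d by (simp add: \<gamma>_def dist_norm norm_mult)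
    have d\<gamma>: "(\<gamma> has_vector_derivative d) (at t)" for t
      unfolding \<gamma>_def[abs_def] by (auto intro!: derivative_eq_intros)
    have e1: "((\<lambda>t. F (\<gamma> t) $ i) has_vector_derivative d * F' (\<gamma> t) i) (at t)" if "\<bar>t\<bar> < r" for t i
      using field_vector_diff_chain_at[OF d\<gamma> D1[OF \<gamma>[OF that]]] by (simp add: o_def)
    have e2: "((\<lambda>t. F' (\<gamma> t) i) has_vector_derivative d * F'' (\<gamma> t) i) (at t)" if "\<bar>t\<bar> < r" for t i
      using field_vector_diff_chain_at[OF d\<gamma> D2[OF \<gamma>[OF that]]] by (simp add: o_def)
    define n n1 where "n t = (\<Sum>i\<in>UNIV. Re (F (\<gamma> t) $ i * cnj (F (\<gamma> t) $ i)))"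
      and "n1 t = (\<Sum>i\<in>UNIV. 2 * Re (d * F' (\<gamma> t) i * cnj (F (\<gamma> t) $ i)))" for t
    have nn: "n t = nsq (F (\<gamma> t))" for t
      unfolding n_def nsq_sum by (simp add: complex_mult_cnj cmod_power2)
    have npos: "n t > 0" if "\<bar>t\<bar> < r" for t unfolding nn using nz[OF \<gamma>[OF that]] by (rule nsq_pos)
    have dn: "(n has_real_derivative n1 t) (at t)" if t: "\<bar>t\<bar> < r" for t
    proof -
      have "((\<lambda>t. Re (F (\<gamma> t) $ i * cnj (F (\<gamma> t) $ i))) has_real_derivative
          2 * Re (d * F' (\<gamma> t) i * cnj (F (\<gamma> t) $ i))) (at t)" for i
      proof -
        have "((\<lambda>t. F (\<gamma> t) $ i * cnj (F (\<gamma> t) $ i)) has_vector_derivative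
           (F (\<gamma> t) $ i * cnj (d * F' (\<gamma> t) i) + d * F' (\<gamma> t) i * cnj (F (\<gamma> t) $ i))) (at t)"
          by (intro has_vector_derivative_mult e1[OF t] has_vector_derivative_cnj)
        then have "((\<lambda>t. Re (F (\<gamma> t) $ i * cnj (F (\<gamma> t) $ i))) has_vector_derivative
           Re (F (\<gamma> t) $ i * cnj (d * F' (\<gamma> t) i) + d * F' (\<gamma> t) i * cnj (F (\<gamma> t) $ i))) (at t)"
          by (rule bounded_linear.has_vector_derivative[OF bounded_linear_Re])
        then show ?thesis by (simp add: has_real_derivative_iff_has_vector_derivative algebra_simps)
      qed
      then show ?thesis unfolding n_def n1_def by (intro DERIV_sum)
    qed
    have dn1: "(n1 has_real_derivative (2 * B + 2 * Re (d\<^sup>2 * C))) (at 0)"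
    proof -
      have "((\<lambda>t. 2 * Re (d * F' (\<gamma> t) i * cnj (F (\<gamma> t) $ i))) has_real_derivative
          2 * ((cmod (F' z1 i))\<^sup>2 + Re (d\<^sup>2 * F'' z1 i * cnj (F z1 $ i)))) (at 0)" for i
      proof -
        have 0: "\<bar>0::real\<bar> < r" "\<gamma> 0 = z1" using r by (auto simp: \<gamma>_def)
        have "((\<lambda>t. d * (F' (\<gamma> t) i * cnj (F (\<gamma> t) $ i))) has_vector_derivative
           d * (F' (\<gamma> 0) i * cnj (d * F' (\<gamma> 0) i) + d * F'' (\<gamma> 0) i * cnj (F (\<gamma> 0) $ i))) (at 0)"
          by (intro has_vector_derivative_mult_right has_vector_derivative_mult e1[OF 0(1)] e2[OF 0(1)] has_vector_derivative_cnj)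
        then have "((\<lambda>t. 2 * Re (d * (F' (\<gamma> t) i * cnj (F (\<gamma> t) $ i)))) has_vector_derivative
           2 * Re (d * (F' (\<gamma> 0) i * cnj (d * F' (\<gamma> 0) i) + d * F'' (\<gamma> 0) i * cnj (F (\<gamma> 0) $ i)))) (at 0)"
          using has_vector_derivative_mult_right[OF bounded_linear.has_vector_derivative[OF bounded_linear_Re], where a = 2]
          by blast
        moreover have "2 * Re (d * (F' (\<gamma> 0) i * cnj (d * F' (\<gamma> 0) i) + d * F'' (\<gamma> 0) i * cnj (F (\<gamma> 0) $ i)))
          = 2 * ((cmod (F' z1 i))\<^sup>2 + Re (d\<^sup>2 * F'' z1 i * cnj (F z1 $ i)))"
        proof -
          have dd: "d * cnj d = 1" using d complex_norm_square[of d] by simp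
          have "d * (F' z1 i * cnj (d * F' z1 i) + d * F'' z1 i * cnj (F z1 $ i)) =
              (d * cnj d) * (F' z1 i * cnj (F' z1 i)) + d\<^sup>2 * F'' z1 i * cnj (F z1 $ i)"
            by (simp add: power2_eq_square algebra_simps)
          also have "\<dots> = of_real ((cmod (F' z1 i))\<^sup>2) + d\<^sup>2 * F'' z1 i * cnj (F z1 $ i)"
            by (simp only: dd complex_norm_square mult_1)
          finally show ?thesis by (simp only: 0 plus_complex.sel Re_complex_of_real)
        qed
        ultimately show ?thesis
          by (simp only: has_real_derivative_iff_has_vector_derivative mult.assoc)
      qed
      then have "(n1 has_real_derivative (\<Sum>i\<in>UNIV. 2 * ((cmod (F' z1 i))\<^sup>2 + Re (d\<^sup>2 * F'' z1 i * cnj (F z1 $ i))))) (at 0)"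
        unfolding n1_def by (intro DERIV_sum)
      moreover have "(\<Sum>i\<in>UNIV. 2 * ((cmod (F' z1 i))\<^sup>2 + Re (d\<^sup>2 * F'' z1 i * cnj (F z1 $ i)))) = 2 * B + 2 * Re (d\<^sup>2 * C)"
        unfolding B_def C_def sum_distrib_left sum.distrib distrib_left Re_sum
        by (simp add: mult.assoc)
      ultimately show ?thesis by simp
    qed
    define q where "q t = (cmod (\<gamma> t - z0))\<^sup>2" for t
    have dq: "(q has_real_derivative 2 * t + 2 * Re (d * cnj (z1 - z0))) (at t)" for t
    proof -
      have "q t = t\<^sup>2 + 2 * Re (d * cnj (z1 - z0)) * t + (cmod (z1 - z0))\<^sup>2" for t
      proof -
        have "(Re d)\<^sup>2 + (Im d)\<^sup>2 = 1" using d cmod_power2[of d] by simp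
        then have "t\<^sup>2 = t\<^sup>2 * ((Re d)\<^sup>2 + (Im d)\<^sup>2)" by simp
        then show ?thesis unfolding q_def \<gamma>_def cmod_power2
          by (simp add: power2_eq_square algebra_simps)
      qed
      then have "q = (\<lambda>t. t\<^sup>2 + 2 * Re (d * cnj (z1 - z0)) * t + (cmod (z1 - z0))\<^sup>2)" by (rule ext)
      then show ?thesis by (auto intro!: derivative_eq_intros)
    qed
    show "r > 0" by (rule r)
    show "((\<lambda>t. ln (n t) - 2 * K * q t) has_real_derivative
       n1 t / n t - 2 * K * (2 * t + 2 * Re (d * cnj (z1 - z0)))) (at t)" if "\<bar>t\<bar> < r" for t
      using npos[OF that] by (auto intro!: derivative_eq_intros dn[OF that] dq)
    have 0: "n 0 = N" "n1 0 = 2 * Re (d * A)"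
      by (simp_all add: nn N_def n1_def A_def \<gamma>_def sum_distrib_left mult.assoc)
    show "((\<lambda>t. n1 t / n t - 2 * K * (2 * t + 2 * Re (d * cnj (z1 - z0)))) has_real_derivative
       (2 * B + 2 * Re (d\<^sup>2 * C)) / N - (2 * Re (d * A) / N)\<^sup>2 - 4 * K) (at 0)"
    proof (rule DERIV_cong[OF DERIV_diff[OF DERIV_divide[OF dn1 dn]]])
      show "((\<lambda>t. 2 * K * (2 * t + 2 * Re (d * cnj (z1 - z0)))) has_real_derivative 4 * K) (at 0)"
        by (auto intro!: derivative_eq_intros)
      show "((2 * B + 2 * Re (d\<^sup>2 * C)) * n 0 - n1 0 * n1 0) / (n 0 * n 0) - 4 * K =
        (2 * B + 2 * Re (d\<^sup>2 * C)) / N - (2 * Re (d * A) / N)\<^sup>2 - 4 * K"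
        unfolding 0 power_divide using N by (simp add: diff_divide_distrib power2_eq_square del: times_complex.sel)
    qed (use N r 0 in auto)
    show "ln (n 0) - 2 * K * q 0 \<le> ln (n t) - 2 * K * q t" if "\<bar>t\<bar> < r" for t
      using min[OF \<gamma>[OF that]] unfolding nn q_def by (simp add: \<gamma>_def)
  qed
  \<comment> \<open>Adding the directions 1 and \<open>\<i>\<close> gives the Laplacian: the terms
    with \<open>C\<close> cancel, and the squares of the real and imaginary parts of
    \<open>A\<close> add up to \<open>|A|^2\<close>.\<close>
  have "Re (\<i>\<^sup>2 * C) = - Re C" by simp
  then have "0 \<le> 4 * B / N - (2 * Re A / N)\<^sup>2 - (2 * Re (\<i> * A) / N)\<^sup>2 - 8 * K"
    using main[of 1] main[of \<i>] by (simp add: add_divide_distrib diff_divide_distrib)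
  also have "(2 * Re A / N)\<^sup>2 = 4 * (Re A)\<^sup>2 / N\<^sup>2" by (simp add: power_divide power_mult_distrib)
  also have "(2 * Re (\<i> * A) / N)\<^sup>2 = 4 * (Im A)\<^sup>2 / N\<^sup>2" by (simp add: power_divide power_mult_distrib)
  also have "4 * B / N = 4 * (B * N) / N\<^sup>2" using N by (simp add: power2_eq_square)
  finally have "8 * K \<le> (4 * (B * N) - 4 * (cmod A)\<^sup>2) / N\<^sup>2"
    by (simp add: cmod_power2 diff_divide_distrib add_divide_distrib)
  then have "8 * K * N\<^sup>2 \<le> 4 * (B * N) - 4 * (cmod A)\<^sup>2"
    using N by (simp add: pos_le_divide_eq)
  also have "\<dots> \<le> 2 * K * N\<^sup>2"
    using wr2_bound_gram[OF wr] unfolding K N_def A_def B_def F'_def by simp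
  finally have "K * N\<^sup>2 \<le> 0" by simp
  moreover have "K > 0" by (simp add: K)
  ultimately show False using N by (simp add: mult_le_0_iff)
qed

text \<open>The matrix of the orthogonal projection onto the line spanned by \<open>v\<close>. It
  embeds projective space into matrices, so that Lipschitz bounds, compactness and uniform limits
  can be handled in a normed space without choosing coordinates.\<close>

definition pmat :: "complex ^ 'i::finite \<Rightarrow> 'i \<Rightarrow> 'i \<Rightarrow> complex" where
  "pmat v i j = v $ i * cnj (v $ j) / of_real (nsq v)"

text \<open>The derivative of the projection only sees the part of \<open>F'\<close> orthogonal to
  \<open>F\<close>. Scaled by \<open>nsq F\<close> this is the vector with entries
  \<open>F' z l * Nc z - F z $ l * A z\<close>, and the fact \<open>G\<close> expresses it through
  \<open>wr2\<close>.\<close>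

lemma pmat_lipschitz:
  fixes F :: "complex \<Rightarrow> complex ^ 'i::finite"
  assumes S: "convex S" "open S" and F: "\<And>i. (\<lambda>z. F z $ i) holomorphic_on S"
    and nz: "\<And>z. z \<in> S \<Longrightarrow> F z \<noteq> 0"
    and wr: "\<And>s t z. z \<in> S \<Longrightarrow> cmod (wr2 F s t z) \<le> M * nsq (F z)"
    and xy: "x \<in> S" "y \<in> S"
  shows "cmod (pmat (F x) i j - pmat (F y) i j) \<le> 2 * real CARD('i) * M * cmod (x - y)"
proof -
  define F' where "F' z i = deriv (\<lambda>z. F z $ i) z" for z i
  define Nc where "Nc z = (\<Sum>l\<in>UNIV. F z $ l * cnj (F z $ l))" for z
  define A where "A z = (\<Sum>l\<in>UNIV. F' z l * cnj (F z $ l))" for z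
  have Nc: "Nc z = of_real (nsq (F z))" for z by (simp add: Nc_def nsq_complex)
  have D1: "((\<lambda>z. F z $ i) has_derivative (*) (F' z i)) (at z)" if "z \<in> S" for z i
    unfolding F'_def has_field_derivative_def[symmetric] by (rule holomorphic_derivI[OF F S(2) that])
  have DN: "(Nc has_derivative (\<lambda>h. A z * h + cnj (A z * h))) (at z)" if "z \<in> S" for z
    unfolding Nc_def
    by (rule has_derivative_eq_rhs, (rule derivative_intros D1 that)+)
       (simp add: A_def fun_eq_iff sum_distrib_left sum.distrib algebra_simps)
  define D where "D z h = (((F' z i * h) * cnj (F z $ j) + F z $ i * cnj (F' z j * h)) * Nc z
     - F z $ i * cnj (F z $ j) * (A z * h + cnj (A z * h))) / (Nc z * Nc z)" for z h
  have DP: "((\<lambda>z. pmat (F z) i j) has_derivative D z) (at z within S)" if z: "z \<in> S" for z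
  proof -
    have "((\<lambda>z. F z $ i * cnj (F z $ j) / Nc z) has_derivative D z) (at z)"
      unfolding D_def
    proof (rule has_derivative_divide')
      show "((\<lambda>z. F z $ i * cnj (F z $ j)) has_derivative
         (\<lambda>h. F' z i * h * cnj (F z $ j) + F z $ i * cnj (F' z j * h))) (at z)"
        by (rule has_derivative_eq_rhs, (rule derivative_intros D1 z)+) (simp add: fun_eq_iff algebra_simps)
      show "Nc z \<noteq> 0" using nsq_pos[OF nz[OF z]] by (simp add: Nc)
    qed (rule DN[OF z])
    then show ?thesis unfolding pmat_def Nc by (rule has_derivative_at_withinI)
  qed
  have bound: "cmod (D z h) \<le> 2 * real CARD('i) * M * cmod h" if z: "z \<in> S" for z h
  proof -
    define n where "n = norm (F z)"
    have n: "n > 0" "nsq (F z) = n\<^sup>2" using nz[OF z] by (simp_all add: n_def nsq_def)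
    have comp: "cmod (F z $ l) \<le> n" for l
      unfolding n_def by (rule Finite_Cartesian_Product.norm_nth_le)
    have G: "F' z l * Nc z - F z $ l * A z = (\<Sum>k\<in>UNIV. wr2 F k l z * cnj (F z $ k))" for l
      unfolding Nc_def A_def wr2_def F'_def[symmetric] sum_distrib_left sum_subtractf[symmetric]
      by (intro sum.cong) (auto simp: algebra_simps)
    have Gb: "cmod (F' z l * Nc z - F z $ l * A z) \<le> real CARD('i) * M * n ^ 3" for l
    proof -
      have "cmod (F' z l * Nc z - F z $ l * A z) \<le> (\<Sum>k\<in>(UNIV::'i set). M * n\<^sup>2 * n)"
        unfolding G
        by (intro sum_norm_le) (auto simp: norm_mult n(2)[symmetric] intro!: mult_mono wr[OF z] comp
            intro: order_trans[OF norm_ge_zero wr[OF z]])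
      then show ?thesis by (simp add: power2_eq_square power3_eq_cube mult_ac)
    qed
    have "D z h * (Nc z * Nc z) = h * cnj (F z $ j) * (F' z i * Nc z - F z $ i * A z)
       + cnj h * F z $ i * cnj (F' z j * Nc z - F z $ j * A z)"
    proof -
      have "Nc z \<noteq> 0" using nsq_pos[OF nz[OF z]] by (simp add: Nc)
      then have "D z h * (Nc z * Nc z) = ((F' z i * h) * cnj (F z $ j) + F z $ i * cnj (F' z j * h)) * Nc z
         - F z $ i * cnj (F z $ j) * (A z * h + cnj (A z * h))"
        unfolding D_def by simp
      moreover have "cnj (Nc z) = Nc z" by (simp add: Nc)
      ultimately show ?thesis by (simp add: algebra_simps)
    qed
    moreover have "cmod (D z h * (Nc z * Nc z)) = cmod (D z h) * n ^ 4"
      by (simp add: Nc norm_mult n(2) power2_eq_square power4_eq_xxxx)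
    ultimately have "cmod (D z h) * n ^ 4 = cmod (h * cnj (F z $ j) * (F' z i * Nc z - F z $ i * A z)
       + cnj h * F z $ i * cnj (F' z j * Nc z - F z $ j * A z))" by (simp only:)
    also have "\<dots> \<le> cmod h * n * (real CARD('i) * M * n ^ 3) + cmod h * n * (real CARD('i) * M * n ^ 3)"
      using Gb comp n by (intro norm_triangle_le add_mono) (auto simp: norm_mult simp del: complex_cnj_diff complex_cnj_mult intro!: mult_mono)
    also have "\<dots> = (2 * real CARD('i) * M * cmod h) * n ^ 4" by (simp add: power4_eq_xxxx power3_eq_cube)
    finally show ?thesis using n by simp
  qed
  have M: "2 * real CARD('i) * M \<ge> 0"
  proof -
    have "0 \<le> M * nsq (F x)" using wr[OF xy(1)] norm_ge_zero order_trans by blast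
    then show ?thesis using nsq_pos[OF nz[OF xy(1)]] by (simp add: zero_le_mult_iff)
  qed
  show ?thesis
    using differentiable_bound[OF S(1) DP, of "2 * real CARD('i) * M" x y] bound M xy
    by (simp add: onorm_bound)
qed

text \<open>The barrier is \<open>w = |h|^2 / |F|^2 * exp (2 K |z - z0|^2) * |z - z0|^(-2
  \<beta>)\<close> on an annulus about \<open>z0\<close>. It has no interior maximum where
  \<open>h\<close> does not vanish, since the exponential outweighs the Laplacian of
  \<open>ln (nsq F)\<close> while \<open>ln |h|\<close> and \<open>ln |z - z0|\<close> are harmonic.
  Because of the value at \<open>o'\<close>, the maximum lies neither on the outer circle, where the
  power is small, nor on the inner one, where \<open>h\<close> is supposed to be tiny. In
  \<open>M\<close> the summand \<open>ln (T / \<rho>)\<close> is weakened to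
  \<open>T / \<rho>\<close>, which keeps the bound polynomial in the distance to
  \<open>o'\<close>.\<close>

lemma linear_form_not_tiny:
  fixes F :: "complex \<Rightarrow> complex ^ 'i::finite"
  assumes F: "\<And>i. (\<lambda>z. F z $ i) holomorphic_on UNIV" and nz: "\<And>z. F z \<noteq> 0"
    and wr: "\<And>s t z. cmod (wr2 F s t z) \<le> nsq (F z)"
    and h: "h holomorphic_on UNIV" and hle: "\<And>z. (cmod (h z))\<^sup>2 \<le> nsq (F z)"
    and o: "\<sigma> > 0" "\<sigma> \<le> (cmod (h o'))\<^sup>2 / nsq (F o')"
    and K: "K = (real CARD('i))\<^sup>2" and \<rho>: "0 < \<rho>"
    and T: "T = dist z0 o'" 
    and M: "M \<ge> 2 * K * \<rho>\<^sup>2 - ln \<sigma> + 2 * (8 * K * T\<^sup>2 - ln \<sigma> + 1) * (T / \<rho>) + 1"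
  shows "\<exists>z\<in>cball z0 \<rho>. (cmod (h z))\<^sup>2 \<ge> exp (- M) * nsq (F z)"
proof (rule ccontr)
  assume "\<not> ?thesis"
  then have tiny: "\<And>z. z \<in> cball z0 \<rho> \<Longrightarrow> (cmod (h z))\<^sup>2 < exp (- M) * nsq (F z)" by force
  have npos: "nsq (F z) > 0" for z by (rule nsq_pos[OF nz])
  define w0 where "w0 z = (cmod (h z))\<^sup>2 / nsq (F z)" for z
  have w01: "w0 z \<le> 1" "w0 z \<ge> 0" for z using hle[of z] npos[of z] by (auto simp: w0_def)
  have \<sigma>1: "\<sigma> \<le> 1" using o w01(1)[of o'] by (simp add: w0_def)
  then have ln\<sigma>: "ln \<sigma> \<le> 0" using o by simp
  have K0: "K > 0" by (simp add: K)
  \<comment> \<open>Chosen for the outer circle: passing from radius \<open>T\<close> to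
    \<open>2 T\<close> costs \<open>2 \<beta> ln 2 \<ge> \<beta>\<close>, which has to exceed
    \<open>8 K T^2 - ln \<sigma>\<close>.\<close>
  define \<beta> where "\<beta> = 8 * K * T\<^sup>2 - ln \<sigma> + 1"
  have "0 \<le> 8 * K * T\<^sup>2" using K0 by simp
  then have \<beta>: "\<beta> > 0" using ln\<sigma> unfolding \<beta>_def by linarith
  have T0: "T \<ge> 0" by (simp add: T)
  have T\<rho>: "T > \<rho>"
  proof (rule ccontr)
    assume "\<not> T > \<rho>"
    then have "w0 o' < exp (- M)" using tiny[of o'] npos[of o'] by (simp add: w0_def T field_simps)
    then have "\<sigma> < exp (- M)" using o by (simp add: w0_def)
    then have "ln \<sigma> < - M" using o(1) ln_less_cancel_iff[of \<sigma> "exp (- M)"] by simp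
    moreover have "0 \<le> 2 * K * \<rho>\<^sup>2 + 2 * \<beta> * (T / \<rho>)" using K0 \<beta> T0 \<rho> by simp
    ultimately show False using M unfolding \<beta>_def[symmetric] by linarith
  qed
  define R where "R = {z. \<rho> \<le> dist z0 z \<and> dist z0 z \<le> 2 * T}"
  define w where "w z = w0 z * exp (2 * K * (dist z0 z)\<^sup>2) * dist z0 z powr (- (2 * \<beta>))" for z
  have "R = cball z0 (2 * T) - ball z0 \<rho>" by (auto simp: R_def)
  then have "compact R" by (simp add: compact_diff)
  have oR: "o' \<in> R" using T\<rho> T0 \<rho> by (simp add: R_def T)
  have "continuous_on R w"
    unfolding w_def[abs_def] w0_def nsq_sum
    by (intro continuous_intros holomorphic_on_imp_continuous_on holomorphic_on_subset[OF F] holomorphic_on_subset[OF h])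
       (use npos[unfolded nsq_sum] \<rho> in \<open>auto simp: R_def less_le\<close>)
  then obtain z1 where z1: "z1 \<in> R" "\<And>z. z \<in> R \<Longrightarrow> w z \<le> w z1"
    using continuous_attains_sup[OF \<open>compact R\<close>, of w] oR by blast
  have wo: "w o' \<ge> \<sigma> * T powr (- (2 * \<beta>))"
  proof -
    have "\<sigma> * 1 \<le> w0 o' * exp (2 * K * T\<^sup>2)"
      using o K0 by (intro mult_mono) (auto simp: w0_def)
    then show ?thesis unfolding w_def T by (auto intro!: mult_right_mono)
  qed
  have "w z1 \<ge> \<sigma> * T powr (- (2 * \<beta>))" using wo z1(2)[OF oR] by linarith
  then have "\<sigma> * T powr (- (2 * \<beta>)) \<le> w0 z1 * exp (2 * K * (dist z0 z1)\<^sup>2) * dist z0 z1 powr (- (2 * \<beta>))"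
    by (simp add: w_def)
  moreover have wz1: "w0 z1 > 0"
  proof (rule ccontr)
    assume "\<not> w0 z1 > 0"
    then have "w0 z1 = 0" using w01(2)[of z1] by linarith
    then show False using calculation o T\<rho> \<rho> by (simp add: mult_le_0_iff)
  qed
  moreover have "dist z0 z1 \<ge> \<rho>" using z1(1) by (simp add: R_def)
  then have d1: "dist z0 z1 > 0" using \<rho> by linarith
  ultimately have "ln (\<sigma> * T powr (- (2 * \<beta>))) \<le> ln (w0 z1 * exp (2 * K * (dist z0 z1)\<^sup>2) * dist z0 z1 powr (- (2 * \<beta>)))"
    using o T\<rho> \<rho> by (intro ln_mono) auto
  then have ineq: "ln \<sigma> - 2 * \<beta> * ln T \<le> ln (w0 z1) + 2 * K * (dist z0 z1)\<^sup>2 - 2 * \<beta> * ln (dist z0 z1)"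
    using o T\<rho> \<rho> wz1 d1 by (simp add: ln_mult ln_powr)
  consider "dist z0 z1 = \<rho>" | "dist z0 z1 = 2 * T" | "\<rho> < dist z0 z1" "dist z0 z1 < 2 * T"
    using z1(1) by (force simp: R_def)
  then show False
  proof cases
    case 1
    have "w0 z1 < exp (- M)" using tiny[of z1] npos[of z1] 1 by (simp add: w0_def field_simps)
    then have "ln (w0 z1) < - M" using wz1 ln_less_cancel_iff[of "w0 z1" "exp (- M)"] by simp
    then have "M < 2 * K * \<rho>\<^sup>2 - ln \<sigma> + 2 * \<beta> * (ln T - ln \<rho>)"
      using ineq 1 by (simp add: algebra_simps)
    also have "ln T - ln \<rho> = ln (T / \<rho>)" using T\<rho> \<rho> by (simp add: ln_div)
    also have "2 * \<beta> * ln (T / \<rho>) \<le> 2 * \<beta> * (T / \<rho>)"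
      using T\<rho> \<rho> \<beta> ln_le_minus_one[of "T / \<rho>"] by (intro mult_left_mono) auto
    finally show False using M unfolding \<beta>_def[symmetric] by linarith
  next
    case 2
    have "ln (w0 z1) \<le> 0" using w01(1)[of z1] wz1 by simp
    then have "ln \<sigma> - 2 * \<beta> * ln T \<le> 8 * K * T\<^sup>2 - 2 * \<beta> * ln (2 * T)"
      using ineq 2 by (simp add: power_mult_distrib)
    also have "ln (2 * T) = ln 2 + ln T" using T\<rho> \<rho> by (simp add: ln_mult)
    finally have "2 * \<beta> * ln 2 \<le> 8 * K * T\<^sup>2 - ln \<sigma>" by (simp add: algebra_simps)
    moreover have "2 * \<beta> * ln 2 \<ge> 2 * \<beta> * (1/2)"
      using \<beta> ln_le_minus_one[of "1/2"] by (intro mult_left_mono) (auto simp: ln_div)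
    ultimately show False by (simp add: \<beta>_def)
  next
    case 3
    have "h z1 \<noteq> 0" using wz1 by (auto simp: w0_def)
    moreover have "isCont h z1" using holomorphic_on_imp_continuous_on[OF h] by (simp add: continuous_on_eq_continuous_at)
    ultimately obtain e where e: "e > 0" "\<And>z. dist z1 z < e \<Longrightarrow> h z \<noteq> 0"
      using continuous_at_avoid[of z1 h 0] by auto
    define r where "r = min e (min (dist z0 z1 - \<rho>) (2 * T - dist z0 z1))"
    have r: "r > 0" using e 3 by (simp add: r_def)
    have sub: "\<rho> < dist z0 z \<and> dist z0 z < 2 * T \<and> h z \<noteq> 0" if "z \<in> ball z1 r" for z
    proof -
      have "dist z0 z \<le> dist z0 z1 + dist z1 z" "dist z0 z1 \<le> dist z0 z + dist z1 z"
        using dist_triangle[of z0 z z1] dist_triangle[of z0 z1 z] by (auto simp: dist_commute)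
      then show ?thesis using that e(2)[of z] by (auto simp: r_def)
    qed
    obtain L1 where L1: "L1 holomorphic_on ball z1 r" "\<And>z. z \<in> ball z1 r \<Longrightarrow> exp (L1 z) = h z"
    proof (rule holomorphic_logarithm_exists[of "ball z1 r" h z1])
      show "h holomorphic_on ball z1 r" using h by (rule holomorphic_on_subset) auto
    qed (use sub r in auto)
    have sub0: "z - z0 \<noteq> 0" if "z \<in> ball z1 r" for z using sub[OF that] \<rho> by auto
    obtain L2 where L2: "L2 holomorphic_on ball z1 r" "\<And>z. z \<in> ball z1 r \<Longrightarrow> exp (L2 z) = z - z0"
    proof (rule holomorphic_logarithm_exists[of "ball z1 r" "\<lambda>z. z - z0" z1])
      show "(\<lambda>z. z - z0) holomorphic_on ball z1 r" by (intro holomorphic_intros)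
    qed (use sub0 r in auto)
    \<comment> \<open>A branch of \<open>(z - z0)^\<beta> / h\<close>. Multiplying \<open>F\<close>
      by it turns \<open>- ln w\<close> into \<open>ln (nsq (u F)) - 2 K |z - z0|^2\<close>, so a
      maximum of \<open>w\<close> is a minimum of the kind excluded by
      \<open>no_local_minimum\<close>; the bound on \<open>wr2\<close> is unaffected by the
      factor.\<close>
    define u where "u z = exp (of_real \<beta> * L2 z - L1 z)" for z
    have u: "u holomorphic_on ball z1 r" unfolding u_def by (intro holomorphic_intros L1 L2)
    have FB: "(\<lambda>z. F z $ i) holomorphic_on ball z1 r" for i using F by (rule holomorphic_on_subset) auto
    have lnG: "ln (nsq (u z *s F z)) = 2 * K * (dist z0 z)\<^sup>2 - ln (w z)" if z: "z \<in> ball z1 r" for z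
    proof -
      have "cmod (h z) = exp (Re (L1 z))" "dist z0 z = exp (Re (L2 z))"
        using L1(2)[OF z] L2(2)[OF z] by (auto simp: dist_norm norm_minus_commute simp flip: norm_exp_eq_Re)
      then have "Re (L1 z) = ln (cmod (h z))" "Re (L2 z) = ln (dist z0 z)" by simp_all
      then have "ln (cmod (u z)) = \<beta> * ln (dist z0 z) - ln (cmod (h z))" by (simp add: u_def)
      moreover have "ln (nsq (u z *s F z)) = 2 * ln (cmod (u z)) + ln (nsq (F z))"
        using npos[of z] by (simp add: nsq_smult ln_mult ln_realpow u_def)
      moreover have "ln (w z) = 2 * ln (cmod (h z)) - ln (nsq (F z)) + 2 * K * (dist z0 z)\<^sup>2 - 2 * \<beta> * ln (dist z0 z)"
      proof -
        have "z0 \<noteq> z" using sub[OF z] \<rho> by auto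
        then show ?thesis
          using sub[OF z] npos[of z] by (simp add: w_def w0_def ln_mult ln_div ln_powr ln_realpow)
      qed
      ultimately show ?thesis by (simp add: algebra_simps)
    qed
    show False
    proof (rule no_local_minimum[of r "\<lambda>z. u z *s F z" z1 K z0])
      show "(\<lambda>z. (u z *s F z) $ i) holomorphic_on ball z1 r" for i
        by (auto intro!: holomorphic_intros u FB)
      show "u z *s F z \<noteq> 0" for z using nz[of z] by (simp add: u_def)
      show "cmod (wr2 (\<lambda>z. u z *s F z) s t z1) \<le> nsq (u z1 *s F z1)" for s t
      proof -
        have "wr2 (\<lambda>z. u z *s F z) s t z1 = (u z1)\<^sup>2 * wr2 F s t z1"
          by (rule wr2_smult[OF open_ball _ FB u]) (use r in auto)
        then show ?thesis using wr[of s t z1] by (simp add: nsq_smult norm_mult norm_power mult_left_mono)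
      qed
      fix z assume z: "z \<in> ball z1 r"
      have "z \<in> R" using sub[OF z] by (simp add: R_def)
      then have "w z \<le> w z1" by (rule z1)
      moreover have "z0 \<noteq> z" using sub[OF z] \<rho> by auto
      then have "w z > 0" using sub[OF z] npos[of z] by (simp add: w_def w0_def)
      ultimately have "ln (w z) \<le> ln (w z1)" by simp
      then show "ln (nsq (u z1 *s F z1)) - 2 * K * (cmod (z1 - z0))\<^sup>2 \<le> ln (nsq (u z *s F z)) - 2 * K * (cmod (z - z0))\<^sup>2"
        using lnG[OF z] lnG[of z1] r by (simp add: dist_norm norm_minus_commute)
    qed (use r K in auto)
  qed
qed

section \<open>Wronskians\<close>


lemma norm_det_le:
  assumes "\<And>l i. l < p \<Longrightarrow> i < p \<Longrightarrow> cmod (f l i) \<le> A l * X i"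
  shows "cmod (det (mat p p (\<lambda>(l, i). f l i))) \<le> fact p * (\<Prod>l<p. A l) * (\<Prod>i<p. X i)"
proof -
  have "cmod (det (mat p p (\<lambda>(l, i). f l i))) \<le>
     (\<Sum>\<pi>\<in>{\<pi>. \<pi> permutes {0..<p}}. (\<Prod>l<p. A l) * (\<Prod>i<p. X i))"
    unfolding det_def'[of "mat p p (\<lambda>(l, i). f l i)" p, OF mat_carrier]
  proof (rule sum_norm_le)
    fix \<pi> assume "\<pi> \<in> {\<pi>. \<pi> permutes {0..<p}}"
    then have p: "\<pi> permutes {0..<p}" by simp
    have "cmod (signof \<pi> * (\<Prod>i = 0..<p. mat p p (\<lambda>(l, i). f l i) $$ (i, \<pi> i)))
      = cmod (\<Prod>i = 0..<p. f i (\<pi> i))"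
      using permutes_in_image[OF p] by (auto simp: norm_mult sign_def intro!: arg_cong[of _ _ cmod] prod.cong)
    also have "\<dots> \<le> (\<Prod>i = 0..<p. A i * X (\<pi> i))"
      unfolding prod_norm[symmetric] using permutes_in_image[OF p] by (intro prod_mono) (auto intro!: assms)
    also have "\<dots> = (\<Prod>l<p. A l) * (\<Prod>i<p. X i)"
      unfolding prod.distrib lessThan_atLeast0 using prod.permute[OF p, of X] by (simp add: o_def)
    finally show "cmod (signof \<pi> * (\<Prod>i = 0..<p. mat p p (\<lambda>(l, i). f l i) $$ (i, \<pi> i)))
      \<le> (\<Prod>l<p. A l) * (\<Prod>i<p. X i)" .
  qed
  also have "\<dots> = fact p * ((\<Prod>l<p. A l) * (\<Prod>i<p. X i))" by (simp add: card_permutations)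
  finally show ?thesis by (simp add: mult.assoc)
qed

lemma holomorphic_on_det:
  assumes "\<And>l i. l < p \<Longrightarrow> i < p \<Longrightarrow> f l i holomorphic_on U"
  shows "(\<lambda>z. det (mat p p (\<lambda>(l, i). f l i z))) holomorphic_on U"
proof -
  have "(\<lambda>z. \<Sum>\<pi>\<in>{\<pi>. \<pi> permutes {0..<p}}. signof \<pi> * (\<Prod>i = 0..<p. f i (\<pi> i) z)) holomorphic_on U"
    using assms by (intro holomorphic_intros) (auto simp: permutes_in_image)
  also have "(\<lambda>z. \<Sum>\<pi>\<in>{\<pi>. \<pi> permutes {0..<p}}. signof \<pi> * (\<Prod>i = 0..<p. f i (\<pi> i) z))
    = (\<lambda>z. det (mat p p (\<lambda>(l, i). f l i z)))"
    unfolding det_def by (auto intro!: sum.cong prod.cong ext simp: permutes_in_image)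
  finally show ?thesis .
qed

definition wronskian :: "nat \<Rightarrow> (nat \<Rightarrow> complex \<Rightarrow> complex) \<Rightarrow> complex \<Rightarrow> complex" where
  "wronskian p h z = det (mat p p (\<lambda>(l, i). (deriv ^^ l) (h i) z))"

lemma wronskian_norm_le:
  assumes "\<And>l i. l < p \<Longrightarrow> i < p \<Longrightarrow> cmod ((deriv ^^ l) (h i) z) \<le> A l * X i"
  shows "cmod (wronskian p h z) \<le> fact p * (\<Prod>l<p. A l) * (\<Prod>i<p. X i)"
  unfolding wronskian_def using assms by (rule norm_det_le)

lemma holomorphic_on_wronskian:
  assumes "open U" "\<And>i. i < p \<Longrightarrow> h i holomorphic_on U"
  shows "wronskian p h holomorphic_on U"
  unfolding wronskian_def[abs_def] using assms
  by (intro holomorphic_on_det holomorphic_higher_deriv) auto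

lemma higher_deriv_lincomb:
  fixes p :: nat
  assumes "open U" "z \<in> U" "\<And>j. j < p \<Longrightarrow> h j holomorphic_on U"
  shows "(deriv ^^ l) (\<lambda>z. \<Sum>j<p. M j * h j z) z = (\<Sum>j<p. M j * (deriv ^^ l) (h j) z)"
  using assms(3)
proof (induct p)
  case 0
  have "(deriv ^^ l) (\<lambda>_. 0::complex) = (\<lambda>_. 0)"
    by (induction l) (auto simp del: funpow.simps simp: funpow_Suc_right)
  then show ?case by simp
next
  case (Suc p)
  have "(deriv ^^ l) (\<lambda>z. (\<Sum>j<p. M j * h j z) + M p * h p z) z =
     (deriv ^^ l) (\<lambda>z. \<Sum>j<p. M j * h j z) z + (deriv ^^ l) (\<lambda>z. M p * h p z) z"
    using assms Suc.prems by (intro higher_deriv_add[of _ U] holomorphic_intros) auto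
  also have "(deriv ^^ l) (\<lambda>z. M p * h p z) z = M p * (deriv ^^ l) (h p) z"
    using assms Suc.prems by (intro higher_deriv_cmult[of _ U]) auto
  finally show ?case using Suc by simp
qed

lemma wronskian_lincomb:
  assumes U: "open U" and h: "\<And>j. j < p \<Longrightarrow> h j holomorphic_on U"
    and g: "\<And>i. i < p \<Longrightarrow> g i = (\<lambda>z. \<Sum>j<p. M i j * h j z)"
  obtains c where "\<And>z. z \<in> U \<Longrightarrow> wronskian p g z = c * wronskian p h z"
proof
  fix z assume z: "z \<in> U"
  have "mat p p (\<lambda>(l, i). (deriv ^^ l) (g i) z) =
     mat p p (\<lambda>(l, i). (deriv ^^ l) (h i) z) * mat p p (\<lambda>(j, i). M i j)"
    using higher_deriv_lincomb[OF U z h, unfolded lessThan_atLeast0]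
    by (intro eq_matI) (auto simp: scalar_prod_def g lessThan_atLeast0 mult.commute intro!: sum.cong)
  then show "wronskian p g z = det (mat p p (\<lambda>(j, i). M i j)) * wronskian p h z"
    unfolding wronskian_def by (simp add: det_mult[of _ p])
qed

text \<open>Leibniz' rule writes the matrix of the functions \<open>u h\<close> as a lower
  triangular matrix with constant diagonal \<open>u\<close>, times the matrix of the functions
  \<open>h\<close>.\<close>

lemma wronskian_mult:
  assumes U: "open U" and h: "\<And>j. j < p \<Longrightarrow> h j holomorphic_on U" and u: "u holomorphic_on U" and z: "z \<in> U"
  shows "wronskian p (\<lambda>i z. u z * h i z) z = u z ^ p * wronskian p h z"
proof -
  define L where "L = mat p p (\<lambda>(l, r). if r \<le> l then of_nat (l choose r) * (deriv ^^ (l - r)) u z else 0)"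
  have "mat p p (\<lambda>(l, i). (deriv ^^ l) (\<lambda>z. u z * h i z) z) =
     L * mat p p (\<lambda>(l, i). (deriv ^^ l) (h i) z)"
  proof (intro eq_matI)
    fix l i assume "l < dim_row (L * mat p p (\<lambda>(l, i). (deriv ^^ l) (h i) z))"
      "i < dim_col (L * mat p p (\<lambda>(l, i). (deriv ^^ l) (h i) z))"
    then have li: "l < p" "i < p" by (auto simp: L_def)
    have "(deriv ^^ l) (\<lambda>z. h i z * u z) z =
      (\<Sum>r = 0..l. of_nat (l choose r) * (deriv ^^ r) (h i) z * (deriv ^^ (l - r)) u z)"
      using U h[OF li(2)] u z by (intro higher_deriv_mult) auto
    also have "\<dots> = (\<Sum>r = 0..<p. (if r \<le> l then of_nat (l choose r) * (deriv ^^ (l - r)) u z else 0) * (deriv ^^ r) (h i) z)"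
      using li by (intro sum.mono_neutral_cong_left) auto
    finally show "mat p p (\<lambda>(l, i). (deriv ^^ l) (\<lambda>z. u z * h i z) z) $$ (l, i) =
      (L * mat p p (\<lambda>(l, i). (deriv ^^ l) (h i) z)) $$ (l, i)"
      using li by (simp add: L_def scalar_prod_def mult.commute)
  qed (auto simp: L_def)
  moreover have "det L = u z ^ p"
    by (subst det_lower_triangular[of p]) (auto simp: L_def prod_list_diag_prod)
  ultimately show ?thesis unfolding wronskian_def by (simp add: det_mult[of _ p] L_def)
qed

text \<open>The last column of the adjugate is a relation among the columns of the singular matrix,
  and its last entry is the nonvanishing smaller Wronskian. After normalising that entry to 1,
  differentiate the relation in row \<open>l < k\<close> and subtract the relation in row
  \<open>l + 1\<close>: the derivatives of the coefficients lie in the kernel of the smaller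
  Wronskian matrix, so the coefficients are constant.\<close>

lemma wronskian_relation_constant:
  assumes B: "open B" "connected B" and h: "\<And>i. i \<le> k \<Longrightarrow> h i holomorphic_on B"
    and W0: "\<And>z. z \<in> B \<Longrightarrow> wronskian (Suc k) h z = 0" and Wk: "\<And>z. z \<in> B \<Longrightarrow> wronskian k h z \<noteq> 0"
  obtains c where "\<And>z. z \<in> B \<Longrightarrow> h k z + (\<Sum>i<k. c i * h i z) = 0"
proof -
  define A where "A z = mat (Suc k) (Suc k) (\<lambda>(l, i). (deriv ^^ l) (h i) z)" for z
  define c where "c i z = adj_mat (A z) $$ (i, k)" for i z
  have A: "A z \<in> carrier_mat (Suc k) (Suc k)" for z by (simp add: A_def)
  have rel: "(\<Sum>i<Suc k. (deriv ^^ l) (h i) z * c i z) = 0" if "z \<in> B" "l \<le> k" for z l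
  proof -
    have "(A z * adj_mat (A z)) $$ (l, k) = (\<Sum>i<Suc k. (deriv ^^ l) (h i) z * c i z)"
      using that adj_mat(1)[OF A, of z] unfolding c_def lessThan_atLeast0
      by (subst index_mult_mat) (auto simp: scalar_prod_def A_def simp del: sum.op_ivl_Suc intro!: sum.cong)
    moreover have "det (A z) = 0" using W0[OF that(1)] by (simp add: wronskian_def A_def)
    ultimately show ?thesis using adj_mat(2)[OF A] that by simp
  qed
  have ceq: "c i z = (-1) ^ (k + i) * det (mat k k (\<lambda>(l, j). (deriv ^^ (if l < k then l else Suc l)) (h (if j < i then j else Suc j)) z))"
    if "i \<le> k" for i z
    using that unfolding c_def adj_mat_def cofactor_def mat_delete_def
    by (auto simp: A_def intro!: arg_cong[of _ _ det] eq_matI)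
  have ck: "c k z = wronskian k h z" for z
    unfolding ceq[OF order_refl] wronskian_def by (auto intro!: arg_cong[of _ _ det] eq_matI)
  have hd: "(deriv ^^ l) (h i) holomorphic_on B" if "i \<le> k" for l i
    using h[OF that] B(1) by (intro holomorphic_higher_deriv)
  have hc: "c i holomorphic_on B" if "i \<le> k" for i
  proof -
    have "(\<lambda>z. (-1) ^ (k + i) * det (mat k k (\<lambda>(l, j). (deriv ^^ (if l < k then l else Suc l)) (h (if j < i then j else Suc j)) z))) holomorphic_on B"
      by (intro holomorphic_intros holomorphic_on_det hd) auto
    then show ?thesis unfolding ceq[OF that, abs_def] .
  qed
  define e where "e i z = c i z / c k z" for i z
  have he: "e i holomorphic_on B" if "i \<le> k" for i
    unfolding e_def[abs_def] using that Wk by (intro holomorphic_intros hc) (auto simp: ck)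
  have rel': "(deriv ^^ l) (h k) z + (\<Sum>i<k. (deriv ^^ l) (h i) z * e i z) = 0" if "z \<in> B" "l \<le> k" for z l
  proof -
    have "(deriv ^^ l) (h k) z + (\<Sum>i<k. (deriv ^^ l) (h i) z * e i z)
      = (\<Sum>i<Suc k. (deriv ^^ l) (h i) z * c i z) / c k z"
      using Wk[OF that(1)] by (simp add: e_def ck add_divide_distrib sum_divide_distrib)
    then show ?thesis using rel[OF that] by simp
  qed
  have de: "deriv (e i) z = 0" if z: "z \<in> B" and i: "i < k" for z i
  proof -
    define v where "v = vec k (\<lambda>i. deriv (e i) z)"
    have "(\<Sum>i<k. (deriv ^^ l) (h i) z * deriv (e i) z) = 0" if l: "l < k" for l
    proof -
      have D: "((\<lambda>z. (deriv ^^ l) (h k) z + (\<Sum>i<k. (deriv ^^ l) (h i) z * e i z)) has_field_derivative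
         deriv ((deriv ^^ l) (h k)) z + (\<Sum>i<k. deriv ((deriv ^^ l) (h i)) z * e i z + (deriv ^^ l) (h i) z * deriv (e i) z)) (at z)"
      proof (intro DERIV_add DERIV_sum)
        show "((deriv ^^ l) (h k) has_field_derivative deriv ((deriv ^^ l) (h k)) z) (at z)"
          by (rule holomorphic_derivI[OF hd B(1) z]) simp
        fix i assume "i \<in> {..<k}"
        then have "((deriv ^^ l) (h i) has_field_derivative deriv ((deriv ^^ l) (h i)) z) (at z)"
          "(e i has_field_derivative deriv (e i) z) (at z)"
          using holomorphic_derivI[OF hd B(1) z, of i l] holomorphic_derivI[OF he B(1) z, of i] by auto
        from DERIV_mult[OF this] show "((\<lambda>z. (deriv ^^ l) (h i) z * e i z) has_field_derivative
          deriv ((deriv ^^ l) (h i)) z * e i z + (deriv ^^ l) (h i) z * deriv (e i) z) (at z)"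
          by (simp add: algebra_simps)
      qed
      have "((\<lambda>z. 0) has_field_derivative
         deriv ((deriv ^^ l) (h k)) z + (\<Sum>i<k. deriv ((deriv ^^ l) (h i)) z * e i z + (deriv ^^ l) (h i) z * deriv (e i) z)) (at z)"
        by (rule has_field_derivative_transform_within_open[OF D B(1) z]) (use rel' l in auto)
      then have "deriv ((deriv ^^ l) (h k)) z + (\<Sum>i<k. deriv ((deriv ^^ l) (h i)) z * e i z + (deriv ^^ l) (h i) z * deriv (e i) z) = 0"
        using DERIV_unique DERIV_const by blast
      then show ?thesis using rel'[OF z, of "Suc l"] l by (simp add: sum.distrib flip: add.assoc)
    qed
    moreover define D where "D = mat k k (\<lambda>(l, i). (deriv ^^ l) (h i) z)"
    ultimately have "D *\<^sub>v v = 0\<^sub>v k"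
      by (intro eq_vecI) (auto simp: scalar_prod_def v_def lessThan_atLeast0)
    moreover have "v \<in> carrier_vec k" "D \<in> carrier_mat k k" by (auto simp: v_def D_def)
    moreover have "det D \<noteq> 0"
      using Wk[OF z] by (simp add: wronskian_def D_def)
    ultimately have "v = 0\<^sub>v k"
      using det_0_iff_vec_prod_zero[of D k] by blast
    then have "vec_index v i = 0" using i by simp
    then show ?thesis using i by (simp add: v_def)
  qed
  have "\<exists>d. \<forall>z\<in>B. e i z = d" if i: "i < k" for i
  proof -
    have "(e i has_field_derivative 0) (at z)" if "z \<in> B" for z
      using holomorphic_derivI[OF he[of i] B(1) that, of UNIV] de[OF that i] i by simp
    then have "e i constant_on B"
      by (intro has_field_derivative_0_imp_constant_on B)
    then show ?thesis by (simp add: constant_on_def)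
  qed
  then obtain d where d: "\<And>i z. i < k \<Longrightarrow> z \<in> B \<Longrightarrow> e i z = d i" by metis
  show ?thesis
    by (rule that[of d]) (use rel'[of _ 0] d in \<open>auto simp: mult.commute\<close>)
qed

text \<open>In the inductive step the smaller Wronskian is nonzero on some ball. If the larger one
  vanished identically, the functions would satisfy a linear relation there, and by analytic
  continuation on \<open>U\<close>; its coefficient at \<open>h k\<close> is 1.\<close>

lemma wronskian_nonzero:
  assumes U: "open U" "connected U" "U \<noteq> {}" and h: "\<And>i. i < p \<Longrightarrow> h i holomorphic_on U"
    and ind: "\<And>c i. (\<And>z. z \<in> U \<Longrightarrow> (\<Sum>j<p. c j * h j z) = 0) \<Longrightarrow> i < p \<Longrightarrow> c i = 0"
  shows "\<exists>z\<in>U. wronskian p h z \<noteq> 0"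
  using h ind
proof (induction p)
  case 0
  have "det (mat 0 0 f) = (1::complex)" for f by (simp add: det_def)
  then show ?case using U(3) by (auto simp: wronskian_def)
next
  case (Suc k)
  have "\<exists>z\<in>U. wronskian k h z \<noteq> 0"
  proof (rule Suc.IH)
    fix c i assume *: "\<And>z. z \<in> U \<Longrightarrow> (\<Sum>j<k. c j * h j z) = 0" and i: "i < k"
    have "(c(k := 0)) i = 0" by (rule Suc.prems(2)) (use * i in auto)
    then show "c i = 0" using i by simp
  qed (use Suc.prems in auto)
  then obtain z0 where z0: "z0 \<in> U" "wronskian k h z0 \<noteq> 0" by blast
  show ?case
  proof (rule ccontr)
    assume "\<not> ?thesis"
    then have W0: "\<And>z. z \<in> U \<Longrightarrow> wronskian (Suc k) h z = 0" by blast
    define V where "V = U \<inter> wronskian k h -` (- {0})"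
    have "open V" unfolding V_def
      using holomorphic_on_wronskian[OF U(1), of k h] Suc.prems U
      by (intro continuous_open_preimage holomorphic_on_imp_continuous_on) auto
    moreover have "z0 \<in> V" using z0 by (simp add: V_def)
    ultimately obtain r where r: "r > 0" "ball z0 r \<subseteq> V" by (meson openE)
    obtain c where c: "\<And>z. z \<in> ball z0 r \<Longrightarrow> h k z + (\<Sum>i<k. c i * h i z) = 0"
    proof (rule wronskian_relation_constant[of "ball z0 r" k h])
      show "h i holomorphic_on ball z0 r" if "i \<le> k" for i
        using Suc.prems(1)[of i] that r by (auto simp: V_def intro: holomorphic_on_subset)
    qed (use r W0 in \<open>auto simp: V_def\<close>)
    have "(\<Sum>j<Suc k. (c(k := 1)) j * h j z) = 0" if "z \<in> U" for z
    proof (rule analytic_continuation_open[of "ball z0 r" U "\<lambda>z. \<Sum>j<Suc k. (c(k := 1)) j * h j z" "\<lambda>_. 0"])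
      show "(\<lambda>z. \<Sum>j<Suc k. (c(k := 1)) j * h j z) holomorphic_on U"
        using Suc.prems(1) by (intro holomorphic_intros) auto
      show "(\<Sum>j<Suc k. (c(k := 1)) j * h j z) = 0" if "z \<in> ball z0 r" for z
        using c[OF that] by (simp add: add.commute)
    qed (use r U that in \<open>auto simp: V_def\<close>)
    then have "(c(k := 1)) k = 0" by (rule Suc.prems(2)) auto
    then show False by simp
  qed
qed

section \<open>Linear forms in general position\<close>

text \<open>Bilinear and not Hermitian, so that \<open>bil a (F z)\<close> is holomorphic in
  \<open>z\<close>.\<close>

definition bil :: "complex ^ 'i \<Rightarrow> complex ^ 'i::finite \<Rightarrow> complex" where
  "bil a v = (\<Sum>i\<in>UNIV. a $ i * v $ i)"

lemma bil_add: "bil (a + b) v = bil a v + bil b v"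
  by (simp add: bil_def sum.distrib algebra_simps)

lemma bil_smult: "bil (c *s a) v = c * bil a v"
  by (simp add: bil_def sum_distrib_left mult.assoc)

lemma bil_smult_right: "bil a (c *s v) = c * bil a v"
  by (simp add: bil_def sum_distrib_left algebra_simps)

lemma bil_sum: "bil (\<Sum>x\<in>X. f x) v = (\<Sum>x\<in>X. bil (f x) v)"
  by (induction X rule: infinite_finite_induct) (simp_all add: bil_add, simp_all add: bil_def)

lemma bil_axis: "bil (axis i 1) v = v $ i"
  by (simp add: bil_def axis_def if_distrib[of "\<lambda>x. x * _"] cong: if_cong)

lemma norm_bil_le: "cmod (bil a v) \<le> norm a * norm v"
proof -
  have "bil a v = hermitian a (\<chi> i. cnj (v $ i))" by (simp add: bil_def hermitian_def)
  moreover have "norm (\<chi> i. cnj (v $ i)) = norm v" by (simp add: norm_vec_def)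
  ultimately show ?thesis using cmod_hermitian_le by metis
qed

text \<open>The square matrix with rows \<open>J\<close> is injective, hence invertible, hence has
  independent rows. This turns the geometric form of general position into linear
  independence.\<close>

lemma independent_if_kernel_trivial:
  fixes J :: "(complex ^ 'i::finite) set"
  assumes card: "card J = CARD('i)" and ker: "\<And>v. (\<And>a. a \<in> J \<Longrightarrow> bil a v = 0) \<Longrightarrow> v = 0"
  shows "vec.independent J"
proof -
  have "finite J" using card card.infinite by fastforce
  then obtain f where f: "bij_betw f (UNIV :: 'i set) J"
    using finite_same_card_bij[of "UNIV :: 'i set" J] card by auto
  define A :: "complex ^ 'i ^ 'i" where "A = (\<chi> i. f i)"
  have "A *v v = 0 \<Longrightarrow> v = 0" for v
  proof (rule ker)
    fix a assume "A *v v = 0" "a \<in> J"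
    then obtain i where "a = f i" using f by (auto simp: bij_betw_def)
    moreover have "(A *v v) $ i = bil (f i) v" by (simp add: A_def matrix_vector_mult_def bil_def)
    ultimately show "bil a v = 0" using \<open>A *v v = 0\<close> by simp
  qed
  then obtain B where "B ** A = Finite_Cartesian_Product.mat 1" using matrix_left_invertible_ker[of A] by blast
  then have "\<exists>B. A ** B = Finite_Cartesian_Product.mat 1" using matrix_left_right_inverse by blast
  then have rows: "\<And>c i. (\<Sum>i\<in>UNIV. c i *s Finite_Cartesian_Product.row i A) = 0 \<Longrightarrow> c i = 0"
    unfolding matrix_right_invertible_independent_rows by blast
  have row: "Finite_Cartesian_Product.row i A = f i" for i by (simp add: Finite_Cartesian_Product.row_def A_def Finite_Cartesian_Product.vec_eq_iff)
  show ?thesis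
  proof
    assume "vec.dependent J"
    then obtain u v where u: "v \<in> J" "u v \<noteq> 0" "(\<Sum>v\<in>J. u v *s v) = 0"
      using vec.dependent_finite[OF \<open>finite J\<close>] by auto
    have "(\<Sum>i\<in>UNIV. u (f i) *s f i) = (\<Sum>v\<in>J. u v *s v)"
      using f by (rule sum.reindex_bij_betw)
    then have "u (f i) = 0" for i using rows[of "\<lambda>i. u (f i)"] u(3) by (simp add: row)
    then show False using u f by (auto simp: bij_betw_def)
  qed
qed

text \<open>
  The restrictions to a linear subspace of a family of linear forms in general position:
  \<open>C0\<close> is a basis of the forms vanishing on the subspace.
\<close>

locale general_forms =
  fixes A C0 :: "(complex ^ 'i::finite) set"
  assumes finA: "finite A" and cardA: "card A \<ge> CARD('i)"
    and gpA: "\<And>J. J \<subseteq> A \<Longrightarrow> card J = CARD('i) \<Longrightarrow> vec.independent J"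
    and indC0: "vec.independent C0"
begin

text \<open>Forms of the family whose restrictions to the subspace cut out by \<open>C0\<close> are
  a basis of its dual space.\<close>

definition base :: "(complex ^ 'i) set \<Rightarrow> bool" where
  "base B \<longleftrightarrow> B \<subseteq> A \<and> B \<inter> C0 = {} \<and> vec.independent (B \<union> C0) \<and> card B = CARD('i) - card C0"

lemma finC0: "finite C0"
  using indC0 vec.finiteI_independent by blast

lemma cardC0: "card C0 \<le> CARD('i)"
  using vec.independent_bound_general[OF indC0] vec.dim_subset[of C0 UNIV]
  by (simp add: vec_dim_card card_cart_basis)

lemma independent_small:
  assumes "S \<subseteq> A" "card S \<le> CARD('i)"
  shows "vec.independent S"
proof -
  obtain T where "S \<subseteq> T" "T \<subseteq> A" "card T = CARD('i)"
    using exists_subset_between[OF assms(2) cardA assms(1) finA] by blast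
  with vec.independent_mono[OF gpA] show ?thesis by simp
qed

lemma span_A: "vec.span A = UNIV"
proof -
  obtain T where T: "T \<subseteq> A" "card T = CARD('i)"
    using obtain_subset_with_card_n[OF cardA] by blast
  have "UNIV \<subseteq> vec.span T"
    using T gpA[OF T] by (intro vec.card_ge_dim_independent) (auto simp: vec_dim_card card_cart_basis)
  then show ?thesis using vec.span_mono[OF T(1)] by blast
qed

lemma base_extend:
  assumes "B \<subseteq> A" "B \<inter> C0 = {}" "vec.independent (B \<union> C0)"
  obtains B' where "B \<subseteq> B'" "base B'"
proof -
  obtain X where X: "B \<union> C0 \<subseteq> X" "X \<subseteq> A \<union> C0" "vec.independent X" "A \<union> C0 \<subseteq> vec.span X"
    using vec.maximal_independent_subset_extend[of "B \<union> C0" "A \<union> C0"] assms by blast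
  have "vec.span X = UNIV"
    using vec.span_minimal[OF _ vec.subspace_span, of A X] X(4) span_A by auto
  then have cX: "card X = CARD('i)"
    using vec.dim_eq_card_independent[OF X(3)] vec.dim_span[of X] by (simp add: vec_dim_card card_cart_basis)
  have "base (X - C0)"
    unfolding base_def using X cX finC0 by (auto simp: card_Diff_subset Un_absorb2)
  then show ?thesis using that[of "X - C0"] X assms by blast
qed

text \<open>A crude substitute for Nochka weights. Start with an element \<open>a\<close> of largest
  weight and extend it inside \<open>S\<close> to a maximal set \<open>B\<close> that is independent
  modulo \<open>C0\<close>. As \<open>S\<close> itself is independent and lies in the span of
  \<open>B\<close> and \<open>C0\<close>, it has at most \<open>card C0\<close> elements outside
  \<open>B\<close>, each of weight at most \<open>x a\<close>, which already occurs in the sum over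
  \<open>B\<close>.\<close>

lemma base_select:
  assumes S: "S \<subseteq> A" "S \<inter> vec.span C0 = {}" "card S < CARD('i)"
    and x: "\<And>a. a \<in> A \<Longrightarrow> (0::real) \<le> x a"
  obtains B where "base B" "sum x S \<le> (real (card C0) + 1) * sum x B"
proof (cases "S = {}")
  case True
  obtain B where B: "base B" using base_extend[of "{}"] indC0 by auto
  have "0 \<le> sum x B" using B x by (intro sum_nonneg) (auto simp: base_def)
  then show ?thesis using that[OF B] True by simp
next
  case False
  have finS: "finite S" using S finA finite_subset by blast
  obtain a where a: "a \<in> S" "\<And>b. b \<in> S \<Longrightarrow> x b \<le> x a"
  proof -
    have "Max (x ` S) \<in> x ` S" using finS False by (intro Max_in) auto
    then obtain a where "a \<in> S" "x a = Max (x ` S)" by auto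
    then show thesis using that[of a] Max_ge[of "x ` S"] finS by auto
  qed
  have aC: "a \<notin> vec.span C0" using S a by blast
  then have "vec.independent (insert a C0)" using indC0 by (simp add: vec.independent_insert)
  then obtain X where X: "insert a C0 \<subseteq> X" "X \<subseteq> S \<union> C0" "vec.independent X" "S \<union> C0 \<subseteq> vec.span X"
    using vec.maximal_independent_subset_extend[of "insert a C0" "S \<union> C0"] a by blast
  define B where "B = X - C0"
  have finX: "finite X" using X(3) vec.finiteI_independent by blast
  have BS: "B \<subseteq> S" "a \<in> B" using X aC vec.span_superset[of C0] by (auto simp: B_def)
  have "card S \<le> card X"
    using vec.independent_span_bound[OF finX independent_small] S X(4) by auto
  also have "card X = card B + card C0"
    unfolding B_def using X(1) finX finC0 by (subst card_Diff_subset) (auto simp: card_mono)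
  finally have "card (S - B) \<le> card C0"
    using BS finS finite_subset[OF BS(1)] by (simp add: card_Diff_subset)
  moreover have xa: "0 \<le> x a" using x a S by auto
  ultimately have le: "real (card (S - B)) * x a \<le> real (card C0) * x a" by (intro mult_right_mono) auto
  have "B \<union> C0 = X" using X(1) by (auto simp: B_def)
  then have indB: "vec.independent (B \<union> C0)" using X(3) by simp
  obtain B' where B': "B \<subseteq> B'" "base B'"
    by (rule base_extend[OF _ _ indB]) (use BS S in \<open>auto simp: B_def\<close>)
  have finB': "finite B'" using B'(2) finA finite_subset by (auto simp: base_def)
  have BB': "sum x B \<le> sum x B'" using B' x by (intro sum_mono2 finB') (auto simp: base_def)
  have "x a \<le> sum x B"
    using BS finite_subset[OF BS(1) finS] x S by (intro member_le_sum) auto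
  have "sum x S = sum x B + sum x (S - B)" using sum.subset_diff[OF BS(1) finS, of x] by simp
  also have "sum x (S - B) \<le> real (card (S - B)) * x a"
    using a(2) by (intro sum_bounded_above) auto
  also note le
  also have "real (card C0) * x a \<le> real (card C0) * sum x B'"
    using \<open>x a \<le> sum x B\<close> BB' by (intro mult_left_mono) auto
  finally have "sum x S \<le> (real (card C0) + 1) * sum x B'"
    using BB' by (simp add: algebra_simps)
  then show ?thesis using that B'(2) by blast
qed

lemma card_inter_span:
  assumes "card C0 < CARD('i)"
  shows "card (A \<inter> vec.span C0) \<le> card C0"
proof (rule ccontr)
  assume "\<not> ?thesis"
  then have "Suc (card C0) \<le> card (A \<inter> vec.span C0)" by simp
  then obtain T where T: "T \<subseteq> A \<inter> vec.span C0" "card T = Suc (card C0)"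
    by (rule obtain_subset_with_card_n) blast
  have "vec.independent T" by (rule independent_small) (use T assms in auto)
  then show False using vec.independent_span_bound[OF finC0, of T] T by auto
qed

lemma base_representation:
  assumes "base (set bs)" "distinct bs" "length bs = p"
  obtains M w where "w \<in> vec.span C0" "a = (\<Sum>j<p. M j *s (bs ! j)) + w"
proof -
  have c: "card (set bs \<union> C0) = CARD('i)"
    using assms(1) finC0 cardC0 by (subst card_Un_disjoint) (auto simp: base_def)
  have "UNIV \<subseteq> vec.span (set bs \<union> C0)"
    using assms(1) c finC0 by (intro vec.card_ge_dim_independent) (auto simp: vec_dim_card card_cart_basis base_def)
  then have "a \<in> vec.span (set bs \<union> C0)" by auto
  then obtain b w where bw: "a = b + w" "b \<in> vec.span (set bs)" "w \<in> vec.span C0"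
    unfolding vec.span_Un by auto
  obtain u where u: "b = (\<Sum>v\<in>set bs. u v *s v)"
    using bw(2) vec.span_finite[of "set bs"] by auto
  have "bij_betw (\<lambda>j. bs ! j) {..<p} (set bs)"
    using assms by (intro bij_betw_nth) auto
  then have "b = (\<Sum>j<p. u (bs ! j) *s (bs ! j))"
    unfolding u by (rule sum.reindex_bij_betw[symmetric])
  then show ?thesis using that[of w "\<lambda>j. u (bs ! j)"] bw by simp
qed

end

section \<open>Logarithmic derivatives on circles\<close>

text \<open>Schwarz's lemma for \<open>f / (4 M - f)\<close> with \<open>f = L - L a\<close>, since
  this fraction maps the half-plane of real part below \<open>2 M\<close> into the disc. The real
  part of \<open>f\<close> is at most \<open>M\<close>; the doubled bound makes the inequality
  strict.\<close>

lemma Borel_Caratheodory: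
  assumes L: "L holomorphic_on ball a R" and neg: "\<And>z. z \<in> ball a R \<Longrightarrow> Re (L z) \<le> 0"
    and M: "Re (L a) \<ge> - M" "M > 0" and z: "z \<in> ball a R"
  shows "cmod (L z - L a) \<le> 4 * M * (dist z a / R) / (1 - dist z a / R)"
proof -
  have R: "R > 0" using z by (auto simp: dist_commute intro: le_less_trans[OF zero_le_dist])
  define f where "f w = L (a + of_real R * w) - L a" for w
  have sub: "a + of_real R * w \<in> ball a R" if "w \<in> ball 0 1" for w :: complex
    using that R by (simp add: dist_norm norm_mult)
  have Ref: "Re (f w) < 2 * M" if "w \<in> ball 0 1" for w
    using neg[OF sub[OF that]] M by (simp add: f_def)
  have nz: "4 * M - f w \<noteq> 0" if "w \<in> ball 0 1" for w
  proof
    assume "4 * M - f w = 0"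
    then have "Re (4 * M - f w) = 0" by simp
    then show False using Ref[OF that] M by simp
  qed
  define g where "g w = f w / (4 * M - f w)" for w
  have hf: "f holomorphic_on ball 0 1"
  proof -
    have "(L \<circ> (\<lambda>w. a + of_real R * w)) holomorphic_on ball 0 1"
      by (rule holomorphic_on_compose_gen[OF _ L]) (use sub in \<open>auto intro!: holomorphic_intros\<close>)
    then show ?thesis unfolding f_def[abs_def] o_def by (intro holomorphic_intros)
  qed
  have less: "cmod (f w) < cmod (4 * M - f w)" if "w \<in> ball 0 1" for w
  proof (rule power_less_imp_less_base[of _ 2])
    have "(cmod (4 * M - f w))\<^sup>2 - (cmod (f w))\<^sup>2 = 8 * M * (2 * M - Re (f w))"
      unfolding cmod_power2 by (simp add: power2_eq_square algebra_simps)
    moreover have "8 * M * (2 * M - Re (f w)) > 0" using Ref[OF that] M by simp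
    ultimately show "(cmod (f w))\<^sup>2 < (cmod (4 * M - f w))\<^sup>2" by linarith
  qed simp
  define \<xi> where "\<xi> = (z - a) / of_real R"
  have \<xi>: "cmod \<xi> < 1" "cmod \<xi> = dist z a / R"
    using z R by (auto simp: \<xi>_def norm_divide dist_norm norm_minus_commute)
  have g: "cmod (g \<xi>) \<le> cmod \<xi>"
  proof (rule Schwarz_Lemma(1))
    show "g holomorphic_on ball 0 1" unfolding g_def[abs_def] by (intro holomorphic_intros hf) (use nz in auto)
    show "g 0 = 0" by (simp add: g_def f_def)
    show "cmod (g w) < 1" if "cmod w < 1" for w
      using less[of w] that le_less_trans[OF norm_ge_zero less[of w]] by (simp add: g_def norm_divide)
  qed (rule \<xi>)
  have \<xi>b: "\<xi> \<in> ball 0 1" using \<xi> by simp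
  have "f \<xi> = L z - L a" using R by (simp add: f_def \<xi>_def)
  moreover have "f \<xi> * (1 + g \<xi>) = 4 * M * g \<xi>"
    using nz[OF \<xi>b] by (simp add: g_def field_simps)
  then have "cmod (f \<xi> * (1 + g \<xi>)) = cmod (4 * M * g \<xi>)" by (rule arg_cong)
  then have "cmod (f \<xi>) * cmod (1 + g \<xi>) = 4 * M * cmod (g \<xi>)"
    using M by (simp add: norm_mult)
  moreover have "cmod (1 + g \<xi>) \<ge> 1 - cmod \<xi>"
    using g norm_triangle_ineq2[of 1 "- g \<xi>"] by simp
  then have "cmod (f \<xi>) * (1 - cmod \<xi>) \<le> cmod (f \<xi>) * cmod (1 + g \<xi>)"
    by (intro mult_left_mono) auto
  moreover have "4 * M * cmod (g \<xi>) \<le> 4 * M * cmod \<xi>" using g M by simp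
  ultimately have "cmod (L z - L a) * (1 - cmod \<xi>) \<le> 4 * M * cmod \<xi>" by simp
  then show ?thesis using \<xi> by (subst pos_le_divide_eq) auto
qed

section \<open>Splitting off zeros, listed with multiplicity\<close>

lemma norm_prod_list_le:
  assumes "\<And>x. x \<in> set xs \<Longrightarrow> cmod (f x) \<le> B"
  shows "cmod (\<Prod>x\<leftarrow>xs. f x) \<le> B ^ length xs"
  using assms
  by (induction xs) (auto simp: norm_mult intro!: mult_mono intro: order_trans[OF norm_ge_zero])

lemma norm_prod_list_ge:
  assumes "\<And>x. x \<in> set xs \<Longrightarrow> B \<le> cmod (f x)" "B \<ge> 0"
  shows "B ^ length xs \<le> cmod (\<Prod>x\<leftarrow>xs. f x)"
  using assms(1)
  by (induction xs) (auto simp: norm_mult assms(2) intro!: mult_mono)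

text \<open>
  The number of zeros is controlled by the lower bound at one point: each linear factor gains
  a factor of at most \<open>8/9\<close> when passing from the circle of radius \<open>7.5 \<delta>\<close> to that point.
\<close>

lemma zero_count:
  fixes M :: real
  assumes \<delta>: "\<delta> > 0" and bd: "\<And>z. z \<in> ball z0 (8 * \<delta>) \<Longrightarrow> cmod (h z) \<le> 1"
    and a: "a \<in> cball z0 \<delta>" "cmod (h a) \<ge> exp (- M)"
    and xs: "set xs \<subseteq> cball z0 (3 * \<delta>)" and k: "k holomorphic_on ball z0 (8 * \<delta>)"
    and eq: "\<And>z. z \<in> ball z0 (8 * \<delta>) \<Longrightarrow> h z = (\<Prod>x\<leftarrow>xs. z - x) * k z"
  shows "length xs \<le> 9 * M" (is ?A)
    and "\<And>z. z \<in> cball z0 (7 * \<delta>) \<Longrightarrow> cmod (k z) * (9/2 * \<delta>) ^ length xs \<le> 1" (is "\<And>z. _ \<Longrightarrow> ?B z")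
    and "cmod (k a) * (9/2 * \<delta>) ^ length xs \<ge> exp (- M)" (is ?C)
proof -
  have B: "cmod (k z) * (9/2 * \<delta>) ^ length xs \<le> 1" if z: "z \<in> cball z0 (15/2 * \<delta>)" for z
  proof -
    have "cmod (k z) \<le> 1 / (9/2 * \<delta>) ^ length xs"
    proof (rule maximum_modulus_frontier[of k "cball z0 (15/2 * \<delta>)"])
      have "cball z0 (15/2 * \<delta>) \<subseteq> ball z0 (8 * \<delta>)" using \<delta> by (auto simp: subset_iff)
      then have "k holomorphic_on cball z0 (15/2 * \<delta>)" using k by (rule holomorphic_on_subset[rotated])
      then show "k holomorphic_on interior (cball z0 (15/2 * \<delta>))"
        "continuous_on (closure (cball z0 (15/2 * \<delta>))) k"
        by (auto intro: holomorphic_on_subset[OF _ ball_subset_cball] holomorphic_on_imp_continuous_on)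
      fix w assume "w \<in> frontier (cball z0 (15/2 * \<delta>))"
      then have w: "dist z0 w = 15/2 * \<delta>" using \<delta> by (simp add: frontier_cball)
      have "(9/2 * \<delta>) ^ length xs \<le> cmod (\<Prod>x\<leftarrow>xs. w - x)"
      proof (rule norm_prod_list_ge)
        fix x assume "x \<in> set xs"
        then have "dist z0 x \<le> 3 * \<delta>" using xs by auto
        then show "9/2 * \<delta> \<le> cmod (w - x)"
          using w dist_triangle[of z0 w x] by (simp add: dist_norm norm_minus_commute)
      qed (use \<delta> in auto)
      then have "(9/2 * \<delta>) ^ length xs * cmod (k w) \<le> cmod (h w)"
        using eq[of w] w \<delta> by (auto simp: norm_mult intro!: mult_right_mono)
      also have "\<dots> \<le> 1" using bd[of w] w \<delta> by auto
      finally show "cmod (k w) \<le> 1 / (9/2 * \<delta>) ^ length xs"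
        using \<delta> by (simp add: field_simps)
    qed (use z in auto)
    then show ?thesis using \<delta> by (simp add: field_simps)
  qed
  then show "\<And>z. z \<in> cball z0 (7 * \<delta>) \<Longrightarrow> ?B z" using \<delta> by (auto simp: subset_iff)
  have "cmod (\<Prod>x\<leftarrow>xs. a - x) \<le> (4 * \<delta>) ^ length xs"
  proof (rule norm_prod_list_le)
    fix x assume "x \<in> set xs"
    then have "dist z0 x \<le> 3 * \<delta>" using xs by auto
    then show "cmod (a - x) \<le> 4 * \<delta>"
      using a dist_triangle[of a x z0] by (simp add: dist_norm norm_minus_commute)
  qed
  then have "cmod (h a) \<le> (4 * \<delta>) ^ length xs * cmod (k a)"
    using eq[of a] a \<delta> by (auto simp: norm_mult intro!: mult_right_mono)
  also have "\<dots> = (8/9) ^ length xs * (cmod (k a) * (9/2 * \<delta>) ^ length xs)"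
  proof -
    have "4 * \<delta> = 8/9 * (9/2 * \<delta>)" by simp
    then have "(4 * \<delta>) ^ length xs = (8/9) ^ length xs * (9/2 * \<delta>) ^ length xs"
      by (metis power_mult_distrib)
    then show ?thesis by (simp only: mult_ac)
  qed
  finally have *: "exp (- M) \<le> (8/9) ^ length xs * (cmod (k a) * (9/2 * \<delta>) ^ length xs)"
    using a by linarith
  also have "\<dots> \<le> 1 * (cmod (k a) * (9/2 * \<delta>) ^ length xs)"
    using \<delta> by (intro mult_right_mono) (auto simp: power_le_one)
  finally show ?C by simp
  have "exp (- M) \<le> (8/9) ^ length xs * 1"
    by (rule order_trans[OF *]) (use B[of a] a \<delta> in \<open>intro mult_left_mono, auto\<close>)
  also have "\<dots> \<le> exp (- 1/9) ^ length xs"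
    using exp_ge_add_one_self[of "-1/9"] by (simp add: power_mono)
  also have "\<dots> = exp (- (length xs / 9))"
    by (simp flip: exp_of_nat_mult)
  finally show ?A by simp
qed

text \<open>By \<open>zero_count\<close> the number of linear factors that can be split off is
  bounded. Take a factorization with the largest number: a zero of \<open>k\<close> in the smaller
  disc would allow one more.\<close>

lemma zero_factorization:
  fixes M :: real
  assumes \<delta>: "\<delta> > 0" and h: "h holomorphic_on ball z0 (8 * \<delta>)"
    and bd: "\<And>z. z \<in> ball z0 (8 * \<delta>) \<Longrightarrow> cmod (h z) \<le> 1"
    and a: "a \<in> cball z0 \<delta>" "cmod (h a) \<ge> exp (- M)"
  obtains xs k where "set xs \<subseteq> cball z0 (3 * \<delta>)" "k holomorphic_on ball z0 (8 * \<delta>)"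
    "\<And>z. z \<in> ball z0 (8 * \<delta>) \<Longrightarrow> h z = (\<Prod>x\<leftarrow>xs. z - x) * k z"
    "\<And>z. z \<in> cball z0 (3 * \<delta>) \<Longrightarrow> k z \<noteq> 0"
proof -
  define P where "P xs k \<longleftrightarrow> set xs \<subseteq> cball z0 (3 * \<delta>) \<and> k holomorphic_on ball z0 (8 * \<delta>) \<and>
    (\<forall>z\<in>ball z0 (8 * \<delta>). h z = (\<Prod>x\<leftarrow>xs. z - x) * k z)" for xs k
  define N where "N = {length xs | xs. \<exists>k. P xs k}"
  have "N \<subseteq> {..nat \<lfloor>9 * M\<rfloor>}"
  proof
    fix l assume "l \<in> N"
    then obtain xs k where l: "l = length xs" "P xs k" by (auto simp: N_def)
    have "real (length xs) \<le> 9 * M"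
      by (rule zero_count(1)[of \<delta> z0 h a M xs k]) (use l(2) \<delta> bd a in \<open>auto simp: P_def\<close>)
    then show "l \<in> {..nat \<lfloor>9 * M\<rfloor>}" using l(1) by (simp add: le_nat_floor)
  qed
  then have fin: "finite N" by (rule finite_subset) simp
  have "P [] h" using h by (simp add: P_def)
  then have "0 \<in> N" unfolding N_def by force
  then have "Max N \<in> N" using fin by (intro Max_in) auto
  then obtain xs k where xs: "P xs k" "length xs = Max N" by (auto simp: N_def)
  show ?thesis
  proof (rule that[of xs k])
    fix b assume b: "b \<in> cball z0 (3 * \<delta>)"
    show "k b \<noteq> 0"
    proof
      assume "k b = 0"
      define k' where "k' z = (if z = b then deriv k b else (k z - k b) / (z - b))" for z
      have "b \<in> ball z0 (8 * \<delta>)" using b \<delta> by auto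
      then have "k' holomorphic_on ball z0 (8 * \<delta>)"
        unfolding k'_def[abs_def] using xs(1) by (intro pole_lemma) (auto simp: P_def)
      moreover have "k z = (z - b) * k' z" for z using \<open>k b = 0\<close> by (simp add: k'_def)
      ultimately have "P (b # xs) k'" using xs(1) b by (auto simp: P_def)
      then have "length (b # xs) \<in> N" unfolding N_def by blast
      then show False using Max_ge[OF fin] xs(2) by fastforce
    qed
  qed (use xs in \<open>auto simp: P_def\<close>)
qed

lemma norm_prod_list_ratio:
  assumes "\<And>x. x \<in> set xs \<Longrightarrow> \<eta> \<le> cmod (z - x)" "\<eta> > 0" "cmod (w - z) \<le> t"
  shows "cmod (\<Prod>x\<leftarrow>xs. w - x) \<le> (1 + t / \<eta>) ^ length xs * cmod (\<Prod>x\<leftarrow>xs. z - x)"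
  using assms(1)
proof (induction xs)
  case (Cons x xs)
  have t: "t \<ge> 0" using assms(3) norm_ge_zero order_trans by blast
  have "cmod (w - x) \<le> cmod (w - z) + cmod (z - x)"
    using norm_triangle_ineq[of "w - z" "z - x"] by simp
  also have "\<dots> \<le> t / \<eta> * \<eta> + cmod (z - x)" using assms by simp
  also have "\<dots> \<le> t / \<eta> * cmod (z - x) + cmod (z - x)"
    using Cons.prems t assms(2) by (intro add_right_mono mult_left_mono) auto
  finally have "cmod (w - x) \<le> (1 + t / \<eta>) * cmod (z - x)" by (simp add: algebra_simps)
  then have "cmod (w - x) * cmod (\<Prod>x\<leftarrow>xs. w - x) \<le>
      ((1 + t / \<eta>) * cmod (z - x)) * ((1 + t / \<eta>) ^ length xs * cmod (\<Prod>x\<leftarrow>xs. z - x))"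
    using Cons t assms(2) by (intro mult_mono) auto
  then show ?case by (simp add: norm_mult mult_ac)
qed simp

text \<open>The source of all estimates of logarithmic derivatives: if a function grows by at most a
  constant factor on a disc about \<open>z\<close>, then its derivatives at \<open>z\<close> are
  bounded by its own value there.\<close>

lemma Cauchy_growth_bound:
  assumes h: "h holomorphic_on ball z R" and t: "0 < t" "t < R"
    and bd: "\<And>w. cmod (w - z) \<le> t \<Longrightarrow> cmod (h w) \<le> C * cmod (h z)"
  shows "cmod ((deriv ^^ l) h z) \<le> fact l * (C * cmod (h z)) / t ^ l"
proof (rule Cauchy_inequality)
  have sub: "cball z t \<subseteq> ball z R" using t by auto
  show "h holomorphic_on ball z t" using h by (rule holomorphic_on_subset) (use sub in auto)
  show "continuous_on (cball z t) h"
    using h sub holomorphic_on_imp_continuous_on continuous_on_subset by blast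
qed (use t bd in \<open>auto simp: norm_minus_commute\<close>)

text \<open>
  Pigeonhole among concentric circles: one of them stays away from all the points.
\<close>

lemma avoiding_radius:
  fixes X :: "complex list"
  assumes \<delta>: "\<delta> > 0"
  shows "\<exists>r. \<delta> / 4 \<le> r \<and> r \<le> \<delta> / 2 \<and>
    (\<forall>x\<in>set X. \<forall>z. dist z0 z = r \<longrightarrow> \<delta> / (8 * (length X + 1)) \<le> cmod (z - x))"
proof -
  define N where "N = length X"
  define s where "s = \<delta> / (4 * (N + 1))"
  define r where "r j = \<delta> / 4 + real j * s" for j :: nat
  have s: "s > 0" using \<delta> by (simp add: s_def)
  have "\<exists>j\<le>N. \<forall>x\<in>set X. s / 2 \<le> \<bar>dist z0 x - r j\<bar>"
  proof (rule ccontr)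
    assume "\<not> ?thesis"
    then have "\<forall>j\<in>{..N}. \<exists>x\<in>set X. \<bar>dist z0 x - r j\<bar> < s / 2" by force
    then obtain g where g: "\<And>j. j \<le> N \<Longrightarrow> g j \<in> set X \<and> \<bar>dist z0 (g j) - r j\<bar> < s / 2"
      by (metis atMost_iff)
    have "inj_on g {..N}"
    proof (rule inj_onI)
      fix i j assume ij: "i \<in> {..N}" "j \<in> {..N}" "g i = g j"
      then have "\<bar>dist z0 (g i) - r i\<bar> < s / 2" "\<bar>dist z0 (g i) - r j\<bar> < s / 2" using g[of i] g[of j] by auto
      then have "\<bar>r i - r j\<bar> < s" by linarith
      also have "r i - r j = (real i - real j) * s" by (simp add: r_def algebra_simps)
      finally have "\<bar>real i - real j\<bar> * s < 1 * s" using s by (simp add: abs_mult)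
      then have "\<bar>real i - real j\<bar> < 1" using s by (simp only: mult_less_cancel_right_pos)
      then show "i = j" by linarith
    qed
    then have "card {..N} \<le> card (set X)" by (rule card_inj_on_le) (use g in auto)
    also have "\<dots> \<le> N" by (simp add: N_def card_length)
    finally show False by simp
  qed
  then obtain j where j: "j \<le> N" "\<And>x. x \<in> set X \<Longrightarrow> s / 2 \<le> \<bar>dist z0 x - r j\<bar>" by blast
  show ?thesis
  proof (intro exI[of _ "r j"] conjI ballI allI impI)
    show "\<delta> / 4 \<le> r j" using s by (simp add: r_def)
    have "real j * s \<le> real (N + 1) * s" using j(1) s by (intro mult_right_mono) auto
    also have "real (N + 1) * s = \<delta> / 4" by (simp add: s_def field_simps)
    finally show "r j \<le> \<delta> / 2" by (simp add: r_def)
    fix x z assume xz: "x \<in> set X" "dist z0 z = r j"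
    have "\<bar>dist z0 x - r j\<bar> \<le> cmod (z - x)"
      using xz(2) abs_dist_diff_le[of x z0 z] by (simp add: dist_commute dist_norm norm_minus_commute)
    moreover have "s / 2 = \<delta> / (8 * (length X + 1))" by (simp add: s_def N_def)
    ultimately show "\<delta> / (8 * (length X + 1)) \<le> cmod (z - x)"
      using j(2)[OF xz(1)] by linarith
  qed
qed

lemma length_concat_le:
  fixes B :: real
  assumes "\<And>i. i \<in> set J \<Longrightarrow> real (length (f i)) \<le> B"
  shows "real (length (concat (map f J))) \<le> length J * B"
  using assms by (induction J) (auto simp: algebra_simps intro: add_mono)

text \<open>The logarithm \<open>L\<close> of the normalised function has nonpositive real part, and
  real part at least \<open>- M\<close> at \<open>a\<close>. Borel-Caratheodory about
  \<open>a\<close>, with distance ratio at most \<open>3/4\<close>, gives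
  \<open>Re (L z) \<ge> - (13 * M)\<close>. Applied a second time, about \<open>z\<close>, it shows
  that a shift by \<open>\<delta> / (120 * M)\<close> changes \<open>L\<close> by at most 1, and
  \<open>exp 1 \<le> 3\<close>.\<close>

lemma zero_free_growth:
  assumes \<delta>: "\<delta> > 0" and k: "k holomorphic_on ball z0 (8 * \<delta>)"
    and bd: "\<And>z. z \<in> cball z0 (7 * \<delta>) \<Longrightarrow> cmod (k z) * c \<le> 1" and c: "c > 0"
    and nz: "\<And>z. z \<in> cball z0 (3 * \<delta>) \<Longrightarrow> k z \<noteq> 0"
    and a: "a \<in> cball z0 \<delta>" "cmod (k a) * c \<ge> exp (- M)" and M: "M \<ge> 1"
    and z: "z \<in> cball z0 (\<delta> / 2)" and w: "cmod (w - z) \<le> \<delta> / (120 * M)"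
  shows "cmod (k w) \<le> 3 * cmod (k z)"
proof -
  have k3: "k holomorphic_on ball z0 (3 * \<delta>)"
    using k by (rule holomorphic_on_subset) (use \<delta> in auto)
  obtain g where g: "g holomorphic_on ball z0 (3 * \<delta>)" "\<And>z. z \<in> ball z0 (3 * \<delta>) \<Longrightarrow> k z = exp (g z)"
  proof (rule holomorphic_logarithm_exists[of "ball z0 (3 * \<delta>)" k z0])
    fix g assume "g holomorphic_on ball z0 (3 * \<delta>)" "\<And>z. z \<in> ball z0 (3 * \<delta>) \<Longrightarrow> exp (g z) = k z"
    then show thesis using that[of g] by auto
  qed (use k3 nz \<delta> in auto)
  define L where "L z = g z + ln c" for z
  have kL: "cmod (k z) * c = exp (Re (L z))" if "z \<in> ball z0 (3 * \<delta>)" for z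
    using g(2)[OF that] c by (simp add: L_def exp_add)
  have L: "L holomorphic_on ball z0 (3 * \<delta>)" unfolding L_def by (intro holomorphic_intros g)
  have neg: "Re (L z) \<le> 0" if "z \<in> ball z0 (3 * \<delta>)" for z
    using kL[OF that] bd[of z] that \<delta> by simp
  have a3: "a \<in> ball z0 (3 * \<delta>)" using a \<delta> by auto
  have La: "Re (L a) \<ge> - M" using kL[OF a3] a by simp
  have za: "dist z a \<le> 3/2 * \<delta>"
    using z a dist_triangle[of z a z0] by (simp add: dist_commute)
  have suba: "ball a (2 * \<delta>) \<subseteq> ball z0 (3 * \<delta>)"
    using a by (auto simp: subset_iff) (smt (verit) dist_triangle)
  have "cmod (L z - L a) \<le> 4 * M * (dist z a / (2 * \<delta>)) / (1 - dist z a / (2 * \<delta>))"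
  proof (rule Borel_Caratheodory[of L a "2 * \<delta>"])
    show "L holomorphic_on ball a (2 * \<delta>)" using L suba by (rule holomorphic_on_subset)
    show "Re (L w) \<le> 0" if "w \<in> ball a (2 * \<delta>)" for w using neg suba that by blast
  qed (use La M za \<delta> in \<open>auto simp: dist_commute\<close>)
  also have "\<dots> \<le> 4 * M * (3/4) / (1 - 3/4)"
  proof -
    have "dist z a / (2 * \<delta>) \<le> 3/4" using za \<delta> by (simp add: field_simps)
    then have "4 * M * (dist z a / (2 * \<delta>)) \<le> 4 * M * (3/4)" using M by (intro mult_left_mono) auto
    moreover have "1 - 3/4 \<le> 1 - dist z a / (2 * \<delta>)" using \<open>dist z a / (2 * \<delta>) \<le> 3/4\<close> by linarith
    ultimately show ?thesis using M by (intro frac_le) auto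
  qed
  finally have "cmod (L z - L a) \<le> 12 * M" by simp
  then have Lz: "Re (L z) \<ge> - (13 * M)"
    using La abs_Re_le_cmod[of "L z - L a"] by simp
  have subz: "ball z \<delta> \<subseteq> ball z0 (3 * \<delta>)"
    using z \<delta> by (auto simp: subset_iff) (smt (verit) dist_triangle)
  have wz: "dist w z / \<delta> \<le> 1 / (120 * M)" using w \<delta> M by (simp add: dist_norm field_simps)
  have "1 / (120 * M) < 1" using M by (simp add: field_simps)
  with wz have wz1: "dist w z / \<delta> < 1" by linarith
  then have wb: "w \<in> ball z \<delta>" using \<delta> by (simp add: field_simps dist_commute)
  have "cmod (L w - L z) \<le> 4 * (13 * M) * (dist w z / \<delta>) / (1 - dist w z / \<delta>)"
  proof (rule Borel_Caratheodory[of L z \<delta>])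
    show "L holomorphic_on ball z \<delta>" using L subz by (rule holomorphic_on_subset)
    show "Re (L w) \<le> 0" if "w \<in> ball z \<delta>" for w using neg subz that by blast
  qed (use Lz M wb in auto)
  also have "\<dots> \<le> 4 * (13 * M) * (1 / (120 * M)) / (1 - 1 / 2)"
  proof -
    have "4 * (13 * M) * (dist w z / \<delta>) \<le> 4 * (13 * M) * (1 / (120 * M))"
      using wz M by (intro mult_left_mono) auto
    moreover have "1 / (120 * M) \<le> 1 / 2" using M by (simp add: field_simps)
    then have "1 - 1 / 2 \<le> 1 - dist w z / \<delta>" using wz by linarith
    ultimately show ?thesis using M by (intro frac_le) auto
  qed
  also have "\<dots> \<le> 1" using M by simp
  finally have "Re (L w) \<le> 1 + Re (L z)" using abs_Re_le_cmod[of "L w - L z"] by simp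
  then have "cmod (k w) * c \<le> exp (1 + Re (L z))"
    using kL[of w] wb subz by auto
  also have "\<dots> \<le> 3 * (cmod (k z) * c)"
    using kL[of z] z \<delta> exp_le by (simp add: exp_add)
  finally show ?thesis using c by simp
qed

text \<open>Each \<open>h i\<close> is a product of at most \<open>9 M\<close> linear factors and a
  zero-free part, so at most \<open>Nt = 9 q M\<close> zeros have to be avoided and some circle
  keeps distance \<open>\<eta> = \<delta> / (8 (Nt + 1))\<close> from all of them. A shift by
  \<open>\<eta> / (Nt + 1)\<close> enlarges a product of linear factors at most by
  \<open>(1 + 1 / (Nt + 1))^Nt \<le> 3\<close>, which is the reason for the square in the admissible
  shift; the zero-free part gives the other factor 3.\<close>

lemma good_circle:
  fixes h :: "'a \<Rightarrow> complex \<Rightarrow> complex"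
  assumes \<delta>: "\<delta> > 0" and fin: "finite I" "card I \<le> q"
    and h: "\<And>i. i \<in> I \<Longrightarrow> h i holomorphic_on ball z0 (8 * \<delta>)"
    and bd: "\<And>i z. i \<in> I \<Longrightarrow> z \<in> ball z0 (8 * \<delta>) \<Longrightarrow> cmod (h i z) \<le> 1"
    and a: "\<And>i. i \<in> I \<Longrightarrow> \<exists>z\<in>cball z0 \<delta>. cmod (h i z) \<ge> exp (- M)" and M: "M \<ge> 1"
  obtains r where "0 < r" "r < \<delta>"
    "\<And>i z w. i \<in> I \<Longrightarrow> dist z0 z = r \<Longrightarrow> h i z \<noteq> 0"
    "\<And>i z w. i \<in> I \<Longrightarrow> dist z0 z = r \<Longrightarrow> cmod (w - z) \<le> \<delta> / (120 * (9 * q * M + 1)\<^sup>2) \<Longrightarrow>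
       cmod (h i w) \<le> 9 * cmod (h i z)"
proof -
  define G where "G i xs k a \<longleftrightarrow> a \<in> cball z0 \<delta> \<and> cmod (h i a) \<ge> exp (- M) \<and>
     set xs \<subseteq> cball z0 (3 * \<delta>) \<and> k holomorphic_on ball z0 (8 * \<delta>) \<and>
     (\<forall>z\<in>ball z0 (8 * \<delta>). h i z = (\<Prod>x\<leftarrow>xs. z - x) * k z) \<and> (\<forall>z\<in>cball z0 (3 * \<delta>). k z \<noteq> 0)" for i xs k a
  have "\<exists>xs k a. G i xs k a" if i: "i \<in> I" for i
  proof -
    obtain b where b: "b \<in> cball z0 \<delta>" "cmod (h i b) \<ge> exp (- M)" using a[OF i] by blast
    show ?thesis
    proof (rule zero_factorization[OF \<delta> h[OF i] bd[OF i] b])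
      fix xs k assume "set xs \<subseteq> cball z0 (3 * \<delta>)" "k holomorphic_on ball z0 (8 * \<delta>)"
        "\<And>z. z \<in> ball z0 (8 * \<delta>) \<Longrightarrow> h i z = (\<Prod>x\<leftarrow>xs. z - x) * k z"
        "\<And>z. z \<in> cball z0 (3 * \<delta>) \<Longrightarrow> k z \<noteq> 0"
      with b show ?thesis unfolding G_def by blast
    qed
  qed
  then have "\<forall>i\<in>I. \<exists>y. G i (fst y) (fst (snd y)) (snd (snd y))" by simp
  from bchoice[OF this] obtain y where y: "\<forall>i\<in>I. G i (fst (y i)) (fst (snd (y i))) (snd (snd (y i)))"
    by blast
  define xs k a where "xs i = fst (y i)" and "k i = fst (snd (y i))" and "a i = snd (snd (y i))" for i
  have G: "G i (xs i) (k i) (a i)" if "i \<in> I" for i using y that by (simp add: xs_def k_def a_def)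
  have f: "a i \<in> cball z0 \<delta>" "cmod (h i (a i)) \<ge> exp (- M)"
     "set (xs i) \<subseteq> cball z0 (3 * \<delta>)" "k i holomorphic_on ball z0 (8 * \<delta>)"
     "\<And>z. z \<in> ball z0 (8 * \<delta>) \<Longrightarrow> h i z = (\<Prod>x\<leftarrow>xs i. z - x) * k i z"
     "\<And>z. z \<in> cball z0 (3 * \<delta>) \<Longrightarrow> k i z \<noteq> 0" if "i \<in> I" for i
    using G[OF that] unfolding G_def by blast+
  have cnt: "length (xs i) \<le> 9 * M"
    "\<And>z. z \<in> cball z0 (7 * \<delta>) \<Longrightarrow> cmod (k i z) * (9/2 * \<delta>) ^ length (xs i) \<le> 1"
    "cmod (k i (a i)) * (9/2 * \<delta>) ^ length (xs i) \<ge> exp (- M)" if i: "i \<in> I" for i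
  proof -
    have eq: "h i z = (\<Prod>x\<leftarrow>xs i. z - x) * k i z" if "z \<in> ball z0 (8 * \<delta>)" for z using f[OF i] that by blast
    have fs: "a i \<in> cball z0 \<delta>" "exp (- M) \<le> cmod (h i (a i))" "set (xs i) \<subseteq> cball z0 (3 * \<delta>)"
      "k i holomorphic_on ball z0 (8 * \<delta>)" using f[OF i] by blast+
    show "length (xs i) \<le> 9 * M"
      by (rule zero_count(1)[of \<delta> z0 "h i" "a i" M "xs i" "k i"]) (fact \<delta> fs eq bd[OF i])+
    show "cmod (k i z) * (9/2 * \<delta>) ^ length (xs i) \<le> 1" if "z \<in> cball z0 (7 * \<delta>)" for z
      by (rule zero_count(2)[of \<delta> z0 "h i" "a i" M "xs i" "k i"]) (fact \<delta> fs eq bd[OF i] that)+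
    show "cmod (k i (a i)) * (9/2 * \<delta>) ^ length (xs i) \<ge> exp (- M)"
      by (rule zero_count(3)[of \<delta> z0 "h i" "a i" M "xs i" "k i"]) (fact \<delta> fs eq bd[OF i])+
  qed
  obtain J where J: "set J = I" "distinct J" using finite_distinct_list[OF fin(1)] by blast
  define X where "X = concat (map xs J)"
  define Nt where "Nt = 9 * real q * M"
  have "real (length X) \<le> length J * (9 * M)"
    unfolding X_def by (rule length_concat_le) (use cnt(1) J in auto)
  also have "\<dots> = card I * (9 * M)" using J distinct_card[of J] by simp
  also have "\<dots> \<le> Nt" using fin(2) M by (simp add: Nt_def mult_right_mono)
  finally have lX: "length X \<le> Nt" .
  obtain r where r: "\<delta> / 4 \<le> r" "r \<le> \<delta> / 2"
    "\<And>x z. x \<in> set X \<Longrightarrow> dist z0 z = r \<Longrightarrow> \<delta> / (8 * (length X + 1)) \<le> cmod (z - x)"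
    using avoiding_radius[OF \<delta>, of X z0] by blast
  define \<eta> where "\<eta> = \<delta> / (8 * (Nt + 1))"
  have Nt: "Nt \<ge> 0" using M by (simp add: Nt_def)
  have \<eta>: "\<eta> > 0" using \<delta> Nt by (simp add: \<eta>_def)
  have rx: "\<eta> \<le> cmod (z - x)" if "x \<in> set (xs i)" "i \<in> I" "dist z0 z = r" for x i z
  proof -
    have "\<eta> \<le> \<delta> / (8 * (length X + 1))"
      unfolding \<eta>_def using lX \<delta> by (intro divide_left_mono) auto
    also have "\<dots> \<le> cmod (z - x)" using that J by (intro r) (auto simp: X_def)
    finally show ?thesis .
  qed
  have zb: "z \<in> cball z0 (\<delta> / 2)" if "dist z0 z = r" for z using that r by auto
  have growth: "cmod (h i w) \<le> 9 * cmod (h i z)"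
    if i: "i \<in> I" and z: "dist z0 z = r" and w: "cmod (w - z) \<le> \<delta> / (120 * (Nt + 1)\<^sup>2)" for i z w
  proof -
    have q1: "q \<ge> 1" using i fin by (metis One_nat_def Suc_leI card_gt_0_iff empty_iff le_trans)
    have "9 * 1 * M \<le> Nt" unfolding Nt_def using q1 M by (intro mult_right_mono mult_left_mono) auto
    then have NtM: "Nt \<ge> 9 * M" by simp
    have sq: "(Nt + 1)\<^sup>2 \<ge> (Nt + 1) * 1" unfolding power2_eq_square using Nt by (intro mult_left_mono) auto
    have "\<delta> / (120 * (Nt + 1)\<^sup>2) \<le> \<delta> / (120 * M)"
      using \<delta> M NtM Nt sq by (intro divide_left_mono) auto
    then have 1: "cmod (k i w) \<le> 3 * cmod (k i z)"
      using f[OF i] cnt[OF i] \<delta> M w zb[OF z]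
      by (intro zero_free_growth[of \<delta> "k i" z0 "(9/2 * \<delta>) ^ length (xs i)" "a i" M]) auto
    have "\<delta> / (120 * (Nt + 1)\<^sup>2) \<le> \<delta> / (8 * (Nt + 1)\<^sup>2)"
      using \<delta> Nt by (intro divide_left_mono) auto
    also have "\<dots> = \<eta> / (Nt + 1)" using Nt by (simp add: \<eta>_def power2_eq_square)
    finally have w': "cmod (w - z) \<le> \<eta> / (Nt + 1)" using w by linarith
    have "cmod (\<Prod>x\<leftarrow>xs i. w - x) \<le> (1 + \<eta> / (Nt + 1) / \<eta>) ^ length (xs i) * cmod (\<Prod>x\<leftarrow>xs i. z - x)"
      by (rule norm_prod_list_ratio[OF rx[OF _ i z] \<eta> w'])
    also have "\<dots> \<le> 3 * cmod (\<Prod>x\<leftarrow>xs i. z - x)"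
    proof (rule mult_right_mono)
      have "(1 + \<eta> / (Nt + 1) / \<eta>) ^ length (xs i) \<le> exp (1 / (Nt + 1)) ^ length (xs i)"
        using \<eta> Nt exp_ge_add_one_self[of "1 / (Nt + 1)"] by (intro power_mono) auto
      also have "\<dots> = exp (length (xs i) / (Nt + 1))" by (simp flip: exp_of_nat_mult)
      also have "\<dots> \<le> exp 1" using cnt(1)[OF i] NtM Nt by simp
      also have "\<dots> \<le> 3" by (rule exp_le)
      finally show "(1 + \<eta> / (Nt + 1) / \<eta>) ^ length (xs i) \<le> 3" .
    qed simp
    finally have 2: "cmod (\<Prod>x\<leftarrow>xs i. w - x) \<le> 3 * cmod (\<Prod>x\<leftarrow>xs i. z - x)" .
    have "(Nt + 1) * 120 \<ge> 1 * 1" using Nt by (intro mult_mono) auto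
    then have "\<delta> / (120 * (Nt + 1)\<^sup>2) \<le> \<delta> / 1" using sq \<delta> Nt by (intro divide_left_mono) auto
    then have "dist z0 w < 8 * \<delta>"
      using w zb[OF z] \<delta> dist_triangle[of z0 w z] by (simp add: dist_norm norm_minus_commute)
    then have "h i w = (\<Prod>x\<leftarrow>xs i. w - x) * k i w" using f[OF i] by auto
    moreover have "h i z = (\<Prod>x\<leftarrow>xs i. z - x) * k i z" using f[OF i] zb[OF z] \<delta> by auto
    moreover have "cmod (\<Prod>x\<leftarrow>xs i. w - x) * cmod (k i w) \<le>
       (3 * cmod (\<Prod>x\<leftarrow>xs i. z - x)) * (3 * cmod (k i z))"
      using 1 2 by (intro mult_mono) auto
    ultimately show ?thesis by (simp add: norm_mult)
  qed
  show ?thesis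
  proof (rule that[of r])
    show "h i z \<noteq> 0" if "i \<in> I" "dist z0 z = r" for i z
    proof -
      have "z \<in> ball z0 (8 * \<delta>)" "z \<in> cball z0 (3 * \<delta>)" using that r \<delta> by auto
      moreover have "z \<notin> set (xs i)" using rx[of z i z] that \<eta> by auto
      ultimately show ?thesis using f[OF that(1)] by (auto simp: prod_list_zero_iff)
    qed
  qed (use r \<delta> growth in \<open>auto simp: Nt_def\<close>)
qed

section \<open>Quotients of entire functions\<close>

lemma entire_punctured_nonzero:
  assumes "h holomorphic_on UNIV" "\<exists>z. h z \<noteq> 0"
  obtains r where "r > 0" "\<And>w. w \<in> ball z r - {z} \<Longrightarrow> h w \<noteq> (0::complex)"
proof -
  have "eventually (\<lambda>w. h w \<noteq> 0) (at z)"
    using non_zero_neighbour_alt[OF assms(1), of z] assms(2) by (auto simp: eventually_conj_iff)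
  then show ?thesis using that by (auto simp: eventually_at dist_commute)
qed

text \<open>Riemann's theorem on removable singularities at the zeros of \<open>Q\<close>. The local
  bound is the form in which divisibility is verified later, where orders of vanishing on both sides
  are compared by powers of the distance.\<close>

lemma entire_quotient:
  assumes P: "P holomorphic_on UNIV" and Q: "Q holomorphic_on UNIV" "\<exists>z. Q z \<noteq> 0"
    and bd: "\<And>z. \<exists>B. \<forall>\<^sub>F w in at z. cmod (P w) \<le> B * cmod (Q w)"
  obtains \<phi> where "\<phi> holomorphic_on UNIV" "\<And>z. P z = \<phi> z * Q z"
proof -
  have "\<exists>r g. r > 0 \<and> (\<forall>w\<in>ball z r - {z}. Q w \<noteq> 0 \<and> g w = P w / Q w) \<and> g holomorphic_on ball z r" for z
  proof -
    obtain r where r: "r > 0" "\<And>w. w \<in> ball z r - {z} \<Longrightarrow> Q w \<noteq> 0"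
      using entire_punctured_nonzero[OF Q, of z] by blast
    have "(\<lambda>w. P w / Q w) holomorphic_on ball z r - {z}"
      using P Q r by (intro holomorphic_intros) (auto intro: holomorphic_on_subset)
    moreover obtain B where "\<forall>\<^sub>F w in at z. cmod (P w) \<le> B * cmod (Q w)" using bd by blast
    moreover have "\<forall>\<^sub>F w in at z. w \<in> ball z r - {z}"
      using r(1) by (auto simp: eventually_at intro!: exI[of _ r] simp: dist_commute)
    ultimately have "\<forall>\<^sub>F w in at z. cmod (P w) \<le> B * cmod (Q w) \<and> w \<in> ball z r - {z}"
      by (simp add: eventually_conj_iff)
    then have "\<forall>\<^sub>F w in at z. cmod (P w / Q w) \<le> B"
    proof eventually_elim
      case (elim w)
      then have "cmod (Q w) > 0" using r(2)[of w] by simp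
      then show ?case using elim by (simp add: norm_divide pos_divide_le_eq)
    qed
    then obtain g where "g holomorphic_on ball z r" "\<forall>w\<in>ball z r - {z}. g w = P w / Q w"
      using holomorphic_on_extend_bounded[of "\<lambda>w. P w / Q w" "ball z r" z] r
        \<open>(\<lambda>w. P w / Q w) holomorphic_on ball z r - {z}\<close> by auto
    then show ?thesis using r by blast
  qed
  then obtain r g where rg: "\<And>z. r z > 0" "\<And>z w. w \<in> ball z (r z) - {z} \<Longrightarrow> Q w \<noteq> 0 \<and> g z w = P w / Q w"
    "\<And>z. g z holomorphic_on ball z (r z)" by metis
  \<comment> \<open>At a zero of \<open>Q\<close> the value is taken from the extension centred at
    that very zero; it agrees with the quotient nearby.\<close>
  define \<phi> where "\<phi> z = (if Q z = 0 then g z z else P z / Q z)" for z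
  have "\<phi> field_differentiable at z" for z
  proof (cases "Q z = 0")
    case True
    have "\<phi> w = g z w" if "w \<in> ball z (r z)" for w
      using rg(2)[of w z] that True by (cases "w = z") (auto simp: \<phi>_def)
    then have "\<phi> holomorphic_on ball z (r z)" using holomorphic_transform[OF rg(3)[of z]] by metis
    then show ?thesis using rg(1) holomorphic_on_imp_differentiable_at[of \<phi> "ball z (r z)"] by auto
  next
    case False
    have "open (- (Q -` {0}))"
      using Q(1) by (intro open_Compl closed_vimage continuous_on_subset[OF holomorphic_on_imp_continuous_on]) auto
    moreover have "\<phi> holomorphic_on - (Q -` {0})"
    proof -
      have "(\<lambda>z. P z / Q z) holomorphic_on - (Q -` {0})"
        using P Q by (intro holomorphic_intros) (auto intro: holomorphic_on_subset)
      then show ?thesis by (rule holomorphic_transform) (auto simp: \<phi>_def)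
    qed
    ultimately show ?thesis using False holomorphic_on_imp_differentiable_at by blast
  qed
  then have "\<phi> holomorphic_on UNIV" by (simp add: holomorphic_on_def)
  moreover have "P z = \<phi> z * Q z" for z
  proof (cases "Q z = 0")
    case True
    obtain B where B: "\<forall>\<^sub>F w in at z. cmod (P w) \<le> B * cmod (Q w)" using bd by blast
    have "P \<midarrow>z\<rightarrow> P z" "Q \<midarrow>z\<rightarrow> Q z"
      using holomorphic_on_imp_continuous_on[OF P] holomorphic_on_imp_continuous_on[OF Q(1)]
      by (auto simp: continuous_on_eq_continuous_at isCont_def)
    then have "cmod (P z) \<le> B * cmod (Q z)"
      by (intro tendsto_le[OF _ _ _ B]) (auto intro!: tendsto_intros)
    then show ?thesis using True by simp
  qed (simp add: \<phi>_def)
  ultimately show ?thesis using that by blast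
qed

section \<open>Orders of vanishing of derivatives\<close>

lemma higher_deriv_factor:
  assumes g: "g holomorphic_on ball z r" and h: "\<And>w. w \<in> ball z r \<Longrightarrow> h w = (w - z) ^ \<nu> * g w"
  shows "\<exists>g'. g' holomorphic_on ball z r \<and> (\<forall>w\<in>ball z r. (deriv ^^ l) h w = (w - z) ^ (\<nu> - l) * g' w)"
proof (induction l)
  case 0
  then show ?case using g h by auto
next
  case (Suc l)
  then obtain g' where g': "g' holomorphic_on ball z r" "\<And>w. w \<in> ball z r \<Longrightarrow> (deriv ^^ l) h w = (w - z) ^ (\<nu> - l) * g' w"
    by blast
  define j where "j = \<nu> - l"
  \<comment> \<open>Once the truncated exponent \<open>j = \<nu> - l\<close> has reached 0, no power
    is left to lower and differentiation just continues with \<open>g'\<close>.\<close>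
  define g'' where "g'' w = (if j = 0 then deriv g' w else of_nat j * g' w + (w - z) * deriv g' w)" for w
  have hd: "deriv g' holomorphic_on ball z r" using g' by (intro holomorphic_intros) auto
  have "g'' holomorphic_on ball z r"
    unfolding g''_def[abs_def] by (cases "j = 0") (auto intro!: holomorphic_intros hd g')
  moreover have "(deriv ^^ Suc l) h w = (w - z) ^ (\<nu> - Suc l) * g'' w" if w: "w \<in> ball z r" for w
  proof -
    have "((\<lambda>w. (w - z) ^ j * g' w) has_field_derivative
        (w - z) ^ j * deriv g' w + (of_nat j * (w - z) ^ (j - 1)) * g' w) (at w)"
      by (rule derivative_eq_intros holomorphic_derivI[OF g'(1) open_ball w] refl | simp)+
    then have "((deriv ^^ l) h has_field_derivative
        (w - z) ^ j * deriv g' w + (of_nat j * (w - z) ^ (j - 1)) * g' w) (at w)"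
      by (rule has_field_derivative_transform_within_open[OF _ open_ball w]) (simp add: g'(2) j_def)
    then have "(deriv ^^ Suc l) h w = (w - z) ^ j * deriv g' w + (of_nat j * (w - z) ^ (j - 1)) * g' w"
      by (simp add: DERIV_imp_deriv)
    also have "\<dots> = (w - z) ^ (j - 1) * g'' w"
      by (cases j) (auto simp: g''_def algebra_simps)
    finally show ?thesis by (simp add: j_def)
  qed
  ultimately show ?case by blast
qed

text \<open>Every differentiation lowers the order by at most one, so all derivatives up to order
  \<open>k\<close> share the truncated order \<open>\<nu> - k\<close>. This is what a column of a
  Wronskian of \<open>k + 1\<close> functions contributes.\<close>

lemma entire_local_order:
  assumes h: "h holomorphic_on UNIV" "\<exists>z. h z \<noteq> (0::complex)"
  obtains \<nu> c C where "c > 0" "C \<ge> 0" "h z \<noteq> 0 \<Longrightarrow> \<nu> = 0"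
    "\<forall>\<^sub>F w in at z. c * cmod (w - z) ^ \<nu> \<le> cmod (h w)"
    "\<forall>\<^sub>F w in at z. \<forall>l\<le>k. cmod ((deriv ^^ l) h w) \<le> C * cmod (w - z) ^ (\<nu> - k)"
proof -
  define \<nu> g where "\<nu> = nat (zorder h z)" and "g = zor_poly h z"
  obtain r where r: "if h z = 0 then zorder h z > 0 else zorder h z = 0" "r > 0"
    "g holomorphic_on cball z r" "\<And>w. w \<in> cball z r \<Longrightarrow> h w = g w * (w - z) ^ \<nu> \<and> g w \<noteq> 0"
  proof -
    have "\<exists>w\<in>UNIV. h w \<noteq> 0" using h(2) by blast
    from zorder_exist_zero[OF h(1) open_UNIV connected_UNIV UNIV_I this, of z] show thesis
      using that unfolding \<nu>_def g_def by blast
  qed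
  have gb: "g holomorphic_on ball z r" using r(3) by (rule holomorphic_on_subset) auto
  \<comment> \<open>A radius of at most 1 makes powers of the distance decrease in the exponent, so
    the bounds for all \<open>l \<le> k\<close> reduce to the one exponent
    \<open>\<nu> - k\<close>.\<close>
  define s where "s = min (r / 2) 1"
  have s: "s > 0" "s \<le> 1" "cball z s \<subseteq> ball z r" using r by (auto simp: s_def)
  have ev: "\<forall>\<^sub>F w in at z. w \<in> cball z s"
    using s by (auto simp: eventually_at intro!: exI[of _ s] simp: dist_commute)
  have cont: "continuous_on (cball z s) g"
    using gb s(3) by (meson continuous_on_subset holomorphic_on_imp_continuous_on)
  obtain x where x: "x \<in> cball z s" "\<And>w. w \<in> cball z s \<Longrightarrow> cmod (g x) \<le> cmod (g w)"
  proof -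
    have "\<exists>x\<in>cball z s. \<forall>w\<in>cball z s. cmod (g x) \<le> cmod (g w)"
      using s by (intro continuous_attains_inf continuous_on_norm cont) auto
    then show thesis using that by blast
  qed
  have "\<exists>C. \<forall>w\<in>cball z s. cmod ((deriv ^^ l) h w) \<le> C * cmod (w - z) ^ (\<nu> - l)" for l
  proof -
    obtain g' where g': "g' holomorphic_on ball z r" "\<And>w. w \<in> ball z r \<Longrightarrow> (deriv ^^ l) h w = (w - z) ^ (\<nu> - l) * g' w"
      using higher_deriv_factor[OF gb, of h \<nu> l] r(4) by (auto simp: mult.commute)
    have "compact (g' ` cball z s)"
      using g'(1) s(3) by (intro compact_continuous_image) (auto intro: holomorphic_on_imp_continuous_on holomorphic_on_subset)
    then obtain C where "\<And>w. w \<in> cball z s \<Longrightarrow> cmod (g' w) \<le> C"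
      using compact_imp_bounded bounded_iff by (metis imageI)
    then show ?thesis
      using g'(2) s(3) by (intro exI[of _ C]) (auto simp: norm_mult norm_power mult.commute subset_iff intro!: mult_right_mono)
  qed
  then obtain C where C: "\<And>l w. w \<in> cball z s \<Longrightarrow> cmod ((deriv ^^ l) h w) \<le> C l * cmod (w - z) ^ (\<nu> - l)" by metis
  define D where "D = (\<Sum>l\<le>k. \<bar>C l\<bar>)"
  show ?thesis
  proof (rule that[of "cmod (g x)" D \<nu>])
    show "cmod (g x) > 0" using x s r(4) by (auto simp: subset_iff)
    show "D \<ge> 0" by (auto simp: D_def intro: sum_nonneg)
    show "\<nu> = 0" if "h z \<noteq> 0" using r(1) that by (simp add: \<nu>_def)
    show "\<forall>\<^sub>F w in at z. cmod (g x) * cmod (w - z) ^ \<nu> \<le> cmod (h w)"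
      using ev
    proof eventually_elim
      case (elim w)
      then have "h w = g w * (w - z) ^ \<nu>" using r(4)[of w] s(3) by (auto simp: subset_iff)
      then show ?case using x(2)[OF elim] by (auto simp: norm_mult norm_power intro!: mult_right_mono)
    qed
    show "\<forall>\<^sub>F w in at z. \<forall>l\<le>k. cmod ((deriv ^^ l) h w) \<le> D * cmod (w - z) ^ (\<nu> - k)"
      using ev
    proof eventually_elim
      case (elim w)
      show ?case
      proof (intro allI impI)
        fix l assume l: "l \<le> k"
        have "C l \<le> D" unfolding D_def
          using member_le_sum[of l "{..k}" "\<lambda>l. \<bar>C l\<bar>"] l by auto
        moreover have "cmod (w - z) ^ (\<nu> - l) \<le> cmod (w - z) ^ (\<nu> - k)"
          using elim s l by (intro power_decreasing) (auto simp: dist_norm norm_minus_commute)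
        moreover have "0 \<le> D" by (auto simp: D_def intro: sum_nonneg)
        ultimately have "D * cmod (w - z) ^ (\<nu> - l) \<le> D * cmod (w - z) ^ (\<nu> - k)"
          "C l * cmod (w - z) ^ (\<nu> - l) \<le> D * cmod (w - z) ^ (\<nu> - l)"
          by (auto intro: mult_left_mono mult_right_mono)
        then show "cmod ((deriv ^^ l) h w) \<le> D * cmod (w - z) ^ (\<nu> - k)"
          using C[OF elim, of l] by linarith
      qed
    qed
  qed
qed

section \<open>Polynomials near infinity\<close>

lemma poly_asymp_monomial:
  fixes p :: "complex poly"
  shows "((\<lambda>z. poly p z / z ^ degree p) \<longlongrightarrow> lead_coeff p) at_infinity"
proof -
  define d where "d = degree p"
  have "((\<lambda>z. \<Sum>i\<le>d. coeff p i * inverse z ^ (d - i)) \<longlongrightarrow> (\<Sum>i\<le>d. coeff p i * 0 ^ (d - i))) at_infinity"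
    by (intro tendsto_intros tendsto_inverse_0)
  also have "(\<Sum>i\<le>d. coeff p i * 0 ^ (d - i)) = (\<Sum>i\<in>{d}. coeff p i * 0 ^ (d - i))"
    by (intro sum.mono_neutral_right) (auto simp: power_0_left)
  finally have "((\<lambda>z. \<Sum>i\<le>d. coeff p i * inverse z ^ (d - i)) \<longlongrightarrow> coeff p d) at_infinity" by simp
  moreover have "\<forall>\<^sub>F z in at_infinity. (\<Sum>i\<le>d. coeff p i * inverse z ^ (d - i)) = poly p z / z ^ d"
    using eventually_not_equal_at_infinity[of 0]
  proof eventually_elim
    case (elim z)
    have "inverse z ^ (d - i) = z ^ i / z ^ d" if "i \<le> d" for i
      using elim that by (simp add: power_diff field_simps)
    then show ?case unfolding poly_altdef d_def[symmetric] sum_divide_distrib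
      by (intro sum.cong) auto
  qed
  ultimately show ?thesis unfolding d_def by (rule Lim_transform_eventually)
qed

text \<open>Far out a polynomial is within \<open>1/10\<close> of its leading monomial, relatively,
  and the monomial changes by at most \<open>6/5\<close> over the distance \<open>R\<close>; the
  constants fit since \<open>11/10 * 6/5 \<le> 2 * 9/10\<close>. The point is that \<open>R\<close>
  is arbitrary while the factor 2 stays.\<close>

lemma poly_ratio_at_infinity:
  fixes p :: "complex poly"
  assumes p: "p \<noteq> 0" and R: "R > 0"
  obtains B where "B > 0" "\<And>x y. B \<le> cmod x \<Longrightarrow> B \<le> cmod y \<Longrightarrow> cmod (x - y) \<le> R \<Longrightarrow>
    poly p x \<noteq> 0 \<and> cmod (poly p x) \<le> 2 * cmod (poly p y)"
proof -
  define d c where "d = degree p" and "c = cmod (lead_coeff p)"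
  have c: "c > 0" using p by (simp add: c_def)
  have "\<forall>\<^sub>F z in at_infinity. dist (poly p z / z ^ d) (lead_coeff p) < c / 10"
    using tendstoD[OF poly_asymp_monomial[of p], of "c / 10"] c by (simp add: d_def)
  then obtain B1 where B1: "\<And>z. B1 \<le> cmod z \<Longrightarrow> dist (poly p z / z ^ d) (lead_coeff p) < c / 10"
    by (auto simp: eventually_at_infinity)
  have "((\<lambda>x::real. (1 + R / x) ^ d) \<longlongrightarrow> (1 + 0) ^ d) at_top"
    by (intro tendsto_intros tendsto_divide_0[OF tendsto_const] filterlim_at_top_imp_at_infinity filterlim_ident)
  then have "\<forall>\<^sub>F x::real in at_top. (1 + R / x) ^ d < 6 / 5"
    by (rule order_tendstoD) simp
  then obtain B2 where B2: "\<And>x. B2 \<le> x \<Longrightarrow> (1 + R / x) ^ d < 6 / 5"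
    by (auto simp: eventually_at_top_linorder)
  define B where "B = max 1 (max B1 B2)"
  have bd: "9/10 * c * cmod z ^ d \<le> cmod (poly p z)" "cmod (poly p z) \<le> 11/10 * c * cmod z ^ d"
    if z: "B \<le> cmod z" for z
  proof -
    have "1 \<le> cmod z" using z by (simp add: B_def)
    then have z0: "cmod z > 0" by linarith
    have d: "cmod (poly p z / z ^ d - lead_coeff p) < c / 10" using B1[of z] z by (simp add: B_def dist_norm)
    have "cmod (poly p z / z ^ d) \<le> 11/10 * c"
      using d norm_triangle_ineq[of "poly p z / z ^ d - lead_coeff p" "lead_coeff p"] by (simp add: c_def)
    then show "cmod (poly p z) \<le> 11/10 * c * cmod z ^ d"
      using z0 by (simp add: norm_divide norm_power field_simps)
    have "9/10 * c \<le> cmod (poly p z / z ^ d)"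
      using d norm_triangle_ineq2[of "lead_coeff p" "poly p z / z ^ d"] by (simp add: c_def norm_minus_commute)
    then show "9/10 * c * cmod z ^ d \<le> cmod (poly p z)"
      using z0 by (simp add: norm_divide norm_power field_simps)
  qed
  show ?thesis
  proof (rule that[of B])
    show "B > 0" by (simp add: B_def)
    fix x y assume xy: "B \<le> cmod x" "B \<le> cmod y" "cmod (x - y) \<le> R"
    have "1 \<le> cmod x" "1 \<le> cmod y" using xy by (auto simp: B_def)
    then have pos: "cmod x > 0" "cmod y > 0" by linarith+
    have "0 < 9/10 * c * cmod x ^ d" using c pos by simp
    then have px: "poly p x \<noteq> 0" using bd(1)[OF xy(1)] by auto
    have "cmod x \<le> (1 + R / cmod y) * cmod y"
    proof -
      have "(1 + R / cmod y) * cmod y = cmod y + R" using pos by (simp add: field_simps)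
      then show ?thesis using xy(3) norm_triangle_ineq2[of x y] by linarith
    qed
    then have "cmod x ^ d \<le> (1 + R / cmod y) ^ d * cmod y ^ d"
      by (metis norm_ge_zero power_mono power_mult_distrib)
    also have "\<dots> \<le> 6/5 * cmod y ^ d"
      using B2[of "cmod y"] xy(2) by (intro mult_right_mono) (auto simp: B_def)
    finally have "11/10 * c * cmod x ^ d \<le> 11/10 * c * (6/5 * cmod y ^ d)"
      using c by (intro mult_left_mono) auto
    also have "\<dots> \<le> 2 * (9/10 * c * cmod y ^ d)" using c by simp
    finally have "cmod (poly p x) \<le> 2 * cmod (poly p y)"
      using bd(2)[OF xy(1)] bd(1)[OF xy(2)] by linarith
    then show "poly p x \<noteq> 0 \<and> cmod (poly p x) \<le> 2 * cmod (poly p y)" using px by simp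
  qed
qed

section \<open>Ramified entire curves\<close>

text \<open>Only \<open>|z| \<ge> 1\<close> matters, where exponents may be enlarged freely; this
  makes the class closed under sums.\<close>

definition poly_bounded :: "(complex \<Rightarrow> real) \<Rightarrow> bool" where
  "poly_bounded g \<longleftrightarrow> (\<exists>C D. \<forall>z. 1 \<le> cmod z \<longrightarrow> \<bar>g z\<bar> \<le> C * cmod z ^ D)"

lemma poly_bounded_const: "poly_bounded (\<lambda>z. c)"
  unfolding poly_bounded_def by (intro exI[of _ "\<bar>c\<bar>"] exI[of _ 0]) auto

lemma poly_bounded_dist: "poly_bounded (\<lambda>z. dist z c)"
  unfolding poly_bounded_def
proof (intro exI[of _ "1 + cmod c"] exI[of _ 1] allI impI)
  fix z :: complex assume z: "1 \<le> cmod z"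
  have "dist z c \<le> cmod z + cmod c" unfolding dist_norm by (rule norm_triangle_ineq4)
  moreover have "cmod c * 1 \<le> cmod c * cmod z" using z by (intro mult_left_mono) auto
  ultimately show "\<bar>dist z c\<bar> \<le> (1 + cmod c) * cmod z ^ 1" by (simp add: algebra_simps)
qed

lemma poly_bounded_mult:
  assumes "poly_bounded f" "poly_bounded g" shows "poly_bounded (\<lambda>z. f z * g z)"
proof -
  obtain C D C' D' where 1: "\<And>z. 1 \<le> cmod z \<Longrightarrow> \<bar>f z\<bar> \<le> C * cmod z ^ D" "\<And>z. 1 \<le> cmod z \<Longrightarrow> \<bar>g z\<bar> \<le> C' * cmod z ^ D'"
    using assms unfolding poly_bounded_def by metis
  have "\<bar>f z * g z\<bar> \<le> (C * C') * cmod z ^ (D + D')" if "1 \<le> cmod z" for z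
  proof -
    have "\<bar>f z\<bar> * \<bar>g z\<bar> \<le> (C * cmod z ^ D) * (C' * cmod z ^ D')"
      using 1(1)[OF that] 1(2)[OF that] by (intro mult_mono') auto
    then show ?thesis by (simp add: abs_mult power_add mult_ac)
  qed
  then show ?thesis unfolding poly_bounded_def by blast
qed

lemma poly_bounded_add:
  assumes "poly_bounded f" "poly_bounded g" shows "poly_bounded (\<lambda>z. f z + g z)"
proof -
  obtain C D C' D' where 1: "\<And>z. 1 \<le> cmod z \<Longrightarrow> \<bar>f z\<bar> \<le> C * cmod z ^ D" "\<And>z. 1 \<le> cmod z \<Longrightarrow> \<bar>g z\<bar> \<le> C' * cmod z ^ D'"
    using assms unfolding poly_bounded_def by metis
  have "\<bar>f z + g z\<bar> \<le> (\<bar>C\<bar> + \<bar>C'\<bar>) * cmod z ^ (D + D')" if z: "1 \<le> cmod z" for z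
  proof -
    have "C * cmod z ^ D \<le> \<bar>C\<bar> * cmod z ^ (D + D')" "C' * cmod z ^ D' \<le> \<bar>C'\<bar> * cmod z ^ (D + D')"
      using z by (auto intro!: mult_mono power_increasing)
    then show ?thesis using 1(1)[OF z] 1(2)[OF z] by (simp add: algebra_simps)
  qed
  then show ?thesis unfolding poly_bounded_def by blast
qed

lemma poly_bounded_power:
  "poly_bounded f \<Longrightarrow> poly_bounded (\<lambda>z. f z ^ k)"
  by (induction k) (auto intro: poly_bounded_const poly_bounded_mult)

lemmas poly_bounded_intros = poly_bounded_const poly_bounded_dist poly_bounded_mult poly_bounded_add poly_bounded_power

text \<open>
  The dimension count behind the bound on the number of hyperplanes, for a curve whose image
  spans a subspace of dimension \<open>k = n - d\<close>.
\<close>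

lemma weight_count:
  fixes n d k p q' q :: nat
  assumes "n = k + d" "k \<ge> 1" "p = k + 1" "q' + d \<ge> q" "q \<ge> n * (2 * n + 1) + 2"
  shows "2 * (k * n) + (d + 1) * p < q'"
proof -
  have "d * k \<ge> d" using assms(2) by simp
  moreover have "d * d \<ge> d" by (cases d) auto
  moreover have "n * (2 * n + 1) + 2 = 2 * k * k + 4 * (d * k) + 2 * (d * d) + k + d + 2"
    unfolding assms(1) by (simp add: algebra_simps)
  moreover have "2 * (k * n) + (d + 1) * p = 2 * k * k + 2 * (d * k) + d * k + d + k + 1"
    unfolding assms(1,3) by (simp add: algebra_simps)
  ultimately show ?thesis using assms(4,5) by linarith
qed

text \<open>The assumptions describe the limit of the rescaled mappings, and the locale exists to be
  refuted. In \<open>ram\<close> hyperplanes containing the whole curve are exempt, since Hurwitz's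
  theorem says nothing when the limit vanishes identically.\<close>

locale ramified_curve =
  fixes F :: "complex \<Rightarrow> complex ^ 'i::finite" and A :: "(complex ^ 'i) set" and n :: nat
  assumes n1: "n \<ge> 1" and cardI: "CARD('i) = n + 1"
    and hol: "\<And>i. (\<lambda>z. F z $ i) holomorphic_on UNIV"
    and nz: "\<And>z. F z \<noteq> 0"
    and wr: "\<And>s t z. cmod (wr2 F s t z) \<le> nsq (F z)"
    and nonconst: "\<exists>s t z. wr2 F s t z \<noteq> 0"
    and finite_A: "finite A" and card_A: "card A \<ge> n * (2 * n + 1) + 2"
    and unit: "\<And>a. a \<in> A \<Longrightarrow> norm a = 1"
    and gp: "\<And>J v. J \<subseteq> A \<Longrightarrow> card J = n + 1 \<Longrightarrow> (\<And>a. a \<in> J \<Longrightarrow> bil a v = 0) \<Longrightarrow> v = 0"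
    and ram: "\<And>a s t z. a \<in> A \<Longrightarrow> bil a (F z) = 0 \<Longrightarrow> (\<exists>w. bil a (F w) \<noteq> 0) \<Longrightarrow> wr2 F s t z = 0"
begin

definition h :: "complex ^ 'i \<Rightarrow> complex \<Rightarrow> complex" where "h a z = bil a (F z)"

lemma hol_h: "h a holomorphic_on S"
  unfolding h_def[abs_def] bil_def
  by (intro holomorphic_intros holomorphic_on_subset[OF hol]) auto

lemma h_le: "a \<in> A \<Longrightarrow> cmod (h a z) \<le> norm (F z)"
  using norm_bil_le[of a "F z"] unit[of a] by (simp add: h_def)

lemma normF_pos: "norm (F z) > 0" using nz by simp

definition V0 :: "(complex ^ 'i) set" where "V0 = {a. \<forall>z. h a z = 0}"

lemma subspace_V0: "vec.subspace V0"
  unfolding vec.subspace_def V0_def by (auto simp: h_def bil_add bil_smult) (simp add: bil_def)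

definition C0 :: "(complex ^ 'i) set" where
  "C0 = (SOME B. B \<subseteq> V0 \<and> vec.independent B \<and> V0 \<subseteq> vec.span B)"

lemma C0: "C0 \<subseteq> V0" "vec.independent C0" "vec.span C0 = V0"
proof -
  have "\<exists>B. B \<subseteq> V0 \<and> vec.independent B \<and> V0 \<subseteq> vec.span B"
    using vec.maximal_independent_subset[of V0] by metis
  then have "C0 \<subseteq> V0 \<and> vec.independent C0 \<and> V0 \<subseteq> vec.span C0"
    unfolding C0_def by (rule someI_ex)
  then show "C0 \<subseteq> V0" "vec.independent C0" "vec.span C0 = V0"
    using vec.span_minimal[OF _ subspace_V0, of C0] by auto
qed

sublocale general_forms A C0
proof
  have "n + 1 \<le> n * (2 * n + 1) + 2" by simp
  then show "card A \<ge> CARD('i)" using card_A cardI by linarith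
  show "vec.independent J" if "J \<subseteq> A" "card J = CARD('i)" for J
    using that gp[of J] cardI by (intro independent_if_kernel_trivial) auto
qed (use finite_A C0 in auto)

text \<open>\<open>V0\<close> consists of the forms vanishing along the curve, so \<open>d\<close>
  is the codimension of the linear span of the image, \<open>p\<close> the dimension of that span as
  a vector space and \<open>k\<close> its projective dimension. The number \<open>m\<close> is the
  factor lost in \<open>base_select\<close>.\<close>

definition d where "d = card C0"
definition p where "p = n + 1 - d"
definition k where "k = p - 1"
definition m where "m = d + 1"
definition A' where "A' = A - V0"
text \<open>Lists, because a Wronskian takes its functions in an order. There are finitely many of
  them, so constants can be chosen uniformly over all bases.\<close>

definition \<B> where "\<B> = {bs. distinct bs \<and> base (set bs)}"

lemma base_sub: "base B \<Longrightarrow> B \<subseteq> A'"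
proof
  fix b assume B: "base B" "b \<in> B"
  have "b \<notin> vec.span C0"
  proof
    assume "b \<in> vec.span C0"
    then have "b \<in> vec.span ((B \<union> C0) - {b})"
      using B vec.span_mono[of C0 "(B \<union> C0) - {b}"] by (auto simp: base_def)
    then have "vec.dependent (B \<union> C0)" using B unfolding vec.dependent_def by blast
    then show False using B by (simp add: base_def)
  qed
  then show "b \<in> A'" using B C0 by (auto simp: A'_def base_def)
qed

lemma length_bs: "bs \<in> \<B> \<Longrightarrow> length bs = p"
  unfolding \<B>_def base_def p_def d_def using cardI distinct_card[of bs] by auto

lemma nth_bs: "bs \<in> \<B> \<Longrightarrow> i < p \<Longrightarrow> bs ! i \<in> A'"
  using base_sub[of "set bs"] length_bs[of bs] by (auto simp: \<B>_def)

lemma finite_\<B>: "finite \<B>"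
proof (rule finite_subset)
  show "\<B> \<subseteq> {bs. set bs \<subseteq> A \<and> length bs = p}" using length_bs by (auto simp: \<B>_def base_def)
  show "finite {bs. set bs \<subseteq> A \<and> length bs = p}" by (rule finite_lists_length_eq[OF finite_A])
qed

lemma base_list:
  assumes "base B" obtains bs where "bs \<in> \<B>" "set bs = B"
proof -
  have "finite B" using assms finite_A finite_subset by (auto simp: base_def)
  then obtain bs where "set bs = B" "distinct bs" using finite_distinct_list by blast
  then show ?thesis using that assms by (auto simp: \<B>_def)
qed

lemma \<B>_nonempty: "\<B> \<noteq> {}"
proof -
  obtain B where "base B" using base_extend[of "{}"] C0 by auto
  then show ?thesis using base_list by blast
qed

lemma h_representation:
  assumes bs: "bs \<in> \<B>"
  obtains M where "h a = (\<lambda>z. \<Sum>j<p. M j * h (bs ! j) z)"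
proof -
  have "base (set bs)" "distinct bs" "length bs = p" using bs length_bs[OF bs] by (auto simp: \<B>_def)
  then obtain M w where M: "w \<in> vec.span C0" "a = (\<Sum>j<p. M j *s (bs ! j)) + w"
    by (rule base_representation)
  have "h a z = (\<Sum>j<p. M j * h (bs ! j) z)" for z
    using M(1) unfolding h_def by (subst M(2)) (auto simp: bil_add bil_sum bil_smult C0 V0_def h_def)
  then show ?thesis using that by blast
qed

text \<open>If the image spans at most a line through the origin, all coordinates are constant
  multiples of one function and every \<open>wr2\<close> vanishes, against
  \<open>nonconst\<close>.\<close>

lemma p2: "p \<ge> 2"
proof (rule ccontr)
  assume p: "\<not> p \<ge> 2"
  obtain bs where bs: "bs \<in> \<B>" using \<B>_nonempty by blast
  define g where "g = (if p = 0 then (\<lambda>_. 0) else h (bs ! 0))"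
  have g: "g holomorphic_on UNIV" using hol_h by (auto simp: g_def)
  have "\<exists>c. \<forall>z. F z $ t = c * g z" for t
  proof -
    obtain M where "h (axis t 1) = (\<lambda>z. \<Sum>j<p. M j * h (bs ! j) z)" using h_representation[OF bs] by blast
    then have "F z $ t = (\<Sum>j<p. M j * h (bs ! j) z)" for z
      using bil_axis[of t "F z"] by (simp add: h_def fun_eq_iff)
    moreover have "p = 0 \<or> p = 1" using p by linarith
    ultimately show ?thesis by (auto simp: g_def)
  qed
  then obtain c where c: "\<And>t z. F z $ t = c t * g z" by metis
  have "deriv (\<lambda>z. F z $ t) z = c t * deriv g z" for t z
    unfolding c using g by (intro deriv_cmult) (auto simp: holomorphic_on_def)
  then have "wr2 F s t z = 0" for s t z by (simp add: wr2_def c)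
  then show False using nonconst by blast
qed

lemma k1: "k \<ge> 1" "p = k + 1" "n = k + d"
  using p2 by (auto simp: k_def p_def)

lemma card_A': "card A' + d \<ge> card A"
proof -
  have "card (A \<inter> V0) \<le> d" using card_inter_span p2 cardI C0(3) by (simp add: p_def d_def)
  moreover have "card A = card (A \<inter> V0) + card A'"
    using card_Int_Diff[OF finite_A, of V0] by (simp add: A'_def)
  ultimately show ?thesis by linarith
qed

text \<open>The surplus of degree in \<open>F\<close>: the product of the forms in \<open>A'\<close>
  has degree \<open>card A'\<close>, whereas \<open>2 (k n)\<close> and \<open>m p\<close> are the
  degrees of the powers of \<open>wr2\<close> and of the Wronskian. By \<open>weight_count\<close>
  the subtraction is not truncated and the surplus is positive.\<close>

definition e where "e = card A' - (2 * (k * n) + m * p)"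

lemma e: "e \<ge> 1" "card A' = 2 * (k * n) + m * p + e"
  using weight_count[OF k1(3,1,2) card_A' card_A] by (auto simp: e_def m_def)

lemma finite_A': "finite A'" using finite_A by (simp add: A'_def)

section \<open>Wronskians of bases along the curve\<close>

definition Wr where "Wr bs z = wronskian p (\<lambda>i. h (bs ! i)) z"

lemma hol_Wr: "Wr bs holomorphic_on S"
  unfolding Wr_def[abs_def]
  by (rule holomorphic_on_subset[OF holomorphic_on_wronskian[of UNIV]]) (auto intro: hol_h)

lemma Wr_change:
  assumes "bs \<in> \<B>" "bs' \<in> \<B>" obtains c where "\<And>z. Wr bs' z = c * Wr bs z"
proof -
  have "\<exists>M. h (bs' ! i) = (\<lambda>z. \<Sum>j<p. M j * h (bs ! j) z)" for i
    using h_representation[OF assms(1)] by metis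
  then obtain M where "\<And>i. h (bs' ! i) = (\<lambda>z. \<Sum>j<p. M i j * h (bs ! j) z)" by metis
  then obtain c where "\<And>z. z \<in> UNIV \<Longrightarrow> Wr bs' z = c * Wr bs z"
    unfolding Wr_def using wronskian_lincomb[of UNIV p "\<lambda>j. h (bs ! j)" "\<lambda>i. h (bs' ! i)" M] hol_h by auto
  then show ?thesis using that by blast
qed

definition b0 where "b0 = (SOME bs. bs \<in> \<B>)"

lemma b0: "b0 \<in> \<B>" unfolding b0_def using \<B>_nonempty by (simp add: some_in_eq)

lemma Wr_compare:
  obtains C where "C \<ge> 0" "\<And>bs z. bs \<in> \<B> \<Longrightarrow> cmod (Wr b0 z) \<le> C * cmod (Wr bs z)"
proof -
  have "\<exists>c. \<forall>z. Wr b0 z = c * Wr bs z" if "bs \<in> \<B>" for bs using Wr_change[OF that b0] by metis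
  then obtain c where c: "\<And>bs z. bs \<in> \<B> \<Longrightarrow> Wr b0 z = c bs * Wr bs z" by metis
  define C where "C = (\<Sum>bs\<in>\<B>. cmod (c bs))"
  show ?thesis
  proof (rule that[of C])
    show "C \<ge> 0" by (auto simp: C_def intro: sum_nonneg)
    fix bs z assume bs: "bs \<in> \<B>"
    have "cmod (c bs) \<le> C" unfolding C_def using bs finite_\<B> by (intro member_le_sum) auto
    then show "cmod (Wr b0 z) \<le> C * cmod (Wr bs z)"
      using c[OF bs, of z] by (simp add: norm_mult mult_right_mono)
  qed
qed

text \<open>A linear relation between the forms of a base that holds along the curve is a form in
  \<open>V0\<close>, the span of \<open>C0\<close>; independence modulo \<open>C0\<close> makes it
  trivial.\<close>

lemma Wr_nonzero: "\<exists>z. Wr b0 z \<noteq> 0"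
proof -
  have "\<exists>z\<in>UNIV. wronskian p (\<lambda>i. h (b0 ! i)) z \<noteq> 0"
  proof (rule wronskian_nonzero)
    fix c i assume rel: "\<And>z. z \<in> (UNIV::complex set) \<Longrightarrow> (\<Sum>j<p. c j * h (b0 ! j) z) = 0" and i: "i < p"
    define x where "x = (\<Sum>j<p. c j *s (b0 ! j))"
    have "h x z = 0" for z using rel[of z] by (simp add: h_def x_def bil_sum bil_smult)
    then have x: "x \<in> vec.span C0" by (simp add: C0 V0_def)
    show "c i = 0"
    proof (rule ccontr)
      assume ci: "c i \<noteq> 0"
      define S where "S = (set b0 \<union> C0) - {b0 ! i}"
      have ib: "b0 ! i \<in> set b0" using i length_bs[OF b0] by simp
      have dis: "set b0 \<inter> C0 = {}" using b0 by (simp add: \<B>_def base_def)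
      have "x = c i *s (b0 ! i) + (\<Sum>j\<in>{..<p} - {i}. c j *s (b0 ! j))"
        unfolding x_def using i by (intro sum.remove) auto
      then have "c i *s (b0 ! i) = x - (\<Sum>j\<in>{..<p} - {i}. c j *s (b0 ! j))" by simp
      moreover have "x \<in> vec.span S"
        using x vec.span_mono[of C0 S] dis ib by (auto simp: S_def)
      moreover have "(\<Sum>j\<in>{..<p} - {i}. c j *s (b0 ! j)) \<in> vec.span S"
      proof (intro vec.span_sum vec.span_scale vec.span_base)
        fix j assume j: "j \<in> {..<p} - {i}"
        then have "b0 ! j \<in> set b0" "b0 ! j \<noteq> b0 ! i"
          using length_bs[OF b0] b0 i nth_eq_iff_index_eq[of b0 j i] by (auto simp: \<B>_def)
        then show "b0 ! j \<in> S" by (simp add: S_def)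
      qed
      ultimately have "c i *s (b0 ! i) \<in> vec.span S" by (simp add: vec.span_diff)
      then have "inverse (c i) *s (c i *s (b0 ! i)) \<in> vec.span S" by (rule vec.span_scale)
      then have "b0 ! i \<in> vec.span S" using ci by simp
      then have "vec.dependent (set b0 \<union> C0)" using ib unfolding vec.dependent_def S_def by blast
      then show False using b0 by (simp add: \<B>_def base_def)
    qed
  qed (use hol_h in auto)
  then show ?thesis by (simp add: Wr_def)
qed

text \<open>Multiplying all forms by \<open>u\<close> multiplies the Wronskian and the product of
  the forms by \<open>u^p\<close>, so their quotient may be estimated in any affine chart
  \<open>u\<close>. In a suitable chart the functions are bounded or have slowly varying quotients,
  while the coordinates of \<open>F\<close> themselves are not controlled.\<close>

lemma ratio_bound:
  assumes bs: "bs \<in> \<B>" and U: "open U" "z \<in> U" "u holomorphic_on U" "u z \<noteq> 0"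
    and hz: "\<And>a. a \<in> A' \<Longrightarrow> h a z \<noteq> 0"
    and bd: "\<And>l i. l < p \<Longrightarrow> i < p \<Longrightarrow> cmod ((deriv ^^ l) (\<lambda>z. u z * h (bs ! i) z) z) \<le> \<Lambda> l * cmod (u z * h (bs ! i) z)"
  shows "cmod (Wr bs z) / (\<Prod>i<p. cmod (h (bs ! i) z)) \<le> fact p * (\<Prod>l<p. \<Lambda> l)"
proof -
  have "cmod (wronskian p (\<lambda>i z. u z * h (bs ! i) z) z) \<le> fact p * (\<Prod>l<p. \<Lambda> l) * (\<Prod>i<p. cmod (u z * h (bs ! i) z))"
    by (rule wronskian_norm_le) (rule bd)
  also have "wronskian p (\<lambda>i z. u z * h (bs ! i) z) z = u z ^ p * Wr bs z"
    unfolding Wr_def using U by (intro wronskian_mult[of U]) (auto intro: hol_h)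
  also have "(\<Prod>i<p. cmod (u z * h (bs ! i) z)) = cmod (u z) ^ p * (\<Prod>i<p. cmod (h (bs ! i) z))"
    by (simp add: norm_mult prod.distrib)
  finally have "cmod (u z) ^ p * cmod (Wr bs z) \<le> cmod (u z) ^ p * (fact p * (\<Prod>l<p. \<Lambda> l) * (\<Prod>i<p. cmod (h (bs ! i) z)))"
    by (simp add: norm_mult norm_power mult_ac)
  then have "cmod (Wr bs z) \<le> fact p * (\<Prod>l<p. \<Lambda> l) * (\<Prod>i<p. cmod (h (bs ! i) z))"
    using U(4) by simp
  moreover have "(\<Prod>i<p. cmod (h (bs ! i) z)) > 0"
    using hz nth_bs[OF bs] by (intro prod_pos) auto
  ultimately show ?thesis by (simp add: pos_divide_le_eq)
qed

lemma few_zeros: "card {a \<in> A'. h a z = 0} \<le> n"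
proof (rule ccontr)
  assume "\<not> ?thesis"
  then have "n + 1 \<le> card {a \<in> A'. h a z = 0}" by simp
  then obtain J where J: "J \<subseteq> {a \<in> A'. h a z = 0}" "card J = n + 1"
    by (rule obtain_subset_with_card_n) blast
  then have "F z = 0" by (intro gp[of J]) (auto simp: A'_def h_def)
  then show False using nz by blast
qed

text \<open>A quantitative form of \<open>few_zeros\<close> by compactness: for any
  \<open>n + 1\<close> forms the sum of their moduli has a positive minimum on the unit sphere, and
  finitely many such sets have to be considered.\<close>

lemma few_near:
  obtains c where "0 < c" "c \<le> 1" "\<And>z. card {a \<in> A'. cmod (h a z) < c * norm (F z)} \<le> n"
proof -
  define \<J> where "\<J> = {J. J \<subseteq> A \<and> card J = n + 1}"
  have fin: "finite \<J>" using finite_A by (auto simp: \<J>_def)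
  have "\<exists>c>0. \<forall>v. norm v = 1 \<longrightarrow> c \<le> (\<Sum>a\<in>J. cmod (bil a v))" if J: "J \<in> \<J>" for J
  proof -
    have fJ: "finite J" using J finite_A finite_subset by (auto simp: \<J>_def)
    have "compact (sphere (0 :: complex ^ 'i) 1)" by (rule compact_sphere)
    moreover have "complex_of_real (1 / norm (F 0)) *s F 0 \<in> sphere 0 1"
      using normF_pos[of 0] by (simp add: norm_vector_smult norm_divide)
    then have "sphere (0 :: complex ^ 'i) 1 \<noteq> {}" by blast
    moreover have "continuous_on (sphere 0 1) (\<lambda>v. \<Sum>a\<in>J. cmod (bil a v))"
      unfolding bil_def by (intro continuous_intros)
    ultimately obtain v0 where v0: "norm v0 = 1" "\<And>v. norm v = 1 \<Longrightarrow> (\<Sum>a\<in>J. cmod (bil a v0)) \<le> (\<Sum>a\<in>J. cmod (bil a v))"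
      using continuous_attains_inf[of "sphere (0 :: complex ^ 'i) 1" "\<lambda>v. \<Sum>a\<in>J. cmod (bil a v)"] by auto
    have "(\<Sum>a\<in>J. cmod (bil a v0)) \<noteq> 0"
    proof
      assume "(\<Sum>a\<in>J. cmod (bil a v0)) = 0"
      then have "v0 = 0" using J fJ by (intro gp[of J]) (auto simp: \<J>_def sum_nonneg_eq_0_iff)
      then show False using v0 by simp
    qed
    then have "(\<Sum>a\<in>J. cmod (bil a v0)) > 0" using sum_nonneg[of J "\<lambda>a. cmod (bil a v0)"] by simp
    then show ?thesis using v0(2) by blast
  qed
  then obtain c where c: "\<And>J. J \<in> \<J> \<Longrightarrow> c J > 0" "\<And>J v. J \<in> \<J> \<Longrightarrow> norm v = 1 \<Longrightarrow> c J \<le> (\<Sum>a\<in>J. cmod (bil a v))"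
    by metis
  define c0 where "c0 = Min (insert 1 ((\<lambda>J. c J / (n + 1)) ` \<J>))"
  have c0: "c0 > 0" "c0 \<le> 1" "\<And>J. J \<in> \<J> \<Longrightarrow> c0 \<le> c J / (n + 1)"
    unfolding c0_def using fin c(1) by (auto simp: Min_gr_iff)
  show ?thesis
  proof (rule that[OF c0(1,2)], rule ccontr)
    fix z
    assume "\<not> card {a \<in> A'. cmod (h a z) < c0 * norm (F z)} \<le> n"
    then have "n + 1 \<le> card {a \<in> A'. cmod (h a z) < c0 * norm (F z)}" by simp
    then obtain J where J: "J \<subseteq> {a \<in> A'. cmod (h a z) < c0 * norm (F z)}" "card J = n + 1"
      by (rule obtain_subset_with_card_n) blast
    then have JJ: "J \<in> \<J>" by (auto simp: \<J>_def A'_def)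
    define v where "v = complex_of_real (1 / norm (F z)) *s F z"
    have v: "norm v = 1" using normF_pos[of z] by (simp add: v_def norm_vector_smult norm_divide)
    have "(\<Sum>a\<in>J. cmod (bil a v)) < (\<Sum>a\<in>J. c0)"
    proof (rule sum_strict_mono)
      show "finite J" "J \<noteq> {}" using J(2) card.infinite by fastforce+
      fix a assume "a \<in> J"
      then have "cmod (h a z) < c0 * norm (F z)" using J by auto
      then show "cmod (bil a v) < c0"
        using normF_pos[of z] by (simp add: v_def bil_smult_right norm_mult norm_divide h_def field_simps)
    qed
    also have "\<dots> = (n + 1) * c0" using J(2) by simp
    also have "\<dots> \<le> c J" using c0(3)[OF JJ] by (simp add: field_simps)
    also have "\<dots> \<le> (\<Sum>a\<in>J. cmod (bil a v))" by (rule c(2)[OF JJ v])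
    finally show False by simp
  qed
qed

end

section \<open>The entire quotient and its size\<close>

lemma eventually_le_dist_if_zero:
  assumes "f holomorphic_on UNIV" "f z = 0"
  obtains L where "L \<ge> 0" "\<forall>\<^sub>F w in at z. cmod (f w) \<le> L * cmod (w - z)"
proof -
  have "(f has_field_derivative deriv f z) (at z)"
    using assms(1) by (intro holomorphic_derivI[of f UNIV]) auto
  then have "((\<lambda>w. (f w - f z) / (w - z)) \<longlongrightarrow> deriv f z) (at z)"
    by (simp add: has_field_derivative_iff)
  then have "((\<lambda>w. cmod ((f w - f z) / (w - z))) \<longlongrightarrow> cmod (deriv f z)) (at z)"
    by (rule tendsto_norm)
  then have "\<forall>\<^sub>F w in at z. cmod ((f w - f z) / (w - z)) < cmod (deriv f z) + 1"
    by (rule order_tendstoD) simp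
  moreover have "\<forall>\<^sub>F w in at z. w \<noteq> z" by (simp add: eventually_at_filter)
  ultimately have "\<forall>\<^sub>F w in at z. cmod (f w) \<le> (cmod (deriv f z) + 1) * cmod (w - z)"
  proof eventually_elim
    case (elim w)
    then have "cmod (w - z) > 0" by simp
    then show ?case using elim(1) assms(2) by (simp add: norm_divide pos_divide_less_eq)
  qed
  then show ?thesis by (intro that[of "cmod (deriv f z) + 1"]) auto
qed

context ramified_curve
begin

text \<open>If some form of \<open>A'\<close> vanishes at \<open>z\<close>, then \<open>ram\<close>
  yields a zero of \<open>wr2\<close>, and the exponent \<open>k n\<close> suffices for all
  vanishing forms as there are at most \<open>n\<close> of them. If none vanishes, the claim is mere
  boundedness.\<close>

lemma wr2_power_order:
  "\<exists>L\<ge>0. \<forall>\<^sub>F w in at z. cmod (wr2 F s t w) ^ (k * n) \<le> L * cmod (w - z) ^ (k * card {a \<in> A'. h a z = 0})"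
proof (cases "{a \<in> A'. h a z = 0} = {}")
  case True
  have "wr2 F s t holomorphic_on UNIV" by (intro holomorphic_on_wr2 hol) auto
  then have "isCont (wr2 F s t) z"
    using holomorphic_on_imp_continuous_on[of "wr2 F s t" UNIV] by (simp add: continuous_on_eq_continuous_at)
  then have "((\<lambda>w. cmod (wr2 F s t w) ^ (k * n)) \<longlongrightarrow> cmod (wr2 F s t z) ^ (k * n)) (at z)"
    by (intro tendsto_intros) (simp add: isCont_def)
  then have "\<forall>\<^sub>F w in at z. cmod (wr2 F s t w) ^ (k * n) < cmod (wr2 F s t z) ^ (k * n) + 1"
    by (rule order_tendstoD) simp
  then have "\<forall>\<^sub>F w in at z. cmod (wr2 F s t w) ^ (k * n) \<le> cmod (wr2 F s t z) ^ (k * n) + 1"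
    by eventually_elim simp
  then show ?thesis unfolding True by (intro exI[of _ "cmod (wr2 F s t z) ^ (k * n) + 1"]) auto
next
  case False
  then obtain a where "a \<in> A'" "h a z = 0" by blast
  then have "wr2 F s t z = 0" by (intro ram[of a]) (auto simp: A'_def V0_def h_def)
  moreover have "wr2 F s t holomorphic_on UNIV" by (intro holomorphic_on_wr2 hol) auto
  ultimately obtain L where L: "L \<ge> 0" "\<forall>\<^sub>F w in at z. cmod (wr2 F s t w) \<le> L * cmod (w - z)"
    using eventually_le_dist_if_zero by blast
  have "\<forall>\<^sub>F w in at z. cmod (w - z) \<le> 1"
    by (auto simp: eventually_at dist_norm intro!: exI[of _ 1])
  with L(2) have "\<forall>\<^sub>F w in at z. cmod (wr2 F s t w) ^ (k * n) \<le> L ^ (k * n) * cmod (w - z) ^ (k * card {a \<in> A'. h a z = 0})"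
  proof eventually_elim
    case (elim w)
    have "cmod (wr2 F s t w) ^ (k * n) \<le> L ^ (k * n) * cmod (w - z) ^ (k * n)"
      using power_mono[OF elim(1), of "k * n"] by (simp add: power_mult_distrib)
    also have "\<dots> \<le> L ^ (k * n) * cmod (w - z) ^ (k * card {a \<in> A'. h a z = 0})"
      using elim(2) L(1) few_zeros[of z] by (intro mult_left_mono power_decreasing) auto
    finally show ?case .
  qed
  then show ?thesis using L(1) by (intro exI[of _ "L ^ (k * n)"]) auto
qed

definition Q where "Q z = (\<Prod>a\<in>A'. h a z)"

lemma hol_Q: "Q holomorphic_on UNIV"
  unfolding Q_def[abs_def] by (intro holomorphic_intros hol_h)

lemma h_nonzero: "a \<in> A' \<Longrightarrow> \<exists>z. h a z \<noteq> 0"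
  by (auto simp: A'_def V0_def)

text \<open>
  At most \<open>n\<close> of the hyperplanes meet at a point; there \<open>wr2 F s t\<close> vanishes, which pays for
  \<open>k\<close> zeros of each of them. The remaining multiplicity is absorbed by the Wronskian.
\<close>

lemma quotient_locally_bounded:
  "\<exists>B. \<forall>\<^sub>F w in at z. cmod (wr2 F s t w ^ (k * n) * Wr b0 w ^ m) \<le> B * cmod (Q w)"
proof -
  define S where "S = {a \<in> A'. h a z = 0}"
  define P where "P a \<nu> c C \<longleftrightarrow> c > 0 \<and> C \<ge> 0 \<and> (h a z \<noteq> 0 \<longrightarrow> \<nu> = 0) \<and>
    (\<forall>\<^sub>F w in at z. c * cmod (w - z) ^ \<nu> \<le> cmod (h a w)) \<and>
    (\<forall>\<^sub>F w in at z. \<forall>l\<le>k. cmod ((deriv ^^ l) (h a) w) \<le> C * cmod (w - z) ^ (\<nu> - k))" for a \<nu> c C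
  have "\<exists>\<nu> c C. P a \<nu> c C" if a: "a \<in> A'" for a
  proof (rule entire_local_order[OF hol_h h_nonzero[OF a], of z k])
    fix \<nu> c C
    assume "0 < c" "0 \<le> C" "h a z \<noteq> 0 \<Longrightarrow> \<nu> = 0" "\<forall>\<^sub>F w in at z. c * cmod (w - z) ^ \<nu> \<le> cmod (h a w)"
      "\<forall>\<^sub>F w in at z. \<forall>l\<le>k. cmod ((deriv ^^ l) (h a) w) \<le> C * cmod (w - z) ^ (\<nu> - k)"
    then have "P a \<nu> c C" unfolding P_def by simp
    then show ?thesis by blast
  qed
  then obtain \<nu> c C where P: "\<And>a. a \<in> A' \<Longrightarrow> P a (\<nu> a) (c a) (C a)" by metis
  note o = P[unfolded P_def, THEN conjunct1] P[unfolded P_def, THEN conjunct2, THEN conjunct1]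
    P[unfolded P_def, THEN conjunct2, THEN conjunct2, THEN conjunct1, rule_format]
    P[unfolded P_def, THEN conjunct2, THEN conjunct2, THEN conjunct2, THEN conjunct1]
    P[unfolded P_def, THEN conjunct2, THEN conjunct2, THEN conjunct2, THEN conjunct2]
  have SA: "S \<subseteq> A'" by (auto simp: S_def)
  \<comment> \<open>The weights are the multiplicities beyond \<open>k\<close>, the part which
    \<open>wr2\<close> does not pay for. The selected base carries at least \<open>1 / m\<close> of
    their total.\<close>
  obtain B where B: "base B" "real (\<Sum>a\<in>S. \<nu> a - k) \<le> (real (card C0) + 1) * real (\<Sum>a\<in>B. \<nu> a - k)"
  proof (rule base_select[of S "\<lambda>a. real (\<nu> a - k)"])
    show "card S < CARD('i)" using few_zeros[of z] cardI by (simp add: S_def)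
  qed (use SA C0 that in \<open>auto simp: A'_def\<close>)
  have "(real (card C0) + 1) * real (\<Sum>a\<in>B. \<nu> a - k) = real (m * (\<Sum>a\<in>B. \<nu> a - k))"
    by (simp add: m_def d_def algebra_simps)
  then have sel: "(\<Sum>a\<in>S. \<nu> a - k) \<le> m * (\<Sum>a\<in>B. \<nu> a - k)" using B(2) by (simp only: of_nat_le_iff)
  obtain bs where bs: "bs \<in> \<B>" "set bs = B" using base_list[OF B(1)] by blast
  have dbs: "distinct bs" using bs by (simp add: \<B>_def)
  have ord: "(\<Sum>a\<in>A'. \<nu> a) \<le> k * card S + m * (\<Sum>a\<in>B. \<nu> a - k)"
  proof -
    have "(\<Sum>a\<in>A'. \<nu> a) = (\<Sum>a\<in>S. \<nu> a)"
      using SA o(3) finite_A' by (intro sum.mono_neutral_right) (auto simp: S_def)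
    also have "\<dots> \<le> (\<Sum>a\<in>S. k + (\<nu> a - k))" by (intro sum_mono) auto
    also have "\<dots> = k * card S + (\<Sum>a\<in>S. \<nu> a - k)" by (simp add: sum.distrib)
    finally show ?thesis using sel by linarith
  qed
  define D where "D = (\<Sum>a\<in>A'. C a)"
  have D: "C a \<le> D" if "a \<in> A'" for a
    unfolding D_def using that o(2) finite_A' by (intro member_le_sum) auto
  have D0: "D \<ge> 0" unfolding D_def using o(2) by (intro sum_nonneg) auto
  obtain L where L: "L \<ge> 0" "\<forall>\<^sub>F w in at z. cmod (wr2 F s t w) ^ (k * n) \<le> L * cmod (w - z) ^ (k * card S)"
    using wr2_power_order[where z = z and s = s and t = t] unfolding S_def by blast
  \<comment> \<open>The good base depends on \<open>z\<close>, but the quotient must be one entire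
    function; the Wronskians of all bases differ only by constant factors, so \<open>b0\<close> can
    stand for each of them.\<close>
  obtain W where W: "W \<ge> 0" "\<And>bs z. bs \<in> \<B> \<Longrightarrow> cmod (Wr b0 z) \<le> W * cmod (Wr bs z)"
    using Wr_compare by blast
  have ev1: "\<forall>\<^sub>F w in at z. \<forall>a\<in>A'. c a * cmod (w - z) ^ \<nu> a \<le> cmod (h a w)"
    using o(4) finite_A' by (simp add: eventually_ball_finite_distrib)
  have ev2: "\<forall>\<^sub>F w in at z. \<forall>a\<in>A'. \<forall>l\<le>k. cmod ((deriv ^^ l) (h a) w) \<le> C a * cmod (w - z) ^ (\<nu> a - k)"
    using o(5) finite_A' by (simp add: eventually_ball_finite_distrib)
  have ev3: "\<forall>\<^sub>F w in at z. cmod (w - z) \<le> 1"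
    by (auto simp: eventually_at dist_norm intro!: exI[of _ 1])
  define c' where "c' = (\<Prod>a\<in>A'. c a)"
  have c': "c' > 0" unfolding c'_def using o(1) by (intro prod_pos) auto
  define G where "G = L * (W * (fact p * D ^ p)) ^ m"
  have "\<forall>\<^sub>F w in at z. cmod (wr2 F s t w ^ (k * n) * Wr b0 w ^ m) \<le> (G / c') * cmod (Q w)"
    using ev1 ev2 ev3 L(2)
  proof eventually_elim
    case (elim w)
    define \<tau> where "\<tau> = cmod (w - z)"
    have \<tau>: "0 \<le> \<tau>" "\<tau> \<le> 1" using elim(3) by (auto simp: \<tau>_def)
    have "cmod (Wr bs w) \<le> fact p * (\<Prod>l<p. D) * (\<Prod>i<p. \<tau> ^ (\<nu> (bs ! i) - k))"
      unfolding Wr_def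
    proof (rule wronskian_norm_le)
      fix l i assume li: "l < p" "i < p"
      have a: "bs ! i \<in> A'" using nth_bs[OF bs(1) li(2)] .
      have "cmod ((deriv ^^ l) (h (bs ! i)) w) \<le> C (bs ! i) * \<tau> ^ (\<nu> (bs ! i) - k)"
        using elim(2) a li k1 by (auto simp: \<tau>_def)
      also have "\<dots> \<le> D * \<tau> ^ (\<nu> (bs ! i) - k)" using D[OF a] \<tau> by (intro mult_right_mono) auto
      finally show "cmod ((deriv ^^ l) (h (bs ! i)) w) \<le> D * \<tau> ^ (\<nu> (bs ! i) - k)" .
    qed
    also have "(\<Prod>i<p. \<tau> ^ (\<nu> (bs ! i) - k)) = \<tau> ^ (\<Sum>i<p. \<nu> (bs ! i) - k)"
      by (rule power_sum[symmetric])
    also have "(\<Sum>i<p. \<nu> (bs ! i) - k) = (\<Sum>a\<in>B. \<nu> a - k)"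
      using bs dbs length_bs[OF bs(1)] by (intro sum.reindex_bij_betw bij_betw_nth) auto
    finally have "cmod (Wr bs w) \<le> fact p * D ^ p * \<tau> ^ (\<Sum>a\<in>B. \<nu> a - k)" by simp
    then have "W * cmod (Wr bs w) \<le> W * (fact p * D ^ p * \<tau> ^ (\<Sum>a\<in>B. \<nu> a - k))"
      using W(1) by (rule mult_left_mono)
    then have "cmod (Wr b0 w) \<le> (W * (fact p * D ^ p)) * \<tau> ^ (\<Sum>a\<in>B. \<nu> a - k)"
      using W(2)[OF bs(1), of w] by (simp add: mult.assoc)
    then have "cmod (Wr b0 w) ^ m \<le> (W * (fact p * D ^ p)) ^ m * \<tau> ^ (m * (\<Sum>a\<in>B. \<nu> a - k))"
      using power_mono[of "cmod (Wr b0 w)" "(W * (fact p * D ^ p)) * \<tau> ^ (\<Sum>a\<in>B. \<nu> a - k)" m]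
      by (simp add: power_mult_distrib mult.commute flip: power_mult)
    then have "cmod (wr2 F s t w) ^ (k * n) * cmod (Wr b0 w) ^ m \<le>
        (L * \<tau> ^ (k * card S)) * ((W * (fact p * D ^ p)) ^ m * \<tau> ^ (m * (\<Sum>a\<in>B. \<nu> a - k)))"
      using elim(4) L(1) \<tau> by (intro mult_mono) (auto simp: \<tau>_def)
    also have "\<dots> = G * \<tau> ^ (k * card S + m * (\<Sum>a\<in>B. \<nu> a - k))"
      by (simp add: G_def power_add mult_ac)
    also have "\<dots> \<le> G * \<tau> ^ (\<Sum>a\<in>A'. \<nu> a)"
      using \<tau> ord L(1) W(1) D0 by (intro mult_left_mono power_decreasing) (auto simp: G_def)
    also have "\<dots> = (G / c') * (\<Prod>a\<in>A'. c a * \<tau> ^ \<nu> a)"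
      using c' by (simp add: prod.distrib power_sum c'_def)
    also have "\<dots> \<le> (G / c') * (\<Prod>a\<in>A'. cmod (h a w))"
    proof (intro mult_left_mono prod_mono)
      fix a assume "a \<in> A'"
      then show "0 \<le> c a * \<tau> ^ \<nu> a \<and> c a * \<tau> ^ \<nu> a \<le> cmod (h a w)"
        using elim(1) o(1)[of a] \<tau> by (auto simp: \<tau>_def)
    next
      show "0 \<le> G / c'" using L(1) W(1) D0 c' by (simp add: G_def)
    qed
    finally show ?case by (simp add: norm_mult norm_power Q_def prod_norm)
  qed
  then show ?thesis by blast
qed

lemma Q_nonzero: "\<exists>z. Q z \<noteq> 0"
proof -
  have "\<forall>\<^sub>F w in at 0. h a w \<noteq> 0" if a: "a \<in> A'" for a
  proof -
    obtain r where "r > 0" "\<And>w. w \<in> ball 0 r - {0} \<Longrightarrow> h a w \<noteq> 0"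
      using entire_punctured_nonzero[OF hol_h h_nonzero[OF a], of 0] by blast
    then show ?thesis by (auto simp: eventually_at dist_commute)
  qed
  then have "\<forall>\<^sub>F w in at 0. \<forall>a\<in>A'. h a w \<noteq> 0" using finite_A' by (simp add: eventually_ball_finite_distrib)
  then obtain w where "\<forall>a\<in>A'. h a w \<noteq> 0"
    using eventually_happens[of _ "at (0::complex)"] by auto
  then show ?thesis using finite_A' by (auto simp: Q_def intro!: exI[of _ w])
qed

lemma quotient_exists:
  obtains \<phi> s t where "\<phi> holomorphic_on UNIV" "\<exists>z. \<phi> z \<noteq> 0"
    "\<And>z. wr2 F s t z ^ (k * n) * Wr b0 z ^ m = \<phi> z * Q z"
proof -
  obtain s t z1 where st: "wr2 F s t z1 \<noteq> 0" using nonconst by blast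
  have hw: "wr2 F s t holomorphic_on UNIV" by (intro holomorphic_on_wr2 hol) auto
  have hP: "(\<lambda>z. wr2 F s t z ^ (k * n) * Wr b0 z ^ m) holomorphic_on UNIV"
    by (intro holomorphic_intros hw hol_Wr)
  obtain \<phi> where \<phi>: "\<phi> holomorphic_on UNIV" "\<And>z. wr2 F s t z ^ (k * n) * Wr b0 z ^ m = \<phi> z * Q z"
    using entire_quotient[OF hP hol_Q Q_nonzero quotient_locally_bounded] by blast
  obtain r where r: "r > 0" "\<And>w. w \<in> ball 0 r - {0} \<Longrightarrow> wr2 F s t w \<noteq> 0"
    using entire_punctured_nonzero[OF hw, of 0] st by blast
  obtain r' where r': "r' > 0" "\<And>w. w \<in> ball 0 r' - {0} \<Longrightarrow> Wr b0 w \<noteq> 0"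
    using entire_punctured_nonzero[OF hol_Wr Wr_nonzero, of 0] by blast
  define w where "w = complex_of_real (min r r' / 2)"
  have "w \<in> ball 0 r - {0}" "w \<in> ball 0 r' - {0}" using r(1) r'(1) by (auto simp: w_def)
  then have "wr2 F s t w ^ (k * n) * Wr b0 w ^ m \<noteq> 0" using r(2) r'(2) by simp
  then have "\<phi> w \<noteq> 0" using \<phi>(2)[of w] by auto
  then show ?thesis using that \<phi> by blast
qed

text \<open>The counterpart of \<open>quotient_locally_bounded\<close> for sizes: the proximities
  \<open>ln (norm (F z) / cmod (h a z))\<close> replace the multiplicities. At most \<open>n\<close>
  forms are close to vanishing at \<open>z\<close>, a base dominates their proximities up to the
  factor \<open>m\<close>, and the other forms contribute constants. The positive surplus of degree
  appears as the power \<open>norm (F z) ^ e\<close>.\<close>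

lemma quotient_size:
  assumes \<phi>: "\<And>z. wr2 F s t z ^ (k * n) * Wr b0 z ^ m = \<phi> z * Q z"
  obtains G where "G \<ge> 0" "\<And>z. (\<And>a. a \<in> A' \<Longrightarrow> h a z \<noteq> 0) \<Longrightarrow>
    \<exists>bs\<in>\<B>. cmod (\<phi> z) * norm (F z) ^ e \<le> G * (cmod (Wr bs z) / (\<Prod>i<p. cmod (h (bs ! i) z))) ^ m"
proof -
  obtain c where c: "0 < c" "c \<le> 1" "\<And>z. card {a \<in> A'. cmod (h a z) < c * norm (F z)} \<le> n"
    using few_near by blast
  obtain W where W: "W \<ge> 0" "\<And>bs z. bs \<in> \<B> \<Longrightarrow> cmod (Wr b0 z) \<le> W * cmod (Wr bs z)"
    using Wr_compare by blast
  define G where "G = (1 / c) ^ card A' * W ^ m"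
  show ?thesis
  proof (rule that[of G])
    show "G \<ge> 0" using c W by (simp add: G_def)
    fix z assume hz: "\<And>a. a \<in> A' \<Longrightarrow> h a z \<noteq> 0"
    define N where "N = norm (F z)"
    have N: "N > 0" using normF_pos by (simp add: N_def)
    define y where "y a = N / cmod (h a z)" for a
    have y1: "y a \<ge> 1" if "a \<in> A'" for a
      using hz[OF that] h_le[of a z] that by (auto simp: y_def N_def A'_def)
    \<comment> \<open>Selection needs nonnegative weights on all of \<open>A\<close>. For a form
      vanishing along the curve the quotient has denominator 0, so \<open>y a = 0\<close>, and
      \<open>ln 0 = 0\<close> by convention.\<close>
    have ln0: "ln (y a) \<ge> 0" if "a \<in> A" for a
    proof (cases "a \<in> A'")
      case True then show ?thesis using y1 by simp
    next
      case False
      then have "h a z = 0" using that by (auto simp: A'_def V0_def)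
      then show ?thesis by (simp add: y_def)
    qed
    define S where "S = {a \<in> A'. cmod (h a z) < c * N}"
    have SA: "S \<subseteq> A'" by (auto simp: S_def)
    obtain B where B: "base B" "(\<Sum>a\<in>S. ln (y a)) \<le> (real (card C0) + 1) * (\<Sum>a\<in>B. ln (y a))"
    proof (rule base_select[of S "\<lambda>a. ln (y a)"])
      show "card S < CARD('i)" using c(3)[of z] cardI by (simp add: S_def N_def)
    qed (use SA C0 ln0 that in \<open>auto simp: A'_def\<close>)
    obtain bs where bs: "bs \<in> \<B>" "set bs = B" using base_list[OF B(1)] by blast
    have dbs: "distinct bs" using bs by (simp add: \<B>_def)
    have BA: "B \<subseteq> A'" using base_sub[OF B(1)] .
    have finS: "finite S" "finite B" using finite_subset[OF SA finite_A'] finite_subset[OF BA finite_A'] by auto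
    have exp_sum_ln: "exp (\<Sum>a\<in>X. ln (y a)) = (\<Prod>a\<in>X. y a)" if "X \<subseteq> A'" "finite X" for X
    proof -
      have "exp (ln (y a)) = y a" if "a \<in> X" for a using y1[of a] that \<open>X \<subseteq> A'\<close> by (auto simp: exp_ln_iff)
      then show ?thesis using that(2) by (simp add: exp_sum)
    qed
    have "(\<Prod>a\<in>S. y a) \<le> exp (real m * (\<Sum>a\<in>B. ln (y a)))"
      using B(2) unfolding exp_sum_ln[OF SA finS(1), symmetric] by (simp add: m_def d_def algebra_simps)
    also have "\<dots> = (\<Prod>a\<in>B. y a) ^ m"
      unfolding exp_sum_ln[OF BA finS(2), symmetric] by (rule exp_of_nat_mult)
    finally have yS: "(\<Prod>a\<in>S. y a) \<le> (\<Prod>a\<in>B. y a) ^ m" .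
    have "(\<Prod>a\<in>A' - S. y a) \<le> (\<Prod>a\<in>A' - S. 1 / c)"
    proof (intro prod_mono conjI)
      fix a assume a: "a \<in> A' - S"
      show "0 \<le> y a" using y1[of a] a by auto
      have "c * N \<le> cmod (h a z)" "cmod (h a z) > 0" using a hz[of a] by (auto simp: S_def)
      then show "y a \<le> 1 / c" using c by (simp add: y_def field_simps)
    qed
    also have "\<dots> \<le> (1 / c) ^ card A'"
    proof -
      have "(1 / c) ^ card (A' - S) \<le> (1 / c) ^ card A'"
        using c finite_A' by (intro power_increasing card_mono) auto
      then show ?thesis by simp
    qed
    finally have yR: "(\<Prod>a\<in>A' - S. y a) \<le> (1 / c) ^ card A'" .
    have yB0: "(\<Prod>a\<in>B. y a) \<ge> 0" using y1 BA by (intro prod_nonneg) (auto intro: order_trans[OF zero_le_one])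
    have "(\<Prod>a\<in>A'. y a) = (\<Prod>a\<in>A' - S. y a) * (\<Prod>a\<in>S. y a)"
      by (rule prod.subset_diff[OF SA finite_A'])
    also have "\<dots> \<le> (1 / c) ^ card A' * (\<Prod>a\<in>B. y a) ^ m"
      using yR yS y1 SA c by (intro mult_mono prod_nonneg) (auto intro: order_trans[OF zero_le_one])
    finally have yA: "(\<Prod>a\<in>A'. y a) \<le> (1 / c) ^ card A' * (\<Prod>a\<in>B. y a) ^ m" .
    have cB: "card B = p" using bs dbs length_bs[OF bs(1)] distinct_card[of bs] by simp
    have "(\<Prod>a\<in>B. cmod (h a z)) = (\<Prod>i<p. cmod (h (bs ! i) z))"
      using bs dbs length_bs[OF bs(1)] by (intro prod.reindex_bij_betw[symmetric] bij_betw_nth) auto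
    then have yB: "(\<Prod>a\<in>B. y a) = N ^ p / (\<Prod>i<p. cmod (h (bs ! i) z))"
      by (simp add: y_def prod_dividef cB)
    have Qn: "cmod (Q z) = (\<Prod>a\<in>A'. cmod (h a z))" by (simp add: Q_def prod_norm)
    have Q0: "cmod (Q z) > 0" using hz finite_A' by (simp add: Q_def)
    have yA': "(\<Prod>a\<in>A'. y a) = N ^ card A' / cmod (Q z)" by (simp add: y_def prod_dividef Qn)
    define X where "X = cmod (Wr bs z) / (\<Prod>i<p. cmod (h (bs ! i) z))"
    have "cmod (wr2 F s t z) \<le> N\<^sup>2" using wr[of s t z] by (simp add: nsq_def N_def)
    then have "cmod (wr2 F s t z) ^ (k * n) \<le> N ^ (2 * (k * n))"
      unfolding power_mult by (intro power_mono) auto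
    moreover have "cmod (\<phi> z) * cmod (Q z) = cmod (wr2 F s t z) ^ (k * n) * cmod (Wr b0 z) ^ m"
      using arg_cong[OF \<phi>[of z], of cmod] by (simp add: norm_mult norm_power)
    ultimately have "cmod (\<phi> z) * cmod (Q z) \<le> N ^ (2 * (k * n)) * cmod (Wr b0 z) ^ m"
      by (simp add: mult_right_mono)
    then have "cmod (\<phi> z) \<le> N ^ (2 * (k * n)) * cmod (Wr b0 z) ^ m / cmod (Q z)"
      using Q0 by (simp add: pos_le_divide_eq)
    \<comment> \<open>The factor \<open>N^(m p)\<close> completes the exponent of \<open>N\<close>
      to \<open>card A'\<close>, so that \<open>N\<close> and \<open>Q\<close> combine to the
      product of all \<open>y a\<close>. It cancels against the same power arising from the product
      over \<open>B\<close>.\<close>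
    then have "(cmod (\<phi> z) * N ^ e) * N ^ (m * p) \<le>
        (N ^ (2 * (k * n)) * cmod (Wr b0 z) ^ m / cmod (Q z)) * N ^ e * N ^ (m * p)"
      using N by (intro mult_right_mono) auto
    also have "\<dots> = cmod (Wr b0 z) ^ m * (N ^ card A' / cmod (Q z))"
      unfolding e(2) by (simp add: power_add mult_ac)
    also have "\<dots> \<le> (W * cmod (Wr bs z)) ^ m * ((1 / c) ^ card A' * (\<Prod>a\<in>B. y a) ^ m)"
      using yA W(1) W(2)[OF bs(1), of z] N Q0 unfolding yA' by (intro mult_mono power_mono) auto
    also have "\<dots> = G * X ^ m * N ^ (m * p)"
    proof -
      have "(N ^ p) ^ m = N ^ (m * p)" by (metis power_mult mult.commute)
      then have "(\<Prod>a\<in>B. y a) ^ m = N ^ (m * p) / (\<Prod>i<p. cmod (h (bs ! i) z)) ^ m"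
        unfolding yB power_divide by (simp only:)
      then show ?thesis unfolding X_def G_def power_divide power_mult_distrib by simp
    qed
    finally have "cmod (\<phi> z) * N ^ e \<le> G * X ^ m" using N by simp
    then show "\<exists>bs\<in>\<B>. cmod (\<phi> z) * norm (F z) ^ e \<le> G * (cmod (Wr bs z) / (\<Prod>i<p. cmod (h (bs ! i) z))) ^ m"
      using bs(1) unfolding X_def N_def by blast
  qed
qed

end

section \<open>Polynomial growth of the quotient\<close>

lemma large_coordinate:
  fixes v :: "complex ^ 'i::finite"
  obtains i where "nsq v \<le> real CARD('i) * (cmod (v $ i))\<^sup>2"
proof -
  have "\<exists>i. nsq v \<le> real CARD('i) * (cmod (v $ i))\<^sup>2"
  proof (rule ccontr)
    assume "\<not> ?thesis"
    then have "(\<Sum>i\<in>UNIV. real CARD('i) * (cmod (v $ i))\<^sup>2) < (\<Sum>i\<in>(UNIV::'i set). nsq v)"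
      by (intro sum_strict_mono) (auto simp: not_le)
    then show False by (simp add: nsq_sum flip: sum_distrib_left)
  qed
  then show ?thesis using that by blast
qed

lemma pmat_diag: "pmat v i i = of_real ((cmod (v $ i))\<^sup>2 / nsq v)"
  unfolding pmat_def of_real_divide complex_norm_square ..

context ramified_curve
begin

text \<open>A diagonal entry \<open>|F_i|^2 / |F|^2\<close> of the projection is at least
  \<open>1 / N\<close> at \<open>z0\<close> for some \<open>i\<close>, and being Lipschitz with
  constant \<open>2 N\<close> it stays above \<open>1 / (2 N)\<close> on a disc whose radius does
  not depend on \<open>z0\<close>.\<close>

lemma chart:
  defines "N \<equiv> real CARD('i)"
  obtains i where "\<And>z. z \<in> ball z0 (1 / (4 * N\<^sup>2)) \<Longrightarrow> norm (F z) \<le> 2 * N * cmod (F z $ i)"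
proof -
  have N: "N \<ge> 1" by (simp add: N_def Suc_leI)
  obtain i where i: "nsq (F z0) \<le> N * (cmod (F z0 $ i))\<^sup>2"
    unfolding N_def by (rule large_coordinate)
  show ?thesis
  proof (rule that[of i])
    fix z assume z: "z \<in> ball z0 (1 / (4 * N\<^sup>2))"
    define x where "x z = (cmod (F z $ i))\<^sup>2 / nsq (F z)" for z
    have np: "nsq (F z) > 0" for z by (rule nsq_pos[OF nz])
    have "cmod (pmat (F z) i i - pmat (F z0) i i) \<le> 2 * real CARD('i) * 1 * cmod (z - z0)"
      by (rule pmat_lipschitz[of UNIV]) (use hol nz wr in auto)
    also have "\<dots> \<le> 2 * N * (1 / (4 * N\<^sup>2))"
    proof -
      have "cmod (z - z0) \<le> 1 / (4 * N\<^sup>2)" using z by (simp add: dist_norm norm_minus_commute)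
      then have "2 * N * cmod (z - z0) \<le> 2 * N * (1 / (4 * N\<^sup>2))" using N by (intro mult_left_mono) auto
      then show ?thesis by (simp add: N_def)
    qed
    also have "\<dots> = 1 / (2 * N)" using N by (simp add: power2_eq_square)
    finally have "\<bar>x z - x z0\<bar> \<le> 1 / (2 * N)"
      unfolding pmat_diag x_def[symmetric] of_real_diff[symmetric] norm_of_real .
    moreover have "x z0 \<ge> 1 / N" using i np[of z0] N by (simp add: x_def field_simps)
    moreover have "1 / N = 1 / (2 * N) + 1 / (2 * N)" by (simp add: field_simps)
    ultimately have "1 / (2 * N) \<le> x z" by linarith
    then have "nsq (F z) \<le> 2 * N * (cmod (F z $ i))\<^sup>2"
      using np[of z] N by (simp add: x_def field_simps)
    also have "\<dots> \<le> (2 * N)\<^sup>2 * (cmod (F z $ i))\<^sup>2"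
      using N by (intro mult_right_mono) (auto simp: power2_eq_square)
    finally have "(norm (F z))\<^sup>2 \<le> (2 * N * cmod (F z $ i))\<^sup>2"
      by (simp add: nsq_def power_mult_distrib)
    then show "norm (F z) \<le> 2 * N * cmod (F z $ i)"
      using N by (simp add: power2_le_iff_abs_le abs_mult)
  qed
qed

text \<open>Around each \<open>z0\<close> the forms are divided by a large coordinate of
  \<open>F\<close>, which makes them bounded by 1; \<open>linear_form_not_tiny\<close> shows that
  none of them is smaller than \<open>exp (- M z0)\<close> throughout a fixed disc, with
  \<open>M\<close> polynomial in the distance to a reference point. On a circle supplied by
  \<open>good_circle\<close> all logarithmic derivatives are then polynomially bounded, and the
  maximum principle carries the estimate to \<open>z0\<close>.\<close>

lemma quotient_growth:
  assumes \<phi>: "\<phi> holomorphic_on UNIV" "\<And>z. wr2 F s t z ^ (k * n) * Wr b0 z ^ m = \<phi> z * Q z"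
  obtains g where "poly_bounded g" "\<And>z. cmod (\<phi> z) * norm (F z) ^ e \<le> g z"
proof -
  define N where "N = real CARD('i)"
  have N: "N \<ge> 1" by (simp add: N_def Suc_leI)
  \<comment> \<open>\<open>good_circle\<close> works on the disc of radius
    \<open>8 \<delta>\<close>, and this has to be the disc of \<open>chart\<close>.\<close>
  define \<delta> where "\<delta> = 1 / (32 * N\<^sup>2)"
  have N2: "N\<^sup>2 \<ge> 1" using N by simp
  have "32 * N\<^sup>2 > 1" using N2 by linarith
  then have \<delta>: "\<delta> > 0" "\<delta> < 1" "8 * \<delta> = 1 / (4 * N\<^sup>2)" using N by (auto simp: \<delta>_def)
  obtain G where G: "G \<ge> 0" "\<And>z. (\<And>a. a \<in> A' \<Longrightarrow> h a z \<noteq> 0) \<Longrightarrow>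
    \<exists>bs\<in>\<B>. cmod (\<phi> z) * norm (F z) ^ e \<le> G * (cmod (Wr bs z) / (\<Prod>i<p. cmod (h (bs ! i) z))) ^ m"
    using quotient_size[OF \<phi>(2)] by blast
  obtain o' where o': "Q o' \<noteq> 0" using Q_nonzero by blast
  have ho: "h a o' \<noteq> 0" if "a \<in> A'" for a
    using o' that finite_A' by (auto simp: Q_def prod_zero_iff)
  \<comment> \<open>One lower bound at \<open>o'\<close> for all forms; the inserted 1 gives
    \<open>\<sigma> \<le> 1\<close>, hence \<open>s \<ge> 0\<close>.\<close>
  define \<sigma> where "\<sigma> = Min (insert 1 ((\<lambda>a. (cmod (h a o'))\<^sup>2 / nsq (F o')) ` A'))"
  have \<sigma>: "0 < \<sigma>" "\<sigma> \<le> 1" "\<And>a. a \<in> A' \<Longrightarrow> \<sigma> \<le> (cmod (h a o'))\<^sup>2 / nsq (F o')"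
    unfolding \<sigma>_def using finite_A' ho nsq_pos[OF nz, of o'] by (auto simp: Min_gr_iff)
  define s where "s = - ln \<sigma>"
  have s: "s \<ge> 0" using \<sigma> by (simp add: s_def)
  \<comment> \<open>\<open>M1 = M - 2 N\<close> is the exponent that
    \<open>linear_form_not_tiny\<close> provides for squared moduli. The additional
    \<open>2 N\<close> pays for the factor \<open>1 / (2 N)\<close> in \<open>u\<close>, by
    \<open>2 * N \<le> exp (2 * N)\<close>.\<close>
  define M where "M z = (2 * N\<^sup>2 * \<delta>\<^sup>2 + s) + 2 * (8 * N\<^sup>2 * (dist z o')\<^sup>2 + s + 1) * (dist z o' * (1 / \<delta>)) + (1 + 2 * N)" for z
  define M1 where "M1 z = M z - 2 * N" for z
  have M1: "M1 z \<ge> 1" for z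
  proof -
    have "0 \<le> 2 * N\<^sup>2 * \<delta>\<^sup>2" "0 \<le> 2 * (8 * N\<^sup>2 * (dist z o')\<^sup>2 + s + 1) * (dist z o' * (1 / \<delta>))"
      using s N \<delta> by auto
    then show ?thesis using s by (simp add: M1_def M_def)
  qed
  have Mge: "M z \<ge> 1" for z using M1[of z] N by (simp add: M1_def)
  define q where "q = card A'"
  define \<tau> where "\<tau> z = 120 * (9 * real q * M z + 1)\<^sup>2 * (1 / \<delta>)" for z
  have \<tau>: "\<tau> z \<ge> 120" "1 / \<tau> z = \<delta> / (120 * (9 * real q * M z + 1)\<^sup>2)" "1 / \<tau> z \<le> \<delta> / 120" for z
  proof -
    have "1 \<le> (9 * real q * M z + 1)\<^sup>2" using Mge[of z] by (intro one_le_power) auto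
    moreover have "1 \<le> 1 / \<delta>" using \<delta> by simp
    ultimately have "1 * 1 \<le> (9 * real q * M z + 1)\<^sup>2 * (1 / \<delta>)" by (intro mult_mono) auto
    then show "\<tau> z \<ge> 120" by (simp add: \<tau>_def)
    show *: "1 / \<tau> z = \<delta> / (120 * (9 * real q * M z + 1)\<^sup>2)" by (simp add: \<tau>_def)
    show "1 / \<tau> z \<le> \<delta> / 120"
      unfolding * using \<open>1 \<le> (9 * real q * M z + 1)\<^sup>2\<close> \<delta> by (intro divide_left_mono) auto
  qed
  define \<Lambda> where "\<Lambda> z = 9 * fact p * \<tau> z ^ p" for z
  define g where "g z = (2 * N) ^ e * (G * (fact p * \<Lambda> z ^ p) ^ m)" for z
  have "poly_bounded g"
    unfolding g_def[abs_def] \<Lambda>_def \<tau>_def M_def by (intro poly_bounded_intros)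
  moreover have "cmod (\<phi> z0) * norm (F z0) ^ e \<le> g z0" for z0
  proof -
    obtain i where i: "\<And>z. z \<in> ball z0 (8 * \<delta>) \<Longrightarrow> norm (F z) \<le> 2 * N * cmod (F z $ i)"
      using chart[of z0] unfolding \<delta>(3) N_def by blast
    have Fi: "F z $ i \<noteq> 0" if "z \<in> ball z0 (8 * \<delta>)" for z
      using i[OF that] normF_pos[of z] by auto
    define u where "u z = 1 / (2 * of_real N * F z $ i)" for z
    have hu: "u holomorphic_on ball z0 (8 * \<delta>)"
      unfolding u_def[abs_def] using Fi N by (intro holomorphic_intros holomorphic_on_subset[OF hol]) auto
    have hg: "(\<lambda>w. u w * h a w) holomorphic_on ball z0 (8 * \<delta>)" for a
      by (intro holomorphic_intros hu hol_h)
    have nu: "cmod (u z) = 1 / (2 * N * cmod (F z $ i))" for z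
      using N by (simp add: u_def norm_divide norm_mult)
    obtain r where r: "0 < r" "r < \<delta>"
      "\<And>a z. a \<in> A' \<Longrightarrow> dist z0 z = r \<Longrightarrow> u z * h a z \<noteq> 0"
      "\<And>a z w. a \<in> A' \<Longrightarrow> dist z0 z = r \<Longrightarrow> cmod (w - z) \<le> \<delta> / (120 * (9 * q * M z0 + 1)\<^sup>2) \<Longrightarrow>
         cmod (u w * h a w) \<le> 9 * cmod (u z * h a z)"
    proof (rule good_circle[of \<delta> A' q "\<lambda>a w. u w * h a w" z0 "M z0"])
      fix a z assume a: "a \<in> A'" and z: "z \<in> ball z0 (8 * \<delta>)"
      have "cmod (h a z) \<le> 2 * N * cmod (F z $ i)"
        using h_le[of a z] i[OF z] a by (auto simp: A'_def)
      then show "cmod (u z * h a z) \<le> 1"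
        using Fi[OF z] N by (simp add: norm_mult nu field_simps)
    next
      fix a assume a: "a \<in> A'"
      have "\<exists>z\<in>cball z0 \<delta>. (cmod (h a z))\<^sup>2 \<ge> exp (- M1 z0) * nsq (F z)"
      proof (rule linear_form_not_tiny[where F = F and \<sigma> = \<sigma> and o' = o' and K = "N\<^sup>2" and T = "dist z0 o'"])
        show "(cmod (h a z))\<^sup>2 \<le> nsq (F z)" for z
          using h_le[of a z] a by (auto simp: nsq_def A'_def intro: power_mono)
        show "N\<^sup>2 = (real CARD('i))\<^sup>2" by (simp add: N_def)
        show "2 * N\<^sup>2 * \<delta>\<^sup>2 - ln \<sigma> + 2 * (8 * N\<^sup>2 * (dist z0 o')\<^sup>2 - ln \<sigma> + 1) * (dist z0 o' / \<delta>) + 1 \<le> M1 z0"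
          by (simp add: M1_def M_def s_def)
      qed (use hol nz wr hol_h \<sigma>(1) \<sigma>(3)[OF a] \<delta>(1) in auto)
      then obtain z where z: "z \<in> cball z0 \<delta>" "(cmod (h a z))\<^sup>2 \<ge> exp (- M1 z0) * nsq (F z)" by blast
      have zb: "z \<in> ball z0 (8 * \<delta>)" using z(1) \<delta> by auto
      have "(exp (- M1 z0 / 2) * norm (F z))\<^sup>2 \<le> (cmod (h a z))\<^sup>2"
        using z(2) by (simp add: power_mult_distrib nsq_def flip: exp_of_nat_mult)
      then have "exp (- M1 z0 / 2) * norm (F z) \<le> cmod (h a z)" by (rule power2_le_imp_le) simp
      moreover have "exp (- M1 z0 / 2) * cmod (F z $ i) \<le> exp (- M1 z0 / 2) * norm (F z)"
        by (intro mult_left_mono Finite_Cartesian_Product.norm_nth_le) auto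
      ultimately have "exp (- M1 z0 / 2) * cmod (F z $ i) \<le> cmod (h a z)" by linarith
      then have "exp (- M1 z0 / 2) / (2 * N) \<le> cmod (u z * h a z)"
        using Fi[OF zb] N by (simp add: norm_mult nu field_simps)
      moreover have "exp (- M z0) \<le> exp (- M1 z0 / 2) / (2 * N)"
      proof -
        have "2 * N \<le> exp (2 * N)" using exp_ge_add_one_self[of "2 * N"] by linarith
        then have "exp (- M1 z0 / 2) * (1 / exp (2 * N)) \<le> exp (- M1 z0 / 2) * (1 / (2 * N))"
          using N by (intro mult_left_mono divide_left_mono) auto
        moreover have "M z0 = M1 z0 + 2 * N" by (simp add: M1_def)
        then have "- M z0 \<le> - M1 z0 / 2 - 2 * N" using M1[of z0] by simp
        then have "exp (- M z0) \<le> exp (- M1 z0 / 2 - 2 * N)" by simp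
        ultimately show ?thesis by (simp add: exp_diff)
      qed
      ultimately show "\<exists>z\<in>cball z0 \<delta>. exp (- M z0) \<le> cmod (u z * h a z)" using z(1) by (meson order_trans)
    qed (use \<delta> finite_A' hg Mge q_def that in auto)
    have circle: "cmod (\<phi> z) * norm (F z) ^ e \<le> G * (fact p * \<Lambda> z0 ^ p) ^ m" if z: "dist z0 z = r" for z
    proof -
      have zb: "z \<in> ball z0 (8 * \<delta>)" using z r \<delta> by auto
      have hz: "h a z \<noteq> 0" if "a \<in> A'" for a using r(3)[OF that z] by auto
      have uz: "u z \<noteq> 0" using Fi[OF zb] N by (simp add: u_def)
      obtain bs where bs: "bs \<in> \<B>" "cmod (\<phi> z) * norm (F z) ^ e \<le> G * (cmod (Wr bs z) / (\<Prod>i<p. cmod (h (bs ! i) z))) ^ m"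
        using G(2)[OF hz] by blast
      have "cmod (Wr bs z) / (\<Prod>i<p. cmod (h (bs ! i) z)) \<le> fact p * (\<Prod>l<p. \<Lambda> z0)"
      proof (rule ratio_bound[OF bs(1) open_ball zb hu uz hz])
        fix l j assume lj: "l < p" "j < p"
        define v where "v w = u w * h (bs ! j) w" for w
        have "cmod ((deriv ^^ l) v z) \<le> fact l * (9 * cmod (v z)) / (1 / \<tau> z0) ^ l"
        proof (rule Cauchy_growth_bound[where R = "7 * \<delta>"])
          show "v holomorphic_on ball z (7 * \<delta>)"
            unfolding v_def[abs_def]
          proof (rule holomorphic_on_subset[OF hg])
            show "ball z (7 * \<delta>) \<subseteq> ball z0 (8 * \<delta>)"
            proof
              fix w assume "w \<in> ball z (7 * \<delta>)"
              then show "w \<in> ball z0 (8 * \<delta>)" using z r dist_triangle[of z0 w z] by auto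
            qed
          qed
          show "0 < 1 / \<tau> z0" using \<tau>(1)[of z0] by simp
          show "1 / \<tau> z0 < 7 * \<delta>" using \<tau>(3)[of z0] \<delta> by linarith
          fix w assume "cmod (w - z) \<le> 1 / \<tau> z0"
          then show "cmod (v w) \<le> 9 * cmod (v z)"
            unfolding v_def using r(4)[OF nth_bs[OF bs(1) lj(2)] z] by (simp add: \<tau>(2))
        qed
        also have "\<dots> = (9 * fact l * \<tau> z0 ^ l) * cmod (v z)" by (simp add: power_one_over)
        also have "\<dots> \<le> \<Lambda> z0 * cmod (v z)"
          unfolding \<Lambda>_def using lj \<tau>(1)[of z0] by (intro mult_right_mono mult_mono power_increasing fact_mono) auto
        finally show "cmod ((deriv ^^ l) (\<lambda>z. u z * h (bs ! j) z) z) \<le> \<Lambda> z0 * cmod (u z * h (bs ! j) z)"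
          by (simp add: v_def[abs_def])
      qed
      then have "(cmod (Wr bs z) / (\<Prod>i<p. cmod (h (bs ! i) z))) ^ m \<le> (fact p * \<Lambda> z0 ^ p) ^ m"
        by (intro power_mono) (auto intro!: divide_nonneg_nonneg prod_nonneg)
      then have "G * (cmod (Wr bs z) / (\<Prod>i<p. cmod (h (bs ! i) z))) ^ m \<le> G * (fact p * \<Lambda> z0 ^ p) ^ m"
        using G(1) by (rule mult_left_mono)
      then show ?thesis using bs(2) by linarith
    qed
    \<comment> \<open>The norm of \<open>F\<close> is replaced by its large component, because
      \<open>\<phi> F_i^e\<close> is holomorphic and can be propagated from the circle to its
      centre; there the component dominates the norm again.\<close>
    have "cmod (\<phi> z0 * F z0 $ i ^ e) \<le> G * (fact p * \<Lambda> z0 ^ p) ^ m"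
    proof (rule maximum_modulus_frontier[of "\<lambda>z. \<phi> z * F z $ i ^ e" "cball z0 r"])
      have "(\<lambda>z. \<phi> z * F z $ i ^ e) holomorphic_on UNIV" by (intro holomorphic_intros \<phi> hol)
      then show "(\<lambda>z. \<phi> z * F z $ i ^ e) holomorphic_on interior (cball z0 r)"
        "continuous_on (closure (cball z0 r)) (\<lambda>z. \<phi> z * F z $ i ^ e)"
        by (auto intro: holomorphic_on_subset intro!: holomorphic_on_imp_continuous_on)
      fix z assume "z \<in> frontier (cball z0 r)"
      then have z: "dist z0 z = r" using r by (simp add: frontier_cball)
      have "cmod (\<phi> z * F z $ i ^ e) \<le> cmod (\<phi> z) * norm (F z) ^ e"
        by (simp add: norm_mult norm_power mult_left_mono power_mono Finite_Cartesian_Product.norm_nth_le)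
      then show "cmod (\<phi> z * F z $ i ^ e) \<le> G * (fact p * \<Lambda> z0 ^ p) ^ m" using circle[OF z] by linarith
    qed (use r in auto)
    then have "(2 * N) ^ e * (cmod (\<phi> z0) * cmod (F z0 $ i) ^ e) \<le> g z0"
      unfolding g_def using N by (intro mult_left_mono) (auto simp: norm_mult norm_power)
    moreover have "norm (F z0) ^ e \<le> (2 * N * cmod (F z0 $ i)) ^ e"
      using i[of z0] \<delta> N by (intro power_mono) auto
    then have "cmod (\<phi> z0) * norm (F z0) ^ e \<le> cmod (\<phi> z0) * ((2 * N) ^ e * cmod (F z0 $ i) ^ e)"
      unfolding power_mult_distrib by (intro mult_left_mono) auto
    ultimately show ?thesis by (simp add: mult_ac)
  qed
  ultimately show ?thesis using that by blast
qed

text \<open>The polynomials \<open>f a = \<phi> h_a^e\<close> contain the same factor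
  \<open>\<phi>\<close>, so the e-th power of \<open>h b / h a0\<close> is a quotient of two
  polynomials and changes by at most the factor 4 on discs of any prescribed radius \<open>R\<close>
  far enough out. Cauchy's inequality then gains a power of \<open>1 / R\<close> for each
  derivative. As \<open>k \<ge> 1\<close>, the Wronskian has a row with a proper derivative, and the
  bound of \<open>quotient_size\<close> tends to 0.\<close>

lemma contradiction: False
proof -
  obtain \<phi> s t where \<phi>: "\<phi> holomorphic_on UNIV" "\<exists>z. \<phi> z \<noteq> 0"
    "\<And>z. wr2 F s t z ^ (k * n) * Wr b0 z ^ m = \<phi> z * Q z"
    using quotient_exists by blast
  obtain g where g: "poly_bounded g" "\<And>z. cmod (\<phi> z) * norm (F z) ^ e \<le> g z"
    using quotient_growth[OF \<phi>(1,3)] by blast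
  obtain C D where CD: "\<And>z. 1 \<le> cmod z \<Longrightarrow> \<bar>g z\<bar> \<le> C * cmod z ^ D"
    using g(1) unfolding poly_bounded_def by blast
  obtain G where G: "G \<ge> 0" "\<And>z. (\<And>a. a \<in> A' \<Longrightarrow> h a z \<noteq> 0) \<Longrightarrow>
    \<exists>bs\<in>\<B>. cmod (\<phi> z) * norm (F z) ^ e \<le> G * (cmod (Wr bs z) / (\<Prod>i<p. cmod (h (bs ! i) z))) ^ m"
    using quotient_size[OF \<phi>(3)] by blast
  define f where "f a z = \<phi> z * h a z ^ e" for a z
  have hf: "f a holomorphic_on UNIV" for a
    unfolding f_def[abs_def] by (intro holomorphic_intros \<phi> hol_h)
  have f_le: "cmod (f a z) \<le> cmod (\<phi> z) * norm (F z) ^ e" if "a \<in> A'" for a z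
    using h_le[of a z] that by (auto simp: f_def norm_mult norm_power A'_def intro!: mult_left_mono power_mono)
  have fnz: "\<exists>z. f a z \<noteq> 0" if a: "a \<in> A'" for a
  proof -
    obtain r where r: "r > 0" "\<And>w. w \<in> ball 0 r - {0} \<Longrightarrow> \<phi> w \<noteq> 0"
      using entire_punctured_nonzero[OF \<phi>(1,2), of 0] by blast
    obtain r' where r': "r' > 0" "\<And>w. w \<in> ball 0 r' - {0} \<Longrightarrow> h a w \<noteq> 0"
      using entire_punctured_nonzero[OF hol_h h_nonzero[OF a], of 0] by blast
    define w where "w = complex_of_real (min r r' / 2)"
    have "w \<in> ball 0 r - {0}" "w \<in> ball 0 r' - {0}" using r(1) r'(1) by (auto simp: w_def)
    then show ?thesis using r(2) r'(2) by (auto simp: f_def)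
  qed
  have "\<exists>P. P \<noteq> 0 \<and> (\<forall>z. f a z = poly P z)" if a: "a \<in> A'" for a
  proof -
    have bd: "cmod (f a z) \<le> C * cmod z ^ D" if "1 \<le> cmod z" for z
      using f_le[OF a, of z] g(2)[of z] CD[OF that] by linarith
    define P where "P = (\<Sum>j\<le>D. monom ((deriv ^^ j) (f a) 0 / fact j) j)"
    have "f a z = poly P z" for z
      unfolding P_def poly_sum poly_monom by (rule Liouville_polynomial[OF hf bd])
    moreover from this have "P \<noteq> 0" using fnz[OF a] by auto
    ultimately show ?thesis by blast
  qed
  then obtain P where P: "\<And>a. a \<in> A' \<Longrightarrow> P a \<noteq> 0" "\<And>a z. a \<in> A' \<Longrightarrow> f a z = poly (P a) z" by metis
  define c where "c = (\<Prod>l<k. 4 * fact l) * (8 * fact k :: real)"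
  have c: "c > 0" unfolding c_def by (intro mult_pos_pos prod_pos) auto
  have small: "\<exists>B. \<forall>z. B \<le> cmod z \<longrightarrow> cmod (\<phi> z) * norm (F z) ^ e \<le> G * (fact p * (c / R)) ^ m" if R: "R \<ge> 2" for R
  proof -
    have "\<exists>B>0. \<forall>x y. B \<le> cmod x \<longrightarrow> B \<le> cmod y \<longrightarrow> cmod (x - y) \<le> R \<longrightarrow>
      poly (P a) x \<noteq> 0 \<and> cmod (poly (P a) x) \<le> 2 * cmod (poly (P a) y)" if a: "a \<in> A'" for a
      using poly_ratio_at_infinity[OF P(1)[OF a], of R] R by (metis less_le_trans zero_less_numeral)
    then obtain B where B: "\<And>a. a \<in> A' \<Longrightarrow> B a > 0" "\<And>a x y. a \<in> A' \<Longrightarrow> B a \<le> cmod x \<Longrightarrow> B a \<le> cmod y \<Longrightarrow> cmod (x - y) \<le> R \<Longrightarrow>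
      poly (P a) x \<noteq> 0 \<and> cmod (poly (P a) x) \<le> 2 * cmod (poly (P a) y)" by metis
    define B0 where "B0 = (\<Sum>a\<in>A'. B a)"
    have B0: "B a \<le> B0" if "a \<in> A'" for a
      unfolding B0_def using that B(1) finite_A' by (intro member_le_sum) (auto simp: less_imp_le)
    show ?thesis
    proof (intro exI[of _ "B0 + R"] allI impI)
      fix z assume z: "B0 + R \<le> cmod z"
      have near: "B a \<le> cmod w" if "a \<in> A'" "cmod (w - z) \<le> R" for a w
      proof -
        have "cmod z - cmod (w - z) \<le> cmod w"
          using norm_triangle_ineq2[of z "z - w"] by (simp add: norm_minus_commute)
        then show ?thesis using z that B0[OF that(1)] by linarith
      qed
      have fw: "f a w \<noteq> 0" if "a \<in> A'" "cmod (w - z) \<le> R" for a w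
        using B(2)[OF that(1) near[OF that] near[OF that]] P(2)[OF that(1)] R by simp
      have hw: "h a w \<noteq> 0" if "a \<in> A'" "cmod (w - z) \<le> R" for a w
        using fw[OF that] e(1) by (auto simp: f_def power_0_left)
      have phw: "\<phi> w \<noteq> 0" if "a \<in> A'" "cmod (w - z) \<le> R" for a w
        using fw[OF that] by (auto simp: f_def)
      have hz: "h a z \<noteq> 0" if "a \<in> A'" for a using hw[OF that, of z] R by simp
      have fcmp: "cmod (f a w) \<le> 2 * cmod (f a w')" if "a \<in> A'" "cmod (w - z) \<le> R" "cmod (w' - z) \<le> R" "cmod (w - w') \<le> R" for a w w'
        using B(2)[OF that(1) near[OF that(1,2)] near[OF that(1,3)] that(4)] P(2)[OF that(1)] by simp
      obtain bs where bs: "bs \<in> \<B>" "cmod (\<phi> z) * norm (F z) ^ e \<le> G * (cmod (Wr bs z) / (\<Prod>i<p. cmod (h (bs ! i) z))) ^ m"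
        using G(2)[OF hz] by blast
      define a0 where "a0 = bs ! 0"
      have a0: "a0 \<in> A'" using nth_bs[OF bs(1), of 0] p2 by (simp add: a0_def)
      \<comment> \<open>The chart given by one form of the base: the columns become the quotients
        \<open>h b / h a0\<close>.\<close>
      define u where "u w = 1 / h a0 w" for w
      have hu: "u holomorphic_on ball z R"
        unfolding u_def[abs_def] using hw[OF a0]
        by (intro holomorphic_intros hol_h) (auto simp: dist_norm norm_minus_commute less_imp_le)
      \<comment> \<open>Only the row of highest order keeps the gain \<open>2 / R\<close>, since one
        small factor is enough; in the other rows the gain is estimated by 1.\<close>
      define \<Lambda> where "\<Lambda> l = (if l = k then 8 * fact k / R else 4 * fact l)" for l :: nat
      have "cmod (Wr bs z) / (\<Prod>i<p. cmod (h (bs ! i) z)) \<le> fact p * (\<Prod>l<p. \<Lambda> l)"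
      proof (rule ratio_bound[OF bs(1) open_ball _ hu _ hz])
        show "z \<in> ball z R" using R by simp
        show "u z \<noteq> 0" using hz[OF a0] by (simp add: u_def)
        fix l i assume li: "l < p" "i < p"
        define b where "b = bs ! i"
        have b: "b \<in> A'" using nth_bs[OF bs(1) li(2)] by (simp add: b_def)
        define v where "v w = u w * h b w" for w
        have grow: "cmod (v w) \<le> 4 * cmod (v z)" if w: "cmod (w - z) \<le> R / 2" for w
        proof -
          have wR: "cmod (w - z) \<le> R" "cmod (z - w) \<le> R" "cmod (z - z) \<le> R" using w R by (auto simp: norm_minus_commute)
          have ve: "cmod (v x) ^ e = cmod (f b x) / cmod (f a0 x)" if "cmod (x - z) \<le> R" for x
            using phw[OF a0 that] by (simp add: v_def u_def f_def norm_mult norm_divide norm_power power_divide)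
          have "cmod (f b w) / cmod (f a0 w) \<le> (2 * cmod (f b z)) / (cmod (f a0 z) / 2)"
            using fcmp[OF b wR(1,3,1)] fcmp[OF a0 wR(3,1,2)] fw[OF a0 wR(3)] by (intro frac_le) auto
          then have "cmod (v w) ^ e \<le> 4 * cmod (v z) ^ e" unfolding ve[OF wR(1)] ve[OF wR(3)] by simp
          also have "\<dots> \<le> 4 ^ e * cmod (v z) ^ e"
            using e(1) power_increasing[of 1 e "4::real"] by (intro mult_right_mono) auto
          finally have "cmod (v w) ^ e \<le> (4 * cmod (v z)) ^ e" by (simp add: power_mult_distrib)
          then show ?thesis using e(1) by (intro power_le_imp_le_base[of "cmod (v w)" "e - 1"]) auto
        qed
        have "cmod ((deriv ^^ l) v z) \<le> fact l * (4 * cmod (v z)) / (R / 2) ^ l"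
        proof (rule Cauchy_growth_bound[where R = R])
          show "v holomorphic_on ball z R" unfolding v_def[abs_def] by (intro holomorphic_intros hu hol_h)
        qed (use R grow in auto)
        also have "\<dots> = 4 * fact l * (2 / R) ^ l * cmod (v z)" by (simp add: power_divide)
        also have "\<dots> \<le> \<Lambda> l * cmod (v z)"
        proof (rule mult_right_mono)
          have R2: "0 \<le> 2 / R" "2 / R \<le> 1" using R by auto
          show "4 * fact l * (2 / R) ^ l \<le> \<Lambda> l"
          proof (cases "l = k")
            case True
            have "(2 / R) ^ k \<le> (2 / R) ^ 1" using k1 R2 by (intro power_decreasing) auto
            then have "4 * fact k * (2 / R) ^ k \<le> 4 * fact k * (2 / R)" by (intro mult_left_mono) auto
            then show ?thesis using True by (simp add: \<Lambda>_def)
          next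
            case False
            have "(2 / R) ^ l \<le> 1" using R2 by (intro power_le_one) auto
            then have "4 * fact l * (2 / R) ^ l \<le> 4 * fact l * 1" by (intro mult_left_mono) auto
            then show ?thesis using False by (simp add: \<Lambda>_def)
          qed
        qed simp
        finally show "cmod ((deriv ^^ l) (\<lambda>z. u z * h (bs ! i) z) z) \<le> \<Lambda> l * cmod (u z * h (bs ! i) z)"
          by (simp add: v_def[abs_def] b_def)
      qed
      also have "(\<Prod>l<p. \<Lambda> l) = c / R"
      proof -
        have "(\<Prod>l<p. \<Lambda> l) = (\<Prod>l<k. \<Lambda> l) * \<Lambda> k" using k1(2) by simp
        also have "(\<Prod>l<k. \<Lambda> l) = (\<Prod>l<k. 4 * fact l)" by (intro prod.cong) (auto simp: \<Lambda>_def)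
        finally show ?thesis by (simp add: c_def \<Lambda>_def)
      qed
      finally have "(cmod (Wr bs z) / (\<Prod>i<p. cmod (h (bs ! i) z))) ^ m \<le> (fact p * (c / R)) ^ m"
        by (intro power_mono) (auto intro!: divide_nonneg_nonneg prod_nonneg)
      then have "G * (cmod (Wr bs z) / (\<Prod>i<p. cmod (h (bs ! i) z))) ^ m \<le> G * (fact p * (c / R)) ^ m"
        using G(1) by (rule mult_left_mono)
      then show "cmod (\<phi> z) * norm (F z) ^ e \<le> G * (fact p * (c / R)) ^ m" using bs(2) by linarith
    qed
  qed
  have "A' \<noteq> {}" using e by auto
  then obtain a where a: "a \<in> A'" by blast
  have "(f a \<longlongrightarrow> 0) at_infinity"
  proof (rule tendstoI)
    fix \<epsilon> :: real assume \<epsilon>: "\<epsilon> > 0"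
    have "((\<lambda>R. G * (fact p * (c / R)) ^ m) \<longlongrightarrow> G * (fact p * 0) ^ m) at_top"
      by (intro tendsto_intros tendsto_divide_0[OF tendsto_const] filterlim_at_top_imp_at_infinity filterlim_ident)
    \<comment> \<open>The limit is 0 because \<open>m = d + 1\<close> is positive; a zeroth power
      would be 1.\<close>
    then have "\<forall>\<^sub>F R in at_top. G * (fact p * (c / R)) ^ m < \<epsilon>"
      by (rule order_tendstoD) (use \<epsilon> in \<open>simp add: m_def\<close>)
    then have "\<forall>\<^sub>F R in at_top. G * (fact p * (c / R)) ^ m < \<epsilon> \<and> R \<ge> 2"
      using eventually_ge_at_top[of "2::real"] by (rule eventually_conj)
    then obtain R where R: "G * (fact p * (c / R)) ^ m < \<epsilon>" "R \<ge> 2"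
      using eventually_happens'[of "at_top :: real filter"] by fastforce
    obtain B where B: "\<And>z. B \<le> cmod z \<Longrightarrow> cmod (\<phi> z) * norm (F z) ^ e \<le> G * (fact p * (c / R)) ^ m"
      using small[OF R(2)] by blast
    have "dist (f a z) 0 < \<epsilon>" if "B \<le> cmod z" for z
      using B[OF that] f_le[OF a, of z] R(1) by simp
    then show "\<forall>\<^sub>F z in at_infinity. dist (f a z) 0 < \<epsilon>"
      unfolding eventually_at_infinity by blast
  qed
  then have "f a z = 0" for z using Liouville_weak[OF hf] by blast
  then show False using fnz[OF a] by blast
qed

end

section \<open>Global homogeneous coordinates\<close>

text \<open>Limits of sequences come with coordinates near each point only, whereas
  \<open>proj_holomorphic_on\<close> demands coordinates on the whole domain. On discs and the plane
  the two notions agree, which amounts to solving a multiplicative Cousin problem.\<close>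

definition locally_proj_holomorphic :: "(complex \<Rightarrow> 'i::finite cproj) \<Rightarrow> complex set \<Rightarrow> bool" where
  "locally_proj_holomorphic h D \<longleftrightarrow> (\<forall>z\<in>D. \<exists>r>0. \<exists>L. ball z r \<subseteq> D \<and> homogeneous_coords L h (ball z r))"

lemma homogeneous_coords_subset:
  "homogeneous_coords L h S \<Longrightarrow> T \<subseteq> S \<Longrightarrow> homogeneous_coords L h T"
  unfolding homogeneous_coords_def by (meson holomorphic_on_subset subsetD)

lemma homogeneous_coords_nonzero:
  "homogeneous_coords L h S \<Longrightarrow> z \<in> S \<Longrightarrow> L z \<noteq> 0"
  by (simp add: homogeneous_coords_def)

lemma homogeneous_coords_scalar:
  assumes "homogeneous_coords L h S" "homogeneous_coords G h T" "z \<in> S" "z \<in> T"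
  obtains c where "c \<noteq> 0" "G z = c *s L z"
proof -
  have nz: "L z \<noteq> 0" "G z \<noteq> 0" and "proj_point (L z) = proj_point (G z)"
    using assms by (auto simp: homogeneous_coords_def)
  then obtain c where "G z = c *s L z" using proj_point_eq_iff by blast
  then show ?thesis using that[of c] nz by auto
qed

lemma homogeneous_coords_smult:
  assumes "homogeneous_coords L h S" "u holomorphic_on S" "\<And>z. z \<in> S \<Longrightarrow> u z \<noteq> 0"
  shows "homogeneous_coords (\<lambda>z. u z *s L z) h S"
  using assms unfolding homogeneous_coords_def
  by (auto intro!: holomorphic_intros simp: proj_point_smult)

lemma homogeneous_coords_cong:
  assumes "homogeneous_coords L h S" "\<And>z. z \<in> S \<Longrightarrow> G z = L z"
  shows "homogeneous_coords G h S"
  using assms unfolding homogeneous_coords_def by (auto cong: holomorphic_cong)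

lemma homogeneous_coords_local:
  assumes "open S" "\<And>z. z \<in> S \<Longrightarrow> \<exists>r>0. homogeneous_coords G h (ball z r)"
  shows "homogeneous_coords G h S"
proof -
  have "(\<lambda>z. G z $ i) field_differentiable at z \<and> G z \<noteq> 0 \<and> h z = proj_point (G z)" if z: "z \<in> S" for z i
  proof -
    obtain r where r: "r > 0" "homogeneous_coords G h (ball z r)" using assms(2)[OF z] by blast
    then show ?thesis
      using holomorphic_on_imp_differentiable_at[of "\<lambda>z. G z $ i" "ball z r" z]
      by (auto simp: homogeneous_coords_def)
  qed
  then show ?thesis
    by (auto simp: homogeneous_coords_def holomorphic_on_def intro: field_differentiable_at_within)
qed

text \<open>
  Local coordinates \<open>L\<close> around each point are divided by their \<open>i\<close>-th component, and the
  finitely many poles are cancelled by a polynomial.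
\<close>

lemma coords_on_smaller_ball:
  fixes h :: "complex \<Rightarrow> 'i::finite cproj"
  assumes h: "locally_proj_holomorphic h (ball 0 R')" and R: "0 < R" "R < R'"
  obtains G where "homogeneous_coords G h (ball 0 R)"
proof -
  define D where "D = ball (0::complex) R'"
  obtain r0 L0 where L0: "r0 > 0" "homogeneous_coords L0 h (ball 0 r0)" "ball 0 r0 \<subseteq> D"
    using h R unfolding locally_proj_holomorphic_def D_def by force
  have "L0 0 \<noteq> 0" using L0 by (auto simp: homogeneous_coords_def)
  then obtain i where i: "L0 0 $ i \<noteq> 0" by (auto simp: Finite_Cartesian_Product.vec_eq_iff)
  \<comment> \<open>The values of \<open>h\<close> in the i-th coordinate hyperplane, described
    independently of the chosen coordinates (\<open>V_iff\<close>).\<close>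
  define V where "V z \<longleftrightarrow> (\<exists>r L. r > 0 \<and> homogeneous_coords L h (ball z r) \<and> L z $ i = 0)" for z
  have V_iff: "V z \<longleftrightarrow> L z $ i = 0" if VS: "homogeneous_coords L h S" "open S" "z \<in> S" for L S z
  proof
    assume "V z"
    then obtain r L' where L': "r > 0" "homogeneous_coords L' h (ball z r)" "L' z $ i = 0" by (auto simp: V_def)
    obtain c where "L z = c *s L' z"
      using homogeneous_coords_scalar[OF L'(2) VS(1)] VS(3) L'(1) by (metis centre_in_ball)
    then show "L z $ i = 0" using L' by simp
  next
    assume "L z $ i = 0"
    moreover obtain r where "r > 0" "ball z r \<subseteq> S" using VS openE by blast
    ultimately show "V z" using homogeneous_coords_subset[OF VS(1)] by (auto simp: V_def)
  qed
  \<comment> \<open>The interior of that set. By the identity theorem it is open and closed in the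
    connected disc, and by the choice of \<open>i\<close> it misses 0; so the points in
    \<open>V\<close> are isolated.\<close>
  define T where "T = {z\<in>D. \<exists>r>0. \<forall>w\<in>ball z r. V w}"
  have notT: "\<exists>r>0. ball z r \<subseteq> D \<and> (\<forall>w\<in>ball z r - {z}. \<not> V w)" if z: "z \<in> D" "z \<notin> T" for z
  proof -
    obtain r L where L: "r > 0" "homogeneous_coords L h (ball z r)" "ball z r \<subseteq> D"
      using h z unfolding locally_proj_holomorphic_def D_def by blast
    have hol: "(\<lambda>w. L w $ i) holomorphic_on ball z r" using L by (simp add: homogeneous_coords_def)
    obtain w where w: "w \<in> ball z r" "L w $ i \<noteq> 0"
      using z L V_iff[OF L(2)] by (force simp: T_def)
    have "\<forall>\<^sub>F w in at z. L w $ i \<noteq> 0 \<and> w \<in> ball z r"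
      by (rule non_zero_neighbour_alt[OF hol]) (use L w in auto)
    then obtain s where s: "s > 0" "\<And>w. w \<noteq> z \<Longrightarrow> dist w z < s \<Longrightarrow> L w $ i \<noteq> 0 \<and> w \<in> ball z r"
      unfolding eventually_at by blast
    then have "\<not> V w" if "w \<in> ball z (min s r) - {z}" for w
      using V_iff[OF L(2), of w] that by (auto simp: dist_commute)
    then show ?thesis using s L by (intro exI[of _ "min s r"]) auto
  qed
  have "T = {}"
  proof (rule ccontr)
    assume "T \<noteq> {}"
    have oT: "open T"
    proof (rule openI)
      fix z assume "z \<in> T"
      then obtain r where r: "r > 0" "\<forall>w\<in>ball z r. V w" "z \<in> D" by (auto simp: T_def)
      obtain s where s: "s > 0" "ball z s \<subseteq> D" using r(3) unfolding D_def by (meson open_ball openE)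
      have "ball z (min r s) \<subseteq> T"
      proof
        fix w assume w: "w \<in> ball z (min r s)"
        obtain e where "e > 0" "ball w e \<subseteq> ball z (min r s)" using w by (meson open_ball openE)
        then show "w \<in> T" unfolding T_def using r s w by (auto intro!: exI[of _ e])
      qed
      then show "\<exists>e>0. ball z e \<subseteq> T" using r s by (intro exI[of _ "min r s"]) auto
    qed
    have oD: "open (D - T)"
    proof (rule openI)
      fix z assume z: "z \<in> D - T"
      then obtain r where r: "r > 0" "ball z r \<subseteq> D" "\<forall>w\<in>ball z r - {z}. \<not> V w" using notT by blast
      have "ball z r \<subseteq> D - T"
      proof
        fix w assume w: "w \<in> ball z r"
        show "w \<in> D - T"
        proof (cases "w = z")
          case False
          have "\<exists>v\<in>ball w e. \<not> V v" if "e > 0" for e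
            using False r w that by (intro bexI[of _ w]) auto
          then show ?thesis using w r by (force simp: T_def)
        qed (use z in simp)
      qed
      then show "\<exists>e>0. ball z e \<subseteq> D - T" using r by blast
    qed
    have "0 \<in> D - T"
      using R V_iff[OF L0(2) open_ball, of 0] L0(1) i by (force simp: D_def T_def)
    moreover have "connected D" by (simp add: D_def)
    moreover have "T \<subseteq> D" by (auto simp: T_def)
    ultimately show False
      using connectedD[OF \<open>connected D\<close> oT oD] \<open>T \<noteq> {}\<close> by blast
  qed
  have iso: "\<exists>r>0. ball z r \<subseteq> D \<and> (\<forall>w\<in>ball z r - {z}. \<not> V w)" if "z \<in> D" for z
    using notT[OF that] \<open>T = {}\<close> by simp
  define Z where "Z = cball 0 R \<inter> {z. V z}"
  have "finite Z"
    unfolding Z_def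
  proof (rule finite_not_islimpt_in_compact)
    fix z assume "z \<in> cball (0::complex) R"
    then have "z \<in> D" using R by (auto simp: D_def)
    then obtain r where "r > 0" "\<forall>w\<in>ball z r - {z}. \<not> V w" using iso by blast
    then show "\<not> z islimpt {z. V z}"
      unfolding islimpt_approachable by (force simp: dist_commute)
  qed simp
  define loc where "loc z r L \<nu> g \<longleftrightarrow> r > 0 \<and> homogeneous_coords L h (ball z r) \<and> g holomorphic_on ball z r \<and>
     (\<forall>w\<in>ball z r. L w $ i = (w - z) ^ \<nu> * g w \<and> g w \<noteq> 0) \<and> (\<not> V z \<longrightarrow> \<nu> = 0) \<and> (\<forall>w\<in>ball z r - {z}. \<not> V w)"
    for z r L \<nu> g
  have "\<exists>r L \<nu> g. loc z r L \<nu> g" if z: "z \<in> D" for z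
  proof -
    obtain r1 where r1: "r1 > 0" "\<forall>w\<in>ball z r1 - {z}. \<not> V w" using iso[OF z] by blast
    obtain r2 L where L: "r2 > 0" "homogeneous_coords L h (ball z r2)"
      using h z unfolding locally_proj_holomorphic_def D_def by blast
    define r where "r = min r1 r2"
    have r: "r > 0" "homogeneous_coords L h (ball z r)" "\<forall>w\<in>ball z r - {z}. \<not> V w"
    proof -
      show "r > 0" using r1 L by (simp add: r_def)
      show "homogeneous_coords L h (ball z r)" by (rule homogeneous_coords_subset[OF L(2)]) (auto simp: r_def)
      show "\<forall>w\<in>ball z r - {z}. \<not> V w" using r1(2) by (auto simp: r_def)
    qed
    have hol: "(\<lambda>w. L w $ i) holomorphic_on ball z r" using r by (simp add: homogeneous_coords_def)
    define w0 where "w0 = z + of_real (r / 2)"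
    have w0: "w0 \<in> ball z r" "w0 \<noteq> z" using r by (auto simp: w0_def dist_norm)
    then have "\<not> V w0" using r by blast
    then have nc: "\<exists>w\<in>ball z r. L w $ i \<noteq> 0" using V_iff[OF r(2) open_ball w0(1)] w0 by blast
    define \<nu> g where "\<nu> = nat (zorder (\<lambda>w. L w $ i) z)" and "g = zor_poly (\<lambda>w. L w $ i) z"
    have ze: "(if L z $ i = 0 then zorder (\<lambda>w. L w $ i) z > 0 else zorder (\<lambda>w. L w $ i) z = 0) \<and>
      (\<exists>s>0. cball z s \<subseteq> ball z r \<and> g holomorphic_on cball z s \<and>
        (\<forall>w\<in>cball z s. L w $ i = g w * (w - z) ^ \<nu> \<and> g w \<noteq> 0))"
      unfolding \<nu>_def g_def by (rule zorder_exist_zero[OF hol]) (use r nc in auto)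
    then obtain s where s: "s > 0" "cball z s \<subseteq> ball z r" "g holomorphic_on cball z s"
      "\<forall>w\<in>cball z s. L w $ i = g w * (w - z) ^ \<nu> \<and> g w \<noteq> 0" by blast
    have sub: "ball z s \<subseteq> ball z r" using s(2) ball_subset_cball by blast
    have "loc z s L \<nu> g"
      unfolding loc_def
    proof (intro conjI)
      show "homogeneous_coords L h (ball z s)" using homogeneous_coords_subset[OF r(2) sub] .
      show "g holomorphic_on ball z s" using s(3) by (rule holomorphic_on_subset) auto
      show "\<forall>w\<in>ball z s. L w $ i = (w - z) ^ \<nu> * g w \<and> g w \<noteq> 0" using s(4) by (auto simp: mult.commute)
      show "\<not> V z \<longrightarrow> \<nu> = 0" using V_iff[OF r(2) open_ball, of z] r(1) ze by (auto simp: \<nu>_def split: if_splits)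
      show "\<forall>w\<in>ball z s - {z}. \<not> V w" using r(3) sub by blast
    qed (rule s)
    then show ?thesis by blast
  qed
  then obtain r L \<nu> g where loc: "\<And>z. z \<in> D \<Longrightarrow> loc z (r z) (L z) (\<nu> z) (g z)" by metis
  note l = loc[unfolded loc_def]
  define P where "P z w = (\<Prod>a\<in>Z - {z}. (w - a) ^ \<nu> a)" for z w
  \<comment> \<open>The coordinates whose i-th component is the polynomial with zeros of order
    \<open>\<nu> a\<close> at the points of \<open>Z\<close>. Using the local data centred at
    \<open>w\<close> itself avoids a quotient \<open>0 / 0\<close> at those points.\<close>
  define G where "G w = (P w w / g w w) *s L w w" for w
  have RD: "ball 0 R \<subseteq> D" using R by (auto simp: D_def)
  have Geq: "G w = (P z w / g z w) *s L z w" if z: "z \<in> ball 0 R" and w: "w \<in> ball z (r z) \<inter> ball 0 R" for z w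
  proof (cases "w = z")
    case False
    have zD: "z \<in> D" and wD: "w \<in> D" using z w RD by auto
    have nVw: "\<not> V w" using l[OF zD] w False by blast
    then have "\<nu> w = 0" using l[OF wD] by blast
    moreover have "w \<in> ball w (r w)" using l[OF wD] by auto
    ultimately have gw: "g w w = L w w $ i" using l[OF wD] by auto
    obtain c where c: "c \<noteq> 0" "L w w = c *s L z w"
      by (rule homogeneous_coords_scalar[of "L z" h "ball z (r z)" "L w" "ball w (r w)" w])
         (use l[OF zD] l[OF wD] w \<open>w \<in> ball w (r w)\<close> in auto)
    have "w \<notin> Z" using nVw by (simp add: Z_def)
    then have Pw: "P w w = (\<Prod>a\<in>Z. (w - a) ^ \<nu> a)" by (simp add: P_def)
    also have "\<dots> = (w - z) ^ \<nu> z * P z w"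
    proof (cases "z \<in> Z")
      case True
      then show ?thesis unfolding P_def using \<open>finite Z\<close> by (intro prod.remove)
    next
      case False
      then have "\<nu> z = 0" using l[OF zD] z by (auto simp: Z_def)
      then show ?thesis using False by (simp add: P_def)
    qed
    finally have PP: "P w w = (w - z) ^ \<nu> z * P z w" .
    have Lz: "L z w $ i = (w - z) ^ \<nu> z * g z w" "g z w \<noteq> 0" using l[OF zD] w by auto
    have "P w w / g w w * c = P z w / g z w"
      unfolding gw c(2) PP using Lz c(1) False by simp
    then show ?thesis unfolding G_def c(2) by simp
  qed (simp add: G_def)
  have "homogeneous_coords G h (ball 0 R)"
  proof (rule homogeneous_coords_local)
    fix z :: complex assume z: "z \<in> ball 0 R"
    then have zD: "z \<in> D" using RD by blast
    obtain s where s: "s > 0" "ball z s \<subseteq> ball 0 R" using z by (meson open_ball openE)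
    define t where "t = min s (r z)"
    have t: "t > 0" "ball z t \<subseteq> ball z (r z) \<inter> ball 0 R" using s l[OF zD] by (auto simp: t_def)
    have "homogeneous_coords (\<lambda>w. (P z w / g z w) *s L z w) h (ball z t)"
    proof (rule homogeneous_coords_smult)
      show "homogeneous_coords (L z) h (ball z t)"
        by (rule homogeneous_coords_subset[of _ _ "ball z (r z)"]) (use l[OF zD] t in auto)
      have "g z holomorphic_on ball z t"
        by (rule holomorphic_on_subset[of _ "ball z (r z)"]) (use l[OF zD] t in auto)
      then show "(\<lambda>w. P z w / g z w) holomorphic_on ball z t"
        unfolding P_def using l[OF zD] t by (intro holomorphic_intros) auto
      fix w assume w: "w \<in> ball z t"
      have "P z w \<noteq> 0"
        unfolding P_def using \<open>finite Z\<close> l[OF zD] w t by (auto simp: prod_zero_iff Z_def)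
      then show "P z w / g z w \<noteq> 0" using l[OF zD] w t by auto
    qed
    then have "homogeneous_coords G h (ball z t)"
      by (rule homogeneous_coords_cong) (use Geq[OF z] t(2) in blast)
    then show "\<exists>r>0. homogeneous_coords G h (ball z r)" using t by blast
  qed simp
  then show ?thesis using that by blast
qed

lemma polynomial_approximation:
  assumes v: "v holomorphic_on ball 0 R" and S: "S < R" and e: "e > 0"
  obtains q where "q holomorphic_on UNIV" "\<And>z. z \<in> cball 0 S \<Longrightarrow> cmod (v z - q z) < (e::real)"
proof (cases "S < 0")
  \<comment> \<open>The disc is empty. This case starts the recursion over an exhaustion, where the
    first function needs no approximation.\<close>
  case True
  then show ?thesis by (intro that[of "\<lambda>_. 0"]) auto
next
  case False
  define T where "T = (S + R) / 2"
  have T: "S < T" "T < R" "0 < T" using S False by (auto simp: T_def)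
  have sm: "(\<lambda>n. (deriv ^^ n) v 0 / fact n * (w - 0) ^ n) sums v w" if "w \<in> ball 0 R" for w
    by (rule holomorphic_power_series[OF v that])
  have "uniformly_convergent_on (cball 0 S) (\<lambda>n x. \<Sum>i<n. (deriv ^^ i) v 0 / fact i * (x - 0) ^ i)"
  proof (rule powser_uniformly_convergent)
    have "ereal S < ereal T" using T by simp
    also have "ereal T \<le> conv_radius (\<lambda>n. (deriv ^^ n) v 0 / fact n)"
      using sm[of "of_real T"] T conv_radius_geI[of "\<lambda>n. (deriv ^^ n) v 0 / fact n" "of_real T"]
      by (auto simp: sums_iff)
    finally show "ereal S < conv_radius (\<lambda>n. (deriv ^^ n) v 0 / fact n)" .
  qed
  then obtain l where l: "uniform_limit (cball 0 S) (\<lambda>n x. \<Sum>i<n. (deriv ^^ i) v 0 / fact i * x ^ i) l sequentially"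
    by (auto simp: uniformly_convergent_on_def)
  have "l x = v x" if x: "x \<in> cball 0 S" for x
  proof (rule LIMSEQ_unique)
    show "(\<lambda>n. \<Sum>i<n. (deriv ^^ i) v 0 / fact i * x ^ i) \<longlonglongrightarrow> l x"
      using tendsto_uniform_limitI[OF l x] .
    show "(\<lambda>n. \<Sum>i<n. (deriv ^^ i) v 0 / fact i * x ^ i) \<longlonglongrightarrow> v x"
      using sm[of x] x S by (simp add: sums_def)
  qed
  moreover have "\<forall>\<^sub>F n in sequentially. \<forall>x\<in>cball 0 S. dist (\<Sum>i<n. (deriv ^^ i) v 0 / fact i * x ^ i) (l x) < e"
    using uniform_limitD[OF l e] .
  then obtain n where "\<forall>x\<in>cball 0 S. dist (\<Sum>i<n. (deriv ^^ i) v 0 / fact i * x ^ i) (l x) < e"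
    by (auto simp: eventually_sequentially)
  ultimately show ?thesis
    by (intro that[of "\<lambda>x. \<Sum>i<n. (deriv ^^ i) v 0 / fact i * x ^ i"])
       (auto intro!: holomorphic_intros simp: dist_norm norm_minus_commute)
qed

text \<open>
  Coordinates \<open>G m\<close> on an exhaustion by balls differ by factors \<open>exp (v m)\<close>; subtracting
  polynomial approximations makes the infinite product of these factors converge.
\<close>

lemma proj_holomorphic_if_locally:
  fixes h :: "complex \<Rightarrow> 'i::finite cproj"
  assumes h: "locally_proj_holomorphic h D" and D: "D = (\<Union>m. ball (0::complex) (R m))"
    and R: "strict_mono R" "\<And>m::nat. R m > 0"
  shows "h proj_holomorphic_on D"
proof -
  have Rle: "R a \<le> R b" if "a \<le> b" for a b using R(1) that by (simp add: strict_mono_less_eq)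
  have sub: "ball 0 (R a) \<subseteq> ball (0::complex) (R b)" if "a \<le> b" for a b using Rle[OF that] by auto
  have "locally_proj_holomorphic h (ball 0 (R m))" for m
    unfolding locally_proj_holomorphic_def
  proof
    fix z :: complex assume z: "z \<in> ball 0 (R m)"
    then have "z \<in> D" by (auto simp: D)
    then obtain r L where L: "r > 0" "homogeneous_coords L h (ball z r)"
      using h unfolding locally_proj_holomorphic_def by blast
    obtain s where s: "s > 0" "ball z s \<subseteq> ball 0 (R m)" using z by (meson open_ball openE)
    have "homogeneous_coords L h (ball z (min r s))" by (rule homogeneous_coords_subset[OF L(2)]) auto
    then show "\<exists>r>0. \<exists>L. ball z r \<subseteq> ball 0 (R m) \<and> homogeneous_coords L h (ball z r)"
      using L s by (intro exI[of _ "min r s"] conjI exI[of _ L]) auto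
  qed
  then have "\<exists>G. homogeneous_coords G h (ball 0 (R m))" for m
    using coords_on_smaller_ball[of h "R (Suc m)" "R m"] R by (metis lessI strict_mono_less)
  then obtain G where G: "\<And>m. homogeneous_coords (G m) h (ball 0 (R m))" by metis
  have "\<exists>v. v holomorphic_on ball 0 (R m) \<and> (\<forall>z\<in>ball 0 (R m). G (Suc m) z = exp (v z) *s G m z)" for m
  proof -
    define B where "B = ball (0::complex) (R m)"
    have GB: "homogeneous_coords (G m) h B" "homogeneous_coords (G (Suc m)) h B"
      using G homogeneous_coords_subset[OF G sub, of m "Suc m"] by (auto simp: B_def)
    have "\<exists>c. c \<noteq> 0 \<and> G (Suc m) z = c *s G m z" if "z \<in> B" for z
      by (rule homogeneous_coords_scalar[OF GB that that]) blast
    then obtain c where c: "\<And>z. z \<in> B \<Longrightarrow> c z \<noteq> 0" "\<And>z. z \<in> B \<Longrightarrow> G (Suc m) z = c z *s G m z" by metis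
    \<comment> \<open>The scalar was chosen pointwise, but near \<open>z\<close> it is the quotient
      of two holomorphic components with nonvanishing denominator.\<close>
    have "c field_differentiable at z" if z: "z \<in> B" for z
    proof -
      obtain j where j: "G m z $ j \<noteq> 0"
        using homogeneous_coords_nonzero[OF GB(1) z] by (auto simp: Finite_Cartesian_Product.vec_eq_iff)
      have hj: "(\<lambda>z. G m z $ j) holomorphic_on B" "(\<lambda>z. G (Suc m) z $ j) holomorphic_on B"
        using GB by (auto simp: homogeneous_coords_def)
      define U where "U = B \<inter> (\<lambda>z. G m z $ j) -` (- {0})"
      have U: "open U" unfolding U_def
        by (rule continuous_open_preimage) (use hj in \<open>auto simp: B_def holomorphic_on_imp_continuous_on\<close>)
      have "(\<lambda>z. G (Suc m) z $ j / G m z $ j) holomorphic_on U"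
        by (intro holomorphic_intros) (auto simp: U_def intro: holomorphic_on_subset[OF hj(1)] holomorphic_on_subset[OF hj(2)])
      then have "c holomorphic_on U"
        by (rule holomorphic_transform) (auto simp: U_def c)
      then show ?thesis using holomorphic_on_imp_differentiable_at U j z by (auto simp: U_def)
    qed
    then have "c holomorphic_on B" by (auto simp: holomorphic_on_def intro: field_differentiable_at_within)
    moreover have "convex B" "open B" "0 \<in> B" using R(2)[of m] by (auto simp: B_def)
    ultimately obtain v where "v holomorphic_on B" "\<And>z. z \<in> B \<Longrightarrow> exp (v z) = c z"
      using holomorphic_logarithm_exists[of B c 0] c(1) by metis
    then show ?thesis using c(2) unfolding B_def by (intro exI[of _ v]) auto
  qed
  then obtain v where v: "\<And>m. v m holomorphic_on ball 0 (R m)"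
    "\<And>m z. z \<in> ball 0 (R m) \<Longrightarrow> G (Suc m) z = exp (v m z) *s G m z" by metis
  \<comment> \<open>\<open>v m\<close> is approximated on the disc before its own; for
    \<open>m = 0\<close> there is none, and the radius \<open>-1\<close> makes the condition
    void.\<close>
  have "\<exists>q. q holomorphic_on UNIV \<and> (\<forall>z\<in>cball 0 (if m = 0 then -1 else R (m - 1)). cmod (v m z - q z) < (1/2) ^ m)" for m
  proof -
    have "(if m = 0 then -1 else R (m - 1)) < R m"
      using R(2)[of m] R(1) by (auto simp: strict_mono_less)
    then show ?thesis using polynomial_approximation[OF v(1)[of m], of _ "(1/2) ^ m"] by (metis zero_less_divide_1_iff zero_less_numeral zero_less_power)
  qed
  then obtain q where q: "\<And>m. q m holomorphic_on UNIV"
    "\<And>m z. z \<in> cball 0 (if m = 0 then -1 else R (m - 1)) \<Longrightarrow> cmod (v m z - q m z) < (1/2) ^ m" by metis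
  define w where "w m z = v m z - q m z" for m z
  have w_small: "cmod (w j z) \<le> (1/2) ^ j" if "z \<in> ball 0 (R m)" "m < j" for m j z
  proof -
    have "R m \<le> R (j - 1)" using that by (intro Rle) auto
    then show ?thesis using q(2)[where z = z and m = j] that by (auto simp: w_def less_imp_le)
  qed
  define S where "S m z = (\<Sum>j. w (m + j) z)" for m z
  have S_summable: "summable (\<lambda>j. w (m + j) z)" if z: "z \<in> ball 0 (R m)" for m z
  proof (rule summable_comparison_test)
    have "cmod (w (m + j) z) \<le> (1/2) ^ j" if "j \<ge> 1" for j
    proof -
      have "cmod (w (m + j) z) \<le> (1/2) ^ (m + j)" using w_small[OF z, of "m + j"] that by simp
      also have "\<dots> \<le> (1/2) ^ j" by (intro power_decreasing) auto
      finally show ?thesis .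
    qed
    then show "\<exists>N. \<forall>j\<ge>N. cmod (w (m + j) z) \<le> (1/2) ^ j" by blast
    show "summable (\<lambda>j. (1/2::real) ^ j)" by simp
  qed
  have hw: "w j holomorphic_on ball 0 (R m)" if "m \<le> j" for m j
    unfolding w_def[abs_def]
    by (intro holomorphic_intros holomorphic_on_subset[OF v(1) sub[OF that]] holomorphic_on_subset[OF q(1)]) auto
  have S_hol: "S m holomorphic_on ball 0 (R m)" for m
  proof -
    \<comment> \<open>On the m-th disc the estimate \<open>w_small\<close> holds only for indices
      above \<open>m\<close>, so the first term is split off.\<close>
    have "(\<lambda>z. \<Sum>j. w (Suc m + j) z) holomorphic_on ball 0 (R m)"
    proof (rule holomorphic_uniform_sequence)
      show "(\<lambda>z. \<Sum>j<n. w (Suc m + j) z) holomorphic_on ball 0 (R m)" for n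
        by (intro holomorphic_intros hw) auto
      fix x assume "x \<in> ball (0::complex) (R m)"
      then obtain d where d: "d > 0" "cball x d \<subseteq> ball 0 (R m)" by (meson open_ball open_contains_cball)
      have "uniform_limit (cball x d) (\<lambda>n z. \<Sum>j<n. w (Suc m + j) z) (\<lambda>z. \<Sum>j. w (Suc m + j) z) sequentially"
      proof (rule Weierstrass_m_test)
        show "cmod (w (Suc m + j) z) \<le> (1/2) ^ j" if "z \<in> cball x d" for j z
        proof -
          have "cmod (w (Suc m + j) z) \<le> (1/2) ^ (Suc m + j)" using w_small[of z m "Suc m + j"] that d by auto
          also have "\<dots> \<le> (1/2) ^ j" by (intro power_decreasing) auto
          finally show ?thesis .
        qed
      qed simp
      then show "\<exists>d>0. cball x d \<subseteq> ball 0 (R m) \<and> uniform_limit (cball x d) (\<lambda>n z. \<Sum>j<n. w (Suc m + j) z) (\<lambda>z. \<Sum>j. w (Suc m + j) z) sequentially"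
        using d by blast
    qed simp
    then have "(\<lambda>z. w m z + (\<Sum>j. w (Suc m + j) z)) holomorphic_on ball 0 (R m)"
      using hw[of m m] by (intro holomorphic_intros) auto
    then show ?thesis
    proof (rule holomorphic_transform)
      fix z :: complex assume "z \<in> ball 0 (R m)"
      then show "w m z + (\<Sum>j. w (Suc m + j) z) = S m z"
        using suminf_split_head[OF S_summable] by (simp add: S_def)
    qed
  qed
  \<comment> \<open>Chosen such that \<open>E m / E (Suc m) = exp (w m + q m) = exp (v m)\<close>.
    This cancels the transition factor, and the coordinates \<open>E m z *s G m z\<close> agree on
    overlaps.\<close>
  define E where "E m z = exp (S m z - (\<Sum>j<m. q j z))" for m z
  have step: "E (Suc m) z *s G (Suc m) z = E m z *s G m z" if z: "z \<in> ball 0 (R m)" for m z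
  proof -
    have "S m z = w m z + S (Suc m) z"
      using suminf_split_head[OF S_summable[OF z]] by (simp add: S_def)
    then have "E m z = E (Suc m) z * exp (v m z)"
      unfolding E_def w_def exp_add[symmetric] by (intro arg_cong[of _ _ exp]) simp
    then show ?thesis using v(2)[OF z] by simp
  qed
  have steps: "E (m + j) z *s G (m + j) z = E m z *s G m z" if z: "z \<in> ball 0 (R m)" for m j z
  proof (induction j)
    case (Suc j)
    have "z \<in> ball 0 (R (m + j))" using z sub[of m "m + j"] by auto
    from step[OF this] show ?case using Suc by simp
  qed simp
  define H where "H z = (let m = (LEAST m. z \<in> ball 0 (R m)) in E m z *s G m z)" for z
  have H: "H z = E m z *s G m z" if "z \<in> ball 0 (R m)" for m z
  proof -
    define l where "l = (LEAST m. z \<in> ball 0 (R m))"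
    have "z \<in> ball 0 (R l)" "l \<le> m" unfolding l_def using that by (auto intro: LeastI Least_le)
    moreover have "H z = E l z *s G l z" unfolding H_def Let_def l_def ..
    ultimately show ?thesis using steps[of z l "m - l"] by simp
  qed
  have "homogeneous_coords H h D"
  proof (rule homogeneous_coords_local)
    show "open D" by (auto simp: D)
    fix z assume "z \<in> D"
    then obtain m where m: "z \<in> ball 0 (R m)" by (auto simp: D)
    have "homogeneous_coords (\<lambda>z. E m z *s G m z) h (ball 0 (R m))"
      by (rule homogeneous_coords_smult[OF G]) (auto simp: E_def intro!: holomorphic_intros S_hol holomorphic_on_subset[OF q(1)])
    then have "homogeneous_coords H h (ball 0 (R m))" by (rule homogeneous_coords_cong) (rule H)
    moreover obtain r where "r > 0" "ball z r \<subseteq> ball 0 (R m)" using m by (meson open_ball openE)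
    ultimately show "\<exists>r>0. homogeneous_coords H h (ball z r)" using homogeneous_coords_subset by blast
  qed
  then show ?thesis unfolding proj_holomorphic_on_def by blast
qed

section \<open>Marty's criterion\<close>

definition pm :: "complex ^ 'i::finite \<Rightarrow> complex ^ 'i ^ 'i" where
  "pm v = (\<chi> a b. pmat v a b)"

lemma pm_nth [simp]: "pm v $ a $ b = pmat v a b"
  by (simp add: pm_def)

lemma norm_cmatrix_le: "norm (M :: complex ^ 'i::finite ^ 'j::finite) \<le> (\<Sum>a\<in>UNIV. \<Sum>b\<in>UNIV. cmod (M $ a $ b))"
proof -
  have "norm M \<le> (\<Sum>a\<in>UNIV. norm (M $ a))"
    unfolding norm_vec_def by (rule L2_set_le_sum) auto
  also have "\<dots> \<le> (\<Sum>a\<in>UNIV. \<Sum>b\<in>UNIV. cmod (M $ a $ b))"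
    unfolding norm_vec_def[where 'b = 'i] by (intro sum_mono L2_set_le_sum) auto
  finally show ?thesis .
qed

lemma norm_cmatrix_bound:
  assumes "\<And>a b. cmod ((M :: complex ^ 'i::finite ^ 'i) $ a $ b) \<le> B"
  shows "norm M \<le> (real CARD('i))\<^sup>2 * B"
proof -
  have "norm M \<le> (\<Sum>a\<in>(UNIV::'i set). \<Sum>b\<in>(UNIV::'i set). B)"
    by (rule order_trans[OF norm_cmatrix_le]) (intro sum_mono assms)
  then show ?thesis by (simp add: power2_eq_square)
qed

lemma pmat_smult: "c \<noteq> 0 \<Longrightarrow> pmat (c *s v) a b = pmat v a b"
proof -
  assume c: "c \<noteq> 0"
  have "complex_of_real (nsq (c *s v)) = (c * cnj c) * of_real (nsq v)"
    unfolding nsq_smult of_real_mult complex_norm_square ..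
  then show ?thesis using c by (simp add: pmat_def)
qed

lemma pmat_norm_le_1: "cmod (pmat v a b) \<le> 1"
proof (cases "v = 0")
  case False
  have "cmod (v $ a) * cmod (v $ b) \<le> norm v * norm v"
    by (intro mult_mono Finite_Cartesian_Product.norm_nth_le) auto
  then show ?thesis using nsq_pos[OF False]
    by (simp add: pmat_def norm_divide norm_mult nsq_def power2_eq_square)
qed (simp add: pmat_def)

text \<open>A closed condition, hence preserved by limits. Together with trace one it forces a
  matrix to be a projection onto a line, see \<open>rank1_matrix\<close>, so limits of projections
  are again points of projective space.\<close>

lemma pmat_rank1: "pmat v a b * pmat v i i = pmat v a i * cnj (pmat v b i)"
  by (simp add: pmat_def)

lemma pmat_trace: "v \<noteq> 0 \<Longrightarrow> (\<Sum>i\<in>UNIV. pmat v i i) = 1"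
  using nsq_pos[of v] by (simp add: pmat_def flip: sum_divide_distrib nsq_complex)

lemma pmat_ratio: "pmat v a i / pmat v i i = v $ a / v $ i"
  by (cases "v = 0"; cases "v $ i = 0") (auto simp: pmat_def nsq_def)

lemma pmat_inj:
  assumes "v \<noteq> 0" "w \<noteq> 0" "\<And>a b. pmat v a b = pmat w a b"
  shows "proj_point v = proj_point w"
proof -
  obtain j where j: "v $ j \<noteq> 0" using assms(1) by (auto simp: Finite_Cartesian_Product.vec_eq_iff)
  have "pmat v j j \<noteq> 0" using j nsq_pos[OF assms(1)] by (simp add: pmat_def)
  then have wj: "w $ j \<noteq> 0" using assms(3)[of j j] by (auto simp: pmat_def)
  have "v $ a / v $ j = w $ a / w $ j" for a using pmat_ratio[of v a j] pmat_ratio[of w a j] assms(3) by simp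
  then have "w = (w $ j / v $ j) *s v" using j wj by (simp add: Finite_Cartesian_Product.vec_eq_iff field_simps)
  then show ?thesis using proj_point_eq_iff[OF assms(1,2)] by blast
qed

lemma pm_lipschitz:
  fixes F :: "complex \<Rightarrow> complex ^ 'i::finite"
  assumes "convex S" "open S" "\<And>i. (\<lambda>z. F z $ i) holomorphic_on S" "\<And>z. z \<in> S \<Longrightarrow> F z \<noteq> 0"
    "\<And>s t z. z \<in> S \<Longrightarrow> cmod (wr2 F s t z) \<le> M * nsq (F z)" "x \<in> S" "y \<in> S"
  shows "norm (pm (F x) - pm (F y)) \<le> 2 * (real CARD('i)) ^ 3 * M * cmod (x - y)"
proof -
  have "norm (pm (F x) - pm (F y)) \<le> (real CARD('i))\<^sup>2 * (2 * real CARD('i) * M * cmod (x - y))"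
    using pmat_lipschitz[OF assms] by (intro norm_cmatrix_bound) simp
  then show ?thesis by (simp add: power2_eq_square power3_eq_cube mult_ac)
qed

lemma rank1_matrix:
  fixes Q :: "complex ^ 'i::finite ^ 'i"
  assumes r: "\<And>a b. Q $ a $ b * Q $ i $ i = Q $ a $ i * cnj (Q $ b $ i)"
    and tr: "(\<Sum>i\<in>UNIV. Q $ i $ i) = 1" and i: "Q $ i $ i \<noteq> 0"
  shows "pm (\<chi> a. Q $ a $ i / Q $ i $ i) = Q"
proof -
  define L where "L = (\<chi> a. Q $ a $ i / Q $ i $ i)"
  have "Q $ i $ i * Q $ i $ i = Q $ i $ i * cnj (Q $ i $ i)" by (rule r)
  then have ri: "cnj (Q $ i $ i) = Q $ i $ i" using i by simp
  have LL: "L $ a * cnj (L $ b) = Q $ a $ b / Q $ i $ i" for a b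
  proof -
    have "L $ a * cnj (L $ b) = (Q $ a $ i * cnj (Q $ b $ i)) / (Q $ i $ i * Q $ i $ i)"
      by (simp add: L_def ri)
    then show ?thesis using i by (simp add: r[symmetric])
  qed
  have "complex_of_real (nsq L) = (\<Sum>a\<in>UNIV. Q $ a $ a) / Q $ i $ i"
    unfolding nsq_complex LL sum_divide_distrib ..
  then have "pmat L a b = Q $ a $ b" for a b
    unfolding pmat_def LL using i tr by simp
  then show ?thesis by (simp add: L_def Finite_Cartesian_Product.vec_eq_iff)
qed

text \<open>The affine coordinate \<open>F_a / F_i\<close> is a quotient of two entries of the
  projection, and on the compact set the denominator of the limit is bounded away from 0.
  Convergence of projections thus becomes convergence of holomorphic functions.\<close>

lemma chart_limit:
  fixes F :: "nat \<Rightarrow> complex \<Rightarrow> complex ^ 'i::finite"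
  assumes S: "compact S" and lim: "uniform_limit S (\<lambda>n z. pm (F n z)) Q sequentially"
    and Q: "continuous_on S Q" and nz: "\<And>z. z \<in> S \<Longrightarrow> Q z $ i $ i \<noteq> 0"
  shows "\<forall>\<^sub>F n in sequentially. \<forall>z\<in>S. F n z $ i \<noteq> 0" (is ?A)
    and "uniform_limit S (\<lambda>n z. F n z $ a / F n z $ i) (\<lambda>z. Q z $ a $ i / Q z $ i $ i) sequentially" (is ?B)
proof -
  have lim': "uniform_limit S (\<lambda>n z. pmat (F n z) a b) (\<lambda>z. Q z $ a $ b) sequentially" for a b
    using bounded_linear.uniform_limit[OF bounded_linear_vec_nth bounded_linear.uniform_limit[OF bounded_linear_vec_nth lim]]
    by simp
  have cont: "continuous_on S (\<lambda>z. Q z $ a $ b)" for a b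
    using Q by (intro continuous_intros)
  obtain c where c: "c > 0" "\<And>z. z \<in> S \<Longrightarrow> c \<le> cmod (Q z $ i $ i)"
  proof (cases "S = {}")
    case False
    obtain x where "x \<in> S" "\<And>z. z \<in> S \<Longrightarrow> cmod (Q x $ i $ i) \<le> cmod (Q z $ i $ i)"
      using continuous_attains_inf[OF S False continuous_on_norm[OF cont[of i i]]] by blast
    then show ?thesis using that[of "cmod (Q x $ i $ i)"] nz by auto
  qed (use that[of 1] in auto)
  have "\<forall>\<^sub>F n in sequentially. \<forall>z\<in>S. dist (pmat (F n z) i i) (Q z $ i $ i) < c"
    using uniform_limitD[OF lim' c(1)] .
  then show ?A
  proof eventually_elim
    case (elim n)
    show ?case
    proof
      fix z assume z: "z \<in> S"
      have "dist (pmat (F n z) i i) (Q z $ i $ i) < c" using elim z by blast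
      then have "pmat (F n z) i i \<noteq> 0" using c(2)[OF z] by auto
      then show "F n z $ i \<noteq> 0" by (auto simp: pmat_def)
    qed
  qed
  have "uniform_limit S (\<lambda>n z. pmat (F n z) a i / pmat (F n z) i i) (\<lambda>z. Q z $ a $ i / Q z $ i $ i) sequentially"
    using S by (intro uniform_lim_divide[OF lim' lim' _ c(2,1)] compact_imp_bounded compact_continuous_image cont) auto
  then show ?B by (simp only: pmat_ratio)
qed

lemma continuous_on_pm:
  assumes "\<And>i. continuous_on S (\<lambda>z. F z $ i)" "\<And>z. z \<in> S \<Longrightarrow> F z \<noteq> 0"
  shows "continuous_on S (\<lambda>z. pm (F z))"
proof -
  have "complex_of_real (nsq (F z)) \<noteq> 0" if "z \<in> S" for z using nsq_pos[OF assms(2)[OF that]] by simp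
  then show ?thesis
    unfolding pm_def pmat_def nsq_complex
    by (intro continuous_on_vec_lambda continuous_on_divide continuous_on_mult continuous_on_cnj continuous_on_sum assms(1)) auto
qed

lemma pmat_diag_nonzero: "v \<noteq> 0 \<Longrightarrow> pmat v i i \<noteq> 0 \<longleftrightarrow> v $ i \<noteq> 0"
  using nsq_pos[of v] by (auto simp: pmat_def)

text \<open>The thresholds \<open>N m\<close> admit sequences whose domains of definition only
  exhaust \<open>D\<close>, as for rescaled mappings; bounds depending on \<open>m\<close> admit a
  family on the disc whose derivative may grow towards the boundary.\<close>

locale marty_sequence =
  fixes F :: "nat \<Rightarrow> complex \<Rightarrow> complex ^ 'i::finite" and R :: "nat \<Rightarrow> real" and N :: "nat \<Rightarrow> nat" and M :: "nat \<Rightarrow> real"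
  assumes R: "strict_mono R" "\<And>m. R m > 0"
    and hol: "\<And>m n i. n \<ge> N m \<Longrightarrow> (\<lambda>z. F n z $ i) holomorphic_on ball 0 (R m)"
    and nz: "\<And>m n z. n \<ge> N m \<Longrightarrow> z \<in> ball 0 (R m) \<Longrightarrow> F n z \<noteq> 0"
    and wr: "\<And>m n z s t. n \<ge> N m \<Longrightarrow> z \<in> ball 0 (R m) \<Longrightarrow> cmod (wr2 (F n) s t z) \<le> M m * nsq (F n z)"
begin

definition D where "D = (\<Union>m. ball (0::complex) (R m))"

lemma R_less: "a < b \<Longrightarrow> R a < R b"
  using R(1) by (simp add: strict_mono_less)

lemma cball_sub: "cball 0 (R m) \<subseteq> ball (0::complex) (R (Suc m))"
  using R_less[of m "Suc m"] by auto

lemma compact_sub: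
  assumes "compact S" "S \<subseteq> D" obtains m where "S \<subseteq> cball 0 (R m)"
proof -
  obtain I where I: "finite I" "S \<subseteq> (\<Union>m\<in>I. ball 0 (R m))"
    by (rule compactE_image[OF assms(1), of UNIV "\<lambda>m. ball 0 (R m)"]) (use assms(2) in \<open>auto simp: D_def\<close>)
  have "S \<subseteq> cball 0 (R (Max (insert 0 I)))"
  proof
    fix z assume "z \<in> S"
    then obtain m where m: "m \<in> I" "z \<in> ball 0 (R m)" using I by blast
    then have "m \<le> Max (insert 0 I)" using I(1) by simp
    then have "R m \<le> R (Max (insert 0 I))" using R(1) by (simp add: strict_mono_less_eq)
    then show "z \<in> cball 0 (R (Max (insert 0 I)))" using m by auto
  qed
  then show ?thesis using that by blast
qed

lemma subsequence_exists:
  obtains r Q where "strict_mono (r :: nat \<Rightarrow> nat)"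
    "\<And>m. uniform_limit (cball 0 (R m)) (\<lambda>n z. pm (F (r n) z)) Q sequentially"
proof -
  \<comment> \<open>Arzela-Ascoli wants all members of the sequence, so those below the threshold
    are replaced by 0. The threshold is the one of the next larger ball, because the Lipschitz bound
    is needed on a closed ball.\<close>
  define \<Phi> where "\<Phi> m n z = (if n \<ge> N (Suc m) then pm (F n z) else 0)" for m n z
  define P where "P m r \<longleftrightarrow> (\<exists>g. \<forall>e>0. \<exists>n0. \<forall>n\<ge>n0. \<forall>z\<in>cball 0 (R m). norm (\<Phi> m (r n) z - g z) < e)" for m and r :: "nat \<Rightarrow> nat"
  have sub: "\<exists>k. strict_mono k \<and> P m (r \<circ> k)" for m and r :: "nat \<Rightarrow> nat"
  proof -
    define C where "C = 2 * (real CARD('i)) ^ 3 * \<bar>M (Suc m)\<bar>"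
    have C: "C \<ge> 0" by (simp add: C_def)
    have lip: "norm (\<Phi> m n x - \<Phi> m n y) \<le> C * cmod (x - y)" if "x \<in> cball 0 (R m)" "y \<in> cball 0 (R m)" for n x y
    proof (cases "n \<ge> N (Suc m)")
      case True
      have wr': "cmod (wr2 (F n) s t z) \<le> \<bar>M (Suc m)\<bar> * nsq (F n z)" if "z \<in> ball 0 (R (Suc m))" for s t z
      proof -
        have "M (Suc m) * nsq (F n z) \<le> \<bar>M (Suc m)\<bar> * nsq (F n z)"
          by (intro mult_right_mono) (auto simp: nsq_def)
        then show ?thesis using wr[OF True that, of s t] by linarith
      qed
      have "norm (pm (F n x) - pm (F n y)) \<le> 2 * (real CARD('i)) ^ 3 * \<bar>M (Suc m)\<bar> * cmod (x - y)"
        by (rule pm_lipschitz[OF convex_ball open_ball hol[OF True] nz[OF True] wr'])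
           (use that cball_sub[of m] in auto)
      then show ?thesis using True by (simp add: \<Phi>_def C_def)
    qed (use C in \<open>auto simp: \<Phi>_def\<close>)
    have bd: "norm (\<Phi> m n z) \<le> (real CARD('i))\<^sup>2 * 1" for n z
      by (rule norm_cmatrix_bound) (auto simp: \<Phi>_def pmat_norm_le_1)
    obtain g k where "strict_mono (k :: nat \<Rightarrow> nat)" and
      gk: "\<And>e. 0 < e \<Longrightarrow> \<exists>n0. \<forall>n x. n \<ge> n0 \<and> x \<in> cball 0 (R m) \<longrightarrow> norm (\<Phi> m (r (k n)) x - g x) < e"
    proof (rule Arzela_Ascoli[of "cball 0 (R m)" "\<lambda>n. \<Phi> m (r n)" "(real CARD('i))\<^sup>2 * 1"])
      fix x :: complex and e :: real assume x: "x \<in> cball 0 (R m)" and e: "0 < e"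
      have "norm (\<Phi> m (r n) x - \<Phi> m (r n) y) < e" if "y \<in> cball 0 (R m)" "cmod (x - y) < e / (C + 1)" for n y
      proof -
        have "norm (\<Phi> m (r n) x - \<Phi> m (r n) y) \<le> C * cmod (x - y)" using lip[OF x that(1)] .
        also have "\<dots> \<le> (C + 1) * cmod (x - y)" by (intro mult_right_mono) auto
        also have "\<dots> < e" using that(2) C by (simp add: pos_less_divide_eq mult.commute)
        finally show ?thesis .
      qed
      then show "\<exists>d>0. \<forall>n y. y \<in> cball 0 (R m) \<and> norm (x - y) < d \<longrightarrow> norm (\<Phi> m (r n) x - \<Phi> m (r n) y) < e"
        using e C by (intro exI[of _ "e / (C + 1)"]) auto
    qed (use bd in auto)
    then show ?thesis unfolding P_def o_def by (intro exI[of _ k]) blast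
  qed
  obtain r where r: "strict_mono r" "\<And>m. P m (id \<circ> r)"
  proof (rule subsequence_diagonalization_lemma[of P id])
    fix i and r k1 k2 :: "nat \<Rightarrow> nat" and n1
    assume *: "P i (r \<circ> k1)" "\<And>j. n1 \<le> j \<Longrightarrow> \<exists>j'\<ge>j. k2 j = k1 j'"
    obtain g where g: "\<And>e. e > 0 \<Longrightarrow> \<exists>n0. \<forall>n\<ge>n0. \<forall>z\<in>cball 0 (R i). norm (\<Phi> i (r (k1 n)) z - g z) < e"
      using *(1) unfolding P_def o_def by blast
    have "\<exists>n0. \<forall>n\<ge>n0. \<forall>z\<in>cball 0 (R i). norm (\<Phi> i (r (k2 n)) z - g z) < e" if e: "e > 0" for e
    proof -
      obtain n0 where n0: "\<And>n z. n \<ge> n0 \<Longrightarrow> z \<in> cball 0 (R i) \<Longrightarrow> norm (\<Phi> i (r (k1 n)) z - g z) < e"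
        using g[OF e] by blast
      have "norm (\<Phi> i (r (k2 n)) z - g z) < e" if n: "n \<ge> max n0 n1" and z: "z \<in> cball 0 (R i)" for n z
      proof -
        obtain j' where "j' \<ge> n" "k2 n = k1 j'" using *(2)[of n] n by auto
        then show ?thesis using n0[of j' z] n z by simp
      qed
      then show ?thesis by blast
    qed
    then show "P i (r \<circ> k2)" unfolding P_def o_def by blast
  qed (use sub in blast)+
  have "\<exists>g. \<forall>e>0. \<exists>n0. \<forall>n\<ge>n0. \<forall>z\<in>cball 0 (R m). norm (\<Phi> m (r n) z - g z) < e" for m
    using r(2)[of m] by (simp add: P_def)
  then obtain g where g: "\<And>m e. e > 0 \<Longrightarrow> \<exists>n0. \<forall>n\<ge>n0. \<forall>z\<in>cball 0 (R m). norm (\<Phi> m (r n) z - g m z) < e"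
    by metis
  have ul: "uniform_limit (cball 0 (R m)) (\<lambda>n z. pm (F (r n) z)) (g m) sequentially" for m
  proof (rule uniform_limitI)
    fix e :: real assume "e > 0"
    then obtain n0 where n0: "\<forall>n\<ge>n0. \<forall>z\<in>cball 0 (R m). norm (\<Phi> m (r n) z - g m z) < e" using g by blast
    have "\<forall>z\<in>cball 0 (R m). dist (pm (F (r n) z)) (g m z) < e" if "n \<ge> max n0 (N (Suc m))" for n
    proof -
      have "r n \<ge> N (Suc m)" using that seq_suble[OF r(1), of n] by linarith
      then show ?thesis using n0 that by (auto simp: \<Phi>_def dist_norm)
    qed
    then show "\<forall>\<^sub>F n in sequentially. \<forall>z\<in>cball 0 (R m). dist (pm (F (r n) z)) (g m z) < e"
      unfolding eventually_sequentially by blast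
  qed
  \<comment> \<open>A pointwise limit, so that the limits on the various balls become restrictions
    of a single function.\<close>
  define Q where "Q z = lim (\<lambda>n. pm (F (r n) z))" for z
  have "uniform_limit (cball 0 (R m)) (\<lambda>n z. pm (F (r n) z)) Q sequentially" for m
  proof (rule uniform_limit_cong'[THEN iffD1, OF _ _ ul[of m]])
    fix z :: complex assume z: "z \<in> cball 0 (R m)"
    show "g m z = Q z" unfolding Q_def using limI[OF tendsto_uniform_limitI[OF ul z]] by simp
  qed auto
  then show ?thesis using that r(1) by blast
qed

text \<open>The limit matrix has rank one and trace one, so near each point some diagonal entry is
  nonzero and the column through it, divided by that entry, gives coordinates. These are uniform
  limits of quotients of components, hence holomorphic, and the local coordinates are then
  globalised.\<close>

lemma limit_exists:
  obtains r H h where "strict_mono (r :: nat \<Rightarrow> nat)" "homogeneous_coords H h D"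
    "\<And>S. compact S \<Longrightarrow> S \<subseteq> D \<Longrightarrow> uniform_limit S (\<lambda>n z. pm (F (r n) z)) (\<lambda>z. pm (H z)) sequentially"
proof -
  obtain r Q where r: "strict_mono (r :: nat \<Rightarrow> nat)"
    and ul: "\<And>m. uniform_limit (cball 0 (R m)) (\<lambda>n z. pm (F (r n) z)) Q sequentially"
    using subsequence_exists by blast
  have rN: "r n \<ge> N m" if "n \<ge> N m" for n m using that seq_suble[OF r, of n] by linarith
  have inD: "\<exists>m. z \<in> ball 0 (R m)" if "z \<in> D" for z using that by (auto simp: D_def)
  have contQ: "continuous_on (cball 0 (R m)) Q" for m
  proof (rule uniform_limit_theorem[OF _ ul])
    have "continuous_on (cball 0 (R m)) (\<lambda>z. pm (F (r n) z))" if n: "n \<ge> N (Suc m)" for n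
    proof (rule continuous_on_pm)
      show "continuous_on (cball 0 (R m)) (\<lambda>z. F (r n) z $ i)" for i
        using holomorphic_on_imp_continuous_on[OF hol[OF rN[OF n]]] cball_sub[of m] continuous_on_subset by blast
      show "F (r n) z \<noteq> 0" if "z \<in> cball 0 (R m)" for z
        using nz[OF rN[OF n]] that cball_sub[of m] by blast
    qed
    then show "\<forall>\<^sub>F n in sequentially. continuous_on (cball 0 (R m)) (\<lambda>z. pm (F (r n) z))"
      unfolding eventually_sequentially by blast
  qed simp
  have lim: "(\<lambda>n. pmat (F (r n) z) a b) \<longlonglongrightarrow> Q z $ a $ b" if z: "z \<in> ball 0 (R m)" for z a b m
  proof -
    have "(\<lambda>n. pm (F (r n) z)) \<longlonglongrightarrow> Q z"
      by (rule tendsto_uniform_limitI[OF ul[of m]]) (use z in auto)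
    then have "(\<lambda>n. pm (F (r n) z) $ a $ b) \<longlonglongrightarrow> Q z $ a $ b" by (intro tendsto_vec_nth)
    then show ?thesis by simp
  qed
  have rk: "Q z $ a $ b * Q z $ i $ i = Q z $ a $ i * cnj (Q z $ b $ i)" if "z \<in> D" for z a b i
  proof -
    obtain m where m: "z \<in> ball 0 (R m)" using inD \<open>z \<in> D\<close> by blast
    show ?thesis
    proof (rule LIMSEQ_unique)
      show "(\<lambda>n. pmat (F (r n) z) a b * pmat (F (r n) z) i i) \<longlonglongrightarrow> Q z $ a $ b * Q z $ i $ i"
        by (intro tendsto_intros lim[OF m])
      show "(\<lambda>n. pmat (F (r n) z) a b * pmat (F (r n) z) i i) \<longlonglongrightarrow> Q z $ a $ i * cnj (Q z $ b $ i)"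
        unfolding pmat_rank1 by (intro tendsto_intros lim[OF m])
    qed
  qed
  have tr: "(\<Sum>i\<in>UNIV. Q z $ i $ i) = 1" if "z \<in> D" for z
  proof -
    obtain m where m: "z \<in> ball 0 (R m)" using inD \<open>z \<in> D\<close> by blast
    show ?thesis
    proof (rule LIMSEQ_unique)
      show "(\<lambda>n. \<Sum>i\<in>UNIV. pmat (F (r n) z) i i) \<longlonglongrightarrow> (\<Sum>i\<in>UNIV. Q z $ i $ i)"
        by (intro tendsto_intros lim[OF m])
      have "(\<Sum>i\<in>UNIV. pmat (F (r n) z) i i) = 1" if "n \<ge> N m" for n
        by (rule pmat_trace[OF nz[OF rN[OF that] m]])
      then show "(\<lambda>n. \<Sum>i\<in>UNIV. pmat (F (r n) z) i i) \<longlonglongrightarrow> 1"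
        by (intro tendsto_eventually) (auto simp: eventually_sequentially)
    qed
  qed
  \<comment> \<open>The i-th column of the projection, normalised to i-th component 1: the affine
    coordinates of the limit point in the chart \<open>i\<close>.\<close>
  define L where "L i z = (\<chi> a. Q z $ a $ i / Q z $ i $ i)" for i z
  have pmL: "pm (L i z) = Q z" if "z \<in> D" "Q z $ i $ i \<noteq> 0" for i z
    unfolding L_def using rank1_matrix[of "Q z" i] rk[OF that(1)] tr[OF that(1)] that(2) by blast
  define V where "V z = (SOME v. v \<noteq> 0 \<and> pm v = Q z)" for z
  have Li1: "L i z \<noteq> 0" if "Q z $ i $ i \<noteq> 0" for i z
    using that by (auto simp: L_def Finite_Cartesian_Product.vec_eq_iff intro!: exI[of _ i])
  have ex_i: "\<exists>i. Q z $ i $ i \<noteq> 0" if "z \<in> D" for z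
    using tr[OF that] by (metis (no_types, lifting) sum.neutral zero_neq_one)
  have V: "V z \<noteq> 0" "pm (V z) = Q z" if z: "z \<in> D" for z
  proof -
    obtain i where "Q z $ i $ i \<noteq> 0" using ex_i[OF z] by blast
    then have "\<exists>v. v \<noteq> 0 \<and> pm v = Q z" using Li1 pmL[OF z] by blast
    then have "V z \<noteq> 0 \<and> pm (V z) = Q z" unfolding V_def by (rule someI_ex)
    then show "V z \<noteq> 0" "pm (V z) = Q z" by auto
  qed
  define h where "h z = proj_point (V z)" for z
  have hL: "h z = proj_point v" if "z \<in> D" "v \<noteq> 0" "pm v = Q z" for z v
    unfolding h_def using V[OF that(1)] that(2,3) by (intro pmat_inj) (auto simp: Finite_Cartesian_Product.vec_eq_iff)
  have "locally_proj_holomorphic h D"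
    unfolding locally_proj_holomorphic_def
  proof
    fix z0 assume z0: "z0 \<in> D"
    then obtain i where i: "Q z0 $ i $ i \<noteq> 0" using ex_i by blast
    obtain m where m: "z0 \<in> ball 0 (R m)" using inD[OF z0] by blast
    have "continuous_on (ball 0 (R m)) (\<lambda>z. Q z $ i $ i)"
      using continuous_on_subset[OF contQ[of m] ball_subset_cball] by (intro continuous_intros)
    then have "open (ball 0 (R m) \<inter> (\<lambda>z. Q z $ i $ i) -` (- {0}))"
      by (intro continuous_open_preimage) auto
    moreover have "z0 \<in> ball 0 (R m) \<inter> (\<lambda>z. Q z $ i $ i) -` (- {0})" using i m by simp
    ultimately obtain e where e: "e > 0" "cball z0 e \<subseteq> ball 0 (R m) \<inter> (\<lambda>z. Q z $ i $ i) -` (- {0})"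
      using open_contains_cball by blast
    have sub: "ball z0 e \<subseteq> cball z0 e" "ball z0 e \<subseteq> ball 0 (R m)" "ball 0 (R m) \<subseteq> D"
      using e ball_subset_cball[of z0 e] by (auto simp: D_def)
    have nzQ: "Q z $ i $ i \<noteq> 0" if "z \<in> cball z0 e" for z using e(2) that by auto
    have ule: "uniform_limit (cball z0 e) (\<lambda>n z. pm (F (r n) z)) Q sequentially"
      by (rule uniform_limit_on_subset[OF ul[of m]]) (use e(2) in auto)
    have conte: "continuous_on (cball z0 e) Q" by (rule continuous_on_subset[OF contQ[of m]]) (use e(2) in auto)
    note ch = chart_limit[OF compact_cball ule conte nzQ]
    obtain n0 where n0: "\<And>n z. n \<ge> n0 \<Longrightarrow> z \<in> cball z0 e \<Longrightarrow> F (r n) z $ i \<noteq> 0"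
      using ch(1) unfolding eventually_sequentially by blast
    define n1 where "n1 = max n0 (N m)"
    have holL: "(\<lambda>z. L i z $ a) holomorphic_on ball z0 e" for a
    proof (rule holomorphic_uniform_sequence)
      show "(\<lambda>z. F (r (n + n1)) z $ a / F (r (n + n1)) z $ i) holomorphic_on ball z0 e" for n
      proof -
        have hF: "(\<lambda>z. F (r (n + n1)) z $ a) holomorphic_on ball z0 e" for a
          by (rule holomorphic_on_subset[OF hol[of m] sub(2)]) (rule rN, simp add: n1_def)
        show ?thesis
        proof (intro holomorphic_on_divide hF)
          show "F (r (n + n1)) z $ i \<noteq> 0" if "z \<in> ball z0 e" for z
          using n0[of "n + n1" z] that sub(1) by (auto simp: n1_def)
        qed
      qed
      fix x assume "x \<in> ball z0 e"
      then obtain d where d: "d > 0" "cball x d \<subseteq> ball z0 e" by (meson open_ball open_contains_cball)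
      have "uniform_limit (cball x d) (\<lambda>n z. F (r n) z $ a / F (r n) z $ i) (\<lambda>z. Q z $ a $ i / Q z $ i $ i) sequentially"
        by (rule uniform_limit_on_subset[OF ch(2)]) (use d sub in auto)
      then have "uniform_limit (cball x d) (\<lambda>n z. F (r (n + n1)) z $ a / F (r (n + n1)) z $ i) (\<lambda>z. L i z $ a) sequentially"
        unfolding uniform_limit_iff L_def
        by (simp add: eventually_sequentially_seg[where k = n1 and P = "\<lambda>n. \<forall>z\<in>cball x d. dist (F (r n) z $ a / F (r n) z $ i) (Q z $ a $ i / Q z $ i $ i) < _"])
      then show "\<exists>d>0. cball x d \<subseteq> ball z0 e \<and> uniform_limit (cball x d) (\<lambda>n z. F (r (n + n1)) z $ a / F (r (n + n1)) z $ i) (\<lambda>z. L i z $ a) sequentially"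
        using d by blast
    qed simp
    have "homogeneous_coords (L i) h (ball z0 e)"
      unfolding homogeneous_coords_def
    proof (intro conjI allI ballI holL)
      fix z assume z: "z \<in> ball z0 e"
      then have zz: "z \<in> D" "Q z $ i $ i \<noteq> 0" using sub nzQ by auto
      show "L i z \<noteq> 0" by (rule Li1[OF zz(2)])
      then show "h z = proj_point (L i z)" by (rule hL[OF zz(1) _ pmL[OF zz]])
    qed
    then show "\<exists>s>0. \<exists>L. ball z0 s \<subseteq> D \<and> homogeneous_coords L h (ball z0 s)"
      using e(1) sub by blast
  qed
  then have "h proj_holomorphic_on D"
    by (rule proj_holomorphic_if_locally[OF _ D_def R])
  then obtain H where H: "homogeneous_coords H h D" unfolding proj_holomorphic_on_def by blast
  have HQ: "pm (H z) = Q z" if z: "z \<in> D" for z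
  proof -
    have Hz: "H z \<noteq> 0" "proj_point (V z) = proj_point (H z)" using H z by (auto simp: homogeneous_coords_def h_def)
    then obtain c where "H z = c *s V z" using proj_point_eq_iff[OF V(1)[OF z]] by blast
    moreover from this have "c \<noteq> 0" using Hz by auto
    ultimately have "pm (H z) = pm (V z)" by (simp add: pm_def pmat_smult)
    then show ?thesis using V(2)[OF z] by simp
  qed
  have "uniform_limit S (\<lambda>n z. pm (F (r n) z)) (\<lambda>z. pm (H z)) sequentially" if S: "compact S" "S \<subseteq> D" for S
  proof -
    obtain m where m: "S \<subseteq> cball 0 (R m)" using compact_sub[OF S] by blast
    have "uniform_limit S (\<lambda>n z. pm (F (r n) z)) Q sequentially"
      by (rule uniform_limit_on_subset[OF ul m])
    then show ?thesis using S(2) HQ by (subst (asm) uniform_limit_cong'[of _ _ _ Q "\<lambda>z. pm (H z)"]) auto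
  qed
  then show ?thesis using that[OF r H] by blast
qed

end

text \<open>If \<open>x\<close> is the cosine of the Fubini-Study distance, then \<open>x^2\<close>
  is the Hermitian product of the two projection matrices, so \<open>1 - x^2\<close> is the product
  of the first with their difference and is at most \<open>C\<close> times their distance. It
  remains to use continuity of \<open>arccos (sqrt y)\<close> at \<open>y = 1\<close>.\<close>

lemma dist_small_if_pm_close:
  fixes \<epsilon> :: real
  assumes "\<epsilon> > 0"
  obtains \<delta> where "\<delta> > 0" "\<And>v w :: complex ^ 'i::finite. v \<noteq> 0 \<Longrightarrow> w \<noteq> 0 \<Longrightarrow> dist (pm v) (pm w) < \<delta> \<Longrightarrow>
    dist (proj_point v) (proj_point w) < \<epsilon>"
proof -
  have "continuous_on {0..1} (\<lambda>y::real. arccos (sqrt y))"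
    by (intro continuous_intros) (auto intro: order_trans[OF _ real_sqrt_ge_zero])
  then obtain \<eta> where \<eta>: "\<eta> > 0" "\<And>y. y \<in> {0..1} \<Longrightarrow> dist y 1 < \<eta> \<Longrightarrow> dist (arccos (sqrt y)) (arccos (sqrt 1)) < \<epsilon>"
    unfolding continuous_on_iff using assms by (metis atLeastAtMost_iff order_refl zero_le_one)
  define C where "C = (real CARD('i))\<^sup>2"
  have C: "C > 0" by (simp add: C_def)
  show ?thesis
  proof (rule that[of "\<eta> / C"])
    show "\<eta> / C > 0" using \<eta> C by simp
    fix v w :: "complex ^ 'i" assume vw: "v \<noteq> 0" "w \<noteq> 0" and d: "dist (pm v) (pm w) < \<eta> / C"
    define x where "x = cmod (hermitian v w) / (norm v * norm w)"
    have np: "nsq v > 0" "nsq w > 0" using vw by (auto intro: nsq_pos)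
    have S: "(\<Sum>a\<in>UNIV. \<Sum>b\<in>UNIV. pmat v a b * cnj (pmat u a b)) = of_real ((cmod (hermitian v u))\<^sup>2 / (nsq v * nsq u))" for u
    proof -
      have "(\<Sum>a\<in>UNIV. \<Sum>b\<in>UNIV. pmat v a b * cnj (pmat u a b)) =
        (\<Sum>a\<in>UNIV. \<Sum>b\<in>UNIV. (v $ a * cnj (u $ a)) * cnj (v $ b * cnj (u $ b))) / (of_real (nsq v) * of_real (nsq u))"
        unfolding sum_divide_distrib by (intro sum.cong) (auto simp: pmat_def)
      also have "(\<Sum>a\<in>UNIV. \<Sum>b\<in>UNIV. (v $ a * cnj (u $ a)) * cnj (v $ b * cnj (u $ b))) = hermitian v u * cnj (hermitian v u)"
        by (simp add: hermitian_def sum_product)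
      finally show ?thesis by (simp only: complex_norm_square of_real_divide of_real_mult)
    qed
    have xx: "x\<^sup>2 = (cmod (hermitian v w))\<^sup>2 / (nsq v * nsq w)" by (simp add: x_def power_divide power_mult_distrib nsq_def)
    have vv: "(cmod (hermitian v v))\<^sup>2 / (nsq v * nsq v) = 1"
      using np by (simp add: hermitian_self norm_power nsq_def)
    have "complex_of_real (1 - x\<^sup>2) = (\<Sum>a\<in>UNIV. \<Sum>b\<in>UNIV. pmat v a b * cnj (pmat v a b - pmat w a b))"
      using S[of v] S[of w] unfolding vv xx by (simp add: sum_subtractf right_diff_distrib)
    then have "\<bar>1 - x\<^sup>2\<bar> = cmod (\<Sum>a\<in>UNIV. \<Sum>b\<in>UNIV. pmat v a b * cnj (pmat v a b - pmat w a b))"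
      by (metis norm_of_real)
    also have "\<dots> \<le> (\<Sum>a\<in>(UNIV::'i set). \<Sum>b\<in>(UNIV::'i set). dist (pm v) (pm w))"
    proof (intro sum_norm_le)
      fix a b :: 'i
      have "cmod (pmat v a b - pmat w a b) \<le> norm (pm v - pm w)"
        using Finite_Cartesian_Product.norm_nth_le[of "pm v - pm w" a] Finite_Cartesian_Product.norm_nth_le[of "(pm v - pm w) $ a" b]
        by simp
      then have "cmod (pmat v a b) * cmod (pmat v a b - pmat w a b) \<le> 1 * dist (pm v) (pm w)"
        unfolding dist_norm using pmat_norm_le_1[of v a b] by (intro mult_mono) auto
      then show "cmod (pmat v a b * cnj (pmat v a b - pmat w a b)) \<le> dist (pm v) (pm w)"
        by (simp only: norm_mult complex_mod_cnj mult_1)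
    qed
    also have "\<dots> = C * dist (pm v) (pm w)" by (simp add: C_def power2_eq_square)
    also have "\<dots> < \<eta>" using d C by (simp add: pos_less_divide_eq mult.commute)
    finally have "dist (x\<^sup>2) 1 < \<eta>" by (simp add: dist_real_def abs_minus_commute)
    moreover have x01: "0 \<le> x" "x \<le> 1" using cmod_hermitian_le[of v w] vw by (auto simp: x_def)
    then have "x\<^sup>2 \<in> {0..1}" by (simp add: power_le_one)
    ultimately have "dist (arccos (sqrt (x\<^sup>2))) (arccos (sqrt 1)) < \<epsilon>" by (intro \<eta>(2))
    then have "\<bar>arccos x\<bar> < \<epsilon>" using x01 by simp
    then show "dist (proj_point v) (proj_point w) < \<epsilon>"
      using vw unfolding dist_cproj_def by (simp add: fs_dist_proj_point x_def)
  qed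
qed

section \<open>Rescaling\<close>

lemma disc_automorphism_bound:
  assumes c: "cmod c < 1" and w: "cmod w < 1"
  shows "1 - cnj c * w \<noteq> 0" "cmod ((w - c) / (1 - cnj c * w)) < 1"
proof -
  have "(cmod (1 - cnj c * w))\<^sup>2 - (cmod (w - c))\<^sup>2 = (1 - (cmod c)\<^sup>2) * (1 - (cmod w)\<^sup>2)"
    unfolding cmod_power2 by (simp add: power2_eq_square algebra_simps)
  moreover have "(1 - (cmod c)\<^sup>2) * (1 - (cmod w)\<^sup>2) > 0"
  proof (rule mult_pos_pos)
    show "1 - (cmod c)\<^sup>2 > 0" "1 - (cmod w)\<^sup>2 > 0"
      using power_strict_mono[OF c norm_ge_zero, of 2] power_strict_mono[OF w norm_ge_zero, of 2] by simp_all
  qed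
  ultimately have "(cmod (w - c))\<^sup>2 < (cmod (1 - cnj c * w))\<^sup>2" by linarith
  then have less: "cmod (w - c) < cmod (1 - cnj c * w)"
    by (rule power2_less_imp_less) (rule norm_ge_zero)
  then have "cmod (1 - cnj c * w) > 0" using norm_ge_zero[of "w - c"] by linarith
  then show nz: "1 - cnj c * w \<noteq> 0" by simp
  show "cmod ((w - c) / (1 - cnj c * w)) < 1"
    using less nz by (simp add: norm_divide divide_less_eq_1)
qed

lemma Schwarz_Pick:
  assumes \<phi>: "\<phi> holomorphic_on unit_disc" "\<And>z. z \<in> unit_disc \<Longrightarrow> \<phi> z \<in> unit_disc" and a: "a \<in> unit_disc"
  shows "cmod (deriv \<phi> a) * (1 - (cmod a)\<^sup>2) \<le> 1 - (cmod (\<phi> a))\<^sup>2"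
proof -
  define \<mu> where "\<mu> c w = (w - c) / (1 - cnj c * w)" for c w
  define b where "b = \<phi> a"
  have ab: "cmod a < 1" "cmod b < 1" "cmod (- a) < 1" using a \<phi>(2)[OF a] by (auto simp: b_def)
  have \<mu>: "\<mu> c w \<in> unit_disc" if "cmod c < 1" "w \<in> unit_disc" for c w
    using disc_automorphism_bound(2)[OF that(1), of w] that(2) by (simp add: \<mu>_def)
  have h\<mu>: "\<mu> c holomorphic_on unit_disc" if "cmod c < 1" for c
    unfolding \<mu>_def[abs_def] using disc_automorphism_bound(1)[OF that] by (intro holomorphic_intros) auto
  have d\<mu>: "(\<mu> c has_field_derivative (1 - c * cnj c) / (1 - cnj c * w)\<^sup>2) (at w)" if "cmod c < 1" "cmod w < 1" for c w
  proof -
    have nz: "1 - cnj c * w \<noteq> 0" by (rule disc_automorphism_bound(1)[OF that])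
    have "(\<mu> c has_field_derivative (1 * (1 - cnj c * w) - (w - c) * (- cnj c)) / ((1 - cnj c * w) * (1 - cnj c * w))) (at w)"
      unfolding \<mu>_def[abs_def] using nz by (auto intro!: derivative_eq_intros)
    moreover have "1 * (1 - cnj c * w) - (w - c) * (- cnj c) = 1 - c * cnj c" by (simp add: algebra_simps)
    ultimately show ?thesis by (simp only: power2_eq_square)
  qed
  \<comment> \<open>Conjugated by automorphisms that move \<open>a\<close> and
    \<open>\<phi> a\<close> to the origin, so that Schwarz's lemma applies at 0.\<close>
  define \<psi> where "\<psi> w = \<mu> b (\<phi> (\<mu> (- a) w))" for w
  have \<mu>0: "\<mu> (- a) 0 = a" by (simp add: \<mu>_def)
  have "\<psi> holomorphic_on unit_disc"
  proof -
    have "(\<phi> \<circ> \<mu> (- a)) holomorphic_on unit_disc"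
      by (rule holomorphic_on_compose_gen[OF h\<mu>[OF ab(3)] \<phi>(1)]) (use \<mu>[OF ab(3)] in blast)
    then have "(\<mu> b \<circ> (\<phi> \<circ> \<mu> (- a))) holomorphic_on unit_disc"
      by (rule holomorphic_on_compose_gen[OF _ h\<mu>[OF ab(2)]]) (use \<mu>[OF ab(3)] \<phi>(2) in auto)
    then show ?thesis by (simp add: \<psi>_def[abs_def] o_def)
  qed
  moreover have "\<psi> 0 = 0" by (simp add: \<psi>_def \<mu>0 b_def[symmetric]) (simp add: \<mu>_def)
  moreover have "cmod (\<psi> z) < 1" if "cmod z < 1" for z
    using \<mu>[OF ab(2) \<phi>(2)[OF \<mu>[OF ab(3)]], of z] that by (simp add: \<psi>_def)
  ultimately have le: "cmod (deriv \<psi> 0) \<le> 1" by (intro Schwarz_Lemma(2)[of \<psi> 0]) auto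
  have cc: "c * cnj c = of_real ((cmod c)\<^sup>2)" for c by (simp only: complex_norm_square)
  have pos: "1 - (cmod b)\<^sup>2 > 0" "1 - (cmod a)\<^sup>2 > 0" using ab by (auto simp: abs_square_less_1)
  have d1: "(\<mu> (- a) has_field_derivative of_real (1 - (cmod a)\<^sup>2)) (at 0)"
    using d\<mu>[OF ab(3), of 0] by (simp add: cc)
  have d2: "(\<phi> has_field_derivative deriv \<phi> a) (at (\<mu> (- a) 0))"
    unfolding \<mu>0 by (rule holomorphic_derivI[OF \<phi>(1) open_ball a])
  have d3: "(\<mu> b has_field_derivative 1 / of_real (1 - (cmod b)\<^sup>2)) (at (\<phi> (\<mu> (- a) 0)))"
  proof -
    have "(1 - b * cnj b) / (1 - cnj b * b)\<^sup>2 = 1 / of_real (1 - (cmod b)\<^sup>2)"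
      using pos(1) cc[of b] by (simp add: power2_eq_square mult.commute[of "cnj b"])
    then show ?thesis unfolding \<mu>0 b_def[symmetric] using d\<mu>[OF ab(2,2)] by simp
  qed
  have "(\<psi> has_field_derivative 1 / of_real (1 - (cmod b)\<^sup>2) * (deriv \<phi> a * of_real (1 - (cmod a)\<^sup>2))) (at 0)"
    unfolding \<psi>_def[abs_def] by (rule DERIV_chain2[OF d3 DERIV_chain2[OF d2 d1]])
  then have "deriv \<psi> 0 = 1 / of_real (1 - (cmod b)\<^sup>2) * (deriv \<phi> a * of_real (1 - (cmod a)\<^sup>2))"
    by (rule DERIV_imp_deriv)
  then have "cmod (deriv \<psi> 0) = 1 / (1 - (cmod b)\<^sup>2) * (cmod (deriv \<phi> a) * (1 - (cmod a)\<^sup>2))"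
    using pos by (simp only: norm_mult norm_divide norm_of_real norm_one abs_of_pos)
  then have "cmod (deriv \<phi> a) * (1 - (cmod a)\<^sup>2) = cmod (deriv \<psi> 0) * (1 - (cmod b)\<^sup>2)"
    using pos by simp
  also have "\<dots> \<le> 1 * (1 - (cmod b)\<^sup>2)" using le pos by (intro mult_right_mono) auto
  finally show ?thesis by (simp add: b_def)
qed

text \<open>By Schwarz-Pick, composing with an automorphism does not increase the supremum of
  \<open>(1 - |z|^2) |wr2| / nsq\<close>. Hence the whole family satisfies one bound on each smaller
  disc, and Marty's argument yields a convergent subsequence.\<close>

lemma normal_if_bounded:
  fixes f :: "complex \<Rightarrow> 'i::finite cproj"
  assumes F: "homogeneous_coords F f unit_disc"
    and bd: "\<And>z s t. z \<in> unit_disc \<Longrightarrow> cmod (wr2 F s t z) * (1 - (cmod z)\<^sup>2) \<le> M * nsq (F z)"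
  shows "normal_map f"
proof -
  have hF: "(\<lambda>z. F z $ i) holomorphic_on unit_disc" for i using F by (simp add: homogeneous_coords_def)
  have nzF: "F z \<noteq> 0" and fF: "f z = proj_point (F z)" if "z \<in> unit_disc" for z
    using F that by (auto simp: homogeneous_coords_def)
  have "normal_family {f \<circ> \<phi> |\<phi>. \<phi> \<in> Aut_disc} unit_disc"
    unfolding normal_family_def
  proof (intro allI impI)
    fix g :: "nat \<Rightarrow> complex \<Rightarrow> 'i cproj"
    assume "range g \<subseteq> {f \<circ> \<phi> |\<phi>. \<phi> \<in> Aut_disc}"
    then have "\<exists>\<phi>. \<phi> \<in> Aut_disc \<and> g n = f \<circ> \<phi>" for n by blast
    then obtain \<phi> where \<phi>: "\<And>n. \<phi> n \<in> Aut_disc" "\<And>n. g n = f \<circ> \<phi> n" by metis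
    have h\<phi>: "\<phi> n holomorphic_on unit_disc" and m\<phi>: "\<And>z. z \<in> unit_disc \<Longrightarrow> \<phi> n z \<in> unit_disc" for n
      using \<phi>(1)[of n] by (auto simp: Aut_disc_def bij_betw_def)
    define R where "R m = 1 - 1 / (real m + 2)" for m
    have R1: "0 < R m" "R m < 1" for m by (auto simp: R_def field_simps)
    have subR: "ball 0 (R m) \<subseteq> unit_disc" for m using R1(2)[of m] by auto
    interpret marty_sequence "\<lambda>n z. F (\<phi> n z)" R "\<lambda>_. 0" "\<lambda>m. \<bar>M\<bar> / (1 - (R m)\<^sup>2)"
    proof
      show "strict_mono R" unfolding strict_mono_Suc_iff by (auto simp: R_def field_simps)
      show "R m > 0" for m by (rule R1)
      fix m n :: nat
      show "(\<lambda>z. F (\<phi> n z) $ i) holomorphic_on ball 0 (R m)" for i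
      proof -
        have "\<phi> n ` ball 0 (R m) \<subseteq> unit_disc" using m\<phi>[of _ n] subR[of m] by blast
        then have "((\<lambda>w. F w $ i) \<circ> \<phi> n) holomorphic_on ball 0 (R m)"
          by (rule holomorphic_on_compose_gen[OF holomorphic_on_subset[OF h\<phi>[of n] subR[of m]] hF[of i]])
        then show ?thesis by (simp add: o_def)
      qed
      fix z :: complex assume z: "z \<in> ball 0 (R m)"
      then have zd: "z \<in> unit_disc" using subR by blast
      have wd: "\<phi> n z \<in> unit_disc" by (rule m\<phi>[OF zd])
      show "F (\<phi> n z) \<noteq> 0" by (rule nzF[OF wd])
      fix s t
      have pos: "1 - (cmod (\<phi> n z))\<^sup>2 > 0" "1 - (cmod z)\<^sup>2 > 0" "1 - (R m)\<^sup>2 > 0"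
        using wd zd R1[of m] by (auto simp: abs_square_less_1)
      have "wr2 (\<lambda>z. F (\<phi> n z)) s t z = deriv (\<phi> n) z * wr2 F s t (\<phi> n z)"
        by (rule wr2_compose[OF open_ball wd hF holomorphic_derivI[OF h\<phi> open_ball zd]])
      then have "cmod (wr2 (\<lambda>z. F (\<phi> n z)) s t z) * (1 - (cmod z)\<^sup>2) =
          (cmod (deriv (\<phi> n) z) * (1 - (cmod z)\<^sup>2)) * cmod (wr2 F s t (\<phi> n z))"
        by (simp add: norm_mult)
      also have "\<dots> \<le> (1 - (cmod (\<phi> n z))\<^sup>2) * cmod (wr2 F s t (\<phi> n z))"
        by (intro mult_right_mono Schwarz_Pick h\<phi> m\<phi> zd) auto
      also have "\<dots> \<le> M * nsq (F (\<phi> n z))" using bd[OF wd, of s t] by (simp add: mult.commute)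
      also have "\<dots> \<le> \<bar>M\<bar> * nsq (F (\<phi> n z))" by (intro mult_right_mono) (auto simp: nsq_def)
      finally have "cmod (wr2 (\<lambda>z. F (\<phi> n z)) s t z) \<le> \<bar>M\<bar> * nsq (F (\<phi> n z)) / (1 - (cmod z)\<^sup>2)"
        using pos(2) by (simp add: pos_le_divide_eq)
      also have "\<dots> \<le> \<bar>M\<bar> * nsq (F (\<phi> n z)) / (1 - (R m)\<^sup>2)"
        using z pos R1[of m] by (intro divide_left_mono) (auto simp: nsq_def intro!: power_mono)
      finally show "cmod (wr2 (\<lambda>z. F (\<phi> n z)) s t z) \<le> \<bar>M\<bar> / (1 - (R m)\<^sup>2) * nsq (F (\<phi> n z))"
        by simp
    qed
    have D: "D = unit_disc"
    proof
      show "D \<subseteq> unit_disc" using subR by (auto simp: D_def)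
      show "unit_disc \<subseteq> D"
      proof
        fix z :: complex assume "z \<in> unit_disc"
        then have z: "1 - cmod z > 0" by simp
        obtain m :: nat where m: "1 / (1 - cmod z) < real m" using reals_Archimedean2 by blast
        then have "1 < real m * (1 - cmod z)" using z by (simp add: pos_divide_less_eq)
        also have "\<dots> \<le> (real m + 2) * (1 - cmod z)" using z by (intro mult_right_mono) auto
        finally have "cmod z < R m" by (simp add: R_def field_simps)
        then show "z \<in> D" by (auto simp: D_def)
      qed
    qed
    obtain r H h where r: "strict_mono (r :: nat \<Rightarrow> nat)" "homogeneous_coords H h D"
      "\<And>S. compact S \<Longrightarrow> S \<subseteq> D \<Longrightarrow> uniform_limit S (\<lambda>n z. pm (F (\<phi> (r n) z))) (\<lambda>z. pm (H z)) sequentially"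
      using limit_exists by blast
    have "uniform_limit K (g \<circ> r) h sequentially" if K: "compact K" "K \<subseteq> unit_disc" for K
    proof (rule uniform_limitI)
      fix e :: real assume "e > 0"
      then obtain \<delta> where \<delta>: "\<delta> > 0" "\<And>v w :: complex ^ 'i. v \<noteq> 0 \<Longrightarrow> w \<noteq> 0 \<Longrightarrow> dist (pm v) (pm w) < \<delta> \<Longrightarrow>
        dist (proj_point v) (proj_point w) < e" using dist_small_if_pm_close by blast
      have "\<forall>\<^sub>F n in sequentially. \<forall>z\<in>K. dist (pm (F (\<phi> (r n) z))) (pm (H z)) < \<delta>"
        using uniform_limitD[OF r(3) \<delta>(1)] K by (simp add: D)
      then show "\<forall>\<^sub>F n in sequentially. \<forall>z\<in>K. dist ((g \<circ> r) n z) (h z) < e"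
      proof eventually_elim
        case (elim n)
        show ?case
        proof
          fix z assume z: "z \<in> K"
          then have zd: "z \<in> unit_disc" using K by blast
          have "(g \<circ> r) n z = proj_point (F (\<phi> (r n) z))" using \<phi>(2)[of "r n"] fF[OF m\<phi>[OF zd]] by simp
          moreover have "h z = proj_point (H z)" "H z \<noteq> 0" using r(2) zd by (auto simp: homogeneous_coords_def D)
          ultimately show "dist ((g \<circ> r) n z) (h z) < e"
            using \<delta>(2)[OF nzF[OF m\<phi>[OF zd]]] elim z by auto
        qed
      qed
    qed
    then show "\<exists>r h. strict_mono r \<and> h proj_holomorphic_on unit_disc \<and>
      (\<forall>K. compact K \<and> K \<subseteq> unit_disc \<longrightarrow> uniform_limit K (g \<circ> r) h sequentially)"
      using r(1,2) unfolding proj_holomorphic_on_def D by blast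
  qed
  then show ?thesis using F by (auto simp: normal_map_def proj_holomorphic_on_def)
qed

text \<open>The Fubini-Study derivative computed from coordinates (\<open>fs_deriv_eq_fsn\<close>).
  The sum over ordered pairs counts every unordered pair twice, hence the division by 2.\<close>

definition fsn :: "(complex \<Rightarrow> complex ^ 'i::finite) \<Rightarrow> complex \<Rightarrow> real" where
  "fsn F z = sqrt ((\<Sum>s\<in>UNIV. \<Sum>t\<in>UNIV. (cmod (wr2 F s t z))\<^sup>2) / 2) / nsq (F z)"

lemma fsn_nonneg: "fsn F z \<ge> 0"
  unfolding fsn_def nsq_def
  by (intro divide_nonneg_nonneg real_sqrt_ge_zero sum_nonneg zero_le_power2) simp_all

lemma fs_deriv_eq_fsn:
  assumes F: "homogeneous_coords F f S" and S: "open S" "z \<in> S"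
  shows "fs_deriv f z = fsn F z"
proof -
  have hF: "\<And>i. (\<lambda>z. F z $ i) holomorphic_on S" "\<And>z. z \<in> S \<Longrightarrow> F z \<noteq> 0"
    using F by (auto simp: homogeneous_coords_def)
  have "(fs_deriv_coords F z)\<^sup>2 = (\<Sum>s\<in>UNIV. \<Sum>t\<in>UNIV. (cmod (wr2 F s t z))\<^sup>2) / 2 / (nsq (F z))\<^sup>2"
    unfolding wr2_def nsq_sum by (rule fs_deriv_coords_eq(1)[OF S hF])
  also have "\<dots> = (fsn F z)\<^sup>2"
    unfolding fsn_def power_divide
    by (subst real_sqrt_pow2) (intro divide_nonneg_nonneg sum_nonneg zero_le_power2, simp_all)
  finally have "fs_deriv_coords F z = fsn F z"
    by (rule power2_eq_imp_eq[OF _ fs_deriv_coords_eq(2)[OF S hF] fsn_nonneg])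
  then show ?thesis using fs_deriv_eq_coords[OF F S] by simp
qed

lemma wr2_swap: "wr2 F t s z = - wr2 F s t z"
  by (simp add: wr2_def)

text \<open>For distinct \<open>s\<close> and \<open>t\<close> both orders occur in the sum with the
  same modulus, which compensates the division by 2; for equal indices \<open>wr2\<close> is
  0.\<close>

lemma wr2_le_fsn:
  assumes "F z \<noteq> 0" shows "cmod (wr2 F s t z) \<le> fsn F z * nsq (F z)"
proof -
  define \<Sigma> where "\<Sigma> = (\<Sum>s\<in>UNIV. \<Sum>t\<in>UNIV. (cmod (wr2 F s t z))\<^sup>2)"
  have \<Sigma>0: "\<Sigma> \<ge> 0" by (auto simp: \<Sigma>_def intro!: sum_nonneg)
  have "2 * (cmod (wr2 F s t z))\<^sup>2 \<le> \<Sigma>"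
  proof (cases "s = t")
    case True
    then show ?thesis using \<Sigma>0 by (simp add: wr2_def)
  next
    case False
    have "2 * (cmod (wr2 F s t z))\<^sup>2 = (\<Sum>(a, b)\<in>{(s, t), (t, s)}. (cmod (wr2 F a b z))\<^sup>2)"
      using False by (simp add: wr2_swap[of F t s])
    also have "\<dots> \<le> (\<Sum>(a, b)\<in>UNIV \<times> UNIV. (cmod (wr2 F a b z))\<^sup>2)"
      by (intro sum_mono2) auto
    also have "\<dots> = \<Sigma>" unfolding \<Sigma>_def by (rule sum.cartesian_product[symmetric])
    finally show ?thesis .
  qed
  then have "(cmod (wr2 F s t z))\<^sup>2 \<le> \<Sigma> / 2" by simp
  then have "cmod (wr2 F s t z) \<le> sqrt (\<Sigma> / 2)" by (rule real_le_rsqrt)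
  then show ?thesis using nsq_pos[OF assms] by (simp add: fsn_def \<Sigma>_def)
qed

lemma fsn_le_wr2_sum:
  assumes "F z \<noteq> 0"
  shows "fsn F z * nsq (F z) \<le> (\<Sum>s\<in>UNIV. \<Sum>t\<in>UNIV. cmod (wr2 F s t z))"
proof -
  have "(\<Sum>s\<in>UNIV. \<Sum>t\<in>UNIV. (cmod (wr2 F s t z))\<^sup>2) = (\<Sum>(s, t)\<in>UNIV. (cmod (wr2 F s t z))\<^sup>2)"
    unfolding UNIV_Times_UNIV[symmetric] by (rule sum.cartesian_product)
  also have "sqrt \<dots> = L2_set (\<lambda>(s, t). cmod (wr2 F s t z)) UNIV"
    by (simp add: L2_set_def case_prod_beta)
  also have "\<dots> \<le> (\<Sum>(s, t)\<in>UNIV. cmod (wr2 F s t z))" by (rule L2_set_le_sum) auto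
  also have "\<dots> = (\<Sum>s\<in>UNIV. \<Sum>t\<in>UNIV. cmod (wr2 F s t z))"
    unfolding UNIV_Times_UNIV[symmetric] by (rule sum.cartesian_product[symmetric])
  finally have "sqrt (\<Sum>s\<in>UNIV. \<Sum>t\<in>UNIV. (cmod (wr2 F s t z))\<^sup>2) \<le> (\<Sum>s\<in>UNIV. \<Sum>t\<in>UNIV. cmod (wr2 F s t z))" .
  then have "sqrt ((\<Sum>s\<in>UNIV. \<Sum>t\<in>UNIV. (cmod (wr2 F s t z))\<^sup>2) / 2) \<le> (\<Sum>s\<in>UNIV. \<Sum>t\<in>UNIV. cmod (wr2 F s t z))"
    by (rule order_trans[rotated]) (intro real_sqrt_le_mono, auto intro!: sum_nonneg)
  then show ?thesis using nsq_pos[OF assms] by (simp add: fsn_def)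
qed

lemma continuous_on_fsn:
  assumes "open S" "\<And>i. (\<lambda>z. F z $ i) holomorphic_on S" "\<And>z. z \<in> S \<Longrightarrow> F z \<noteq> 0"
  shows "continuous_on S (fsn F)"
proof -
  have "nsq (F z) \<noteq> 0" if "z \<in> S" for z using nsq_pos[OF assms(3)[OF that]] by simp
  then show ?thesis
    unfolding fsn_def[abs_def] nsq_sum
    by (intro continuous_on_divide continuous_on_real_sqrt continuous_on_sum continuous_on_power continuous_on_norm
        continuous_on_const holomorphic_on_imp_continuous_on[OF holomorphic_on_wr2[OF assms(1,2)]]
        holomorphic_on_imp_continuous_on[OF assms(2)]) auto
qed

text \<open>
  The rescaling point maximises \<open>(r\<^sup>2 - |z|\<^sup>2) fsn F z\<close> on a closed disc of radius \<open>r < 1\<close>.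
\<close>

lemma zalcman_point:
  fixes F :: "complex \<Rightarrow> complex ^ 'i::finite"
  assumes F: "\<And>i. (\<lambda>z. F z $ i) holomorphic_on unit_disc" "\<And>z. z \<in> unit_disc \<Longrightarrow> F z \<noteq> 0"
    and unb: "\<And>K. \<exists>z\<in>unit_disc. (1 - (cmod z)\<^sup>2) * fsn F z > K" and K: "K > 0"
  obtains z1 \<rho> where "\<rho> > 0" "\<rho> * fsn F z1 = 1/4"
    "\<And>x. cmod x \<le> K \<Longrightarrow> z1 + of_real \<rho> * x \<in> unit_disc"
    "\<And>x. cmod x \<le> K \<Longrightarrow> \<rho> * fsn F (z1 + of_real \<rho> * x) \<le> 1"
    "\<And>x. cmod x \<le> K \<Longrightarrow> K * \<rho> \<le> 1 - (cmod (z1 + of_real \<rho> * x))\<^sup>2"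
proof -
  note fsn0 = fsn_nonneg[of F]
  obtain w where w: "cmod w < 1" "(1 - (cmod w)\<^sup>2) * fsn F w > K" using unb[of K] by auto
  \<comment> \<open>A radius \<open>r < 1\<close> is chosen so close to 1 that the value at
    \<open>w\<close> still exceeds \<open>K\<close> with the smaller weight. That weight vanishes on
    the circle of radius \<open>r\<close>, and a maximum exists on the compact disc.\<close>
  have "((\<lambda>r. (r\<^sup>2 - (cmod w)\<^sup>2) * fsn F w) \<longlongrightarrow> (1\<^sup>2 - (cmod w)\<^sup>2) * fsn F w) (at_left 1)"
    by (intro tendsto_intros)
  then have "\<forall>\<^sub>F r in at_left 1. K < (r\<^sup>2 - (cmod w)\<^sup>2) * fsn F w"
    by (rule order_tendstoD) (use w in simp)
  moreover have "\<forall>\<^sub>F r in at_left (1::real). r \<in> {cmod w<..<1}"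
    by (rule eventually_at_left_real[OF w(1)])
  ultimately have "\<forall>\<^sub>F r in at_left 1. K < (r\<^sup>2 - (cmod w)\<^sup>2) * fsn F w \<and> r \<in> {cmod w<..<1}"
    by (rule eventually_conj)
  then obtain r where r: "K < (r\<^sup>2 - (cmod w)\<^sup>2) * fsn F w" "cmod w < r" "r < 1"
    using eventually_happens[of _ "at_left (1::real)"] by auto
  define \<Psi> where "\<Psi> z = (r\<^sup>2 - (cmod z)\<^sup>2) * fsn F z" for z
  have sub: "cball 0 r \<subseteq> unit_disc" using r by auto
  have "continuous_on unit_disc (fsn F)" using open_ball F by (rule continuous_on_fsn)
  then have "continuous_on (cball 0 r) (fsn F)" using sub by (rule continuous_on_subset)
  then have c\<Psi>: "continuous_on (cball 0 r) \<Psi>"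
    unfolding \<Psi>_def[abs_def] by (intro continuous_intros)
  have wr: "w \<in> cball 0 r" using r by simp
  then have "cball 0 r \<noteq> ({} :: complex set)" by (metis empty_iff)
  then obtain z1 where z1: "z1 \<in> cball 0 r" "\<forall>z\<in>cball 0 r. \<Psi> z \<le> \<Psi> z1"
    using continuous_attains_sup[OF compact_cball _ c\<Psi>] by metis
  have \<Psi>K: "\<Psi> z1 > K" using z1(2)[rule_format, OF wr] r(1) by (simp add: \<Psi>_def)
  have rz: "cmod z1 \<le> r" using z1(1) by simp
  then have "r\<^sup>2 - (cmod z1)\<^sup>2 \<ge> 0" by (simp add: power_mono)
  then have fz: "fsn F z1 > 0" and dz: "r\<^sup>2 - (cmod z1)\<^sup>2 > 0"
    using \<Psi>K K fsn0[of z1] unfolding \<Psi>_def by (smt (verit) mult_nonneg_nonneg mult_eq_0_iff)+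
  \<comment> \<open>The 4 anticipates the loss in \<open>far\<close>: with it the rescaled
    derivative is \<open>1/4\<close> at the centre and at most 1 on the disc of radius
    \<open>K\<close>.\<close>
  define \<rho> where "\<rho> = 1 / (4 * fsn F z1)"
  have \<rho>: "\<rho> > 0" using fz by (simp add: \<rho>_def)
  define d where "d = r - cmod z1"
  have r0: "r > 0" using r(2) norm_ge_zero[of w] by linarith
  have prod: "r\<^sup>2 - (cmod z1)\<^sup>2 = d * (r + cmod z1)" by (simp add: d_def power2_eq_square algebra_simps)
  have d: "d > 0" using dz r0 rz norm_ge_zero[of z1] unfolding prod
    by (smt (verit) zero_less_mult_iff)
  have K\<rho>: "4 * (K * \<rho>) < r\<^sup>2 - (cmod z1)\<^sup>2"
    using \<Psi>K fz by (simp add: \<Psi>_def \<rho>_def field_simps)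
  also have "\<dots> \<le> d * 2" unfolding prod using d rz r by (intro mult_left_mono) auto
  finally have K\<rho>d: "K * \<rho> \<le> d / 2" by simp
  \<comment> \<open>A step of at most half the distance to the circle of radius \<open>r\<close>
    leaves at least half of each factor of \<open>(r - |z|) (r + |z|)\<close>, so the weight keeps
    at least a quarter of its value.\<close>
  have far: "(r\<^sup>2 - (cmod z1)\<^sup>2) / 4 \<le> r\<^sup>2 - (cmod (z1 + of_real \<rho> * x))\<^sup>2" "cmod (z1 + of_real \<rho> * x) < r"
    if x: "cmod x \<le> K" for x
  proof -
    define y where "y = cmod (z1 + of_real \<rho> * x)"
    have "cmod (of_real \<rho> * x) = cmod x * \<rho>" using \<rho> by (simp add: norm_mult)
    also have "\<dots> \<le> K * \<rho>" using x \<rho> by (intro mult_right_mono) auto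
    finally have sm: "cmod (of_real \<rho> * x) \<le> d / 2" using K\<rho>d by linarith
    have "y \<le> cmod z1 + cmod (of_real \<rho> * x)" unfolding y_def by (rule norm_triangle_ineq)
    then have y1: "d / 2 \<le> r - y" using sm by (simp add: d_def)
    have "cmod z1 - cmod (of_real \<rho> * x) \<le> y"
      unfolding y_def using norm_triangle_ineq2[of z1 "- (of_real \<rho> * x)"] by simp
    then have "cmod z1 - d / 2 \<le> y" using sm by linarith
    then have y2: "(r + cmod z1) / 2 \<le> r + y"
    proof -
      define l where "l = cmod z1"
      have "0 \<le> l" by (simp add: l_def)
      with \<open>cmod z1 - d / 2 \<le> y\<close> show ?thesis unfolding d_def l_def[symmetric] by (simp add: field_simps)
    qed
    from y1 y2 have "(d / 2) * ((r + cmod z1) / 2) \<le> (r - y) * (r + y)"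
      using d r0 by (intro mult_mono) auto
    then show "(r\<^sup>2 - (cmod z1)\<^sup>2) / 4 \<le> r\<^sup>2 - (cmod (z1 + of_real \<rho> * x))\<^sup>2"
      unfolding prod y_def[symmetric] by (simp add: power2_eq_square algebra_simps)
    show "cmod (z1 + of_real \<rho> * x) < r" using y1 d unfolding y_def by linarith
  qed
  show ?thesis
  proof (rule that[OF \<rho>])
    show "\<rho> * fsn F z1 = 1/4" using fz by (simp add: \<rho>_def)
    fix x assume x: "cmod x \<le> K"
    define y where "y = z1 + of_real \<rho> * x"
    note fx = far[OF x, folded y_def]
    show "z1 + of_real \<rho> * x \<in> unit_disc" using fx(2) r unfolding y_def by simp
    have "r\<^sup>2 \<le> 1" using r r0 by (simp add: power_le_one)
    then show "K * \<rho> \<le> 1 - (cmod (z1 + of_real \<rho> * x))\<^sup>2"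
    proof -
      have "K * \<rho> \<le> (r\<^sup>2 - (cmod z1)\<^sup>2) / 4" using K\<rho> by simp
      also note fx(1)
      also have "r\<^sup>2 - (cmod y)\<^sup>2 \<le> 1 - (cmod y)\<^sup>2" using \<open>r\<^sup>2 \<le> 1\<close> by simp
      finally show ?thesis unfolding y_def .
    qed
    have "(r\<^sup>2 - (cmod z1)\<^sup>2) / 4 * fsn F y \<le> \<Psi> y"
      unfolding \<Psi>_def using fx(1) fsn0 by (intro mult_right_mono) auto
    also have "\<dots> \<le> \<Psi> z1" using fx(2) by (intro z1(2)[rule_format]) auto
    finally have "(r\<^sup>2 - (cmod z1)\<^sup>2) * fsn F y \<le> (r\<^sup>2 - (cmod z1)\<^sup>2) * (4 * fsn F z1)" by (simp add: \<Psi>_def)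
    then have "fsn F y \<le> 4 * fsn F z1" using dz by simp
    then show "\<rho> * fsn F (z1 + of_real \<rho> * x) \<le> 1"
      unfolding y_def[symmetric] using fz by (simp add: \<rho>_def)
  qed
qed

lemma uniform_limit_deriv:
  fixes f :: "nat \<Rightarrow> complex \<Rightarrow> complex"
  assumes e: "e > 0" and lim: "uniform_limit (cball z0 e) f g sequentially"
    and hol: "\<forall>\<^sub>F n in sequentially. f n holomorphic_on ball z0 e" and g: "g holomorphic_on ball z0 e"
  shows "uniform_limit (cball z0 (e / 2)) (\<lambda>n. deriv (f n)) (deriv g) sequentially"
proof (rule uniform_limitI)
  fix \<epsilon> :: real assume \<epsilon>: "\<epsilon> > 0"
  have "\<forall>\<^sub>F n in sequentially. \<forall>z\<in>cball z0 e. dist (f n z) (g z) < \<epsilon> * (e / 3) / 2"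
    using uniform_limitD[OF lim, of "\<epsilon> * (e / 3) / 2"] \<epsilon> e by simp
  with hol show "\<forall>\<^sub>F n in sequentially. \<forall>z\<in>cball z0 (e / 2). dist (deriv (f n) z) (deriv g z) < \<epsilon>"
  proof eventually_elim
    case (elim n)
    show ?case
    proof
      fix z assume z: "z \<in> cball z0 (e / 2)"
      have sub: "cball z (e / 3) \<subseteq> ball z0 e"
      proof
        fix w assume "w \<in> cball z (e / 3)"
        then show "w \<in> ball z0 e" using z e dist_triangle[of z0 w z] by auto
      qed
      have hd: "(\<lambda>w. f n w - g w) holomorphic_on ball z0 e" using elim(1) g by (intro holomorphic_intros)
      have "cmod ((deriv ^^ 1) (\<lambda>w. f n w - g w) z) \<le> fact 1 * (\<epsilon> * (e / 3) / 2) / (e / 3) ^ 1"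
      proof (rule Cauchy_inequality)
        show "(\<lambda>w. f n w - g w) holomorphic_on ball z (e / 3)"
          using hd by (rule holomorphic_on_subset) (use sub ball_subset_cball in blast)
        show "continuous_on (cball z (e / 3)) (\<lambda>w. f n w - g w)"
          using holomorphic_on_imp_continuous_on[OF hd] sub continuous_on_subset by blast
        fix x assume "cmod (z - x) = e / 3"
        then have "x \<in> cball z (e / 3)" by (simp add: dist_norm)
        then have "x \<in> cball z0 e" using sub ball_subset_cball by blast
        then show "cmod (f n x - g x) \<le> \<epsilon> * (e / 3) / 2" using elim(2) by (auto simp: dist_norm less_imp_le)
      qed (use e in auto)
      also have "\<dots> < \<epsilon>" using e \<epsilon> by simp
      finally have "cmod (deriv (\<lambda>w. f n w - g w) z) < \<epsilon>" by simp
      moreover have zb: "z \<in> ball z0 e" using z e by auto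
      have "deriv (\<lambda>w. f n w - g w) z = deriv (f n) z - deriv g z"
        by (intro deriv_diff holomorphic_on_imp_differentiable_at[OF elim(1) open_ball zb]
            holomorphic_on_imp_differentiable_at[OF g open_ball zb])
      ultimately show "dist (deriv (f n) z) (deriv g z) < \<epsilon>" by (simp add: dist_norm)
    qed
  qed
qed

section \<open>Limits of rescaled mappings\<close>

text \<open>Division by the i-th component is a change of coordinates, covered by
  \<open>wr2_smult\<close>. The right side involves only affine coordinates, whose limits are known,
  in contrast to those of \<open>F\<close> itself.\<close>

lemma wr2_chart:
  assumes V: "open V" "z \<in> V" and F: "\<And>i. (\<lambda>z. F z $ i) holomorphic_on V"
    and nz: "\<And>z. z \<in> V \<Longrightarrow> F z $ i \<noteq> 0"
  shows "wr2 F s t z / (F z $ i)\<^sup>2 = F z $ s / F z $ i * deriv (\<lambda>z. F z $ t / F z $ i) z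
    - F z $ t / F z $ i * deriv (\<lambda>z. F z $ s / F z $ i) z"
proof -
  have u: "(\<lambda>z. 1 / F z $ i) holomorphic_on V" using F nz by (intro holomorphic_intros) auto
  have "wr2 F s t z / (F z $ i)\<^sup>2 = (1 / F z $ i)\<^sup>2 * wr2 F s t z" by (simp add: power_divide)
  also have "\<dots> = wr2 (\<lambda>z. (1 / F z $ i) *s F z) s t z" by (rule wr2_smult[OF V F u, symmetric])
  also have "\<dots> = F z $ s / F z $ i * deriv (\<lambda>z. F z $ t / F z $ i) z
    - F z $ t / F z $ i * deriv (\<lambda>z. F z $ s / F z $ i) z" by (simp add: wr2_def)
  finally show ?thesis .
qed

text \<open>Only the projections are required to converge: the homogeneous coordinates
  \<open>F n\<close> are determined up to nowhere vanishing factors and need not have a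
  limit.\<close>

definition proj_converges ::
    "complex set \<Rightarrow> (nat \<Rightarrow> complex \<Rightarrow> complex ^ 'i::finite) \<Rightarrow> (complex \<Rightarrow> complex ^ 'i) \<Rightarrow> bool" where
  "proj_converges U F H \<longleftrightarrow> open U \<and>
    (\<forall>\<^sub>F n in sequentially. \<forall>i. (\<lambda>z. F n z $ i) holomorphic_on U) \<and>
    (\<forall>i. (\<lambda>z. H z $ i) holomorphic_on U) \<and> (\<forall>z\<in>U. H z \<noteq> 0) \<and>
    (\<forall>S. compact S \<longrightarrow> S \<subseteq> U \<longrightarrow> uniform_limit S (\<lambda>n z. pm (F n z)) (\<lambda>z. pm (H z)) sequentially)"

lemma proj_convergesD:
  assumes "proj_converges U F H"
  shows "open U" "\<forall>\<^sub>F n in sequentially. \<forall>i. (\<lambda>z. F n z $ i) holomorphic_on U"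
    "(\<lambda>z. H z $ i) holomorphic_on U" "z \<in> U \<Longrightarrow> H z \<noteq> 0"
    "compact S \<Longrightarrow> S \<subseteq> U \<Longrightarrow> uniform_limit S (\<lambda>n z. pm (F n z)) (\<lambda>z. pm (H z)) sequentially"
  using assms unfolding proj_converges_def by simp_all

text \<open>Affine coordinates converge by \<open>chart_limit\<close> and their derivatives by
  Cauchy's inequality on a disc of half the radius; \<open>wr2_chart\<close> combines both.\<close>

lemma chart_convergence:
  fixes F :: "nat \<Rightarrow> complex \<Rightarrow> complex ^ 'i::finite"
  assumes conv: "proj_converges U F H" and z0: "z0 \<in> U"
    and i: "H z0 $ i \<noteq> 0"
  shows "\<exists>e>0. cball z0 e \<subseteq> U \<and> (\<forall>z\<in>cball z0 e. H z $ i \<noteq> 0) \<and>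
    (\<forall>\<^sub>F n in sequentially. \<forall>z\<in>cball z0 e. F n z $ i \<noteq> 0) \<and>
    (\<forall>a. uniform_limit (cball z0 e) (\<lambda>n z. F n z $ a / F n z $ i) (\<lambda>z. H z $ a / H z $ i) sequentially) \<and>
    (\<forall>s t. uniform_limit (cball z0 e) (\<lambda>n z. wr2 (F n) s t z / (F n z $ i)\<^sup>2)
      (\<lambda>z. wr2 H s t z / (H z $ i)\<^sup>2) sequentially)"
proof -
  note U = proj_convergesD(1)[OF conv] z0 and F = proj_convergesD(2)[OF conv]
    and H = proj_convergesD(3,4)[OF conv] and lim = proj_convergesD(5)[OF conv]
  have cH: "continuous_on U (\<lambda>z. H z $ i)" by (rule holomorphic_on_imp_continuous_on[OF H(1)])
  have "open (U \<inter> (\<lambda>z. H z $ i) -` (- {0}))" by (rule continuous_open_preimage[OF cH U(1)]) auto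
  moreover have "z0 \<in> U \<inter> (\<lambda>z. H z $ i) -` (- {0})" using U i by simp
  ultimately have "\<exists>e>0. cball z0 e \<subseteq> U \<inter> (\<lambda>z. H z $ i) -` (- {0})" by (simp only: open_contains_cball)
  then obtain e where e: "e > 0" "cball z0 e \<subseteq> U \<inter> (\<lambda>z. H z $ i) -` (- {0})" by metis
  have eU: "cball z0 e \<subseteq> U" using e by simp
  have nzH: "H z $ i \<noteq> 0" if "z \<in> cball z0 e" for z using e(2) that by auto
  have bU: "ball z0 e \<subseteq> U" using eU ball_subset_cball by (rule subset_trans[rotated])
  have cpm: "continuous_on (cball z0 e) (\<lambda>z. pm (H z))"
  proof (rule continuous_on_pm)
    show "continuous_on (cball z0 e) (\<lambda>z. H z $ j)" for j
      by (rule continuous_on_subset[OF holomorphic_on_imp_continuous_on[OF H(1)] eU])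
    show "H z \<noteq> 0" if "z \<in> cball z0 e" for z using nzH[OF that] by auto
  qed
  have Qnz: "pm (H z) $ i $ i \<noteq> 0" if "z \<in> cball z0 e" for z
  proof -
    have "H z \<noteq> 0" using H(2) that eU by blast
    then show ?thesis using pmat_diag_nonzero[of "H z" i] nzH[OF that] by simp
  qed
  have nzF: "\<forall>\<^sub>F n in sequentially. \<forall>z\<in>cball z0 e. F n z $ i \<noteq> 0"
    by (rule chart_limit(1)[OF compact_cball lim[OF compact_cball eU] cpm]) (rule Qnz)
  have R: "uniform_limit (cball z0 e) (\<lambda>n z. F n z $ a / F n z $ i) (\<lambda>z. H z $ a / H z $ i) sequentially" for a
  proof -
    have "uniform_limit (cball z0 e) (\<lambda>n z. F n z $ a / F n z $ i)
        (\<lambda>z. pm (H z) $ a $ i / pm (H z) $ i $ i) sequentially"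
      by (rule chart_limit(2)[OF compact_cball lim[OF compact_cball eU] cpm]) (rule Qnz)
    then show ?thesis by (simp add: pmat_ratio)
  qed
  have hF: "\<forall>\<^sub>F n in sequentially. \<forall>a. (\<lambda>z. F n z $ a / F n z $ i) holomorphic_on ball z0 e"
    using F nzF
  proof eventually_elim
    case (elim n)
    show ?case
    proof
      fix a
      have h: "(\<lambda>z. F n z $ b) holomorphic_on ball z0 e" for b
        using elim(1) bU holomorphic_on_subset by metis
      show "(\<lambda>z. F n z $ a / F n z $ i) holomorphic_on ball z0 e"
        by (rule holomorphic_on_divide[OF h h]) (use elim(2) in auto)
    qed
  qed
  have hH: "(\<lambda>z. H z $ a / H z $ i) holomorphic_on ball z0 e" for a
    by (rule holomorphic_on_divide[OF holomorphic_on_subset[OF H(1) bU] holomorphic_on_subset[OF H(1) bU]])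
      (use nzH in auto)
  define S where "S = cball z0 (e / 2)"
  have S: "compact S" "S \<subseteq> cball z0 e" "S \<subseteq> ball z0 e" using e(1) by (auto simp: S_def)
  have DR: "uniform_limit S (\<lambda>n. deriv (\<lambda>z. F n z $ a / F n z $ i)) (deriv (\<lambda>z. H z $ a / H z $ i)) sequentially" for a
    unfolding S_def
  proof (rule uniform_limit_deriv[OF e(1) R _ hH])
    show "\<forall>\<^sub>F n in sequentially. (\<lambda>z. F n z $ a / F n z $ i) holomorphic_on ball z0 e"
      using hF by (rule eventually_mono) blast
  qed
  have R2: "uniform_limit S (\<lambda>n z. F n z $ a / F n z $ i) (\<lambda>z. H z $ a / H z $ i) sequentially" for a
    by (rule uniform_limit_on_subset[OF R S(2)])
  have bdd: "bounded (g ` S)" if "g holomorphic_on ball z0 e" for g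
    by (rule compact_imp_bounded[OF compact_continuous_image[OF
      continuous_on_subset[OF holomorphic_on_imp_continuous_on[OF that] S(3)] S(1)]])
  have bdD: "bounded (deriv (\<lambda>z. H z $ a / H z $ i) ` S)" for a
    by (rule bdd[OF holomorphic_deriv[OF hH open_ball]])
  have M: "uniform_limit S (\<lambda>n z. F n z $ a / F n z $ i * deriv (\<lambda>z. F n z $ b / F n z $ i) z)
      (\<lambda>z. H z $ a / H z $ i * deriv (\<lambda>z. H z $ b / H z $ i) z) sequentially" for a b
    by (rule uniform_lim_mult[OF R2 DR bdd[OF hH] bdD])
  have W: "uniform_limit S (\<lambda>n z. wr2 (F n) s t z / (F n z $ i)\<^sup>2) (\<lambda>z. wr2 H s t z / (H z $ i)\<^sup>2) sequentially" for s t
  proof (subst uniform_limit_cong)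
    show "\<forall>\<^sub>F n in sequentially. \<forall>z\<in>S. wr2 (F n) s t z / (F n z $ i)\<^sup>2 =
      F n z $ s / F n z $ i * deriv (\<lambda>z. F n z $ t / F n z $ i) z
      - F n z $ t / F n z $ i * deriv (\<lambda>z. F n z $ s / F n z $ i) z"
      using F nzF
    proof eventually_elim
      case (elim n)
      show ?case
      proof
        fix z assume "z \<in> S"
        then have "z \<in> ball z0 e" using S by blast
        then show "wr2 (F n) s t z / (F n z $ i)\<^sup>2 =
          F n z $ s / F n z $ i * deriv (\<lambda>z. F n z $ t / F n z $ i) z
          - F n z $ t / F n z $ i * deriv (\<lambda>z. F n z $ s / F n z $ i) z"
        proof (rule wr2_chart[OF open_ball])
          show "(\<lambda>z. F n z $ j) holomorphic_on ball z0 e" for j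
            using elim(1) bU holomorphic_on_subset by metis
        qed (use elim(2) in auto)
      qed
    qed
    show "wr2 H s t z / (H z $ i)\<^sup>2 =
          H z $ s / H z $ i * deriv (\<lambda>z. H z $ t / H z $ i) z
          - H z $ t / H z $ i * deriv (\<lambda>z. H z $ s / H z $ i) z" if "z \<in> S" for z
    proof (rule wr2_chart[OF open_ball])
      show "z \<in> ball z0 e" using that S by blast
      show "(\<lambda>z. H z $ j) holomorphic_on ball z0 e" for j by (rule holomorphic_on_subset[OF H(1) bU])
    qed (use nzH in auto)
    show "uniform_limit S (\<lambda>n z. F n z $ s / F n z $ i * deriv (\<lambda>z. F n z $ t / F n z $ i) z
          - F n z $ t / F n z $ i * deriv (\<lambda>z. F n z $ s / F n z $ i) z)
        (\<lambda>z. H z $ s / H z $ i * deriv (\<lambda>z. H z $ t / H z $ i) z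
          - H z $ t / H z $ i * deriv (\<lambda>z. H z $ s / H z $ i) z) sequentially"
      by (rule uniform_limit_minus[OF M M])
  qed
  show ?thesis
  proof (intro exI[of _ "e / 2"] conjI ballI allI)
    show "e / 2 > 0" using e(1) by simp
    show "cball z0 (e / 2) \<subseteq> U" using S(2) eU unfolding S_def by blast
    show "H z $ i \<noteq> 0" if "z \<in> cball z0 (e / 2)" for z using nzH S(2) that unfolding S_def by blast
    show "\<forall>\<^sub>F n in sequentially. \<forall>z\<in>cball z0 (e / 2). F n z $ i \<noteq> 0"
      using nzF by (rule eventually_mono) (use S(2) in \<open>auto simp: S_def\<close>)
    show "uniform_limit (cball z0 (e / 2)) (\<lambda>n z. F n z $ a / F n z $ i) (\<lambda>z. H z $ a / H z $ i) sequentially" for a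
      by (rule R2[unfolded S_def])
    show "uniform_limit (cball z0 (e / 2)) (\<lambda>n z. wr2 (F n) s t z / (F n z $ i)\<^sup>2)
      (\<lambda>z. wr2 H s t z / (H z $ i)\<^sup>2) sequentially" for s t by (rule W[unfolded S_def])
  qed
qed

lemma uniform_limit_sum:
  fixes f :: "'a \<Rightarrow> 'b \<Rightarrow> 'c \<Rightarrow> 'd::real_normed_vector"
  assumes "\<And>b. b \<in> I \<Longrightarrow> uniform_limit S (f b) (g b) F"
  shows "uniform_limit S (\<lambda>n z. \<Sum>b\<in>I. f b n z) (\<lambda>z. \<Sum>b\<in>I. g b z) F"
  using assms
proof (induction I rule: infinite_finite_induct)
  case (insert b I)
  have "uniform_limit S (\<lambda>n z. f b n z + (\<Sum>b\<in>I. f b n z)) (\<lambda>z. g b z + (\<Sum>b\<in>I. g b z)) F"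
    by (rule uniform_limit_add) (use insert in auto)
  then show ?case using insert.hyps by simp
qed (auto intro: uniform_limit_const)

lemma nsq_ratio: "nsq v / (cmod c)\<^sup>2 = (\<Sum>a\<in>UNIV. (cmod (v $ a / c))\<^sup>2)"
  by (simp add: nsq_sum sum_divide_distrib norm_divide power_divide)

text \<open>Both estimates are homogeneous of degree two in the coordinates. Divided by the squared
  modulus of the i-th component they become statements about convergent sequences.\<close>

lemma wr2_limit:
  fixes F :: "nat \<Rightarrow> complex \<Rightarrow> complex ^ 'i::finite"
  assumes conv: "proj_converges U F H" and z0: "z0 \<in> U"
  shows "(\<forall>\<^sub>F n in sequentially. cmod (wr2 (F n) s t z0) \<le> nsq (F n z0)) \<Longrightarrow> cmod (wr2 H s t z0) \<le> nsq (H z0)"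
    and "c > 0 \<Longrightarrow> (\<forall>\<^sub>F n in sequentially. c * nsq (F n z0) \<le> (\<Sum>s\<in>UNIV. \<Sum>t\<in>UNIV. cmod (wr2 (F n) s t z0))) \<Longrightarrow>
      \<exists>s t. wr2 H s t z0 \<noteq> 0"
proof -
  note U = proj_convergesD(1)[OF conv] z0 and F = proj_convergesD(2)[OF conv]
    and H = proj_convergesD(3,4)[OF conv] and lim = proj_convergesD(5)[OF conv]
  have "H z0 \<noteq> 0" by (rule H(2)[OF U(2)])
  then have "\<exists>i. H z0 $ i \<noteq> 0" by (simp add: Finite_Cartesian_Product.vec_eq_iff)
  then obtain i where i: "H z0 $ i \<noteq> 0" by metis
  obtain e where e0: "e > 0" "cball z0 e \<subseteq> U" "\<forall>z\<in>cball z0 e. H z $ i \<noteq> 0"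
    "\<forall>\<^sub>F n in sequentially. \<forall>z\<in>cball z0 e. F n z $ i \<noteq> 0"
    "\<forall>a. uniform_limit (cball z0 e) (\<lambda>n z. F n z $ a / F n z $ i) (\<lambda>z. H z $ a / H z $ i) sequentially"
    "\<forall>s t. uniform_limit (cball z0 e) (\<lambda>n z. wr2 (F n) s t z / (F n z $ i)\<^sup>2)
      (\<lambda>z. wr2 H s t z / (H z $ i)\<^sup>2) sequentially"
    using chart_convergence[OF conv U(2) i] by (elim exE conjE)
  note e = e0(1,4) e0(5)[rule_format] e0(6)[rule_format]
  have z0e: "z0 \<in> cball z0 e" using e(1) by simp
  have W: "(\<lambda>n. cmod (wr2 (F n) s t z0) / (cmod (F n z0 $ i))\<^sup>2) \<longlonglongrightarrow> cmod (wr2 H s t z0) / (cmod (H z0 $ i))\<^sup>2" for s t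
    using tendsto_norm[OF tendsto_uniform_limitI[OF e(4) z0e]] by (simp add: norm_divide norm_power)
  have N: "(\<lambda>n. nsq (F n z0) / (cmod (F n z0 $ i))\<^sup>2) \<longlonglongrightarrow> nsq (H z0) / (cmod (H z0 $ i))\<^sup>2"
    unfolding nsq_ratio by (intro tendsto_sum tendsto_power tendsto_norm tendsto_uniform_limitI[OF e(3) z0e])
  have pos: "(cmod (H z0 $ i))\<^sup>2 > 0" using i by simp
  have posF: "\<forall>\<^sub>F n in sequentially. (cmod (F n z0 $ i))\<^sup>2 > 0"
    using e(2) by (rule eventually_mono) (use z0e in auto)
  {
    assume "\<forall>\<^sub>F n in sequentially. cmod (wr2 (F n) s t z0) \<le> nsq (F n z0)"
    then have "\<forall>\<^sub>F n in sequentially. cmod (wr2 (F n) s t z0) / (cmod (F n z0 $ i))\<^sup>2 \<le> nsq (F n z0) / (cmod (F n z0 $ i))\<^sup>2"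
      by (rule eventually_mono) (simp add: divide_right_mono)
    then have "cmod (wr2 H s t z0) / (cmod (H z0 $ i))\<^sup>2 \<le> nsq (H z0) / (cmod (H z0 $ i))\<^sup>2"
      by (rule tendsto_le[OF sequentially_bot N W])
    then show "cmod (wr2 H s t z0) \<le> nsq (H z0)" using pos by (simp add: divide_le_cancel)
  }
  {
    assume c: "c > 0" and ev: "\<forall>\<^sub>F n in sequentially. c * nsq (F n z0) \<le> (\<Sum>s\<in>UNIV. \<Sum>t\<in>UNIV. cmod (wr2 (F n) s t z0))"
    have "(\<lambda>n. c * (nsq (F n z0) / (cmod (F n z0 $ i))\<^sup>2)) \<longlonglongrightarrow> c * (nsq (H z0) / (cmod (H z0 $ i))\<^sup>2)"
      by (intro tendsto_intros N)
    moreover have "(\<lambda>n. \<Sum>s\<in>UNIV. \<Sum>t\<in>UNIV. cmod (wr2 (F n) s t z0) / (cmod (F n z0 $ i))\<^sup>2) \<longlonglongrightarrow>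
        (\<Sum>s\<in>UNIV. \<Sum>t\<in>UNIV. cmod (wr2 H s t z0) / (cmod (H z0 $ i))\<^sup>2)"
      by (intro tendsto_sum W)
    moreover have "\<forall>\<^sub>F n in sequentially. c * (nsq (F n z0) / (cmod (F n z0 $ i))\<^sup>2) \<le>
        (\<Sum>s\<in>UNIV. \<Sum>t\<in>UNIV. cmod (wr2 (F n) s t z0) / (cmod (F n z0 $ i))\<^sup>2)"
      using ev
    proof eventually_elim
      case (elim n)
      have "c * nsq (F n z0) / (cmod (F n z0 $ i))\<^sup>2 \<le>
          (\<Sum>s\<in>UNIV. \<Sum>t\<in>UNIV. cmod (wr2 (F n) s t z0)) / (cmod (F n z0 $ i))\<^sup>2"
        by (rule divide_right_mono[OF elim]) simp
      then show ?case by (simp add: sum_divide_distrib)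
    qed
    ultimately have le: "c * (nsq (H z0) / (cmod (H z0 $ i))\<^sup>2) \<le>
        (\<Sum>s\<in>UNIV. \<Sum>t\<in>UNIV. cmod (wr2 H s t z0) / (cmod (H z0 $ i))\<^sup>2)"
      by (intro tendsto_le[OF sequentially_bot])
    have "c * (nsq (H z0) / (cmod (H z0 $ i))\<^sup>2) > 0"
      using c nsq_pos[OF \<open>H z0 \<noteq> 0\<close>] pos by (intro mult_pos_pos divide_pos_pos)
    with le have "(\<Sum>s\<in>UNIV. \<Sum>t\<in>UNIV. cmod (wr2 H s t z0) / (cmod (H z0 $ i))\<^sup>2) \<noteq> 0" by linarith
    then show "\<exists>s t. wr2 H s t z0 \<noteq> 0" by (rule contrapos_np) simp
  }
qed

text \<open>If \<open>wr2 H s t\<close> were nonzero at \<open>z0\<close>, the normalised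
  \<open>wr2\<close> of \<open>F n\<close> would stay away from 0 near \<open>z0\<close> for large
  \<open>n\<close>. At zeros of \<open>bil a (F n z)\<close> it tends to 0 by assumption, so near
  \<open>z0\<close> there are no such zeros, and Hurwitz's theorem excludes the zero of the limit at
  \<open>z0\<close>.\<close>

lemma ramification_limit:
  fixes F :: "nat \<Rightarrow> complex \<Rightarrow> complex ^ 'i::finite"
  assumes conv: "proj_converges U F H" and z0: "z0 \<in> U"
    and zero: "bil a (H z0) = 0"
    and nonzero: "\<And>V. open V \<Longrightarrow> z0 \<in> V \<Longrightarrow> \<exists>w\<in>V. bil a (H w) \<noteq> 0"
    and \<epsilon>: "\<And>n. \<epsilon> n \<ge> 0" "\<epsilon> \<longlonglongrightarrow> 0"
    and small: "\<forall>\<^sub>F n in sequentially. \<forall>z\<in>U. bil a (F n z) = 0 \<longrightarrow> cmod (wr2 (F n) s t z) \<le> \<epsilon> n * nsq (F n z)"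
  shows "wr2 H s t z0 = 0"
proof (rule ccontr)
  note U = proj_convergesD(1)[OF conv] z0 and F = proj_convergesD(2)[OF conv]
    and H = proj_convergesD(3,4)[OF conv] and lim = proj_convergesD(5)[OF conv]
  assume w0: "wr2 H s t z0 \<noteq> 0"
  have "H z0 \<noteq> 0" by (rule H(2)[OF U(2)])
  then have "\<exists>i. H z0 $ i \<noteq> 0" by (simp add: Finite_Cartesian_Product.vec_eq_iff)
  then obtain i where i: "H z0 $ i \<noteq> 0" by metis
  obtain e where e0: "e > 0" "cball z0 e \<subseteq> U" "\<forall>z\<in>cball z0 e. H z $ i \<noteq> 0"
    "\<forall>\<^sub>F n in sequentially. \<forall>z\<in>cball z0 e. F n z $ i \<noteq> 0"
    "\<forall>a. uniform_limit (cball z0 e) (\<lambda>n z. F n z $ a / F n z $ i) (\<lambda>z. H z $ a / H z $ i) sequentially"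
    "\<forall>s t. uniform_limit (cball z0 e) (\<lambda>n z. wr2 (F n) s t z / (F n z $ i)\<^sup>2)
      (\<lambda>z. wr2 H s t z / (H z $ i)\<^sup>2) sequentially"
    using chart_convergence[OF conv U(2) i] by (elim exE conjE)
  note e = e0(1,2) e0(3)[rule_format] e0(4) e0(5)[rule_format] e0(6)[rule_format]
  have bU: "ball z0 e \<subseteq> U" using e(2) ball_subset_cball by (rule subset_trans[rotated])
  have hHb: "(\<lambda>z. H z $ b) holomorphic_on ball z0 e" for b by (rule holomorphic_on_subset[OF H(1) bU])
  have nzi: "H z $ i \<noteq> 0" if "z \<in> ball z0 e" for z using e(3) that by simp
  define W where "W z = wr2 H s t z / (H z $ i)\<^sup>2" for z
  define c where "c = cmod (W z0)"
  have c: "c > 0" using w0 i by (simp add: c_def W_def)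
  have hW: "W holomorphic_on ball z0 e"
    unfolding W_def[abs_def]
    by (intro holomorphic_on_divide holomorphic_on_wr2 holomorphic_on_power hHb open_ball) (use nzi in auto)
  have "open (ball z0 e \<inter> W -` {x. c / 2 < cmod x})"
    by (rule continuous_open_preimage[OF holomorphic_on_imp_continuous_on[OF hW] open_ball])
      (intro open_Collect_less continuous_intros)
  moreover have "z0 \<in> ball z0 e \<inter> W -` {x. c / 2 < cmod x}" using c e(1) by (simp add: c_def)
  ultimately have "\<exists>r>0. ball z0 r \<subseteq> ball z0 e \<inter> W -` {x. c / 2 < cmod x}" by (simp only: open_contains_ball)
  then obtain r where r: "r > 0" "ball z0 r \<subseteq> ball z0 e \<inter> W -` {x. c / 2 < cmod x}" by metis
  have rb: "ball z0 r \<subseteq> ball z0 e" using r(2) by simp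
  have Wr: "c / 2 < cmod (W z)" if "z \<in> ball z0 r" for z using r(2) that by auto
  have rc: "ball z0 r \<subseteq> cball z0 e" using rb ball_subset_cball by (rule subset_trans)
  have "\<exists>B. \<forall>z\<in>cball z0 e. cmod (H z $ b / H z $ i) \<le> B" for b
  proof -
    have "continuous_on (cball z0 e) (\<lambda>z. H z $ b / H z $ i)"
      by (intro continuous_on_divide continuous_on_subset[OF holomorphic_on_imp_continuous_on[OF H(1)] e(2)])
        (use e(3) in auto)
    then have "bounded ((\<lambda>z. H z $ b / H z $ i) ` cball z0 e)"
      by (intro compact_imp_bounded compact_continuous_image compact_cball)
    then show ?thesis unfolding bounded_iff by auto
  qed
  then obtain B where B: "\<And>b z. z \<in> cball z0 e \<Longrightarrow> cmod (H z $ b / H z $ i) \<le> B b" by metis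
  \<comment> \<open>Bounds \<open>nsq (F n z) / (cmod (F n z $ i))\<^sup>2\<close> for large
    \<open>n\<close>: the affine coordinates are within 1 of their limits, which are bounded by
    \<open>B\<close>.\<close>
  define K where "K = (\<Sum>b\<in>UNIV. (B b + 1)\<^sup>2)"
  have ev1: "\<forall>\<^sub>F n in sequentially. \<forall>b. \<forall>z\<in>cball z0 e. dist (F n z $ b / F n z $ i) (H z $ b / H z $ i) < 1"
    by (rule eventually_all_finite) (rule uniform_limitD[OF e(5)], simp)
  have ev2: "\<forall>\<^sub>F n in sequentially. \<forall>z\<in>cball z0 e. dist (wr2 (F n) s t z / (F n z $ i)\<^sup>2) (W z) < c / 4"
    unfolding W_def by (rule uniform_limitD[OF e(6)]) (use c in simp)
  have "(\<lambda>n. \<epsilon> n * K) \<longlonglongrightarrow> 0" by (rule tendsto_mult_left_zero[OF \<epsilon>(2)])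
  then have ev3: "\<forall>\<^sub>F n in sequentially. \<epsilon> n * K < c / 4" by (rule order_tendstoD(2)) (use c in simp)
  have ev: "\<forall>\<^sub>F n in sequentially. (\<forall>z\<in>ball z0 r. bil a (F n z) / F n z $ i \<noteq> 0) \<and>
      (\<lambda>z. bil a (F n z) / F n z $ i) holomorphic_on ball z0 r"
    using e(4) small F ev1 ev2 ev3
  proof eventually_elim
    case (elim n)
    have "bil a (F n z) / F n z $ i \<noteq> 0" if z: "z \<in> ball z0 r" for z
    proof
      assume 0: "bil a (F n z) / F n z $ i = 0"
      have zc: "z \<in> cball z0 e" and zU: "z \<in> U" using z rc e(2) by auto
      have ni: "F n z $ i \<noteq> 0" using elim(1) zc by blast
      then have "cmod (wr2 (F n) s t z) \<le> \<epsilon> n * nsq (F n z)" using elim(2) zU 0 by simp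
      then have "cmod (wr2 (F n) s t z) / (cmod (F n z $ i))\<^sup>2 \<le> \<epsilon> n * nsq (F n z) / (cmod (F n z $ i))\<^sup>2"
        by (rule divide_right_mono) simp
      also have "\<dots> = \<epsilon> n * (\<Sum>b\<in>UNIV. (cmod (F n z $ b / F n z $ i))\<^sup>2)"
        unfolding nsq_ratio[symmetric] by simp
      also have "\<dots> \<le> \<epsilon> n * K"
        unfolding K_def
      proof (intro mult_left_mono \<epsilon>(1) sum_mono power_mono norm_ge_zero)
        fix b
        have "dist (F n z $ b / F n z $ i) (H z $ b / H z $ i) < 1" using elim(4) zc by blast
        then have "cmod (F n z $ b / F n z $ i - H z $ b / H z $ i) < 1" by (simp only: dist_norm)
        with B[OF zc, of b] norm_triangle_sub[of "F n z $ b / F n z $ i" "H z $ b / H z $ i"]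
        show "cmod (F n z $ b / F n z $ i) \<le> B b + 1" by linarith
      qed
      also have "\<dots> < c / 4" by (rule elim(6))
      finally have "cmod (wr2 (F n) s t z / (F n z $ i)\<^sup>2) < c / 4" by (simp add: norm_divide norm_power)
      moreover have "cmod (W z - wr2 (F n) s t z / (F n z $ i)\<^sup>2) < c / 4"
        using elim(5) zc by (simp add: dist_norm norm_minus_commute)
      moreover note Wr[OF z] norm_triangle_sub[of "W z" "wr2 (F n) s t z / (F n z $ i)\<^sup>2"]
      ultimately show False by linarith
    qed
    moreover have "(\<lambda>z. bil a (F n z) / F n z $ i) holomorphic_on ball z0 r"
    proof (rule holomorphic_on_divide)
      have h: "(\<lambda>z. F n z $ b) holomorphic_on ball z0 r" for b
        by (rule holomorphic_on_subset[OF elim(3)[rule_format]]) (use rc e(2) in blast)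
      show "(\<lambda>z. bil a (F n z)) holomorphic_on ball z0 r"
        unfolding bil_def by (intro holomorphic_intros h)
      show "(\<lambda>z. F n z $ i) holomorphic_on ball z0 r" by (rule h)
      show "F n z $ i \<noteq> 0" if "z \<in> ball z0 r" for z using elim(1) rc that by blast
    qed
    ultimately show ?case by blast
  qed
  then obtain N where N: "\<And>n. n \<ge> N \<Longrightarrow> (\<forall>z\<in>ball z0 r. bil a (F n z) / F n z $ i \<noteq> 0) \<and>
      (\<lambda>z. bil a (F n z) / F n z $ i) holomorphic_on ball z0 r"
    unfolding eventually_sequentially by metis
  define g where "g z = bil a (H z) / H z $ i" for z
  have hg: "g holomorphic_on ball z0 r"
    unfolding g_def[abs_def] bil_def
    by (intro holomorphic_on_divide holomorphic_on_sum holomorphic_on_mult holomorphic_on_const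
        holomorphic_on_subset[OF hHb rb]) (rule nzi, use rb in blast)
  have ratio: "bil a v / x = (\<Sum>b\<in>UNIV. a $ b * (v $ b / x))" for v x
    by (simp add: bil_def sum_divide_distrib)
  have ulim: "uniform_limit (cball z0 e) (\<lambda>n z. bil a (F n z) / F n z $ i) g sequentially"
    unfolding g_def[abs_def] ratio
    by (intro uniform_limit_sum bounded_linear.uniform_limit[OF bounded_linear_mult_right] e(5))
  \<comment> \<open>Hurwitz's theorem asks for zero-free functions throughout the sequence, hence
    the shift of the index by \<open>N\<close>.\<close>
  have "g z0 \<noteq> 0"
  proof (rule Hurwitz_no_zeros[of "ball z0 r" "\<lambda>n z. bil a (F (n + N) z) / F (n + N) z $ i" g z0])
    show "uniform_limit S (\<lambda>n z. bil a (F (n + N) z) / F (n + N) z $ i) g sequentially"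
      if "compact S" "S \<subseteq> ball z0 r" for S
    proof (rule uniform_limitI)
      fix \<delta> :: real assume "\<delta> > 0"
      have "S \<subseteq> cball z0 e" using that rc by blast
      then have "\<forall>\<^sub>F n in sequentially. \<forall>z\<in>S. dist (bil a (F n z) / F n z $ i) (g z) < \<delta>"
        using uniform_limitD[OF uniform_limit_on_subset[OF ulim] \<open>\<delta> > 0\<close>] by blast
      then show "\<forall>\<^sub>F n in sequentially. \<forall>z\<in>S. dist (bil a (F (n + N) z) / F (n + N) z $ i) (g z) < \<delta>"
        by (rule eventually_sequentially_seg[THEN iffD2])
    qed
    show "\<not> g constant_on ball z0 r"
    proof
      assume "g constant_on ball z0 r"
      then obtain k where k: "\<And>z. z \<in> ball z0 r \<Longrightarrow> g z = k" by (auto simp: constant_on_def)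
      have "g z0 = 0" by (simp add: g_def zero)
      then have "k = 0" using k[of z0] r(1) by simp
      obtain w where w: "w \<in> ball z0 r" "bil a (H w) \<noteq> 0" using nonzero[OF open_ball, of z0 r] r(1) by auto
      have "g w = 0" using k[OF w(1)] \<open>k = 0\<close> by simp
      moreover have "H w $ i \<noteq> 0" using nzi rb w(1) by blast
      ultimately show False using w(2) by (simp add: g_def)
    qed
  qed (use N hg r(1) in auto)
  then show False by (simp add: g_def zero)
qed

section \<open>Hyperplanes and normality\<close>

lemma hyperplane_covector:
  assumes "hyperplane H"
  shows "\<exists>a. norm a = 1 \<and> (\<forall>v. v \<noteq> 0 \<longrightarrow> (proj_point v \<in> H \<longleftrightarrow> bil a v = 0))"
proof -
  obtain a0 where a0: "a0 \<noteq> 0" "H = {proj_point v | v. v \<noteq> 0 \<and> bil a0 v = 0}"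
    using assms by (auto simp: hyperplane_def bil_def)
  define c :: complex where "c = of_real (1 / norm a0)"
  have c: "c \<noteq> 0" using a0 by (simp add: c_def)
  show ?thesis
  proof (intro exI[of _ "c *s a0"] conjI allI impI)
    show "norm (c *s a0) = 1" using a0 by (simp add: norm_vector_smult c_def norm_divide)
    fix v :: "complex ^ 'a" assume v: "v \<noteq> 0"
    have "bil a0 v = 0" if "proj_point v = proj_point u" "u \<noteq> 0" "bil a0 u = 0" for u
    proof -
      have "\<exists>k. v = k *s u" using that(1) proj_point_eq_iff[OF that(2) v] by simp
      then show ?thesis using that(3) by (auto simp: bil_smult_right)
    qed
    then have "proj_point v \<in> H \<longleftrightarrow> bil a0 v = 0" using v unfolding a0(2) by blast
    then show "proj_point v \<in> H \<longleftrightarrow> bil (c *s a0) v = 0" using c by (simp add: bil_smult)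
  qed
qed

text \<open>
  Otherwise every set of \<open>CARD('i)\<close> covectors containing \<open>X\<close> and \<open>0\<close> would be independent.
\<close>

lemma common_kernel:
  fixes X :: "(complex ^ 'i::finite) set"
  assumes "finite X" "card X < CARD('i)"
  shows "\<exists>v. v \<noteq> 0 \<and> (\<forall>b\<in>X. bil b v = 0)"
proof (rule ccontr)
  assume no: "\<not> (\<exists>v. v \<noteq> 0 \<and> (\<forall>b\<in>X. bil b v = 0))"
  then have ker: "v = 0" if "\<And>b. b \<in> X \<Longrightarrow> bil b v = 0" for v using that by blast
  \<comment> \<open>The space is infinite, so the set containing \<open>X\<close> and 0 can be
    filled up to exactly \<open>CARD('i)\<close> covectors.\<close>
  have "inj (\<lambda>k. (\<chi> i. of_nat k) :: complex ^ 'i)"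
    by (rule injI) (simp add: Finite_Cartesian_Product.vec_eq_iff)
  then have "infinite (range (\<lambda>k. (\<chi> i. of_nat k) :: complex ^ 'i))" by (rule range_inj_infinite)
  then have "infinite (UNIV :: (complex ^ 'i) set)" using finite_subset[OF subset_UNIV] by metis
  then have "infinite (UNIV - insert 0 X)" using assms(1) by (simp add: Diff_infinite_finite)
  then obtain Y where Y: "finite Y" "card Y = CARD('i) - card (insert 0 X)" "Y \<subseteq> UNIV - insert 0 X"
    using infinite_arbitrarily_large by blast
  have "card (insert 0 X) \<le> CARD('i)" using assms card_insert_le_m1[of "CARD('i)" X 0] by simp
  moreover have "card (insert 0 X \<union> Y) = card (insert 0 X) + card Y"
    using Y assms(1) by (intro card_Un_disjoint) auto
  ultimately have "card (insert 0 X \<union> Y) = CARD('i)" using Y(2) by simp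
  then have "vec.independent (insert 0 X \<union> Y)"
    by (rule independent_if_kernel_trivial) (rule ker, blast)
  moreover have "vec.dependent (insert 0 X \<union> Y)" by (rule vec.dependent_zero) simp
  ultimately show False by blast
qed

lemma rescaled_disc:
  assumes F: "\<And>i. (\<lambda>z. F z $ i) holomorphic_on unit_disc"
  shows "(\<And>x. x \<in> S \<Longrightarrow> c + of_real \<rho> * x \<in> unit_disc) \<Longrightarrow> (\<lambda>x. F (c + of_real \<rho> * x) $ i) holomorphic_on S"
    and "c + of_real \<rho> * x \<in> unit_disc \<Longrightarrow>
      wr2 (\<lambda>x. F (c + of_real \<rho> * x)) s t x = of_real \<rho> * wr2 F s t (c + of_real \<rho> * x)"
proof -
  assume S: "\<And>x. x \<in> S \<Longrightarrow> c + of_real \<rho> * x \<in> unit_disc"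
  have "((\<lambda>z. F z $ i) \<circ> (\<lambda>x. c + of_real \<rho> * x)) holomorphic_on S"
    by (rule holomorphic_on_compose_gen[OF _ F]) (use S in \<open>auto intro!: holomorphic_intros\<close>)
  then show "(\<lambda>x. F (c + of_real \<rho> * x) $ i) holomorphic_on S" by (simp add: o_def)
next
  assume x: "c + of_real \<rho> * x \<in> unit_disc"
  show "wr2 (\<lambda>x. F (c + of_real \<rho> * x)) s t x = of_real \<rho> * wr2 F s t (c + of_real \<rho> * x)"
    by (rule wr2_compose[where g = "\<lambda>x. c + of_real \<rho> * x", OF open_ball[of 0 1]])
      (use x in simp, rule F, auto intro!: derivative_eq_intros)
qed

text \<open>Zalcman's points for the radii \<open>n + 1\<close>. The last estimate on the rescaled
  points is what makes the hypothesis on the hyperplanes effective: a bound \<open>B\<close> for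
  \<open>(1 - |z|^2) fsn F z\<close> becomes the bound \<open>B / (n + 1)\<close> for the rescaled
  derivative. Passing to a subsequence preserves all estimates, since its indices are at least
  \<open>n\<close>.\<close>

lemma rescaling_limit:
  fixes F :: "complex \<Rightarrow> complex ^ 'i::finite"
  assumes F: "\<And>i. (\<lambda>z. F z $ i) holomorphic_on unit_disc" "\<And>z. z \<in> unit_disc \<Longrightarrow> F z \<noteq> 0"
    and unb: "\<And>K. \<exists>z\<in>unit_disc. (1 - (cmod z)\<^sup>2) * fsn F z > K"
  obtains H c \<rho> where "\<And>n. \<rho> n > 0" "\<And>n. \<rho> n * fsn F (c n) = 1/4"
    "\<And>n x. cmod x \<le> real (Suc n) \<Longrightarrow> c n + of_real (\<rho> n) * x \<in> unit_disc"
    "\<And>n x. cmod x \<le> real (Suc n) \<Longrightarrow> \<rho> n * fsn F (c n + of_real (\<rho> n) * x) \<le> 1"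
    "\<And>n x. cmod x \<le> real (Suc n) \<Longrightarrow> real (Suc n) * \<rho> n \<le> 1 - (cmod (c n + of_real (\<rho> n) * x))\<^sup>2"
    "\<And>i. (\<lambda>z. H z $ i) holomorphic_on UNIV" "\<And>z. H z \<noteq> 0"
    "\<And>S. compact S \<Longrightarrow> uniform_limit S (\<lambda>n x. pm (F (c n + of_real (\<rho> n) * x))) (\<lambda>x. pm (H x)) sequentially"
proof -
  define P where "P n c \<rho> \<longleftrightarrow> \<rho> > 0 \<and> \<rho> * fsn F c = 1/4 \<and> (\<forall>x. cmod x \<le> real (Suc n) \<longrightarrow>
    c + of_real \<rho> * x \<in> unit_disc \<and> \<rho> * fsn F (c + of_real \<rho> * x) \<le> 1 \<and>
    real (Suc n) * \<rho> \<le> 1 - (cmod (c + of_real \<rho> * x))\<^sup>2)" for n c \<rho>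
  have "\<exists>c \<rho>. P n c \<rho>" for n
  proof -
    have K: "real (Suc n) > 0" by simp
    show ?thesis
    proof (rule zalcman_point[OF F unb K])
      fix c \<rho> assume "\<rho> > 0" "\<rho> * fsn F c = 1/4"
        "\<And>x. cmod x \<le> real (Suc n) \<Longrightarrow> c + of_real \<rho> * x \<in> unit_disc"
        "\<And>x. cmod x \<le> real (Suc n) \<Longrightarrow> \<rho> * fsn F (c + of_real \<rho> * x) \<le> 1"
        "\<And>x. cmod x \<le> real (Suc n) \<Longrightarrow> real (Suc n) * \<rho> \<le> 1 - (cmod (c + of_real \<rho> * x))\<^sup>2"
      then have "P n c \<rho>" by (simp only: P_def) simp
      then show ?thesis by blast
    qed
  qed
  then obtain c \<rho> where P: "\<And>n. P n (c n) (\<rho> n)" by metis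
  have disc: "c n + of_real (\<rho> n) * x \<in> unit_disc" and le1: "\<rho> n * fsn F (c n + of_real (\<rho> n) * x) \<le> 1"
    and far: "real (Suc n) * \<rho> n \<le> 1 - (cmod (c n + of_real (\<rho> n) * x))\<^sup>2" if "cmod x \<le> real (Suc n)" for n x
    using P[of n] that unfolding P_def by blast+
  have pos: "\<rho> n > 0" and quarter: "\<rho> n * fsn F (c n) = 1/4" for n using P[of n] unfolding P_def by blast+
  have sm: "cmod x \<le> real (Suc n)" if "n \<ge> m" "x \<in> ball 0 (real (Suc m))" for n m and x :: complex
    using that by simp
  interpret marty_sequence "\<lambda>n x. F (c n + of_real (\<rho> n) * x)" "\<lambda>m. real (Suc m)" "\<lambda>m. m" "\<lambda>_. 1"
  proof
    show "strict_mono (\<lambda>m. real (Suc m))" by (simp add: strict_mono_def)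
    show "real (Suc m) > 0" for m by simp
    fix m n :: nat assume n: "n \<ge> m"
    show "(\<lambda>x. F (c n + of_real (\<rho> n) * x) $ i) holomorphic_on ball 0 (real (Suc m))" for i
      by (rule rescaled_disc(1)[OF F(1)]) (rule disc[OF sm[OF n]])
    fix x :: complex assume x: "x \<in> ball 0 (real (Suc m))"
    note d = disc[OF sm[OF n x]]
    show nz: "F (c n + of_real (\<rho> n) * x) \<noteq> 0" by (rule F(2)[OF d])
    fix s t
    have "cmod (wr2 (\<lambda>x. F (c n + of_real (\<rho> n) * x)) s t x) = \<rho> n * cmod (wr2 F s t (c n + of_real (\<rho> n) * x))"
      unfolding rescaled_disc(2)[OF F(1) d] using pos[of n] by (simp add: norm_mult)
    also have "\<dots> \<le> \<rho> n * (fsn F (c n + of_real (\<rho> n) * x) * nsq (F (c n + of_real (\<rho> n) * x)))"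
      using pos[of n] by (intro mult_left_mono wr2_le_fsn nz) auto
    also have "\<dots> \<le> 1 * nsq (F (c n + of_real (\<rho> n) * x))"
      unfolding mult.assoc[symmetric] using le1[OF sm[OF n x]] nsq_pos[OF nz] by (intro mult_right_mono) auto
    finally show "cmod (wr2 (\<lambda>x. F (c n + of_real (\<rho> n) * x)) s t x) \<le> 1 * nsq (F (c n + of_real (\<rho> n) * x))" .
  qed
  have D: "D = UNIV"
  proof -
    have "z \<in> D" for z
    proof -
      obtain m where "cmod z < real m" using reals_Archimedean2 by metis
      then have "z \<in> ball 0 (real (Suc m))" by simp
      then show ?thesis unfolding D_def by blast
    qed
    then show ?thesis by blast
  qed
  show ?thesis
  proof (rule limit_exists)
    fix r H h
    assume r: "strict_mono (r :: nat \<Rightarrow> nat)" and H: "homogeneous_coords H h D"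
      and lim: "\<And>S. compact S \<Longrightarrow> S \<subseteq> D \<Longrightarrow>
        uniform_limit S (\<lambda>n x. pm (F (c (r n) + of_real (\<rho> (r n)) * x))) (\<lambda>z. pm (H z)) sequentially"
    have rn: "real (Suc n) \<le> real (Suc (r n))" for n using seq_suble[OF r, of n] by simp
    show ?thesis
    proof (rule that[of "\<rho> \<circ> r" "c \<circ> r" H], unfold o_def)
      show "\<rho> (r n) > 0" "\<rho> (r n) * fsn F (c (r n)) = 1/4" for n by (rule pos, rule quarter)
      show "(\<lambda>z. H z $ i) holomorphic_on UNIV" "H z \<noteq> 0" for i z
        using H unfolding D homogeneous_coords_def by auto
      show "uniform_limit S (\<lambda>n x. pm (F (c (r n) + of_real (\<rho> (r n)) * x))) (\<lambda>x. pm (H x)) sequentially"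
        if "compact S" for S by (rule lim[OF that]) (simp only: D subset_UNIV)
      fix n and x :: complex assume "cmod x \<le> real (Suc n)"
      then have x: "cmod x \<le> real (Suc (r n))" using rn[of n] by linarith
      show "c (r n) + of_real (\<rho> (r n)) * x \<in> unit_disc" by (rule disc[OF x])
      show "\<rho> (r n) * fsn F (c (r n) + of_real (\<rho> (r n)) * x) \<le> 1" by (rule le1[OF x])
      have "real (Suc n) * \<rho> (r n) \<le> real (Suc (r n)) * \<rho> (r n)"
        using rn[of n] pos[of "r n"] by (intro mult_right_mono) auto
      also note far[OF x]
      finally show "real (Suc n) * \<rho> (r n) \<le> 1 - (cmod (c (r n) + of_real (\<rho> (r n)) * x))\<^sup>2" .
    qed
  qed
qed

theorem theorem4p1:
  fixes n q :: nat
    and f :: "complex \<Rightarrow> 'i::finite cproj"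
    and H :: "nat \<Rightarrow> 'i cproj set"
  assumes "n \<ge> 1"
    and "CARD('i) = n + 1"
    and "f proj_holomorphic_on unit_disc"
    and "\<And>j. j \<in> {1..q} \<Longrightarrow> hyperplane (H j)"
    and "general_position q H"
    and "bdd_above ((\<lambda>z. (1 - (cmod z)\<^sup>2) * fs_deriv f z) `
           (\<Union>j\<in>{1..q}. {z \<in> unit_disc. f z \<in> H j}))"
    and "q \<ge> n * (2 * n + 1) + 2"
  shows "normal_map f"
proof (rule ccontr)
  assume not_normal: "\<not> normal_map f"
  obtain F where F: "homogeneous_coords F f unit_disc" using assms(3) by (auto simp: proj_holomorphic_on_def)
  have hF: "(\<lambda>z. F z $ i) holomorphic_on unit_disc" for i using F by (simp add: homogeneous_coords_def)
  have nzF: "F z \<noteq> 0" and fF: "f z = proj_point (F z)" if "z \<in> unit_disc" for z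
    using F that by (auto simp: homogeneous_coords_def)
  have unb: "\<exists>z\<in>unit_disc. (1 - (cmod z)\<^sup>2) * fsn F z > K" for K
  proof (rule ccontr)
    assume no: "\<not> (\<exists>z\<in>unit_disc. (1 - (cmod z)\<^sup>2) * fsn F z > K)"
    have "cmod (wr2 F s t z) * (1 - (cmod z)\<^sup>2) \<le> K * nsq (F z)" if z: "z \<in> unit_disc" for z s t
    proof -
      have le: "(1 - (cmod z)\<^sup>2) * fsn F z \<le> K" using no z by (meson not_less)
      have "(cmod z)\<^sup>2 \<le> 1" using z by (simp add: power_le_one)
      then have "cmod (wr2 F s t z) * (1 - (cmod z)\<^sup>2) \<le> fsn F z * nsq (F z) * (1 - (cmod z)\<^sup>2)"
        by (intro mult_right_mono wr2_le_fsn nzF[OF z]) simp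
      also have "\<dots> = (1 - (cmod z)\<^sup>2) * fsn F z * nsq (F z)" by simp
      also have "\<dots> \<le> K * nsq (F z)" using le nsq_pos[OF nzF[OF z]] by (intro mult_right_mono) auto
      finally show ?thesis .
    qed
    then have "normal_map f" by (rule normal_if_bounded[OF F])
    with not_normal show False ..
  qed
  obtain B0 where B0: "\<forall>x\<in>(\<lambda>z. (1 - (cmod z)\<^sup>2) * fs_deriv f z) ` (\<Union>j\<in>{1..q}. {z \<in> unit_disc. f z \<in> H j}). x \<le> B0"
    using assms(6) unfolding bdd_above_def by (elim exE)
  \<comment> \<open>The upper bound given by the hypothesis may be negative, for instance when no
    hyperplane is met; later it has to be nonnegative.\<close>
  define B where "B = \<bar>B0\<bar>"
  have B: "(1 - (cmod z)\<^sup>2) * fsn F z \<le> B" if "j \<in> {1..q}" "z \<in> unit_disc" "f z \<in> H j" for j z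
  proof -
    have "(1 - (cmod z)\<^sup>2) * fs_deriv f z \<le> B0" by (rule B0[rule_format, OF imageI]) (use that in auto)
    then show ?thesis unfolding fs_deriv_eq_fsn[OF F open_ball that(2)] B_def by linarith
  qed
  have "\<forall>j\<in>{1..q}. \<exists>a. norm a = 1 \<and> (\<forall>v. v \<noteq> 0 \<longrightarrow> (proj_point v \<in> H j \<longleftrightarrow> bil a v = 0))"
    by (intro ballI hyperplane_covector assms(4))
  from bchoice[OF this] obtain a where
    a0: "\<forall>j\<in>{1..q}. norm (a j) = 1 \<and> (\<forall>v. v \<noteq> 0 \<longrightarrow> (proj_point v \<in> H j \<longleftrightarrow> bil (a j) v = 0))"
    by (elim exE)
  have a: "norm (a j) = 1" "v \<noteq> 0 \<Longrightarrow> proj_point v \<in> H j \<longleftrightarrow> bil (a j) v = 0" if "j \<in> {1..q}" for j v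
    using a0 that by blast+
  have kernel: "v = 0" if J: "J \<subseteq> {1..q}" "card J = n + 1" "\<And>j. j \<in> J \<Longrightarrow> bil (a j) v = 0" for J v
  proof (rule ccontr)
    assume v: "v \<noteq> 0"
    have "proj_point v \<in> H j" if "j \<in> J" for j using a(2)[of j v] J(1) J(3)[OF that] that v by blast
    then have "proj_point v \<in> (\<Inter>j\<in>J. H j)" by blast
    moreover have "(\<Inter>j\<in>J. H j) = {}"
      by (rule assms(5)[unfolded general_position_def, rule_format, OF J(1)]) (use J(2) assms(2) in simp)
    ultimately show False by blast
  qed
  have q: "n + 1 \<le> q" using assms(7) by (simp add: algebra_simps)
  \<comment> \<open>Two equal covectors would leave at most \<open>n\<close> different ones among
    some \<open>n + 1\<close> indices, and these have a common kernel, against general position.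
    Without injectivity the set of covectors could have fewer than \<open>q\<close>
    elements.\<close>
  have inj: "inj_on a {1..q}"
  proof (rule inj_onI, rule ccontr)
    fix i j assume ij: "i \<in> {1..q}" "j \<in> {1..q}" "a i = a j" "i \<noteq> j"
    have "card {i, j} \<le> n + 1" using assms(1) ij(4) by simp
    then have "\<exists>J. {i, j} \<subseteq> J \<and> J \<subseteq> {1..q} \<and> card J = n + 1"
      by (rule exists_subset_between) (use ij q in auto)
    then obtain J where J: "{i, j} \<subseteq> J" "J \<subseteq> {1..q}" "card J = n + 1" by blast
    have fin: "finite J" using J(2) finite_subset by blast
    have "i \<in> J - {j}" using J(1) ij(4) by simp
    then have "a j \<in> a ` (J - {j})" unfolding ij(3)[symmetric] by (rule imageI)
    moreover have "J = insert j (J - {j})" using J(1) by blast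
    then have "a ` J = insert (a j) (a ` (J - {j}))" by (metis image_insert)
    ultimately have "a ` J = a ` (J - {j})" by (simp only: insert_absorb)
    also have "card \<dots> \<le> card (J - {j})" by (rule card_image_le) (use fin in simp)
    also have "\<dots> < CARD('i)" using J(1,3) assms(2) by simp
    finally have small: "card (a ` J) < CARD('i)" .
    have "finite (a ` J)" using fin by simp
    then obtain v where v: "v \<noteq> 0" "\<forall>b\<in>a ` J. bil b v = 0" using common_kernel[OF _ small] by blast
    have "v = 0" by (rule kernel[OF J(2,3)]) (use v(2) in blast)
    with v(1) show False ..
  qed
  show False
  proof (rule rescaling_limit[OF hF nzF unb])
    fix L c \<rho>
    assume \<rho>: "\<And>n. \<rho> n > 0" "\<And>n. \<rho> n * fsn F (c n) = 1/4"
      and disc: "\<And>n x. cmod x \<le> real (Suc n) \<Longrightarrow> c n + of_real (\<rho> n) * x \<in> unit_disc"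
      and le1: "\<And>n x. cmod x \<le> real (Suc n) \<Longrightarrow> \<rho> n * fsn F (c n + of_real (\<rho> n) * x) \<le> 1"
      and far: "\<And>n x. cmod x \<le> real (Suc n) \<Longrightarrow> real (Suc n) * \<rho> n \<le> 1 - (cmod (c n + of_real (\<rho> n) * x))\<^sup>2"
      and L: "\<And>i. (\<lambda>z. L z $ i) holomorphic_on UNIV" "\<And>z. L z \<noteq> 0"
      and lim: "\<And>S. compact S \<Longrightarrow> uniform_limit S (\<lambda>n x. pm (F (c n + of_real (\<rho> n) * x))) (\<lambda>x. pm (L x)) sequentially"
    define G where "G n x = F (c n + of_real (\<rho> n) * x)" for n x
    have cG: "cmod (wr2 (G n) s t x) = \<rho> n * cmod (wr2 F s t (c n + of_real (\<rho> n) * x))"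
      if "cmod x \<le> real (Suc n)" for n x s t
      unfolding G_def rescaled_disc(2)[OF hF disc[OF that]] using \<rho>(1)[of n] by (simp add: norm_mult)
    have nzG: "G n x \<noteq> 0" if "cmod x \<le> real (Suc n)" for n x
      unfolding G_def by (rule nzF[OF disc[OF that]])
    have wrG: "cmod (wr2 (G n) s t x) \<le> \<rho> n * fsn F (c n + of_real (\<rho> n) * x) * nsq (G n x)"
      if x: "cmod x \<le> real (Suc n)" for n x s t
      unfolding cG[OF x] G_def mult.assoc
      using \<rho>(1)[of n] by (intro mult_left_mono wr2_le_fsn nzF[OF disc[OF x]]) auto
    have big: "\<forall>\<^sub>F n in sequentially. \<forall>x\<in>ball z 1. cmod x \<le> real (Suc n)" for z :: complex
    proof -
      obtain N where N: "cmod z + 1 \<le> real N" using real_arch_simple by metis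
      show ?thesis
        using eventually_ge_at_top[of N]
      proof eventually_elim
        case (elim n)
        show ?case
        proof
          fix x assume "x \<in> ball z 1"
          then have "cmod (x - z) < 1" by (simp add: dist_norm norm_minus_commute)
          then show "cmod x \<le> real (Suc n)" using norm_triangle_sub[of x z] N elim by simp
        qed
      qed
    qed
    have hG: "\<forall>\<^sub>F n in sequentially. \<forall>i. (\<lambda>x. G n x $ i) holomorphic_on ball z 1" for z
      using big[of z]
    proof eventually_elim
      case (elim n)
      show ?case unfolding G_def by (intro allI rescaled_disc(1)[OF hF] disc) (use elim in blast)
    qed
    have hL: "(\<lambda>z. L z $ i) holomorphic_on S" for i S by (rule holomorphic_on_subset[OF L(1) subset_UNIV])
    have limG: "uniform_limit S (\<lambda>n x. pm (G n x)) (\<lambda>x. pm (L x)) sequentially" if "compact S" "S \<subseteq> ball z 1" for S z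
      unfolding G_def by (rule lim[OF that(1)])
    have z1: "z \<in> ball z 1" for z :: complex by simp
    have limit: "proj_converges (ball z 1) G L" for z
      unfolding proj_converges_def by (intro conjI allI ballI impI open_ball hG hL L(2) limG)
    interpret ramified_curve L "a ` {1..q}" n
    proof
      show "n \<ge> 1" "CARD('i) = n + 1" by (fact assms)+
      show "(\<lambda>z. L z $ i) holomorphic_on UNIV" "L z \<noteq> 0" for i z by (fact L)+
      show "cmod (wr2 L s t z) \<le> nsq (L z)" for s t z
      proof (rule wr2_limit(1)[OF limit z1])
        show "\<forall>\<^sub>F n in sequentially. cmod (wr2 (G n) s t z) \<le> nsq (G n z)"
          using big[of z]
        proof eventually_elim
          case (elim n)
          then have x: "cmod z \<le> real (Suc n)" using z1 by blast
          note wrG[OF x, of s t]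
          also have "\<rho> n * fsn F (c n + of_real (\<rho> n) * z) * nsq (G n z) \<le> 1 * nsq (G n z)"
            using nsq_pos[OF nzG[OF x]] by (intro mult_right_mono le1[OF x]) simp
          finally show ?case by simp
        qed
      qed
      \<comment> \<open>The normalisation \<open>\<rho> n * fsn F (c n) = 1/4\<close> survives in
        the limit at 0 and keeps the limit curve from being constant.\<close>
      have "\<exists>s t. wr2 L s t 0 \<noteq> 0"
      proof (rule wr2_limit(2)[OF limit z1])
        show "(1/4 :: real) > 0" by simp
        have "1/4 * nsq (G n 0) \<le> (\<Sum>s\<in>UNIV. \<Sum>t\<in>UNIV. cmod (wr2 (G n) s t 0))" for n
        proof -
          have x: "cmod 0 \<le> real (Suc n)" by simp
          have "F (c n) \<noteq> 0" using nzG[OF x] by (simp add: G_def)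
          have "1/4 * nsq (G n 0) = \<rho> n * (fsn F (c n) * nsq (F (c n)))"
            unfolding \<rho>(2)[of n, symmetric] by (simp add: G_def)
          also have "\<dots> \<le> \<rho> n * (\<Sum>s\<in>UNIV. \<Sum>t\<in>UNIV. cmod (wr2 F s t (c n)))"
            using \<rho>(1)[of n] by (intro mult_left_mono fsn_le_wr2_sum \<open>F (c n) \<noteq> 0\<close>) auto
          also have "\<dots> = (\<Sum>s\<in>UNIV. \<Sum>t\<in>UNIV. cmod (wr2 (G n) s t 0))"
            unfolding cG[OF x] by (simp add: sum_distrib_left)
          finally show ?thesis .
        qed
        then show "\<forall>\<^sub>F n in sequentially. 1/4 * nsq (G n 0) \<le> (\<Sum>s\<in>UNIV. \<Sum>t\<in>UNIV. cmod (wr2 (G n) s t 0))"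
          by (rule always_eventually[OF allI])
      qed
      then show "\<exists>s t z. wr2 L s t z \<noteq> 0" by blast
      show "finite (a ` {1..q})" by simp
      show "card (a ` {1..q}) \<ge> n * (2 * n + 1) + 2" using assms(7) card_image[OF inj] by simp
      show "norm b = 1" if "b \<in> a ` {1..q}" for b using a(1) that by blast
      show "v = 0" if X: "X \<subseteq> a ` {1..q}" "card X = n + 1" "\<And>b. b \<in> X \<Longrightarrow> bil b v = 0" for X v
      proof -
        obtain J where J: "J \<subseteq> {1..q}" "inj_on a J" "X = a ` J" using X(1) unfolding subset_image_inj by blast
        have "card J = n + 1" using X(2) card_image[OF J(2)] J(3) by simp
        then show ?thesis by (rule kernel[OF J(1)]) (rule X(3), use J(3) in blast)
      qed
      show "wr2 L s t z = 0" if b: "b \<in> a ` {1..q}" "bil b (L z) = 0" "\<exists>w. bil b (L w) \<noteq> 0" for b s t z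
      proof -
        obtain j where j: "j \<in> {1..q}" "b = a j" using b(1) by blast
        obtain w where w: "bil b (L w) \<noteq> 0" using b(3) by blast
        have hb: "(\<lambda>z. bil b (L z)) holomorphic_on UNIV"
          unfolding bil_def by (intro holomorphic_intros hL)
        show ?thesis
        proof (rule ramification_limit[OF limit z1 b(2)])
          \<comment> \<open>By the identity theorem one point off the hyperplane suffices: the form
            cannot vanish along the curve on any nonempty open set.\<close>
          fix V assume V: "open V" "z \<in> V"
          show "\<exists>w\<in>V. bil b (L w) \<noteq> 0"
          proof (rule ccontr)
            assume "\<not> (\<exists>w\<in>V. bil b (L w) \<noteq> 0)"
            then have V0: "bil b (L w) = 0" if "w \<in> V" for w using that by blast
            have "bil b (L w) = 0"
              by (rule analytic_continuation_open[OF V(1) open_UNIV _ connected_UNIV subset_UNIV hb holomorphic_on_const V0 UNIV_I])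
                (use V(2) in blast)
            with w show False ..
          qed
        next
          show "B / real (Suc n) \<ge> 0" for n by (simp add: B_def)
          show "(\<lambda>n. B / real (Suc n)) \<longlonglongrightarrow> 0" by (rule LIMSEQ_Suc[OF lim_const_over_n])
          show "\<forall>\<^sub>F n in sequentially. \<forall>x\<in>ball z 1. bil b (G n x) = 0 \<longrightarrow>
              cmod (wr2 (G n) s t x) \<le> B / real (Suc n) * nsq (G n x)"
            using big[of z]
          proof eventually_elim
            case (elim n)
            show ?case
            proof (intro ballI impI)
              fix x assume "x \<in> ball z 1" and 0: "bil b (G n x) = 0"
              then have x: "cmod x \<le> real (Suc n)" using elim by blast
              define y where "y = c n + of_real (\<rho> n) * x"
              have y: "y \<in> unit_disc" unfolding y_def by (rule disc[OF x])
              have "bil (a j) (F y) = 0" using 0 unfolding G_def j(2) y_def .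
              then have "f y \<in> H j" unfolding fF[OF y] using a(2)[OF j(1) nzF[OF y]] by simp
              then have By: "(1 - (cmod y)\<^sup>2) * fsn F y \<le> B" by (rule B[OF j(1) y])
              \<comment> \<open>Here the hypothesis acts: \<open>y\<close> lies on a hyperplane, so
                its weighted derivative is at most \<open>B\<close>, and \<open>far\<close> replaces
                the weight by \<open>real (Suc n) * \<rho> n\<close>.\<close>
              have "real (Suc n) * \<rho> n * fsn F y \<le> (1 - (cmod y)\<^sup>2) * fsn F y"
                using far[OF x, folded y_def] by (rule mult_right_mono) (rule fsn_nonneg)
              also note By
              finally have "\<rho> n * fsn F y \<le> B / real (Suc n)"
                by (simp add: pos_le_divide_eq algebra_simps del: of_nat_Suc)
              then have "\<rho> n * fsn F y * nsq (G n x) \<le> B / real (Suc n) * nsq (G n x)"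
                using nsq_pos[OF nzG[OF x]] by (intro mult_right_mono) auto
              then show "cmod (wr2 (G n) s t x) \<le> B / real (Suc n) * nsq (G n x)"
                using wrG[OF x, of s t] unfolding y_def by linarith
            qed
          qed
        qed
      qed
    qed
    show False by (rule contradiction)
  qed
qed

end
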